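(* Let $n\ge\lambda_0$. The random vector $(Y^{(n)}_1,\dots,Y^{(n)}_m)$, conditional on $\mathcal{N}^{(n)}$, follows the infinite mixture density $$f(x_1,\dots,x_m)=\sum_{\boldsymbol{i}=(i_1,\dots,i_p)\in\mathcal{Z}}\ \sum_{j\in\mathcal{E}}\alpha_{i_1,\dots,i_p;j}\,\beta_{|\boldsymbol{i}|;j}\,f_{1;i_1,\dots,i_p}(x_1)f_{2;i_1,\dots,i_p}(x_2)\cdots f_{m;i_1,\dots,i_p}(x_m),$$ where $|\boldsymbol{i}|=i_1+\cdots+i_p$, $\mathcal{Z}=\{\boldsymbol{i}=(i_1,\dots,i_p):i_1,\dots,i_p\in\mathbb{N}_0,\ |\boldsymbol{i}|>0\}$, $$\alpha_{i_1,\dots,i_p;j}:=\mathbb{P}\left(\{J(\chi^{(n)}_\ell)\}_{\ell=0}^{|\boldsymbol{i}|-1}\text{ makes } i_a\text{ visits to }a\text{ for all }a\in\mathcal{E},\ J(\chi^{(n)}_{|\boldsymbol{i}|-1})=j\ \middle|\ \mathcal{N}^{(n)}\right),$$ $$\beta_{\ell;j}:=\mathbb{P}\left(J(\chi^{(n)}_\ell)=\star\mid J(\chi^{(n)}_{\ell-1})=j,\mathcal{N}^{(n)}\right)=1-\sum_{a\in\mathcal{E}}[\boldsymbol{Q}^{(n)}_\ell]_{j,a},$$ and $f_{k;i_1,\dots,i_p}$ denotes the (density of the) hypoexponential distribution associated to $\sum_{j\in\mathcal{E}}\mathrm{Erl}(i_j,n/r(j,k))$, with each $\mathrm{Erl}(i_j,n/r(j,k))$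 an independent Erlang random variable of shape $i_j$ and rate $n/r(j,k)$; here $\mathrm{Erl}(i,\infty)$ denotes the $0$-valued random variable for all $i\ge1$. Moreover, the constants $\alpha_{i_1,\dots,i_p;j}$ can be recursively computed by $$\alpha_{\boldsymbol{e}_h^\intercal;j}=\begin{cases}\pi_j&\text{if }h=j,\\0&\text{if }h\ne j,\end{cases}$$ where $\boldsymbol{e}_h^\intercal$ is the $h$-th unit row vector of length $p$, and for $|\boldsymbol{i}|\ge2$, $$\alpha_{i_1,\dots,i_p;j}=\begin{cases}\sum_{h\in\mathcal{E}}\alpha_{i_1,\dots,i_j-1,\dots,i_p;h}\,[\boldsymbol{Q}^{(n)}_{|\boldsymbol{i}|-1}]_{hj}&\text{if }i_j>0,\\0&\text{if }i_j=0.\end{cases}$$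
   Context: Let $p\ge1$, $\mathcal{E}=\{1,\dots,p\}$, and let $\boldsymbol{S}(t)=\{S_{ij}(t)\}_{i,j\in\mathcal{E}}$, $t\ge0$, be a subintensity matrix function: Borel measurable, integrable over compact intervals, with $S_{ii}(t)\le0$, $S_{ij}(t)\ge0$ for $i\ne j$, and $\sum_jS_{ij}(t)\le0$. Standing assumption: $\sup_{i\in\mathcal{E},t\ge0}|S_{ii}(t)|<\infty$. Let $\boldsymbol{\pi}=(\pi_i)_{i\in\mathcal{E}}$ be a probability vector and $\lambda_0=\lceil\sup_{i,t}|S_{ii}(t)|\rceil$ (positive, as it is a Poisson intensity). Let $m\ge1$ and let $\boldsymbol{R}=\{r(i,k)\}_{i\in\mathcal{E},k\in\{1,\dots,m\}}$ be a nonnegative $p\times m$ matrix. The probability space $(\Omega,\mathcal{F},\mathbb{P})$ supports the following independent components: a Poisson process $\mathcal{N}$ of intensity $\lambda_0$; independent Poisson processes $\{\widehat{\mathcal{N}}^{(\ell)}\}_{\ell\ge\lambda_0+1}$ of intensity $1$; i.i.d. $\mathrm{U}(0,1)$ variables $\{U_\ell\}_{\ell\ge0}$; independent Poisson processes $\mathcal{M}_1,\dots,\mathcal{M}_m$ of intensity $\lambda_0$; and $m$ independent sequences of independent Poisson processes $\{\widehat{\mathcal{M}}^{(\ell)}_k\}_{\ell\ge\lambda_0+1}$, $k\in\{1,\dots,m\}$, of intensity $1$. Process $\mathcal{J}=\{J(t)\}_{t\ge0}$ on $\mathcal{E}\cup\{\star\}$: let $J(0)=i$ if $U_0\in[\sum_{j<i}\pi_j,\sum_{j\le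 i}\pi_j)$. Let $\chi_0=0$ and let $\chi_1<\chi_2<\cdots$ be the arrival times of $\mathcal{N}$; $J$ is constant on each $[\chi_\ell,\chi_{\ell+1})$. On $\{J(\chi_\ell-)=i\}$, $i\in\mathcal{E}$, set $J(\chi_\ell)=k\in\mathcal{E}$ if $U_\ell\in[\sum_{j<k}(\lambda_0^{-1}S_{ij}(\chi_\ell)+\delta_{ij}),\sum_{j\le k}(\lambda_0^{-1}S_{ij}(\chi_\ell)+\delta_{ij}))$, and $J$ moves forever to the absorbing (terminated) state $\star\notin\mathcal{E}$ if $U_\ell\in[1+\sum_{j\in\mathcal{E}}\lambda_0^{-1}S_{ij}(\chi_\ell),1)$. Then $\mathcal{J}$ is a time-inhomogeneous Markov jump process with initial distribution $\boldsymbol{\pi}$ and subintensity matrix function $\boldsymbol{S}(\cdot)$; it is assumed terminating (a.s. reaches $\star$). For $n\ge\lambda_0$, $\mathcal{N}^{(n)}$ is the superposition of $\mathcal{N},\widehat{\mathcal{N}}^{(\lambda_0+1)},\dots,\widehat{\mathcal{N}}^{(n)}$ with arrival times $\{\chi^{(n)}_\ell\}_{\ell\ge0}$, and for each $k\in\{1,\dots,m\}$, $\mathcal{M}^{(n)}_k$ is the superposition of $\mathcal{M}_k,\widehat{\mathcal{M}}^{(\lambda_0+1)}_k,\dots,\widehat{\mathcal{M}}^{(n)}_k$ with arrival times $\{\theta^{(n)}_{k,\ell}\}_{\ell\ge0}$ (with $\chi^{(n)}_0=\theta^{(n)}_{k,0}=0$). Set $J^{(n)}_k(t)=J(\chi^{(n)}_\ell)$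 for $t\in[\theta^{(n)}_{k,\ell},\theta^{(n)}_{k,\ell+1})$, let $\tau^{(n)}_k$ be the termination time of $J^{(n)}_k$, and $$Y^{(n)}_k=\int_0^{\tau^{(n)}_k}r(J^{(n)}_k(t),k)\,\mathrm{d}t,\qquad k\in\{1,\dots,m\}.$$ Finally $\boldsymbol{Q}^{(n)}_\ell=\boldsymbol{I}+\frac1n\boldsymbol{S}(\chi^{(n)}_\ell)$, $\ell\ge1$. An Erlang variable of shape $0$ is $0$. *)

theory Defs
  imports "HOL-Probability.Probability"
begin

definition subintensity :: "nat \<Rightarrow> (real \<Rightarrow> nat \<Rightarrow> nat \<Rightarrow> real) \<Rightarrow> bool" where
  "subintensity p S \<longleftrightarrow>
     (\<forall>i\<in>{1..p}. \<forall>j\<in>{1..p}.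
        (\<lambda>t. S t i j) \<in> borel_measurable (restrict_space borel {0..}) \<and>
        (\<forall>a b. 0 \<le> a \<longrightarrow> a \<le> b \<longrightarrow> set_integrable lborel {a..b} (\<lambda>t. S t i j))) \<and>
     (\<forall>t\<ge>0. \<forall>i\<in>{1..p}.
        S t i i \<le> 0 \<and>
        (\<forall>j\<in>{1..p}. i \<noteq> j \<longrightarrow> 0 \<le> S t i j) \<and>
        (\<Sum>j\<in>{1..p}. S t i j) \<le> 0)"

definition exit_rates :: "nat \<Rightarrow> (real \<Rightarrow> nat \<Rightarrow> nat \<Rightarrow> real) \<Rightarrow> real set" where
  "exit_rates p S = {\<bar>S t i i\<bar> | t i. 0 \<le> t \<and> i \<in> {1..p}}"

definition base_intensity :: "nat \<Rightarrow> (real \<Rightarrow> nat \<Rightarrow> nat \<Rightarrow> real) \<Rightarrow> nat" where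
  "base_intensity p S = nat \<lceil>Sup (exit_rates p S)\<rceil>"

text \<open>A process is represented by its counting process \<open>N t \<omega>\<close>, the number of
  arrivals in \<open>(0, t]\<close>; only \<open>t \<ge> 0\<close> matters. Since paths are
  nondecreasing, the truncated subtraction in the increments is harmless.\<close>

definition poisson_process :: "'a measure \<Rightarrow> real \<Rightarrow> (real \<Rightarrow> 'a \<Rightarrow> nat) \<Rightarrow> bool" where
  "poisson_process P lam N \<longleftrightarrow>
     (\<forall>t\<ge>0. N t \<in> measurable P (count_space UNIV)) \<and>
     (\<forall>\<omega>\<in>space P. N 0 \<omega> = 0 \<and>
        mono_on {0..} (\<lambda>t. N t \<omega>) \<and>
        (\<forall>t\<ge>0. continuous (at_right t) (\<lambda>s. real (N s \<omega>)))) \<and>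
     (\<forall>t :: nat \<Rightarrow> real. 0 \<le> t 0 \<longrightarrow> incseq t \<longrightarrow>
        prob_space.indep_vars P (\<lambda>_. count_space UNIV)
          (\<lambda>l \<omega>. N (t (Suc l)) \<omega> - N (t l) \<omega>) UNIV) \<and>
     (\<forall>s t. 0 \<le> s \<longrightarrow> s < t \<longrightarrow>
        distr P (count_space UNIV) (\<lambda>\<omega>. N t \<omega> - N s \<omega>)
          = measure_pmf (poisson_pmf (lam * (t - s))))"

text \<open>The value of \<open>arrival\<close> is \<open>0\<close> for \<open>l = 0\<close>. The last branch concerns only paths
  with finitely many arrivals, which form a null set; it avoids the unspecified
  infimum of the empty set.\<close>

definition arrival :: "(real \<Rightarrow> 'a \<Rightarrow> nat) \<Rightarrow> nat \<Rightarrow> 'a \<Rightarrow> real" where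
  "arrival N l \<omega> =
     (if \<exists>t\<ge>0. l \<le> N t \<omega> then Inf {t. 0 \<le> t \<and> l \<le> N t \<omega>} else 0)"

definition superposition ::
  "nat \<Rightarrow> nat \<Rightarrow> (real \<Rightarrow> 'a \<Rightarrow> nat) \<Rightarrow> (nat \<Rightarrow> real \<Rightarrow> 'a \<Rightarrow> nat) \<Rightarrow> real \<Rightarrow> 'a \<Rightarrow> nat" where
  "superposition l0 n N N' t \<omega> = N t \<omega> + (\<Sum>l\<in>{l0+1..n}. N' l t \<omega>)"

definition process_algebra :: "'a measure \<Rightarrow> (real \<Rightarrow> 'a \<Rightarrow> nat) \<Rightarrow> 'a measure" where
  "process_algebra P N = sigma (space P) {N t -` B \<inter> space P | t B. 0 \<le> t}"

datatype source =
    Clock | Extra_Clock nat | Unif nat | Reward_Clock nat | Extra_Reward_Clock nat nat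

definition sources :: "nat \<Rightarrow> nat \<Rightarrow> source set" where
  "sources l0 m = {Clock} \<union> Extra_Clock ` {l0+1..} \<union> range Unif \<union> Reward_Clock ` {1..m} \<union>
     {Extra_Reward_Clock k l | k l. k \<in> {1..m} \<and> l0 + 1 \<le> l}"

fun source_events ::
  "'a measure \<Rightarrow> (real \<Rightarrow> 'a \<Rightarrow> nat) \<Rightarrow> (nat \<Rightarrow> real \<Rightarrow> 'a \<Rightarrow> nat) \<Rightarrow> (nat \<Rightarrow> 'a \<Rightarrow> real) \<Rightarrow>
   (nat \<Rightarrow> real \<Rightarrow> 'a \<Rightarrow> nat) \<Rightarrow> (nat \<Rightarrow> nat \<Rightarrow> real \<Rightarrow> 'a \<Rightarrow> nat) \<Rightarrow> source \<Rightarrow> 'a set set" where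
  "source_events P N N' U M M' Clock = sets (process_algebra P N)"
| "source_events P N N' U M M' (Extra_Clock l) = sets (process_algebra P (N' l))"
| "source_events P N N' U M M' (Unif l) = sets (vimage_algebra (space P) (U l) borel)"
| "source_events P N N' U M M' (Reward_Clock k) = sets (process_algebra P (M k))"
| "source_events P N N' U M M' (Extra_Reward_Clock k l) = sets (process_algebra P (M' k l))"

text \<open>States are \<open>1, \<dots>, p\<close>, wrapped in \<open>Some\<close>; the absorbing state \<open>\<star>\<close> is \<open>None\<close>.
  \<open>pick p q u\<close> is the \<open>k\<close> whose interval
  \<open>[q 1 + \<dots> + q (k-1), q 1 + \<dots> + q k)\<close> contains \<open>u\<close>. For \<open>q\<close> with nonnegative
  entries and \<open>u\<close> in \<open>[0,1)\<close>, no such \<open>k\<close> exists exactly when \<open>u\<close> lies in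
  \<open>[q 1 + \<dots> + q p, 1)\<close>.\<close>

definition pick :: "nat \<Rightarrow> (nat \<Rightarrow> real) \<Rightarrow> real \<Rightarrow> nat option" where
  "pick p q u =
     (if \<exists>k\<in>{1..p}. (\<Sum>j\<in>{1..<k}. q j) \<le> u \<and> u < (\<Sum>j\<in>{1..k}. q j)
      then Some (THE k. k \<in> {1..p} \<and> (\<Sum>j\<in>{1..<k}. q j) \<le> u \<and> u < (\<Sum>j\<in>{1..k}. q j))
      else None)"

text \<open>State right after the \<open>l\<close>-th arrival of \<open>N\<close>.\<close>

primrec embedded_chain ::
  "nat \<Rightarrow> (real \<Rightarrow> nat \<Rightarrow> nat \<Rightarrow> real) \<Rightarrow> (nat \<Rightarrow> real) \<Rightarrow> (real \<Rightarrow> 'a \<Rightarrow> nat) \<Rightarrow>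
   (nat \<Rightarrow> 'a \<Rightarrow> real) \<Rightarrow> nat \<Rightarrow> 'a \<Rightarrow> nat option" where
  "embedded_chain p S \<pi> N U 0 \<omega> = pick p \<pi> (U 0 \<omega>)"
| "embedded_chain p S \<pi> N U (Suc l) \<omega> =
     (case embedded_chain p S \<pi> N U l \<omega> of
        None \<Rightarrow> None
      | Some i \<Rightarrow>
          pick p (\<lambda>j. S (arrival N (Suc l) \<omega>) i j / real (base_intensity p S) + (if i = j then 1 else 0))
            (U (Suc l) \<omega>))"

text \<open>\<open>N t \<omega> = l\<close> means that \<open>t\<close> lies between the \<open>l\<close>-th arrival (included) and the next.\<close>

definition jump_process ::
  "nat \<Rightarrow> (real \<Rightarrow> nat \<Rightarrow> nat \<Rightarrow> real) \<Rightarrow> (nat \<Rightarrow> real) \<Rightarrow> (real \<Rightarrow> 'a \<Rightarrow> nat) \<Rightarrow>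
   (nat \<Rightarrow> 'a \<Rightarrow> real) \<Rightarrow> real \<Rightarrow> 'a \<Rightarrow> nat option" where
  "jump_process p S \<pi> N U t \<omega> = embedded_chain p S \<pi> N U (N t \<omega>) \<omega>"

definition termination_time :: "(real \<Rightarrow> 'a \<Rightarrow> nat option) \<Rightarrow> 'a \<Rightarrow> real" where
  "termination_time J \<omega> = Inf {t. 0 \<le> t \<and> J t \<omega> = None}"

definition total_reward ::
  "(nat \<Rightarrow> real) \<Rightarrow> (real \<Rightarrow> 'a \<Rightarrow> nat option) \<Rightarrow> 'a \<Rightarrow> real" where
  "total_reward \<rho> J \<omega> =
     (LINT t:{0..<termination_time J \<omega>}|lborel. (case J t \<omega> of None \<Rightarrow> 0 | Some i \<Rightarrow> \<rho> i))"

definition cond_pr :: "'a measure \<Rightarrow> 'a measure \<Rightarrow> 'a set \<Rightarrow> 'a \<Rightarrow> real" where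
  "cond_pr P G A = real_cond_exp P G (indicator A)"

text \<open>Conditional probability of \<open>A\<close> given the event \<open>B\<close> and the sub-\<open>\<sigma>\<close>-algebra \<open>G\<close>;
  meaningful where \<open>cond_pr P G B \<omega> > 0\<close>, and \<open>0\<close> by convention elsewhere.\<close>

definition cond_pr_event :: "'a measure \<Rightarrow> 'a measure \<Rightarrow> 'a set \<Rightarrow> 'a set \<Rightarrow> 'a \<Rightarrow> real" where
  "cond_pr_event P G A B \<omega> = cond_pr P G (A \<inter> B) \<omega> / cond_pr P G B \<omega>"

text \<open>Conditionally on \<open>G\<close>, the random element \<open>Y\<close> has the (random) density \<open>f \<omega>\<close> with
  respect to \<open>R\<close>, in the sense of regular conditional distributions.\<close>

definition conditional_density ::
  "'a measure \<Rightarrow> 'a measure \<Rightarrow> 'b measure \<Rightarrow> ('a \<Rightarrow> 'b) \<Rightarrow> ('a \<Rightarrow> 'b \<Rightarrow> ennreal) \<Rightarrow> bool" where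
  "conditional_density P G R Y f \<longleftrightarrow>
     Y \<in> measurable P R \<and>
     (\<lambda>(\<omega>, x). f \<omega> x) \<in> borel_measurable (G \<Otimes>\<^sub>M R) \<and>
     (\<forall>A\<in>sets R. AE \<omega> in P.
        ennreal (cond_pr P G (Y -` A \<inter> space P) \<omega>) = emeasure (density R (f \<omega>)) A)"

text \<open>\<open>erlang_density\<close> is indexed by the shape minus one. The rate is an extended real, so
  that \<open>ereal n / ereal 0 = \<infinity>\<close> for \<open>n > 0\<close>.\<close>

definition erlang_law :: "nat \<Rightarrow> ereal \<Rightarrow> real measure" where
  "erlang_law i rate =
     (if i = 0 \<or> rate = \<infinity> then return borel 0
      else density lborel (\<lambda>x. ennreal (erlang_density (i - 1) (real_of_ereal rate) x)))"

definition hypoexp_law :: "nat \<Rightarrow> nat \<Rightarrow> (nat \<Rightarrow> nat \<Rightarrow> real) \<Rightarrow> nat \<Rightarrow> (nat \<Rightarrow> nat) \<Rightarrow> real measure" where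
  "hypoexp_law p n r k i =
     distr (\<Pi>\<^sub>M j\<in>{1..p}. erlang_law (i j) (ereal (real n) / ereal (r j k))) borel
       (\<lambda>x. \<Sum>j\<in>{1..p}. x j)"

text \<open>The hypoexponential law is the point mass at \<open>0\<close> when all rewards of the visited states
  vanish, and absolutely continuous otherwise. Densities are therefore taken with respect to
  Lebesgue measure if all rewards in column \<open>k\<close> are positive, and with respect to Lebesgue
  measure plus a unit atom at \<open>0\<close> if some reward is zero.\<close>

definition reward_base :: "nat \<Rightarrow> (nat \<Rightarrow> nat \<Rightarrow> real) \<Rightarrow> nat \<Rightarrow> real measure" where
  "reward_base p r k =
     (if \<forall>j\<in>{1..p}. 0 < r j k then lborel
      else measure_of UNIV (sets borel) (\<lambda>A. emeasure lborel A + indicator A 0))"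

definition hypoexp_dens ::
  "nat \<Rightarrow> nat \<Rightarrow> (nat \<Rightarrow> nat \<Rightarrow> real) \<Rightarrow> nat \<Rightarrow> (nat \<Rightarrow> nat) \<Rightarrow> real \<Rightarrow> ennreal" where
  "hypoexp_dens p n r k i = RN_deriv (reward_base p r k) (hypoexp_law p n r k i)"

definition multi_indices :: "nat \<Rightarrow> (nat \<Rightarrow> nat) set" where
  "multi_indices p = {i \<in> {1..p} \<rightarrow>\<^sub>E UNIV. 0 < (\<Sum>a\<in>{1..p}. i a)}"

definition unit_index :: "nat \<Rightarrow> nat \<Rightarrow> nat \<Rightarrow> nat" where
  "unit_index p h = (\<lambda>a\<in>{1..p}. if a = h then 1 else 0)"

end

theory Submission
  imports Defs
begin

text \<open>
  The jump process only ever enters through the sequence of its states at the arrival times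
  \<open>\<chi>\<^sub>1 < \<chi>\<^sub>2 < \<dots>\<close> of the superposed clock. Colour an arrival of the superposition if it
  comes from the original clock. Between coloured arrivals the process does not move, and at a
  coloured arrival it moves by the uniform variable that is next in line; so, given the arrival times
  and the colours, the state sequence is the deterministic recursion \<open>marked_chain\<close>
  (\<open>embedded_chain_at_arrival\<close>). By the thinning theorem, proved as \<open>marks_independent\<close>, the colours
  are independent Bernoulli variables with parameter \<open>\<lambda>\<^sub>0 / n\<close>, independent of the superposed
  clock. At each arrival the chain therefore stays put with probability \<open>1 - \<lambda>\<^sub>0 / n\<close> and
  otherwise jumps with the law \<open>I + S / \<lambda>\<^sub>0\<close>, which mixes to the transition matrix
  \<open>Q = I + S / n\<close>.

  Conditioning on the clock is done by freezing: the clock is independent of colours, uniform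
  variables and reward clocks, so a conditional probability given the clock is the probability with
  the arrival times replaced by constants (\<open>cond_pr_freeze\<close>, \<open>cond_pr_path\<close>). For frozen arrival
  times the state sequence is an inhomogeneous Markov chain with kernel \<open>Q\<close> (\<open>frozen_markov\<close>,
  \<open>frozen_termination\<close>, \<open>frozen_initial\<close>). The formula for \<open>\<beta>\<close> and the recursion for \<open>\<alpha>\<close> are then
  the Markov property: the visit counts up to a time arise from the counts one step earlier by
  adding the current state.

  For the rewards, the state sequence is run against the reward clocks, whose holding times are
  independent exponential variables with rate \<open>n\<close> (\<open>hold_indep\<close>, \<open>hold_exponential\<close>). If the chain
  terminates at step \<open>L\<close> the reward of type \<open>k\<close> is the sum over \<open>l < L\<close> of the reward rate of
  the \<open>l\<close>-th state times the \<open>l\<close>-th holding time (\<open>total_reward_regular\<close>). Grouping the summands by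
  state, its law given the history depends on the visit counts only and is hypoexponential
  (\<open>distr_reward_sum\<close>); different reward types use independent clocks. Splitting according to the
  visit counts at termination gives the mixture (\<open>cond_pr_rewards\<close>), and the product of the
  hypoexponential laws has the product of their densities as density (\<open>density_PiM\<close>).

  The facts about Poisson processes are obtained by discretisation. On the dyadic grid of mesh
  \<open>2\<^sup>-\<^sup>q\<close> the increments form a finite list of independent Poisson variables, so statements about
  them are finite combinatorics; almost surely every cell of a fine enough grid contains at most
  one arrival (\<open>crowded_cell_vanishes\<close>), and the events of interest are limits of grid events.
\<close>

section \<open>Counting paths\<close>

text \<open>The pathwise part of the definition of a Poisson process. Such a path may still jump
  by more than one or stay bounded.\<close>

definition counting_path :: "(real \<Rightarrow> nat) \<Rightarrow> bool" where
  "counting_path f \<longleftrightarrow> f 0 = 0 \<and> mono_on {0..} f \<and>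
     (\<forall>t\<ge>0. continuous (at_right t) (\<lambda>s. real (f s)))"

text \<open>The arrival time of a single path, so that pathwise arguments need no probability
  space.\<close>

definition path_arrival :: "(real \<Rightarrow> nat) \<Rightarrow> nat \<Rightarrow> real" where
  "path_arrival f l = (if \<exists>t\<ge>0. l \<le> f t then Inf {t. 0 \<le> t \<and> l \<le> f t} else 0)"

lemma arrival_eq_path_arrival: "arrival N l \<omega> = path_arrival (\<lambda>t. N t \<omega>) l"
  by (simp add: arrival_def path_arrival_def)

lemma counting_path_mono:
  assumes "counting_path f" "0 \<le> s" "s \<le> t"
  shows "f s \<le> f t"
  using assms by (intro mono_onD[of "{0..}" f]) (auto simp: counting_path_def)

text \<open>A right-continuous integer-valued path is constant on a short interval to the
  right.\<close>

lemma counting_path_right_constant: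
  assumes "counting_path f" "0 \<le> t"
  obtains e where "0 < e" "\<And>s. t \<le> s \<Longrightarrow> s < t + e \<Longrightarrow> f s = f t"
proof -
  have "((\<lambda>s. real (f s)) \<longlongrightarrow> real (f t)) (at_right t)"
    using assms unfolding counting_path_def continuous_within by auto
  then have "eventually (\<lambda>s. dist (real (f s)) (real (f t)) < 1) (at_right t)"
    by (rule tendstoD) simp
  then obtain b where b: "b > t" "\<And>s. t < s \<Longrightarrow> s < b \<Longrightarrow> dist (real (f s)) (real (f t)) < 1"
    unfolding eventually_at_right_field by auto
  have const: "f s = f t" if "t \<le> s" "s < t + (b - t)" for s
  proof (cases "s = t")
    case False
    with that b(2)[of s] have "\<bar>real (f s) - real (f t)\<bar> < 1" by (auto simp: dist_real_def)
    then show ?thesis by linarith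
  qed simp
  have "0 < b - t" using b(1) by simp
  from this const show ?thesis by (rule that)
qed

lemma counting_path_add:
  assumes "counting_path f" "counting_path g"
  shows "counting_path (\<lambda>t. f t + g t)"
proof -
  have "continuous (at_right t) (\<lambda>s. real (f s + g s))" if "0 \<le> t" for t
    using assms that unfolding counting_path_def by (simp add: continuous_add)
  moreover have "mono_on {0..} (\<lambda>t. f t + g t)"
    using counting_path_mono[OF assms(1)] counting_path_mono[OF assms(2)]
    by (intro mono_onI add_mono) auto
  ultimately show ?thesis using assms unfolding counting_path_def by simp
qed

lemma counting_path_zero: "counting_path (\<lambda>t. 0)"
  by (simp add: counting_path_def mono_on_def)

lemma counting_path_eventually_eq:
  assumes f: "counting_path f" and t: "0 \<le> t" and s: "s \<longlonglongrightarrow> t" and ge: "\<And>q. t \<le> s q"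
  shows "eventually (\<lambda>q. f (s q) = f t) sequentially"
proof -
  obtain e where e: "0 < e" "\<And>s. t \<le> s \<Longrightarrow> s < t + e \<Longrightarrow> f s = f t"
    using counting_path_right_constant[OF f t] by blast
  have "eventually (\<lambda>q. s q < t + e) sequentially"
    using order_tendstoD(2)[OF s, of "t + e"] e(1) by simp
  then show ?thesis by eventually_elim (rule e(2)[OF ge])
qed

lemma path_arrival_nonneg: "0 \<le> path_arrival f l"
proof (cases "\<exists>t\<ge>0. l \<le> f t")
  case True
  then have "0 \<le> Inf {t. 0 \<le> t \<and> l \<le> f t}" by (intro cInf_greatest) auto
  with True show ?thesis by (simp add: path_arrival_def)
qed (auto simp: path_arrival_def)

text \<open>All levels are attained exactly when the jumps have size one and the path is
  unbounded. This is where arrival times behave as expected, and it holds almost surely.\<close>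

definition regular_path :: "(real \<Rightarrow> nat) \<Rightarrow> bool" where
  "regular_path f \<longleftrightarrow> counting_path f \<and> (\<forall>l. \<exists>t\<ge>0. f t = l)"

lemma regular_pathD: "regular_path f \<Longrightarrow> counting_path f"
  by (simp add: regular_path_def)

lemma arrival_le_iff:
  assumes f: "counting_path f" and ex: "\<exists>t\<ge>0. l \<le> f t" and t: "0 \<le> t"
  shows "path_arrival f l \<le> t \<longleftrightarrow> l \<le> f t"
proof -
  let ?A = "{t. 0 \<le> t \<and> l \<le> f t}"
  have eq: "path_arrival f l = Inf ?A" using ex by (simp add: path_arrival_def)
  have bdd: "bdd_below ?A" by (rule bdd_belowI[of _ 0]) auto
  have ne: "?A \<noteq> {}" using ex by auto
  have 0: "0 \<le> Inf ?A" using ne by (intro cInf_greatest) auto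
  have att: "l \<le> f (Inf ?A)"
  proof -
    obtain e where e: "0 < e" "\<And>s. Inf ?A \<le> s \<Longrightarrow> s < Inf ?A + e \<Longrightarrow> f s = f (Inf ?A)"
      using counting_path_right_constant[OF f 0] by blast
    obtain s where s: "s \<in> ?A" "s < Inf ?A + e"
      using cInf_lessD[OF ne, of "Inf ?A + e"] e(1) by auto
    moreover have "Inf ?A \<le> s" using s(1) bdd by (rule cInf_lower)
    ultimately show ?thesis using e(2)[of s] by auto
  qed
  show ?thesis unfolding eq
  proof
    assume "Inf ?A \<le> t"
    then show "l \<le> f t" using att counting_path_mono[OF f 0] by fastforce
  next
    assume "l \<le> f t"
    then show "Inf ?A \<le> t" using t bdd by (intro cInf_lower) auto
  qed
qed

context
  fixes f :: "real \<Rightarrow> nat"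
  assumes reg: "regular_path f"
begin

lemma regular_arrival_le_iff: "0 \<le> t \<Longrightarrow> path_arrival f l \<le> t \<longleftrightarrow> l \<le> f t"
  using reg by (intro arrival_le_iff) (auto simp: regular_path_def, metis order_refl)

lemma regular_at_arrival: "f (path_arrival f l) = l"
proof -
  obtain t where t: "0 \<le> t" "f t = l" using reg by (auto simp: regular_path_def)
  then have "path_arrival f l \<le> t" using regular_arrival_le_iff by auto
  then have "f (path_arrival f l) \<le> l"
    using counting_path_mono[OF regular_pathD[OF reg], of "path_arrival f l" t] path_arrival_nonneg[of f l] t by simp
  moreover have "l \<le> f (path_arrival f l)"
    using regular_arrival_le_iff[OF path_arrival_nonneg] by auto
  ultimately show ?thesis by simp
qed

lemma regular_less_arrival_iff: "0 \<le> t \<Longrightarrow> t < path_arrival f l \<longleftrightarrow> f t < l"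
  using regular_arrival_le_iff[of t l] by linarith

lemma regular_arrival_mono: "k \<le> l \<Longrightarrow> path_arrival f k \<le> path_arrival f l"
  using regular_arrival_le_iff[OF path_arrival_nonneg] regular_at_arrival by simp

lemma regular_arrival_strict_mono: "k < l \<Longrightarrow> path_arrival f k < path_arrival f l"
  using regular_less_arrival_iff[OF path_arrival_nonneg] regular_at_arrival by simp

lemma regular_arrival_0: "path_arrival f 0 = 0"
  using regular_arrival_le_iff[of 0 0] path_arrival_nonneg[of f 0] by simp

lemma regular_between_arrivals:
  "0 \<le> t \<Longrightarrow> f t = l \<longleftrightarrow> path_arrival f l \<le> t \<and> t < path_arrival f (Suc l)"
  using regular_arrival_le_iff[of t l] regular_less_arrival_iff[of t "Suc l"] by auto

end

subsection \<open>Marks of a superposition\<close>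

text \<open>The \<open>l\<close>-th arrival of the superposition \<open>f\<close> is marked when
  its component \<open>g\<close> jumps there.\<close>

definition mark :: "(real \<Rightarrow> nat) \<Rightarrow> (real \<Rightarrow> nat) \<Rightarrow> nat \<Rightarrow> bool" where
  "mark f g l \<longleftrightarrow> g (path_arrival f (l - 1)) < g (path_arrival f l)"

context
  fixes f g h :: "real \<Rightarrow> nat"
  assumes reg: "regular_path f" and g: "counting_path g" and h: "counting_path h"
    and sum: "\<And>t. f t = g t + h t"
begin

lemma component_constant:
  assumes "0 \<le> s" "0 \<le> t" "f s = f t"
  shows "g s = g t"
proof -
  have *: "g s = g t" if "0 \<le> s" "s \<le> t" "f s = f t" for s t
    using counting_path_mono[OF g that(1,2)] counting_path_mono[OF h that(1,2)] that(3) sum by simp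
  show ?thesis using *[of s t] *[of t s, symmetric] assms
    by (metis linear)
qed

lemma component_step:
  "g (path_arrival f (Suc l)) = g (path_arrival f l) + (if mark f g (Suc l) then 1 else 0)"
proof -
  let ?s = "path_arrival f l" and ?t = "path_arrival f (Suc l)"
  have "?s \<le> ?t" using regular_arrival_mono[OF reg] by simp
  then have "g ?s \<le> g ?t" "h ?s \<le> h ?t"
    using counting_path_mono[OF g path_arrival_nonneg] counting_path_mono[OF h path_arrival_nonneg] by auto
  moreover have "g ?t + h ?t = Suc (g ?s + h ?s)"
    using regular_at_arrival[OF reg, of l] regular_at_arrival[OF reg, of "Suc l"] sum by simp
  ultimately show ?thesis by (auto simp: mark_def)
qed

lemma component_at_arrival: "g (path_arrival f l) = card {i \<in> {1..l}. mark f g i}"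
proof (induction l)
  case 0
  then show ?case using g by (simp add: regular_arrival_0[OF reg] counting_path_def)
next
  case (Suc l)
  have "{i \<in> {1..Suc l}. mark f g i} = {i \<in> {1..l}. mark f g i} \<union> (if mark f g (Suc l) then {Suc l} else {})"
    by (auto simp: le_Suc_eq)
  then show ?case unfolding component_step Suc.IH by (auto simp: card_insert_if)
qed

lemma arrival_of_marked:
  assumes "mark f g (Suc l)"
  shows "path_arrival g (g (path_arrival f (Suc l))) = path_arrival f (Suc l)"
proof (rule antisym)
  let ?t = "path_arrival f (Suc l)"
  have ex: "\<exists>t\<ge>0. g ?t \<le> g t" using path_arrival_nonneg[of f] by blast
  note le = arrival_le_iff[OF g ex]
  show "path_arrival g (g ?t) \<le> ?t" using le[OF path_arrival_nonneg] by simp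
  show "?t \<le> path_arrival g (g ?t)"
  proof (rule ccontr)
    let ?s = "path_arrival g (g ?t)"
    assume "\<not> ?t \<le> ?s"
    then have "f ?s \<le> l" using regular_less_arrival_iff[OF reg path_arrival_nonneg, of g "g ?t" "Suc l"] by simp
    then have le_l: "f ?s \<le> f (path_arrival f l)" using regular_at_arrival[OF reg] by simp
    have "g ?s \<le> g (path_arrival f l)"
    proof (cases "?s \<le> path_arrival f l")
      case True
      then show ?thesis by (rule counting_path_mono[OF g path_arrival_nonneg])
    next
      case False
      then have "f (path_arrival f l) \<le> f ?s"
        by (intro counting_path_mono[OF regular_pathD[OF reg] path_arrival_nonneg]) simp
      with le_l have "f ?s = f (path_arrival f l)" by (rule order_antisym)
      then have "g ?s = g (path_arrival f l)"
        by (rule component_constant[OF path_arrival_nonneg path_arrival_nonneg])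
      then show ?thesis by (rule eq_refl)
    qed
    moreover have "g ?t \<le> g ?s" using le[OF path_arrival_nonneg, of g "g ?t"] by simp
    ultimately show False using component_step[of l] assms by simp
  qed
qed

lemma component_eq_at_last_arrival: "0 \<le> t \<Longrightarrow> g t = g (path_arrival f (f t))"
  using component_constant[OF _ path_arrival_nonneg] regular_at_arrival[OF reg] by simp

text \<open>On a grid without two arrivals in one cell, the marks can be read off cell by cell:
  the nonempty cells correspond to the arrivals, in order.\<close>

lemma marks_from_cells:
  fixes d :: real
  defines "cell \<equiv> \<lambda>i::nat. (g (real (Suc i) * d) - g (real i * d), h (real (Suc i) * d) - h (real i * d))"
  assumes "0 \<le> d" "\<And>i. i < K \<Longrightarrow> f (real (Suc i) * d) - f (real i * d) \<le> 1"
  shows "map (mark f g) [1..<Suc (f (real K * d))] =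
     map (\<lambda>(x, z). 0 < x) (filter (\<lambda>(x, z). 0 < x + z) (map cell [0..<K]))"
  using assms(3)
proof (induction K)
  case 0
  then show ?case using reg by (simp add: regular_path_def counting_path_def)
next
  case (Suc K)
  let ?s = "real K * d" and ?t = "real (Suc K) * d"
  have st: "0 \<le> ?s" "?s \<le> ?t" "0 \<le> ?t" using assms(2) by (auto simp: mult_right_mono)
  note mono = counting_path_mono[OF g st(1,2)] counting_path_mono[OF h st(1,2)]
  have IH: "map (mark f g) [1..<Suc (f ?s)] =
     map (\<lambda>(x, z). 0 < x) (filter (\<lambda>(x, z). 0 < x + z) (map cell [0..<K]))"
    using Suc by simp
  show ?case
  proof (cases "f ?t = f ?s")
    case True
    then have "g ?t + h ?t = g ?s + h ?s" using sum by simp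
    with mono have "cell K = (0, 0)" by (simp add: cell_def)
    then show ?thesis using IH True by simp
  next
    case False
    have "f ?t - f ?s \<le> 1" using Suc.prems by simp
    moreover have "f ?s \<le> f ?t" using counting_path_mono[OF regular_pathD[OF reg] st(1,2)] .
    ultimately have ft: "f ?t = Suc (f ?s)" using False by simp
    then have pos: "0 < fst (cell K) + snd (cell K)" using mono sum by (simp add: cell_def)
    have "mark f g (Suc (f ?s)) \<longleftrightarrow> g ?s < g ?t"
      unfolding mark_def using component_eq_at_last_arrival[OF st(1)] component_eq_at_last_arrival[OF st(3)] ft
      by simp
    then have "mark f g (Suc (f ?s)) \<longleftrightarrow> 0 < fst (cell K)"
      by (simp add: cell_def)
    moreover have "[1..<Suc (f ?t)] = [1..<Suc (f ?s)] @ [Suc (f ?s)]" using ft by simp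
    ultimately show ?thesis using IH pos by (simp add: case_prod_unfold)
  qed
qed

end

subsection \<open>The embedded chain driven by marks\<close>

text \<open>The state sequence as a function of arrival times \<open>t\<close>, marks
  \<open>b\<close> and uniform choices \<open>u\<close>. Choices are consumed only at marked
  arrivals, hence the index is the number of marks so far.\<close>

primrec marked_chain ::
  "nat \<Rightarrow> (real \<Rightarrow> nat \<Rightarrow> nat \<Rightarrow> real) \<Rightarrow> (nat \<Rightarrow> real) \<Rightarrow> real \<Rightarrow> (nat \<Rightarrow> real) \<Rightarrow> (nat \<Rightarrow> bool) \<Rightarrow>
   (nat \<Rightarrow> real) \<Rightarrow> nat \<Rightarrow> nat option" where
  "marked_chain p S \<pi> lam t b u 0 = pick p \<pi> (u 0)"
| "marked_chain p S \<pi> lam t b u (Suc l) =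
     (if b (Suc l)
      then (case marked_chain p S \<pi> lam t b u l of
              None \<Rightarrow> None
            | Some i \<Rightarrow> pick p (\<lambda>j. S (t (Suc l)) i j / lam + (if i = j then 1 else 0))
                (u (card {i \<in> {1..Suc l}. b i})))
      else marked_chain p S \<pi> lam t b u l)"

text \<open>The number of marks up to the \<open>l\<close>-th arrival of the superposition is the
  number of arrivals of the component, and a marked arrival is an arrival of the component; so
  both recursions use the same times and the same choices.\<close>

lemma embedded_chain_at_arrival:
  assumes "regular_path (\<lambda>t. F t \<omega>)" "counting_path (\<lambda>t. N t \<omega>)" "counting_path h"
    and "\<And>t. F t \<omega> = N t \<omega> + h t"
  shows "embedded_chain p S \<pi> N U (N (arrival F l \<omega>) \<omega>) \<omega> =
    marked_chain p S \<pi> (real (base_intensity p S)) (\<lambda>l. arrival F l \<omega>)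
      (mark (\<lambda>t. F t \<omega>) (\<lambda>t. N t \<omega>)) (\<lambda>l. U l \<omega>) l"
proof (induction l)
  case 0
  have "N (arrival F 0 \<omega>) \<omega> = 0"
    using regular_arrival_0[OF assms(1)] assms(2) by (simp add: arrival_eq_path_arrival counting_path_def)
  then show ?case by simp
next
  case (Suc l)
  let ?f = "\<lambda>t. F t \<omega>" and ?g = "\<lambda>t. N t \<omega>"
  note step = component_step[OF assms, of l] and card = component_at_arrival[OF assms, of "Suc l"]
  show ?case
  proof (cases "mark ?f ?g (Suc l)")
    case False
    then show ?thesis using Suc step by (simp add: arrival_eq_path_arrival)
  next
    case True
    have eq: "N (arrival F (Suc l) \<omega>) \<omega> = Suc (N (arrival F l \<omega>) \<omega>)"
      using step True by (simp add: arrival_eq_path_arrival)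
    have same: "arrival N (Suc (N (arrival F l \<omega>) \<omega>)) \<omega> = arrival F (Suc l) \<omega>"
    proof -
      have "arrival N (N (arrival F (Suc l) \<omega>) \<omega>) \<omega> = arrival F (Suc l) \<omega>"
        unfolding arrival_eq_path_arrival by (rule arrival_of_marked[OF assms True])
      then show ?thesis unfolding eq .
    qed
    have count: "card {i \<in> {1..Suc l}. mark ?f ?g i} = Suc (N (arrival F l \<omega>) \<omega>)"
      unfolding card[symmetric] arrival_eq_path_arrival[symmetric] by (rule eq)
    show ?thesis
      unfolding eq embedded_chain.simps marked_chain.simps if_P[OF True] Suc same count ..
  qed
qed

lemma embedded_chain_absorbed:
  "embedded_chain p S \<pi> N U k \<omega> = None \<Longrightarrow> k \<le> l \<Longrightarrow> embedded_chain p S \<pi> N U l \<omega> = None"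
proof (induction l)
  case (Suc l)
  then show ?case by (cases "k = Suc l") simp_all
qed simp

lemma marked_chain_absorbed:
  "marked_chain p S \<pi> lam t b u k = None \<Longrightarrow> k \<le> l \<Longrightarrow> marked_chain p S \<pi> lam t b u l = None"
proof (induction l)
  case (Suc l)
  show ?case
  proof (cases "k = Suc l")
    case False
    then have "marked_chain p S \<pi> lam t b u l = None" using Suc by simp
    then show ?thesis by simp
  qed (use Suc.prems in simp)
qed simp

section \<open>Poisson processes on a dyadic grid\<close>

text \<open>The rate \<open>0\<close> is included because the superposition of no extra clocks,
  for \<open>n = \<lambda>\<^sub>0\<close>, is the zero process.\<close>

definition poisson_law :: "real \<Rightarrow> nat pmf" where
  "poisson_law r = (if r = 0 then return_pmf 0 else poisson_pmf r)"

lemma pmf_poisson_law: "0 \<le> r \<Longrightarrow> pmf (poisson_law r) k = r ^ k / fact k * exp (- r)"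
  by (cases "r = 0") (auto simp: poisson_law_def power_0_left)

text \<open>Poisson laws add under convolution, by the binomial theorem.\<close>

lemma map_pmf_add_poisson_law:
  assumes "0 \<le> a" "0 \<le> b"
  shows "map_pmf (\<lambda>(x, z). x + z) (pair_pmf (poisson_law a) (poisson_law b)) = poisson_law (a + b)"
proof (rule pmf_eqI)
  fix d :: nat
  have inj: "inj_on (\<lambda>x. (x, d - x)) {..d}" by (auto intro: inj_onI)
  have "(\<lambda>(x, z). x + z) -` {d} = (\<lambda>x. (x, d - x)) ` {..d}"
    by (force simp: image_iff)
  then have "pmf (map_pmf (\<lambda>(x, z). x + z) (pair_pmf (poisson_law a) (poisson_law b))) d
    = measure (pair_pmf (poisson_law a) (poisson_law b)) ((\<lambda>x. (x, d - x)) ` {..d})"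
    by (simp add: pmf_map)
  also have "\<dots> = (\<Sum>x\<le>d. pmf (pair_pmf (poisson_law a) (poisson_law b)) (x, d - x))"
    by (simp add: measure_measure_pmf_finite sum.reindex[OF inj])
  also have "\<dots> = (\<Sum>x\<le>d. (a ^ x / fact x * exp (- a)) * (b ^ (d - x) / fact (d - x) * exp (- b)))"
    using assms by (simp add: pmf_pair pmf_poisson_law)
  also have "\<dots> = (\<Sum>x\<le>d. exp (- (a + b)) / fact d * (of_nat (d choose x) * a ^ x * b ^ (d - x)))"
  proof (rule sum.cong[OF refl])
    fix x assume "x \<in> {..d}"
    then have "real (d choose x) = fact d / (fact x * fact (d - x))" by (simp add: binomial_fact)
    then show "(a ^ x / fact x * exp (- a)) * (b ^ (d - x) / fact (d - x) * exp (- b)) =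
      exp (- (a + b)) / fact d * (of_nat (d choose x) * a ^ x * b ^ (d - x))"
      by (simp add: exp_add[symmetric] mult_exp_exp field_simps)
  qed
  also have "\<dots> = exp (- (a + b)) / fact d * (a + b) ^ d"
    by (simp only: sum_distrib_left[symmetric] binomial_ring)
  also have "\<dots> = pmf (poisson_law (a + b)) d"
    using assms by (simp add: pmf_poisson_law)
  finally show "pmf (map_pmf (\<lambda>(x, z). x + z) (pair_pmf (poisson_law a) (poisson_law b))) d
    = pmf (poisson_law (a + b)) d" .
qed

lemma pmf_replicate_pmf:
  "pmf (replicate_pmf K p) xs = (if length xs = K then (\<Prod>i<K. pmf p (xs ! i)) else 0)"
proof (induction K arbitrary: xs)
  case 0
  then show ?case by (simp add: indicator_def)
next
  case (Suc K)
  have eq: "replicate_pmf (Suc K) p = map_pmf (\<lambda>(x, xs). x # xs) (pair_pmf p (replicate_pmf K p))"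
    by (simp add: pair_pmf_def map_bind_pmf)
  show ?case
  proof (cases xs)
    case Nil
    then show ?thesis unfolding eq by (auto simp: pmf_eq_0_set_pmf)
  next
    case (Cons y ys)
    have "pmf (replicate_pmf (Suc K) p) xs = pmf (pair_pmf p (replicate_pmf K p)) (y, ys)"
      unfolding eq Cons
      using pmf_map_inj'[of "\<lambda>(x, xs). x # xs" "pair_pmf p (replicate_pmf K p)" "(y, ys)"]
      by (auto simp: inj_def)
    also have "\<dots> = pmf p y * pmf (replicate_pmf K p) ys" by (simp add: pmf_pair)
    finally show ?thesis unfolding Suc.IH using Cons
      by (simp add: prod.lessThan_Suc_shift del: prod.lessThan_Suc)
  qed
qed

lemma replicate_pmf_Suc_pair:
  "replicate_pmf (Suc K) p = map_pmf (\<lambda>(x, xs). x # xs) (pair_pmf p (replicate_pmf K p))"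
  by (simp add: pair_pmf_def map_bind_pmf)

lemma replicate_pmf_add_pair:
  "replicate_pmf (K + L) p = map_pmf (\<lambda>(xs, ys). xs @ ys) (pair_pmf (replicate_pmf K p) (replicate_pmf L p))"
  by (simp add: replicate_pmf_distrib pair_pmf_def map_bind_pmf)

lemma map_replicate_pmf: "map_pmf (map f) (replicate_pmf K p) = replicate_pmf K (map_pmf f p)"
proof (induction K)
  case (Suc K)
  show ?case unfolding replicate_pmf_Suc_pair Suc.IH[symmetric]
    by (simp add: pmf.map_comp pair_map_pmf1 pair_map_pmf2 o_def case_prod_unfold apfst_def apsnd_def)
qed simp

lemma zip_replicate_pmf:
  "map_pmf (\<lambda>(xs, ys). zip xs ys) (pair_pmf (replicate_pmf K p) (replicate_pmf K r)) =
    replicate_pmf K (pair_pmf p r)"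
proof (induction K)
  case (Suc K)
  have "map_pmf (\<lambda>(xs, ys). zip xs ys) (pair_pmf (replicate_pmf (Suc K) p) (replicate_pmf (Suc K) r)) =
    do {x \<leftarrow> p; xs \<leftarrow> replicate_pmf K p; y \<leftarrow> r; ys \<leftarrow> replicate_pmf K r; return_pmf ((x, y) # zip xs ys)}"
    by (simp add: pair_pmf_def map_bind_pmf bind_assoc_pmf bind_return_pmf)
  also have "\<dots> = do {x \<leftarrow> p; y \<leftarrow> r; xs \<leftarrow> replicate_pmf K p; ys \<leftarrow> replicate_pmf K r; return_pmf ((x, y) # zip xs ys)}"
    by (intro bind_pmf_cong refl) (rule bind_commute_pmf)
  also have "\<dots> = do {xy \<leftarrow> (do {x \<leftarrow> p; y \<leftarrow> r; return_pmf (x, y)});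
      zs \<leftarrow> map_pmf (\<lambda>(xs, ys). zip xs ys) (pair_pmf (replicate_pmf K p) (replicate_pmf K r));
      return_pmf (xy # zs)}"
    by (simp add: pair_pmf_def map_bind_pmf bind_assoc_pmf bind_return_pmf bind_map_pmf)
  finally show ?case unfolding Suc.IH pair_pmf_def[symmetric] by simp
qed simp

lemma measurable_count_space_add:
  fixes f g :: "'a \<Rightarrow> nat"
  assumes "f \<in> measurable M (count_space UNIV)" "g \<in> measurable M (count_space UNIV)"
  shows "(\<lambda>x. f x + g x) \<in> measurable M (count_space UNIV)"
  using assms by measurable

lemma measurable_map_upt:
  fixes D :: "nat \<Rightarrow> 'a \<Rightarrow> 'b :: countable"
  assumes "\<And>i. i < K \<Longrightarrow> D i \<in> measurable M (count_space UNIV)"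
  shows "(\<lambda>\<omega>. map (\<lambda>i. D i \<omega>) [0..<K]) \<in> measurable M (count_space UNIV)"
  using assms
proof (induction K)
  case (Suc K)
  have "(\<lambda>\<omega>. (\<lambda>(xs, x). xs @ [x]) (map (\<lambda>i. D i \<omega>) [0..<K], D K \<omega>)) \<in> measurable M (count_space UNIV)"
    by (rule measurable_compose[OF measurable_Pair[OF Suc.IH Suc.prems]])
      (use Suc.prems in \<open>auto simp: pair_measure_countable\<close>)
  then show ?case by simp
qed simp

lemma (in prob_space) distr_list_of_indep:
  fixes D :: "nat \<Rightarrow> 'a \<Rightarrow> 'b :: countable"
  assumes indep: "indep_vars (\<lambda>_. count_space UNIV) D UNIV"
    and law: "\<And>i. distr M (count_space UNIV) (D i) = measure_pmf p"
  shows "distr M (count_space UNIV) (\<lambda>\<omega>. map (\<lambda>i. D i \<omega>) [0..<K]) = measure_pmf (replicate_pmf K p)"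
proof (rule measure_eqI_countable[where A=UNIV])
  have rv: "D i \<in> measurable M (count_space UNIV)" for i
    using indep by (auto simp: indep_vars_def)
  have meas: "(\<lambda>\<omega>. map (\<lambda>i. D i \<omega>) [0..<K]) \<in> measurable M (count_space UNIV)"
    by (rule measurable_map_upt) (rule rv)
  fix xs :: "'b list"
  have "measure M ((\<lambda>\<omega>. map (\<lambda>i. D i \<omega>) [0..<K]) -` {xs} \<inter> space M) = pmf (replicate_pmf K p) xs"
  proof (cases "length xs = K \<and> K \<noteq> 0")
    case True
    have "map (\<lambda>i. D i \<omega>) [0..<K] = xs \<longleftrightarrow> (\<forall>i<K. D i \<omega> = xs ! i)" for \<omega>
      using True by (simp add: list_eq_iff_nth_eq)
    moreover have "0 < K" using True by simp
    ultimately have "(\<lambda>\<omega>. map (\<lambda>i. D i \<omega>) [0..<K]) -` {xs} \<inter> space M = (\<Inter>i\<in>{..<K}. D i -` {xs ! i} \<inter> space M)"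
      by blast
    moreover have "prob (\<Inter>i\<in>{..<K}. D i -` {xs ! i} \<inter> space M) = (\<Prod>i<K. prob (D i -` {xs ! i} \<inter> space M))"
      using True by (intro indep_varsD[OF indep]) auto
    ultimately have "measure M ((\<lambda>\<omega>. map (\<lambda>i. D i \<omega>) [0..<K]) -` {xs} \<inter> space M) =
      (\<Prod>i<K. prob (D i -` {xs ! i} \<inter> space M))" by (simp only:)
    also have "\<dots> = (\<Prod>i<K. pmf p (xs ! i))"
    proof (rule prod.cong[OF refl])
      fix i
      have "measure (distr M (count_space UNIV) (D i)) {xs ! i} = pmf p (xs ! i)"
        unfolding law by (simp add: measure_pmf_single)
      then show "prob (D i -` {xs ! i} \<inter> space M) = pmf p (xs ! i)"
        by (simp add: measure_distr rv)
    qed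
    finally show ?thesis using True by (simp add: pmf_replicate_pmf)
  next
    case False
    then show ?thesis
    proof (cases "length xs = K")
      case True
      with False have "K = 0" "xs = []" by auto
      then show ?thesis by (simp add: prob_space)
    next
      case False
      then have "(\<lambda>\<omega>. map (\<lambda>i. D i \<omega>) [0..<K]) -` {xs} \<inter> space M = {}" by auto
      then show ?thesis using False by (simp add: pmf_replicate_pmf)
    qed
  qed
  then show "emeasure (distr M (count_space UNIV) (\<lambda>\<omega>. map (\<lambda>i. D i \<omega>) [0..<K])) {xs} =
    emeasure (measure_pmf (replicate_pmf K p)) {xs}"
    by (simp add: emeasure_distr meas emeasure_eq_measure emeasure_pmf_single)
qed simp_all

definition grid_increments :: "(real \<Rightarrow> 'a \<Rightarrow> nat) \<Rightarrow> nat \<Rightarrow> nat \<Rightarrow> 'a \<Rightarrow> nat list" where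
  "grid_increments N q K \<omega> = map (\<lambda>i. N (real (Suc i) / 2 ^ q) \<omega> - N (real i / 2 ^ q) \<omega>) [0..<K]"

text \<open>All that later arguments use about a Poisson process: the law of its increments on
  every dyadic grid. It passes to independent sums cell by cell.\<close>

definition poisson_grid :: "'a measure \<Rightarrow> real \<Rightarrow> (real \<Rightarrow> 'a \<Rightarrow> nat) \<Rightarrow> bool" where
  "poisson_grid P lam N \<longleftrightarrow> 0 \<le> lam \<and>
     (\<forall>t\<ge>0. N t \<in> measurable P (count_space UNIV)) \<and>
     (\<forall>\<omega>\<in>space P. counting_path (\<lambda>t. N t \<omega>)) \<and>
     (\<forall>q K. distr P (count_space UNIV) (grid_increments N q K) =
        measure_pmf (replicate_pmf K (poisson_law (lam / 2 ^ q))))"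

lemma measurable_count_space_diff:
  fixes f g :: "'a \<Rightarrow> nat"
  assumes "f \<in> measurable M (count_space UNIV)" "g \<in> measurable M (count_space UNIV)"
  shows "(\<lambda>x. f x - g x) \<in> measurable M (count_space UNIV)"
  using assms by measurable

lemma measurable_grid_increments:
  assumes "\<forall>t\<ge>0. N t \<in> measurable M (count_space UNIV)"
  shows "grid_increments N q K \<in> measurable M (count_space UNIV)"
  unfolding grid_increments_def[abs_def]
  by (intro measurable_map_upt measurable_count_space_diff) (use assms in auto)

lemma poisson_grid_of_process:
  assumes P: "prob_space P" and "0 < lam" and N: "poisson_process P lam N"
  shows "poisson_grid P lam N"
proof -
  interpret prob_space P by fact
  have "distr P (count_space UNIV) (grid_increments N q K) =
        measure_pmf (replicate_pmf K (poisson_law (lam / 2 ^ q)))" for q K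
    unfolding grid_increments_def[abs_def]
  proof (rule distr_list_of_indep)
    have "incseq (\<lambda>l. real l / 2 ^ q)" by (simp add: incseq_def divide_right_mono)
    moreover have "0 \<le> real 0 / 2 ^ q" by simp
    moreover have "0 \<le> t 0 \<Longrightarrow> incseq t \<Longrightarrow>
        indep_vars (\<lambda>_. count_space UNIV) (\<lambda>l \<omega>. N (t (Suc l)) \<omega> - N (t l) \<omega>) UNIV" for t :: "nat \<Rightarrow> real"
      using N unfolding poisson_process_def by blast
    ultimately show "indep_vars (\<lambda>_. count_space UNIV) (\<lambda>i \<omega>. N (real (Suc i) / 2 ^ q) \<omega> - N (real i / 2 ^ q) \<omega>) UNIV"
      by meson
    fix i
    have "distr P (count_space UNIV) (\<lambda>\<omega>. N (real (Suc i) / 2 ^ q) \<omega> - N (real i / 2 ^ q) \<omega>) =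
      measure_pmf (poisson_pmf (lam * (real (Suc i) / 2 ^ q - real i / 2 ^ q)))"
    proof -
      have "0 \<le> real i / 2 ^ q" "real i / 2 ^ q < real (Suc i) / 2 ^ q"
        by (auto intro!: divide_strict_right_mono)
      then show ?thesis using N unfolding poisson_process_def by blast
    qed
    also have "lam * (real (Suc i) / 2 ^ q - real i / 2 ^ q) = lam / 2 ^ q"
      by (simp add: field_simps)
    also have "poisson_pmf (lam / 2 ^ q) = poisson_law (lam / 2 ^ q)"
      using \<open>0 < lam\<close> by (simp add: poisson_law_def)
    finally show "distr P (count_space UNIV) (\<lambda>\<omega>. N (real (Suc i) / 2 ^ q) \<omega> - N (real i / 2 ^ q) \<omega>) =
      measure_pmf (poisson_law (lam / 2 ^ q))" .
  qed
  then show ?thesis using N \<open>0 < lam\<close>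
    unfolding poisson_grid_def poisson_process_def counting_path_def by auto
qed

lemma poisson_grid_zero:
  assumes "prob_space P"
  shows "poisson_grid P 0 (\<lambda>t \<omega>. 0)"
proof -
  interpret prob_space P by fact
  have rep: "replicate_pmf K (return_pmf (0::nat)) = return_pmf (map (\<lambda>_. 0) [0..<K])" for K
  proof (induction K)
    case (Suc K)
    have "map (\<lambda>_. 0::nat) [0..<Suc K] = 0 # map (\<lambda>_. 0) [0..<K]"
      by (simp add: map_replicate_const del: upt_Suc)
    with Suc show ?case by (simp add: bind_return_pmf)
  qed simp
  have const: "distr P (count_space UNIV) (\<lambda>_. c) = measure_pmf (return_pmf c)" for c :: "nat list"
  proof (rule measure_eqI)
    fix A assume "A \<in> sets (distr P (count_space UNIV) (\<lambda>_. c))"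
    show "emeasure (distr P (count_space UNIV) (\<lambda>_. c)) A = emeasure (measure_pmf (return_pmf c)) A"
      by (cases "c \<in> A") (auto simp: emeasure_distr emeasure_space_1 indicator_def)
  qed simp
  show ?thesis
    unfolding poisson_grid_def
    by (auto simp: counting_path_zero poisson_law_def grid_increments_def[abs_def] const rep)
qed

definition grid_cells ::
  "(real \<Rightarrow> 'a \<Rightarrow> nat) \<Rightarrow> (real \<Rightarrow> 'a \<Rightarrow> nat) \<Rightarrow> nat \<Rightarrow> nat \<Rightarrow> 'a \<Rightarrow> (nat \<times> nat) list" where
  "grid_cells X Z q K \<omega> = zip (grid_increments X q K \<omega>) (grid_increments Z q K \<omega>)"

lemma process_algebra_props:
  assumes "\<forall>t\<ge>0. N t \<in> measurable P (count_space UNIV)"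
  shows "space (process_algebra P N) = space P"
    and "sets (process_algebra P N) =
      sigma_sets (space P) {N t -` B \<inter> space P | t B. 0 \<le> t}"
    and "sets (process_algebra P N) \<subseteq> sets P"
    and "\<forall>t\<ge>0. N t \<in> measurable (process_algebra P N) (count_space UNIV)"
proof -
  let ?E = "{N t -` B \<inter> space P | t B. 0 \<le> t}"
  have sub: "?E \<subseteq> Pow (space P)" by auto
  show sp: "space (process_algebra P N) = space P"
    unfolding process_algebra_def using sub by (rule space_measure_of)
  show st: "sets (process_algebra P N) = sigma_sets (space P) ?E"
    unfolding process_algebra_def using sub by (rule sets_measure_of)
  have "?E \<subseteq> sets P" using assms by (auto intro: measurable_sets)
  then show "sets (process_algebra P N) \<subseteq> sets P"
    unfolding st by (rule sets.sigma_sets_subset)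
  show "\<forall>t\<ge>0. N t \<in> measurable (process_algebra P N) (count_space UNIV)"
  proof (intro allI impI measurableI)
    fix t :: real and B assume "0 \<le> t"
    then show "N t -` B \<inter> space (process_algebra P N) \<in> sets (process_algebra P N)"
      unfolding st sp by (intro sigma_sets.Basic) auto
  qed simp
qed

lemma distr_grid_cells:
  assumes P: "prob_space P" and X: "poisson_grid P a X" and Z: "poisson_grid P b Z"
    and indep: "prob_space.indep_set P (sets (process_algebra P X)) (sets (process_algebra P Z))"
  shows "distr P (count_space UNIV) (grid_cells X Z q K) =
    measure_pmf (replicate_pmf K (pair_pmf (poisson_law (a / 2 ^ q)) (poisson_law (b / 2 ^ q))))"
proof -
  interpret prob_space P by fact
  let ?X = "grid_increments X q K" and ?Z = "grid_increments Z q K"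
  let ?p = "replicate_pmf K (poisson_law (a / 2 ^ q))" and ?r = "replicate_pmf K (poisson_law (b / 2 ^ q))"
  have mX: "\<forall>t\<ge>0. X t \<in> measurable P (count_space UNIV)" and mZ: "\<forall>t\<ge>0. Z t \<in> measurable P (count_space UNIV)"
    and lX: "distr P (count_space UNIV) ?X = measure_pmf ?p" and lZ: "distr P (count_space UNIV) ?Z = measure_pmf ?r"
    using X Z by (auto simp: poisson_grid_def)
  note aX = process_algebra_props[OF mX] and aZ = process_algebra_props[OF mZ]
  have GX: "?X \<in> measurable P (count_space UNIV)" "?X \<in> measurable (process_algebra P X) (count_space UNIV)"
    using measurable_grid_increments mX aX(4) by blast+
  have GZ: "?Z \<in> measurable P (count_space UNIV)" "?Z \<in> measurable (process_algebra P Z) (count_space UNIV)"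
    using measurable_grid_increments mZ aZ(4) by blast+
  have pair: "distr P (count_space UNIV) (\<lambda>\<omega>. (?X \<omega>, ?Z \<omega>)) = measure_pmf (pair_pmf ?p ?r)"
  proof (rule measure_eqI_countable[where A=UNIV])
    fix c :: "nat list \<times> nat list"
    obtain xs zs where c: "c = (xs, zs)" by (cases c)
    have "measure P ((?X -` {xs} \<inter> space P) \<inter> (?Z -` {zs} \<inter> space P)) =
      measure P (?X -` {xs} \<inter> space P) * measure P (?Z -` {zs} \<inter> space P)"
      using measurable_sets[OF GX(2), of "{xs}"] measurable_sets[OF GZ(2), of "{zs}"]
      by (intro indep_setD[OF indep]) (simp_all add: aX(1) aZ(1))
    moreover have "measure P (?X -` {xs} \<inter> space P) = pmf ?p xs"
      using lX by (metis GX(1) UNIV_I measure_distr measure_pmf_single sets_count_space Pow_UNIV)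
    moreover have "measure P (?Z -` {zs} \<inter> space P) = pmf ?r zs"
      using lZ by (metis GZ(1) UNIV_I measure_distr measure_pmf_single sets_count_space Pow_UNIV)
    moreover have "(\<lambda>\<omega>. (?X \<omega>, ?Z \<omega>)) -` {c} \<inter> space P = (?X -` {xs} \<inter> space P) \<inter> (?Z -` {zs} \<inter> space P)"
      by (auto simp: c)
    moreover have "(\<lambda>\<omega>. (?X \<omega>, ?Z \<omega>)) \<in> measurable P (count_space UNIV)"
      using measurable_Pair[OF GX(1) GZ(1)] by (simp add: pair_measure_countable)
    ultimately show "emeasure (distr P (count_space UNIV) (\<lambda>\<omega>. (?X \<omega>, ?Z \<omega>))) {c} = emeasure (pair_pmf ?p ?r) {c}"
      by (simp add: emeasure_distr emeasure_eq_measure emeasure_pmf_single c pmf_pair)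
  qed simp_all
  have "distr P (count_space UNIV) (grid_cells X Z q K) =
    distr (distr P (count_space UNIV) (\<lambda>\<omega>. (?X \<omega>, ?Z \<omega>))) (count_space UNIV) (\<lambda>(xs, zs). zip xs zs)"
    using measurable_Pair[OF GX(1) GZ(1)]
    by (subst distr_distr) (auto simp: pair_measure_countable grid_cells_def[abs_def] comp_def)
  also have "\<dots> = measure_pmf (map_pmf (\<lambda>(xs, zs). zip xs zs) (pair_pmf ?p ?r))"
    unfolding pair by (simp add: map_pmf_rep_eq)
  finally show ?thesis unfolding zip_replicate_pmf .
qed

text \<open>The increments of an independent sum are the sums of the increments cell by cell, and
  Poisson laws add.\<close>

lemma poisson_grid_add:
  assumes P: "prob_space P" and X: "poisson_grid P a X" and Z: "poisson_grid P b Z"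
    and indep: "prob_space.indep_set P (sets (process_algebra P X)) (sets (process_algebra P Z))"
  shows "poisson_grid P (a + b) (\<lambda>t \<omega>. X t \<omega> + Z t \<omega>)"
proof -
  interpret prob_space P by fact
  have mX: "\<forall>t\<ge>0. X t \<in> measurable P (count_space UNIV)" and mZ: "\<forall>t\<ge>0. Z t \<in> measurable P (count_space UNIV)"
    and cX: "\<forall>\<omega>\<in>space P. counting_path (\<lambda>t. X t \<omega>)" and cZ: "\<forall>\<omega>\<in>space P. counting_path (\<lambda>t. Z t \<omega>)"
    and ab: "0 \<le> a" "0 \<le> b"
    using X Z by (auto simp: poisson_grid_def)
  let ?N = "\<lambda>t \<omega>. X t \<omega> + Z t \<omega>"
  have law: "distr P (count_space UNIV) (grid_increments ?N q K) =
        measure_pmf (replicate_pmf K (poisson_law ((a + b) / 2 ^ q)))" for q K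
  proof -
    have eq: "grid_increments ?N q K \<omega> = map (\<lambda>(x, z). x + z) (grid_cells X Z q K \<omega>)" if "\<omega> \<in> space P" for \<omega>
    proof (rule nth_equalityI)
      fix i assume "i < length (grid_increments ?N q K \<omega>)"
      then have i: "i < K" by (simp add: grid_increments_def)
      have le: "real i / 2 ^ q \<le> real (Suc i) / 2 ^ q" by (simp add: divide_right_mono)
      have "X (real i / 2 ^ q) \<omega> \<le> X (real (Suc i) / 2 ^ q) \<omega>" "Z (real i / 2 ^ q) \<omega> \<le> Z (real (Suc i) / 2 ^ q) \<omega>"
        using cX cZ that counting_path_mono[OF _ _ le] by auto
      then show "grid_increments ?N q K \<omega> ! i = map (\<lambda>(x, z). x + z) (grid_cells X Z q K \<omega>) ! i"
        using i by (simp add: grid_increments_def grid_cells_def del: of_nat_Suc)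
    qed (simp add: grid_increments_def grid_cells_def)
    have mc: "grid_cells X Z q K \<in> measurable P (count_space UNIV)"
      unfolding grid_cells_def[abs_def]
      by (rule measurable_compose[OF measurable_Pair[OF measurable_grid_increments[OF mX] measurable_grid_increments[OF mZ]], where g="\<lambda>(x, y). zip x y", simplified])
        (simp add: pair_measure_countable)
    have "distr P (count_space UNIV) (grid_increments ?N q K) =
      distr P (count_space UNIV) (\<lambda>\<omega>. map (\<lambda>(x, z). x + z) (grid_cells X Z q K \<omega>))"
      by (intro distr_cong refl eq)
    also have "\<dots> = distr (distr P (count_space UNIV) (grid_cells X Z q K)) (count_space UNIV) (map (\<lambda>(x, z). x + z))"
      using mc by (subst distr_distr) (auto simp: comp_def)
    also have "\<dots> = measure_pmf (map_pmf (map (\<lambda>(x, z). x + z))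
        (replicate_pmf K (pair_pmf (poisson_law (a / 2 ^ q)) (poisson_law (b / 2 ^ q)))))"
      unfolding distr_grid_cells[OF assms] by (simp add: map_pmf_rep_eq)
    finally show ?thesis
      unfolding map_replicate_pmf using ab by (simp add: map_pmf_add_poisson_law add_divide_distrib)
  qed
  have "\<forall>t\<ge>0. ?N t \<in> measurable P (count_space UNIV)"
    using mX mZ measurable_count_space_add by blast
  moreover have "\<forall>\<omega>\<in>space P. counting_path (\<lambda>t. ?N t \<omega>)"
    using cX cZ counting_path_add by auto
  ultimately show ?thesis using law ab by (simp add: poisson_grid_def)
qed

lemma (in prob_space) prob_tendsto_of_eventually_eq:
  assumes "\<And>q. A q \<in> events" "B \<in> events"
    and ev: "AE \<omega> in M. eventually (\<lambda>q. \<omega> \<in> A q \<longleftrightarrow> \<omega> \<in> B) sequentially"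
  shows "(\<lambda>q. prob (A q)) \<longlonglongrightarrow> prob B"
proof -
  have "(\<lambda>q. integral\<^sup>L M (indicator (A q) :: 'a \<Rightarrow> real)) \<longlonglongrightarrow> integral\<^sup>L M (indicator B :: 'a \<Rightarrow> real)"
  proof (rule integral_dominated_convergence[where w="\<lambda>_. 1"])
    show "AE \<omega> in M. (\<lambda>q. indicator (A q) \<omega> :: real) \<longlonglongrightarrow> indicator B \<omega>"
      using ev
    proof eventually_elim
      case (elim \<omega>)
      have "eventually (\<lambda>q. (indicator (A q) \<omega> :: real) = indicator B \<omega>) sequentially"
        using elim by eventually_elim (simp add: indicator_def)
      then show ?case by (rule tendsto_eventually)
    qed
  qed (use assms in \<open>auto simp: indicator_def\<close>)
  then show ?thesis using assms by simp
qed

lemma measure_pair_pmf_Times: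
  "measure (measure_pmf (pair_pmf p r)) (A \<times> B) = measure (measure_pmf p) A * measure (measure_pmf r) B"
proof -
  have "measure (measure_pmf (pair_pmf p r)) (A \<times> B) = (\<integral>xy. indicator (A \<times> B) xy \<partial>measure_pmf (pair_pmf p r))"
    by simp
  also have "\<dots> = (\<integral>xy. indicator A (fst xy) * indicator B (snd xy) \<partial>measure_pmf (pair_pmf p r))"
    by (intro Bochner_Integration.integral_cong) (auto simp: indicator_def)
  also have "\<dots> = (\<integral>x. indicator A x \<partial>measure_pmf p) * (\<integral>y. indicator B y \<partial>measure_pmf r)"
  proof -
    have "ennreal (\<integral>xy. indicator A (fst xy) * indicator B (snd xy) \<partial>measure_pmf (pair_pmf p r)) =
      (\<integral>\<^sup>+xy. ennreal (indicator A (fst xy) * indicator B (snd xy)) \<partial>measure_pmf (pair_pmf p r))"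
      by (intro nn_integral_eq_integral[symmetric] measure_pmf.integrable_const_bound[where B=1])
        (auto simp: indicator_def)
    also have "\<dots> = (\<integral>\<^sup>+x. \<integral>\<^sup>+y. indicator A x * indicator B y \<partial>measure_pmf r \<partial>measure_pmf p)"
      unfolding nn_integral_pair_pmf' by (intro nn_integral_cong) (auto simp: indicator_def)
    also have "\<dots> = emeasure (measure_pmf p) A * emeasure (measure_pmf r) B"
      by (simp add: nn_integral_cmult nn_integral_multc)
    also have "\<dots> = ennreal (measure (measure_pmf p) A * measure (measure_pmf r) B)"
      by (simp add: measure_pmf.emeasure_eq_measure ennreal_mult)
    finally show ?thesis
      by (subst (asm) ennreal_inj) (auto intro!: integral_nonneg_AE mult_nonneg_nonneg)
  qed
  finally show ?thesis by simp
qed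

lemma counting_path_grid_sum:
  assumes f: "counting_path f" and "i \<le> K"
  shows "f (real i / 2 ^ q) = sum_list (take i (map (\<lambda>i. f (real (Suc i) / 2 ^ q) - f (real i / 2 ^ q)) [0..<K]))"
  using \<open>i \<le> K\<close>
proof (induction i)
  case 0
  then show ?case using f by (simp add: counting_path_def)
next
  case (Suc i)
  have "f (real i / 2 ^ q) \<le> f (real (Suc i) / 2 ^ q)"
    by (intro counting_path_mono[OF f]) (auto simp: divide_right_mono)
  then show ?case using Suc by (simp add: take_Suc_conv_app_nth del: of_nat_Suc)
qed

section \<open>Path regularity and holding times of a Poisson process\<close>

context prob_space
begin

context
  fixes lam :: real and N :: "real \<Rightarrow> 'a \<Rightarrow> nat"
  assumes N: "poisson_grid M lam N" and lam: "0 < lam"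
begin

lemma pg_measurable: "0 \<le> t \<Longrightarrow> N t \<in> measurable M (count_space UNIV)"
  and pg_path: "\<omega> \<in> space M \<Longrightarrow> counting_path (\<lambda>t. N t \<omega>)"
  and pg_law: "distr M (count_space UNIV) (grid_increments N q K) =
        measure_pmf (replicate_pmf K (poisson_law (lam / 2 ^ q)))"
  using N by (auto simp: poisson_grid_def)

lemma pg_increments_measurable: "grid_increments N q K \<in> measurable M (count_space UNIV)"
  by (intro measurable_grid_increments) (use N in \<open>auto simp: poisson_grid_def\<close>)

lemma pg_walk: "\<omega> \<in> space M \<Longrightarrow> i \<le> K \<Longrightarrow> N (real i / 2 ^ q) \<omega> = sum_list (take i (grid_increments N q K \<omega>))"
  unfolding grid_increments_def by (rule counting_path_grid_sum[OF pg_path])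

lemma prob_increments:
  "prob {\<omega> \<in> space M. \<Phi> (grid_increments N q K \<omega>)} =
    measure (measure_pmf (replicate_pmf K (poisson_law (lam / 2 ^ q)))) {xs. \<Phi> xs}"
proof -
  have "prob (grid_increments N q K -` {xs. \<Phi> xs} \<inter> space M) =
    measure (distr M (count_space UNIV) (grid_increments N q K)) {xs. \<Phi> xs}"
    by (simp add: measure_distr pg_increments_measurable)
  also have "grid_increments N q K -` {xs. \<Phi> xs} \<inter> space M = {\<omega> \<in> space M. \<Phi> (grid_increments N q K \<omega>)}"
    by auto
  finally show ?thesis unfolding pg_law .
qed

lemma events_increments: "{\<omega> \<in> space M. \<Phi> (grid_increments N q K \<omega>)} \<in> events"
proof -
  have "grid_increments N q K -` {xs. \<Phi> xs} \<inter> space M \<in> events"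
    by (rule measurable_sets[OF pg_increments_measurable]) simp
  then show ?thesis by (simp add: vimage_def Int_def conj_commute)
qed

lemma prob_no_increments:
  "measure (measure_pmf (replicate_pmf k (poisson_law (lam / 2 ^ q)))) {ys. sum_list ys = 0} =
    exp (- lam * (real k / 2 ^ q))"
proof -
  let ?p = "poisson_law (lam / 2 ^ q)"
  have "measure (measure_pmf (replicate_pmf k ?p)) {ys. sum_list ys = 0} =
     measure (measure_pmf (replicate_pmf k ?p)) {replicate k 0}"
  proof (rule measure_pmf.finite_measure_eq_AE)
    show "AE ys in measure_pmf (replicate_pmf k ?p). ys \<in> {ys. sum_list ys = 0} \<longleftrightarrow> ys \<in> {replicate k 0}"
    proof (rule AE_pmfI)
      fix ys assume "ys \<in> set_pmf (replicate_pmf k ?p)"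
      then have len: "length ys = k" by (simp add: set_replicate_pmf)
      show "ys \<in> {ys. sum_list ys = 0} \<longleftrightarrow> ys \<in> {replicate k 0}"
      proof
        assume "ys \<in> {ys. sum_list ys = 0}"
        then have "\<forall>y\<in>set ys. y = 0" by (simp add: sum_list_eq_0_iff)
        then show "ys \<in> {replicate k 0}" using replicate_eqI[of ys k 0] len by simp
      qed (auto simp: sum_list_replicate)
    qed
  qed simp_all
  also have "\<dots> = (\<Prod>i<k. pmf ?p 0)" by (simp add: measure_pmf_single pmf_replicate_pmf)
  also have "\<dots> = exp (- lam * (real k / 2 ^ q))"
    using lam by (simp add: pmf_poisson_law exp_of_nat_mult[symmetric])
  finally show ?thesis .
qed

text \<open>An event determined by the walk up to grid index \<open>i\<close> is independent of
  the following \<open>k\<close> increments, which all vanish with probability \<open>exp (- lam *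
  k / 2\<^sup>q)\<close>.\<close>

lemma grid_markov:
  fixes Q :: "(nat \<Rightarrow> nat) \<Rightarrow> bool"
  defines "W \<equiv> \<lambda>q \<omega> j. N (real j / 2 ^ q) \<omega>"
  assumes local: "\<And>w w'. (\<And>j. j \<le> i \<Longrightarrow> w j = w' j) \<Longrightarrow> Q w = Q w'"
  shows "{\<omega> \<in> space M. Q (W q \<omega>)} \<in> events"
    and "{\<omega> \<in> space M. Q (W q \<omega>) \<and> W q \<omega> (i + k) = W q \<omega> i} \<in> events"
    and "prob {\<omega> \<in> space M. Q (W q \<omega>) \<and> W q \<omega> (i + k) = W q \<omega> i} =
      prob {\<omega> \<in> space M. Q (W q \<omega>)} * exp (- lam * (real k / 2 ^ q))"
proof -
  let ?L = "grid_increments N q (i + k)"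
  let ?w = "\<lambda>xs j. sum_list (take j xs)"
  have Q: "Q (W q \<omega>) \<longleftrightarrow> Q (?w (?L \<omega>))" if "\<omega> \<in> space M" for \<omega>
    by (rule local) (simp add: W_def pg_walk[OF that, of _ "i + k"])
  have stay: "W q \<omega> (i + k) = W q \<omega> i \<longleftrightarrow> sum_list (drop i (?L \<omega>)) = 0" if "\<omega> \<in> space M" for \<omega>
  proof -
    have "length (?L \<omega>) = i + k" by (simp add: grid_increments_def)
    then have "W q \<omega> (i + k) = sum_list (?L \<omega>)" unfolding W_def by (subst pg_walk[OF that order_refl]) simp
    also have "\<dots> = sum_list (take i (?L \<omega>)) + sum_list (drop i (?L \<omega>))"
      by (metis append_take_drop_id sum_list_append)
    finally show ?thesis unfolding W_def pg_walk[OF that, of i "i + k", OF le_add1] by simp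
  qed
  have e1: "{\<omega> \<in> space M. Q (W q \<omega>)} = {\<omega> \<in> space M. Q (?w (?L \<omega>))}"
    using Q by auto
  have e2: "{\<omega> \<in> space M. Q (W q \<omega>) \<and> W q \<omega> (i + k) = W q \<omega> i} =
      {\<omega> \<in> space M. Q (?w (?L \<omega>)) \<and> sum_list (drop i (?L \<omega>)) = 0}"
    using Q stay by auto
  show "{\<omega> \<in> space M. Q (W q \<omega>)} \<in> events" unfolding e1 by (rule events_increments)
  show "{\<omega> \<in> space M. Q (W q \<omega>) \<and> W q \<omega> (i + k) = W q \<omega> i} \<in> events"
    unfolding e2 by (rule events_increments)
  let ?p = "poisson_law (lam / 2 ^ q)"
  have split: "measure (replicate_pmf (i + k) ?p) {xs. Q (?w xs) \<and> sum_list (drop i xs) \<in> V} =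
     measure (replicate_pmf i ?p) {xs. Q (?w xs)} * measure (replicate_pmf k ?p) {ys. sum_list ys \<in> V}" for V
  proof -
    have "measure (replicate_pmf (i + k) ?p) {xs. Q (?w xs) \<and> sum_list (drop i xs) \<in> V} =
      measure (pair_pmf (replicate_pmf i ?p) (replicate_pmf k ?p))
        ((\<lambda>(xs, ys). xs @ ys) -` {xs. Q (?w xs) \<and> sum_list (drop i xs) \<in> V})"
      unfolding replicate_pmf_add_pair by simp
    also have "\<dots> = measure (pair_pmf (replicate_pmf i ?p) (replicate_pmf k ?p))
        ({xs. Q (?w xs)} \<times> {ys. sum_list ys \<in> V})"
    proof (rule measure_pmf.finite_measure_eq_AE)
      show "AE x in pair_pmf (replicate_pmf i ?p) (replicate_pmf k ?p).
        (x \<in> (\<lambda>(xs, ys). xs @ ys) -` {xs. Q (?w xs) \<and> sum_list (drop i xs) \<in> V}) =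
        (x \<in> {xs. Q (?w xs)} \<times> {ys. sum_list ys \<in> V})"
      proof (rule AE_pmfI)
        fix x assume "x \<in> set_pmf (pair_pmf (replicate_pmf i ?p) (replicate_pmf k ?p))"
        then obtain xs ys where x: "x = (xs, ys)" "length xs = i"
          by (cases x) (auto simp: set_replicate_pmf)
        then have "Q (?w (xs @ ys)) = Q (?w xs)" by (intro local) simp
        then show "(x \<in> (\<lambda>(xs, ys). xs @ ys) -` {xs. Q (?w xs) \<and> sum_list (drop i xs) \<in> V}) =
        (x \<in> {xs. Q (?w xs)} \<times> {ys. sum_list ys \<in> V})"
          using x by auto
      qed
    qed simp_all
    finally show ?thesis unfolding measure_pair_pmf_Times .
  qed
  have "prob {\<omega> \<in> space M. Q (W q \<omega>)} = measure (replicate_pmf i ?p) {xs. Q (?w xs)}"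
    using split[of UNIV] unfolding e1 by (subst prob_increments[where \<Phi>="\<lambda>xs. Q (?w xs)"]) simp
  moreover have "prob {\<omega> \<in> space M. Q (W q \<omega>) \<and> W q \<omega> (i + k) = W q \<omega> i} =
     measure (replicate_pmf i ?p) {xs. Q (?w xs)} * measure (replicate_pmf k ?p) {ys. sum_list ys = 0}"
    unfolding e2 prob_increments[where \<Phi>="\<lambda>xs. Q (?w xs) \<and> sum_list (drop i xs) = 0"]
    using split[of "{0}"] by simp
  ultimately show "prob {\<omega> \<in> space M. Q (W q \<omega>) \<and> W q \<omega> (i + k) = W q \<omega> i} =
      prob {\<omega> \<in> space M. Q (W q \<omega>)} * exp (- lam * (real k / 2 ^ q))"
    unfolding prob_no_increments by simp
qed

text \<open>The walk stays constant for \<open>k\<close> units of time with probability \<open>exp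
  (- lam * k)\<close>, so it leaves every level almost surely.\<close>

lemma AE_unbounded: "AE \<omega> in M. \<forall>l. \<exists>t\<ge>0. l \<le> N t \<omega>"
proof -
  have "AE \<omega> in M. \<exists>k. N (real (i + k)) \<omega> \<noteq> N (real i) \<omega>" for i
  proof -
    let ?A = "\<lambda>k. {\<omega> \<in> space M. True \<and> N (real (i + k) / 2 ^ 0) \<omega> = N (real i / 2 ^ 0) \<omega>}"
    note gm = grid_markov[where Q="\<lambda>_. True" and i=i and q=0]
    have A: "?A k \<in> events" for k using gm(2)[of k] by simp
    have p: "prob (?A k) = exp (- lam * real k)" for k using gm(3)[of k] by (simp add: prob_space)
    have I: "(\<Inter>k. ?A k) \<in> events" using A by (intro sets.countable_INT) auto
    have le: "prob (\<Inter>k. ?A k) \<le> exp (- lam * real k)" for k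
      unfolding p[symmetric] using A by (intro finite_measure_mono) auto
    have "(\<lambda>k. exp (- lam * real k)) \<longlonglongrightarrow> 0"
      using lam by real_asymp
    then have "prob (\<Inter>k. ?A k) \<le> 0"
      by (rule LIMSEQ_le_const) (use le in auto)
    then have "prob (\<Inter>k. ?A k) = 0" using measure_nonneg[of M] by (simp add: order_antisym)
    then have "AE \<omega> in M. \<omega> \<notin> (\<Inter>k. ?A k)"
      using I by (simp add: prob_eq_0)
    then show ?thesis by (rule AE_mp) (auto intro!: AE_I2)
  qed
  then have "AE \<omega> in M. \<forall>i. \<exists>k. N (real (i + k)) \<omega> \<noteq> N (real i) \<omega>"
    by (simp add: AE_all_countable)
  then show ?thesis
  proof (rule AE_mp, intro AE_I2 impI)
    fix \<omega> assume \<omega>: "\<omega> \<in> space M" and step: "\<forall>i. \<exists>k. N (real (i + k)) \<omega> \<noteq> N (real i) \<omega>"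
    show "\<forall>l. \<exists>t\<ge>0. l \<le> N t \<omega>"
    proof
      fix l
      have "\<exists>i::nat. l \<le> N (real i) \<omega>"
      proof (induction l)
        case (Suc l)
        then obtain i where i: "l \<le> N (real i) \<omega>" by auto
        obtain k where k: "N (real (i + k)) \<omega> \<noteq> N (real i) \<omega>" using step by auto
        have "N (real i) \<omega> \<le> N (real (i + k)) \<omega>"
          by (intro counting_path_mono[OF pg_path[OF \<omega>]]) auto
        with i k have "Suc l \<le> N (real (i + k)) \<omega>" by simp
        then show ?case by blast
      qed simp
      then obtain i :: nat where "l \<le> N (real i) \<omega>" by auto
      then show "\<exists>t\<ge>0. l \<le> N t \<omega>" by (intro exI[of _ "real i"]) simp
    qed
  qed
qed

lemma poisson_law_ge_2:
  assumes "0 \<le> r"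
  shows "measure (measure_pmf (poisson_law r)) {x. 2 \<le> x} \<le> r\<^sup>2"
proof -
  let ?p = "measure_pmf (poisson_law r)"
  have "{x::nat. 2 \<le> x} = UNIV - {0, 1}" by auto
  then have "measure ?p {x. 2 \<le> x} = 1 - measure ?p {0, 1}"
    using measure_pmf.prob_compl[of "{0, 1}" "poisson_law r"] by simp
  also have "measure ?p {0, 1} = exp (- r) * (1 + r)"
    using assms by (simp add: measure_measure_pmf_finite pmf_poisson_law algebra_simps)
  also have "1 - exp (- r) * (1 + r) \<le> 1 - (1 - r) * (1 + r)"
    using exp_ge_add_one_self[of "- r"] assms by (intro diff_left_mono mult_right_mono) auto
  also have "\<dots> = r\<^sup>2" by (simp add: power2_eq_square algebra_simps)
  finally show ?thesis .
qed

lemma replicate_pmf_union_bound: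
  "measure (measure_pmf (replicate_pmf K p)) {xs. \<exists>x\<in>set xs. R x} \<le> real K * measure (measure_pmf p) {x. R x}"
proof (induction K)
  case (Suc K)
  let ?P = "pair_pmf p (replicate_pmf K p)"
  have "measure (replicate_pmf (Suc K) p) {xs. \<exists>x\<in>set xs. R x} =
    measure ?P ((\<lambda>(x, xs). x # xs) -` {xs. \<exists>x\<in>set xs. R x})"
    unfolding replicate_pmf_Suc_pair by simp
  also have "\<dots> \<le> measure ?P ({x. R x} \<times> UNIV \<union> UNIV \<times> {xs. \<exists>x\<in>set xs. R x})"
    by (intro measure_pmf.finite_measure_mono) auto
  also have "\<dots> \<le> measure ?P ({x. R x} \<times> UNIV) + measure ?P (UNIV \<times> {xs. \<exists>x\<in>set xs. R x})"
    by (intro measure_subadditive) auto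
  also have "\<dots> \<le> measure p {x. R x} + real K * measure p {x. R x}"
    unfolding measure_pair_pmf_Times using Suc by simp
  finally show ?case by (simp add: algebra_simps)
qed simp

text \<open>The window \<open>[0, q]\<close> grows with the resolution, so that one limit covers
  the whole half-line.\<close>

definition crowded_cell :: "nat \<Rightarrow> 'a set" where
  "crowded_cell q = {\<omega> \<in> space M. \<exists>x\<in>set (grid_increments N q (q * 2 ^ q) \<omega>). 2 \<le> x}"

lemma crowded_cell_events: "crowded_cell q \<in> events"
  unfolding crowded_cell_def by (rule events_increments)

text \<open>There are \<open>q * 2\<^sup>q\<close> cells, and each is crowded with probability of
  order \<open>4\<^sup>-\<^sup>q\<close>.\<close>

lemma crowded_cell_vanishes: "(\<lambda>q. prob (crowded_cell q)) \<longlonglongrightarrow> 0"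
proof (rule tendsto_sandwich[of "\<lambda>_. 0"])
  have "prob (crowded_cell q) \<le> real (q * 2 ^ q) * (lam / 2 ^ q)\<^sup>2" for q
  proof -
    have "prob (crowded_cell q) \<le> real (q * 2 ^ q) * measure (poisson_law (lam / 2 ^ q)) {x. 2 \<le> x}"
      unfolding crowded_cell_def
      by (subst prob_increments[where \<Phi>="\<lambda>xs. \<exists>x\<in>set xs. 2 \<le> x"]) (rule replicate_pmf_union_bound)
    also have "\<dots> \<le> real (q * 2 ^ q) * (lam / 2 ^ q)\<^sup>2"
      using lam by (intro mult_left_mono poisson_law_ge_2) auto
    finally show ?thesis .
  qed
  then show "eventually (\<lambda>q. prob (crowded_cell q) \<le> real (q * 2 ^ q) * (lam / 2 ^ q)\<^sup>2) sequentially"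
    by simp
  have "(\<lambda>q. real q * (1 / 2) ^ q * lam\<^sup>2) \<longlonglongrightarrow> 0 * lam\<^sup>2"
    by (intro tendsto_mult tendsto_const) real_asymp
  moreover have "(\<lambda>q. real (q * 2 ^ q) * (lam / 2 ^ q)\<^sup>2) = (\<lambda>q. real q * (1 / 2) ^ q * lam\<^sup>2)"
    by (rule ext) (simp add: power2_eq_square field_simps)
  ultimately show "(\<lambda>q. real (q * 2 ^ q) * (lam / 2 ^ q)\<^sup>2) \<longlonglongrightarrow> 0" by (simp only: mult_zero_left)
qed simp_all

end

end

lemma grid_cell_around:
  fixes s :: real
  assumes "0 < s"
  obtains i :: nat where "real i / 2 ^ q < s" "s \<le> real (Suc i) / 2 ^ q"
proof -
  define i where "i = nat (\<lceil>s * 2 ^ q\<rceil> - 1)"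
  have "0 < \<lceil>s * 2 ^ q\<rceil>" using assms by simp
  then have i: "real i = of_int \<lceil>s * 2 ^ q\<rceil> - 1" by (simp add: i_def)
  have "real i < s * 2 ^ q" "s * 2 ^ q \<le> real (Suc i)"
    unfolding i of_nat_Suc using ceiling_correct[of "s * 2 ^ q"] by auto
  then show ?thesis by (intro that[of i]) (auto simp: field_simps)
qed

lemma jump_in_grid_cell:
  assumes f: "counting_path f" and ex: "\<exists>t\<ge>0. l \<le> f t" and miss: "\<And>t. 0 \<le> t \<Longrightarrow> f t \<noteq> l"
    and q: "path_arrival f l + 1 \<le> real q"
  shows "\<exists>i<q * 2 ^ q. 2 \<le> f (real (Suc i) / 2 ^ q) - f (real i / 2 ^ q)"
proof -
  let ?s = "path_arrival f l"
  note le_iff = arrival_le_iff[OF f ex]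
  have "f 0 = 0" using f by (simp add: counting_path_def)
  then have "0 < l" using miss[OF order_refl] by linarith
  then have pos: "0 < ?s" using le_iff[OF order_refl] \<open>f 0 = 0\<close> path_arrival_nonneg[of f l] by linarith
  obtain i where i: "real i / 2 ^ q < ?s" "?s \<le> real (Suc i) / 2 ^ q"
    using grid_cell_around[OF pos] by blast
  have nn1: "0 \<le> real i / 2 ^ q" and nn2: "0 \<le> real (Suc i) / 2 ^ q" by simp_all
  have "real i / 2 ^ q < real q" using i(1) q by linarith
  then have "real i < real (q * 2 ^ q)" by (simp add: field_simps)
  then have "i < q * 2 ^ q" by (simp only: of_nat_less_iff)
  moreover have "f (real i / 2 ^ q) < l"
    using le_iff[OF nn1] i(1) by linarith
  moreover have "l < f (real (Suc i) / 2 ^ q)"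
    using le_iff[OF nn2] miss[OF nn2] i(2) by linarith
  ultimately have "i < q * 2 ^ q \<and> 2 \<le> f (real (Suc i) / 2 ^ q) - f (real i / 2 ^ q)" by linarith
  then show ?thesis by blast
qed

text \<open>A jump of size two or more would make its cell crowded on every grid that resolves it,
  and crowded cells become rare.\<close>

lemma (in prob_space) AE_regular_path:
  assumes N: "poisson_grid M lam N" and lam: "0 < lam"
  shows "AE \<omega> in M. regular_path (\<lambda>t. N t \<omega>)"
proof -
  let ?C = "crowded_cell N"
  have null: "AE \<omega> in M. \<omega> \<notin> (\<Inter>q\<in>{T..}. ?C q)" for T
  proof -
    have I: "(\<Inter>q\<in>{T..}. ?C q) \<in> events"
      using crowded_cell_events[OF N lam] by (intro sets.countable_INT') auto
    have "prob (\<Inter>q\<in>{T..}. ?C q) \<le> prob (?C q)" if "T \<le> q" for q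
      using crowded_cell_events[OF N lam] that by (intro finite_measure_mono) auto
    then have "prob (\<Inter>q\<in>{T..}. ?C q) \<le> 0"
      by (intro LIMSEQ_le_const[OF crowded_cell_vanishes[OF N lam]]) auto
    then have "prob (\<Inter>q\<in>{T..}. ?C q) = 0" using measure_nonneg[of M] by (simp add: order_antisym)
    then show ?thesis using I by (simp add: prob_eq_0)
  qed
  then have "AE \<omega> in M. \<forall>T. \<omega> \<notin> (\<Inter>q\<in>{T..}. ?C q)" by (simp add: AE_all_countable)
  with AE_unbounded[OF N lam] show ?thesis
  proof (rule AE_mp[OF AE_conjI], intro AE_I2 impI)
    fix \<omega> assume \<omega>: "\<omega> \<in> space M"
      and *: "(\<forall>l. \<exists>t\<ge>0. l \<le> N t \<omega>) \<and> (\<forall>T. \<omega> \<notin> (\<Inter>q\<in>{T..}. ?C q))"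
    have f: "counting_path (\<lambda>t. N t \<omega>)" by (rule pg_path[OF N lam \<omega>])
    have "\<exists>t\<ge>0. N t \<omega> = l" for l
    proof (rule ccontr)
      assume miss: "\<not> (\<exists>t\<ge>0. N t \<omega> = l)"
      obtain T :: nat where T: "path_arrival (\<lambda>t. N t \<omega>) l + 1 \<le> real T"
        using real_arch_simple by blast
      have "\<omega> \<in> ?C q" if "T \<le> q" for q
      proof -
        have "\<exists>i<q * 2 ^ q. 2 \<le> N (real (Suc i) / 2 ^ q) \<omega> - N (real i / 2 ^ q) \<omega>"
          by (rule jump_in_grid_cell[OF f]) (use * miss T that in auto)
        then show ?thesis using \<omega>
          by (auto simp: crowded_cell_def[OF N lam] grid_increments_def simp del: of_nat_Suc)
      qed
      with * show False by auto
    qed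
    with f show "regular_path (\<lambda>t. N t \<omega>)" by (simp add: regular_path_def)
  qed
qed

lemma arrival_measurable:
  assumes N: "\<forall>t\<ge>0. N t \<in> measurable M (count_space UNIV)"
    and path: "\<And>\<omega>. \<omega> \<in> space M \<Longrightarrow> counting_path (\<lambda>t. N t \<omega>)"
  shows "arrival N l \<in> borel_measurable M"
proof (rule borel_measurableI_le)
  fix t :: real
  have ge: "{\<omega> \<in> space M. l \<le> N s \<omega>} \<in> sets M" if "0 \<le> s" for s
  proof -
    have "N s -` {l..} \<inter> space M \<in> sets M" by (rule measurable_sets) (use N that in auto)
    then show ?thesis by (simp add: vimage_def Int_def conj_commute)
  qed
  show "{\<omega> \<in> space M. arrival N l \<omega> \<le> t} \<in> sets M"
  proof (cases "0 \<le> t")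
    case True
    have "{\<omega> \<in> space M. arrival N l \<omega> \<le> t} =
      {\<omega> \<in> space M. l \<le> N t \<omega>} \<union> (space M - (\<Union>k::nat. {\<omega> \<in> space M. l \<le> N (real k) \<omega>}))"
    proof (rule set_eqI)
      fix \<omega>
      have "arrival N l \<omega> \<le> t \<longleftrightarrow> l \<le> N t \<omega> \<or> (\<forall>k::nat. \<not> l \<le> N (real k) \<omega>)" if \<omega>: "\<omega> \<in> space M"
      proof (cases "\<exists>s\<ge>0. l \<le> N s \<omega>")
        case ex: True
        then obtain s where s: "0 \<le> s" "l \<le> N s \<omega>" by auto
        obtain k :: nat where "s \<le> real k" using real_arch_simple by blast
        then have "N s \<omega> \<le> N (real k) \<omega>" by (rule counting_path_mono[OF path[OF \<omega>] s(1)])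
        then have "l \<le> N (real k) \<omega>" using s(2) by (rule order_trans[rotated])
        then show ?thesis
          unfolding arrival_eq_path_arrival using arrival_le_iff[OF path[OF \<omega>] ex True] by blast
      next
        case False
        then have "arrival N l \<omega> = 0" unfolding arrival_def by (rule if_not_P)
        moreover have "\<not> l \<le> N (real k) \<omega>" for k :: nat using False by (meson of_nat_0_le_iff)
        ultimately show ?thesis using True by simp
      qed
      then show "\<omega> \<in> {\<omega> \<in> space M. arrival N l \<omega> \<le> t} \<longleftrightarrow> \<omega> \<in>
        {\<omega> \<in> space M. l \<le> N t \<omega>} \<union> (space M - (\<Union>k::nat. {\<omega> \<in> space M. l \<le> N (real k) \<omega>}))"
        by blast
    qed
    also have "\<dots> \<in> sets M" using ge True by (intro sets.Un sets.Diff sets.countable_UN) auto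
    finally show ?thesis .
  next
    case False
    have "\<not> arrival N l \<omega> \<le> t" for \<omega>
      using path_arrival_nonneg[of "\<lambda>t. N t \<omega>" l] False unfolding arrival_eq_path_arrival by linarith
    then have empty: "{\<omega> \<in> space M. arrival N l \<omega> \<le> t} = {}" by blast
    show ?thesis unfolding empty by (rule sets.empty_sets)
  qed
qed

definition hold :: "(real \<Rightarrow> 'a \<Rightarrow> nat) \<Rightarrow> nat \<Rightarrow> 'a \<Rightarrow> real" where
  "hold N l \<omega> = arrival N (Suc l) \<omega> - arrival N l \<omega>"

text \<open>The grid index at which a walk first reaches level \<open>l\<close>; the discrete
  stand-in for the \<open>l\<close>-th arrival time.\<close>

definition first_passage :: "(nat \<Rightarrow> nat) \<Rightarrow> nat \<Rightarrow> nat \<Rightarrow> bool" where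
  "first_passage w l j \<longleftrightarrow> l \<le> w j \<and> (\<forall>j'<j. w j' < l)"

lemma first_passage_unique: "first_passage w l j \<Longrightarrow> first_passage w l j' \<Longrightarrow> j = j'"
  unfolding first_passage_def by (metis linorder_neqE_nat not_le)

text \<open>The smallest grid index whose grid point is at least \<open>s\<close>.\<close>

definition grid_index :: "nat \<Rightarrow> real \<Rightarrow> nat" where
  "grid_index q s = nat \<lceil>s * 2 ^ q\<rceil>"

lemma grid_index_le_iff: "grid_index q s \<le> j \<longleftrightarrow> s \<le> real j / 2 ^ q"
proof -
  have "grid_index q s \<le> j \<longleftrightarrow> s * 2 ^ q \<le> real j"
    unfolding grid_index_def by (simp add: nat_le_iff ceiling_le_iff)
  then show ?thesis by (simp add: field_simps)
qed

lemma grid_index_ge: "s \<le> real (grid_index q s) / 2 ^ q"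
  using grid_index_le_iff[of q s "grid_index q s"] by simp

lemma grid_index_limit:
  assumes "0 \<le> s"
  shows "(\<lambda>q. real (grid_index q s) / 2 ^ q) \<longlonglongrightarrow> s"
proof (rule tendsto_sandwich[of "\<lambda>_. s" _ _ "\<lambda>q. s + (1 / 2) ^ q"])
  have "real (grid_index q s) / 2 ^ q \<le> s + (1 / 2) ^ q" for q
  proof -
    have "real (grid_index q s) \<le> s * 2 ^ q + 1"
      using assms unfolding grid_index_def by (simp add: of_nat_nat)
    then have "real (grid_index q s) / 2 ^ q \<le> (s * 2 ^ q + 1) / 2 ^ q"
      by (rule divide_right_mono) simp
    then show ?thesis by (simp add: field_simps power_divide)
  qed
  then show "eventually (\<lambda>q. real (grid_index q s) / 2 ^ q \<le> s + (1 / 2) ^ q) sequentially" by simp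
  have "(\<lambda>q. s + (1 / 2) ^ q) \<longlonglongrightarrow> s + 0"
    by (intro tendsto_add tendsto_const LIMSEQ_realpow_zero) auto
  then show "(\<lambda>q. s + (1 / 2) ^ q) \<longlonglongrightarrow> s" by simp
qed (simp_all add: grid_index_ge)

lemma regular_first_passage:
  assumes "regular_path f"
  shows "first_passage (\<lambda>j. f (real j / 2 ^ q)) l j \<longleftrightarrow> j = grid_index q (path_arrival f l)"
proof -
  have ge: "l \<le> f (real j / 2 ^ q) \<longleftrightarrow> grid_index q (path_arrival f l) \<le> j" for j
    unfolding grid_index_le_iff using regular_arrival_le_iff[OF assms, of "real j / 2 ^ q" l] by simp
  have lt: "f (real j / 2 ^ q) < l \<longleftrightarrow> j < grid_index q (path_arrival f l)" for j
    using ge[of j] by linarith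
  show ?thesis unfolding first_passage_def ge lt by (meson le_antisym leI less_irrefl)
qed

text \<open>The discrete form of the event that the first \<open>L\<close> holding times exceed
  their prescribed lengths \<open>k\<close>, with the time of the \<open>L\<close>-th arrival
  recorded as \<open>i\<close>. It depends on the walk up to \<open>i\<close> only, which is what
  the Markov property requires.\<close>

definition grid_held :: "nat \<Rightarrow> (nat \<Rightarrow> nat) \<Rightarrow> nat \<Rightarrow> (nat \<Rightarrow> nat) \<Rightarrow> bool" where
  "grid_held L k i w \<longleftrightarrow> first_passage w L i \<and>
     (\<forall>l<L. \<exists>j\<le>i. first_passage w l j \<and> j + k l \<le> i \<and> w (j + k l) \<le> l)"

lemma grid_held_local:
  assumes eq: "\<And>j. j \<le> i \<Longrightarrow> w j = w' j"
  shows "grid_held L k i w = grid_held L k i w'"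
proof -
  have fp: "first_passage w l j = first_passage w' l j" if "j \<le> i" for l j
    unfolding first_passage_def using eq that by simp
  have "(\<exists>j\<le>i. first_passage w l j \<and> j + k l \<le> i \<and> w (j + k l) \<le> l) =
    (\<exists>j\<le>i. first_passage w' l j \<and> j + k l \<le> i \<and> w' (j + k l) \<le> l)" for l
    using fp eq by (metis (no_types, lifting))
  then show ?thesis unfolding grid_held_def using fp[of i] by simp
qed

lemma regular_grid_held:
  assumes f: "regular_path f"
  shows "grid_held L k i (\<lambda>j. f (real j / 2 ^ q)) \<longleftrightarrow> i = grid_index q (path_arrival f L) \<and>
     (\<forall>l<L. f (real (grid_index q (path_arrival f l)) / 2 ^ q + real (k l) / 2 ^ q) \<le> l)"
proof -
  let ?g = "\<lambda>l. grid_index q (path_arrival f l)"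
  have "?g l \<le> ?g L \<and> ?g l + k l \<le> ?g L"
    if "l < L" "f (real (?g l + k l) / 2 ^ q) \<le> l" for l
  proof -
    have "L \<le> f (real (?g L) / 2 ^ q)"
      using regular_arrival_le_iff[OF f, of "real (?g L) / 2 ^ q" L] grid_index_ge by simp
    with that have lt: "f (real (?g l + k l) / 2 ^ q) < f (real (?g L) / 2 ^ q)" by linarith
    have "\<not> ?g L \<le> ?g l + k l"
    proof
      assume "?g L \<le> ?g l + k l"
      then have "real (?g L) / 2 ^ q \<le> real (?g l + k l) / 2 ^ q"
        by (intro divide_right_mono) (simp_all only: of_nat_le_iff zero_le_power zero_le_numeral)
      then have "f (real (?g L) / 2 ^ q) \<le> f (real (?g l + k l) / 2 ^ q)"
        by (intro counting_path_mono[OF regular_pathD[OF f]]) simp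
      with lt show False by simp
    qed
    then show ?thesis by simp
  qed
  then show ?thesis
    unfolding grid_held_def regular_first_passage[OF f]
    by (auto simp: add_divide_distrib)
qed

context prob_space
begin

context
  fixes lam :: real and N :: "real \<Rightarrow> 'a \<Rightarrow> nat"
  assumes N: "poisson_grid M lam N" and lam: "0 < lam"
begin

lemma pg_arrival_measurable: "arrival N l \<in> borel_measurable M"
  using N by (intro arrival_measurable) (auto simp: poisson_grid_def)

lemma hold_measurable: "hold N l \<in> borel_measurable M"
  unfolding hold_def[abs_def] using pg_arrival_measurable by measurable

lemma hold_greater_events: "{\<omega> \<in> space M. x < hold N l \<omega>} \<in> events"
  using hold_measurable by measurable

lemma all_hold_greater_events: "{\<omega> \<in> space M. \<forall>l<L. x l < hold N l \<omega>} \<in> events"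
proof -
  have "{\<omega> \<in> space M. \<forall>l\<in>{..<L}. x l < hold N l \<omega>} \<in> events"
    by (rule sets.sets_Collect_finite_All) (rule hold_greater_events, simp)
  then show ?thesis by (simp only: Ball_def lessThan_iff)
qed

text \<open>Induction on the number of holding times. On a grid, summing over the first passage
  index of level \<open>L\<close> and applying the Markov property splits off one exponential
  factor; the grid is then refined.\<close>

lemma prob_hold_greater_nonneg:
  assumes x: "\<And>l. 0 \<le> x l"
  shows "prob {\<omega> \<in> space M. \<forall>l<L. x l < hold N l \<omega>} = (\<Prod>l<L. exp (- lam * x l))"
proof (induction L)
  case 0
  then show ?case by (simp add: prob_space)
next
  case (Suc L)
  define k where "k q l = grid_index q (x l)" for q l
  define W where "W q \<omega> j = N (real j / 2 ^ q) \<omega>" for q \<omega> j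
  define A where "A q i = {\<omega> \<in> space M. grid_held L (k q) i (W q \<omega>)}" for q i
  define B where "B q i = {\<omega> \<in> space M. grid_held L (k q) i (W q \<omega>) \<and> W q \<omega> (i + k q L) = W q \<omega> i}" for q i
  let ?H = "\<lambda>L. {\<omega> \<in> space M. \<forall>l<L. x l < hold N l \<omega>}"
  have H: "?H L \<in> events" for L by (rule all_hold_greater_events)
  have events: "A q i \<in> events" "B q i \<in> events"
    and pAB: "prob (B q i) = prob (A q i) * exp (- lam * (real (k q L) / 2 ^ q))" for q i
  proof -
    have local: "\<And>w w'. (\<And>j. j \<le> i \<Longrightarrow> w j = w' j) \<Longrightarrow> grid_held L (k q) i w = grid_held L (k q) i w'"
      by (rule grid_held_local)
    show "A q i \<in> events"
      unfolding A_def W_def[abs_def] by (rule grid_markov(1)[OF N lam local])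
    show "B q i \<in> events"
      unfolding B_def W_def[abs_def] by (rule grid_markov(2)[OF N lam local])
    show "prob (B q i) = prob (A q i) * exp (- lam * (real (k q L) / 2 ^ q))"
      unfolding A_def B_def W_def[abs_def] by (rule grid_markov(3)[OF N lam local])
  qed
  have disj: "disjoint_family (A q)" "disjoint_family (B q)" for q
    unfolding A_def B_def disjoint_family_on_def grid_held_def
    using first_passage_unique by blast+
  have stage: "prob (\<Union>i. B q i) = prob (\<Union>i. A q i) * exp (- lam * (real (k q L) / 2 ^ q))" for q
  proof -
    have "(\<lambda>i. prob (A q i) * exp (- lam * (real (k q L) / 2 ^ q))) sums
        (prob (\<Union>i. A q i) * exp (- lam * (real (k q L) / 2 ^ q)))"
      using events disj by (intro sums_mult2 finite_measure_UNION) auto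
    moreover have "(\<lambda>i. prob (B q i)) sums prob (\<Union>i. B q i)"
      using events disj by (intro finite_measure_UNION) auto
    ultimately show ?thesis unfolding pAB by (rule sums_unique2[symmetric])
  qed
  have path: "eventually (\<lambda>q. (\<omega> \<in> (\<Union>i. A q i) \<longleftrightarrow> \<omega> \<in> ?H L) \<and> (\<omega> \<in> (\<Union>i. B q i) \<longleftrightarrow> \<omega> \<in> ?H (Suc L))) sequentially"
    if \<omega>: "\<omega> \<in> space M" and f: "regular_path (\<lambda>t. N t \<omega>)" for \<omega>
  proof -
    let ?f = "\<lambda>t. N t \<omega>"
    let ?a = "path_arrival ?f"
    let ?g = "\<lambda>q l. real (grid_index q (?a l)) / 2 ^ q"
    have hold_iff: "x l < hold N l \<omega> \<longleftrightarrow> ?f (?a l + x l) \<le> l" for l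
      unfolding hold_def arrival_eq_path_arrival
      using regular_less_arrival_iff[OF f, of "?a l + x l" "Suc l"] path_arrival_nonneg[of ?f l] x[of l] by auto
    have ev1: "eventually (\<lambda>q. ?f (?g q l + real (k q l) / 2 ^ q) = ?f (?a l + x l)) sequentially" for l
      unfolding k_def
      by (intro counting_path_eventually_eq[OF regular_pathD[OF f]] tendsto_add grid_index_limit add_mono
          grid_index_ge add_nonneg_nonneg path_arrival_nonneg x)
    have ev2: "eventually (\<lambda>q. ?f (?g q L) = ?f (?a L)) sequentially"
      by (intro counting_path_eventually_eq[OF regular_pathD[OF f]] grid_index_limit grid_index_ge path_arrival_nonneg)
    have "eventually (\<lambda>q. \<forall>l\<in>{..L}. ?f (?g q l + real (k q l) / 2 ^ q) = ?f (?a l + x l)) sequentially"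
      using ev1 by (intro eventually_ball_finite) auto
    with ev2 show ?thesis
    proof eventually_elim
      case (elim q)
      have A: "\<omega> \<in> (\<Union>i. A q i) \<longleftrightarrow> (\<forall>l<L. ?f (?a l + x l) \<le> l)"
      proof -
        have "\<omega> \<in> (\<Union>i. A q i) \<longleftrightarrow> (\<forall>l<L. ?f (?g q l + real (k q l) / 2 ^ q) \<le> l)"
          using \<omega> by (simp add: A_def W_def[abs_def] regular_grid_held[OF f])
        also have "\<dots> \<longleftrightarrow> (\<forall>l<L. ?f (?a l + x l) \<le> l)" using elim(2) by simp
        finally show ?thesis .
      qed
      have at: "?f (?a L) = L" by (rule regular_at_arrival[OF f])
      have ge: "L \<le> ?f (?a L + x L)"
        using counting_path_mono[OF regular_pathD[OF f], of "?a L" "?a L + x L"] path_arrival_nonneg[of ?f L] x[of L] at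
        by simp
      have "\<omega> \<in> (\<Union>i. B q i) \<longleftrightarrow> (\<forall>l<L. ?f (?g q l + real (k q l) / 2 ^ q) \<le> l) \<and>
          ?f (?g q L + real (k q L) / 2 ^ q) = ?f (?g q L)"
        using \<omega> by (simp add: B_def W_def[abs_def] regular_grid_held[OF f] add_divide_distrib)
      also have "\<dots> \<longleftrightarrow> (\<forall>l<L. ?f (?a l + x l) \<le> l) \<and> ?f (?a L + x L) = L"
      proof -
        have "(\<forall>l<L. ?f (?g q l + real (k q l) / 2 ^ q) \<le> l) \<longleftrightarrow> (\<forall>l<L. ?f (?a l + x l) \<le> l)"
          using elim(2) by simp
        moreover have "?f (?g q L + real (k q L) / 2 ^ q) = ?f (?a L + x L)" using elim(2) by blast
        ultimately show ?thesis unfolding elim(1) at by simp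
      qed
      also have "\<dots> \<longleftrightarrow> (\<forall>l<Suc L. ?f (?a l + x l) \<le> l)"
        using ge by (auto simp: less_Suc_eq)
      finally show ?case using A \<omega> by (simp add: hold_iff)
    qed
  qed
  have reg: "AE \<omega> in M. regular_path (\<lambda>t. N t \<omega>)" by (rule AE_regular_path[OF N lam])
  have limA: "(\<lambda>q. prob (\<Union>i. A q i)) \<longlonglongrightarrow> prob (?H L)"
  proof (rule prob_tendsto_of_eventually_eq)
    show "(\<Union>i. A q i) \<in> events" for q using events by blast
    show "AE \<omega> in M. eventually (\<lambda>q. \<omega> \<in> (\<Union>i. A q i) \<longleftrightarrow> \<omega> \<in> ?H L) sequentially"
      using reg by (rule AE_mp) (intro AE_I2 impI, drule (1) path, auto elim: eventually_mono)
  qed (rule H)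
  have limB: "(\<lambda>q. prob (\<Union>i. B q i)) \<longlonglongrightarrow> prob (?H (Suc L))"
  proof (rule prob_tendsto_of_eventually_eq)
    show "(\<Union>i. B q i) \<in> events" for q using events by blast
    show "AE \<omega> in M. eventually (\<lambda>q. \<omega> \<in> (\<Union>i. B q i) \<longleftrightarrow> \<omega> \<in> ?H (Suc L)) sequentially"
      using reg by (rule AE_mp) (intro AE_I2 impI, drule (1) path, auto elim: eventually_mono)
  qed (rule H)
  have "(\<lambda>q. exp (- lam * (real (k q L) / 2 ^ q))) \<longlonglongrightarrow> exp (- lam * x L)"
    unfolding k_def by (intro tendsto_exp tendsto_mult tendsto_const grid_index_limit x)
  then have "(\<lambda>q. prob (\<Union>i. B q i)) \<longlonglongrightarrow> prob (?H L) * exp (- lam * x L)"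
    unfolding stage by (intro tendsto_mult limA)
  with limB have "prob (?H (Suc L)) = prob (?H L) * exp (- lam * x L)"
    by (rule LIMSEQ_unique)
  then show ?case unfolding prod.lessThan_Suc Suc.IH[symmetric] .
qed

lemma AE_hold_pos: "AE \<omega> in M. \<forall>l. 0 < hold N l \<omega>"
  using AE_regular_path[OF N lam]
proof (rule AE_mp, intro AE_I2 impI allI)
  fix \<omega> l assume "regular_path (\<lambda>t. N t \<omega>)"
  then show "0 < hold N l \<omega>"
    using regular_arrival_strict_mono[of "\<lambda>t. N t \<omega>" l "Suc l"] by (simp add: hold_def arrival_eq_path_arrival)
qed

lemma prob_hold_greater:
  "prob {\<omega> \<in> space M. \<forall>l<L. x l < hold N l \<omega>} = (\<Prod>l<L. exp (- lam * max 0 (x l)))"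
proof -
  note ev = all_hold_greater_events
  have "prob {\<omega> \<in> space M. \<forall>l<L. x l < hold N l \<omega>} = prob {\<omega> \<in> space M. \<forall>l<L. max 0 (x l) < hold N l \<omega>}"
  proof (rule finite_measure_eq_AE[OF _ ev ev])
    show "AE \<omega> in M. \<omega> \<in> {\<omega> \<in> space M. \<forall>l<L. x l < hold N l \<omega>} \<longleftrightarrow>
        \<omega> \<in> {\<omega> \<in> space M. \<forall>l<L. max 0 (x l) < hold N l \<omega>}"
      using AE_hold_pos by eventually_elim auto
  qed
  then show ?thesis using prob_hold_greater_nonneg[of "\<lambda>l. max 0 (x l)" L] by simp
qed

lemma prob_hold_greater_single: "prob {\<omega> \<in> space M. x < hold N l \<omega>} = exp (- lam * max 0 x)"
proof -
  let ?x = "\<lambda>i. if i = l then x else - 1"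
  have "prob {\<omega> \<in> space M. x < hold N l \<omega>} = prob {\<omega> \<in> space M. \<forall>i<Suc l. ?x i < hold N i \<omega>}"
  proof (rule finite_measure_eq_AE)
    show "AE \<omega> in M. \<omega> \<in> {\<omega> \<in> space M. x < hold N l \<omega>} \<longleftrightarrow> \<omega> \<in> {\<omega> \<in> space M. \<forall>i<Suc l. ?x i < hold N i \<omega>}"
      using AE_hold_pos
    proof (rule AE_mp, intro AE_I2 impI)
      fix \<omega> assume pos: "\<forall>l. 0 < hold N l \<omega>"
      have "- 1 < hold N i \<omega>" for i using pos by (meson less_trans neg_less_0_iff_less zero_less_one)
      then show "\<omega> \<in> {\<omega> \<in> space M. x < hold N l \<omega>} \<longleftrightarrow> \<omega> \<in> {\<omega> \<in> space M. \<forall>i<Suc l. ?x i < hold N i \<omega>}"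
        by auto
    qed
  qed (rule hold_greater_events all_hold_greater_events)+
  also have "\<dots> = (\<Prod>i<Suc l. exp (- lam * max 0 (?x i)))" by (rule prob_hold_greater)
  also have "\<dots> = (\<Prod>i<l. 1) * exp (- lam * max 0 x)"
    unfolding prod.lessThan_Suc by (intro arg_cong2[where f="(*)"] prod.cong refl) auto
  finally show ?thesis by simp
qed

lemma hold_exponential: "distributed M lborel (hold N l) (\<lambda>x. ennreal (exponential_density lam x))"
proof -
  have "prob {\<omega> \<in> space M. hold N l \<omega> \<le> a} = 1 - exp (- a * lam)" if "0 \<le> a" for a
  proof -
    have eq: "{\<omega> \<in> space M. hold N l \<omega> \<le> a} = space M - {\<omega> \<in> space M. a < hold N l \<omega>}" by auto
    have "prob {\<omega> \<in> space M. a < hold N l \<omega>} = exp (- a * lam)"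
      unfolding prob_hold_greater_single using that by (simp add: mult.commute)
    then show ?thesis unfolding eq prob_compl[OF hold_greater_events] by simp
  qed
  then show ?thesis using hold_measurable lam by (subst exponential_distributed_iff) auto
qed

text \<open>Half-lines generate the Borel sets, and on them the joint tail probabilities
  factorise.\<close>

lemma hold_indep: "indep_vars (\<lambda>_. borel) (hold N) {..<L}"
proof (cases "L = 0")
  case True
  then show ?thesis by (simp add: indep_vars_def indep_sets_def)
next
  case False
  let ?E = "insert UNIV (range greaterThan) :: real set set"
  have "indep_vars (\<lambda>_. borel) (hold N) {..<L} \<longleftrightarrow>
    (\<forall>A\<in>(\<Pi> i\<in>{..<L}. ?E). prob (\<Inter>j\<in>{..<L}. hold N j -` A j \<inter> space M) =
       (\<Prod>j\<in>{..<L}. prob (hold N j -` A j \<inter> space M)))"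
  proof (rule indep_vars_finite)
    show "sets borel = sigma_sets (space borel) ?E"
    proof -
      have "sets (borel :: real measure) = sigma_sets UNIV (range greaterThan)"
        unfolding borel_Ioi by (rule sets_measure_of) simp
      also have "\<dots> = sigma_sets UNIV ?E"
        by (rule sigma_sets_eqI) (auto intro: sigma_sets_top)
      finally show ?thesis by simp
    qed
    show "Int_stable ?E"
    proof (rule Int_stableI)
      fix a b :: "real set" assume "a \<in> ?E" "b \<in> ?E"
      moreover have "{x<..} \<inter> {y<..} = {max x y<..}" for x y :: real by auto
      ultimately show "a \<inter> b \<in> ?E" by auto
    qed
  qed (use False hold_measurable in auto)
  also have "\<dots>"
  proof
    fix A assume A: "A \<in> (\<Pi> i\<in>{..<L}. ?E)"
    define x where "x i = (if A i = UNIV then - 1 else (SOME y. A i = {y<..}))" for i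
    have Ax: "A i = UNIV \<and> x i = - 1 \<or> A i = {x i<..}" if "i < L" for i
    proof (cases "A i = UNIV")
      case False
      have "A i \<in> ?E" by (rule Pi_mem[OF A]) (use that in simp)
      with False obtain y where "A i = {y<..}" by blast
      then have "A i = {(SOME y. A i = {y<..})<..}" by (rule someI)
      then show ?thesis using False by (simp add: x_def)
    qed (simp add: x_def)
    have iff: "hold N i \<omega> \<in> A i \<longleftrightarrow> x i < hold N i \<omega>" if "i < L" "0 < hold N i \<omega>" for i \<omega>
      using Ax[OF that(1)] that(2) by auto
    have ev: "hold N i -` A i \<inter> space M \<in> events" if "i < L" for i
    proof (rule measurable_sets[OF hold_measurable])
      show "A i \<in> sets borel" using Ax[OF that]
      proof
        assume "A i = {x i<..}"
        then show ?thesis by (simp only: borel_open open_greaterThan)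
      qed simp
    qed
    have ev': "{\<omega> \<in> space M. x i < hold N i \<omega>} \<in> events" for i
      by (rule hold_greater_events)
    have "prob (\<Inter>j\<in>{..<L}. hold N j -` A j \<inter> space M) = prob {\<omega> \<in> space M. \<forall>l<L. x l < hold N l \<omega>}"
    proof (rule finite_measure_eq_AE)
      show "AE \<omega> in M. \<omega> \<in> (\<Inter>j\<in>{..<L}. hold N j -` A j \<inter> space M) \<longleftrightarrow> \<omega> \<in> {\<omega> \<in> space M. \<forall>l<L. x l < hold N l \<omega>}"
        using AE_hold_pos
      proof (rule AE_mp, intro AE_I2 impI)
        fix \<omega> assume \<omega>: "\<omega> \<in> space M" and pos: "\<forall>l. 0 < hold N l \<omega>"
        have "(\<forall>j<L. hold N j \<omega> \<in> A j) \<longleftrightarrow> (\<forall>l<L. x l < hold N l \<omega>)" using iff pos by blast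
        then show "\<omega> \<in> (\<Inter>j\<in>{..<L}. hold N j -` A j \<inter> space M) \<longleftrightarrow> \<omega> \<in> {\<omega> \<in> space M. \<forall>l<L. x l < hold N l \<omega>}"
          using \<omega> False by auto
      qed
      show "(\<Inter>j\<in>{..<L}. hold N j -` A j \<inter> space M) \<in> events"
        using ev False by (intro sets.finite_INT) auto
      show "{\<omega> \<in> space M. \<forall>l<L. x l < hold N l \<omega>} \<in> events" by (rule all_hold_greater_events)
    qed
    also have "\<dots> = (\<Prod>j<L. exp (- lam * max 0 (x j)))" by (rule prob_hold_greater)
    also have "\<dots> = (\<Prod>j<L. prob (hold N j -` A j \<inter> space M))"
    proof (rule prod.cong[OF refl])
      fix j assume "j \<in> {..<L}"
      then have j: "j < L" by simp
      have "prob (hold N j -` A j \<inter> space M) = prob {\<omega> \<in> space M. x j < hold N j \<omega>}"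
      proof (rule finite_measure_eq_AE[OF _ ev[OF j] ev'])
        show "AE \<omega> in M. \<omega> \<in> hold N j -` A j \<inter> space M \<longleftrightarrow> \<omega> \<in> {\<omega> \<in> space M. x j < hold N j \<omega>}"
          using AE_hold_pos by eventually_elim (use iff[OF j] in auto)
      qed
      then show "exp (- lam * max 0 (x j)) = prob (hold N j -` A j \<inter> space M)"
        by (simp add: prob_hold_greater_single)
    qed
    finally show "prob (\<Inter>j\<in>{..<L}. hold N j -` A j \<inter> space M) = (\<Prod>j<L. prob (hold N j -` A j \<inter> space M))" .
  qed
  finally show ?thesis .
qed

end

end

section \<open>Marks are independent of the superposed process\<close>

definition cell_sums :: "(nat \<times> nat) list \<Rightarrow> nat list" where
  "cell_sums xs = map (\<lambda>(x, z). x + z) xs"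

definition cell_marks :: "(nat \<times> nat) list \<Rightarrow> bool list" where
  "cell_marks xs = map (\<lambda>(x, z). 0 < x) (filter (\<lambda>(x, z). 0 < x + z) xs)"

text \<open>Lists of cell pairs without crowded cells whose sums satisfy \<open>\<Phi>\<close> and
  whose first marks lie in the given sets.\<close>

definition marked_cells :: "(nat list \<Rightarrow> bool) \<Rightarrow> bool set list \<Rightarrow> (nat \<times> nat) list set" where
  "marked_cells \<Phi> Vs = {xs. \<Phi> (cell_sums xs) \<and> (\<forall>d\<in>set (cell_sums xs). d \<le> 1) \<and>
     length Vs \<le> length (cell_marks xs) \<and> (\<forall>i<length Vs. cell_marks xs ! i \<in> Vs ! i)}"

lemma marked_cells_Cons:
  "(x, z) # xs \<in> marked_cells \<Phi> Vs \<longleftrightarrow>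
     (if x + z = 0 then xs \<in> marked_cells (\<lambda>ds. \<Phi> (0 # ds)) Vs
      else x + z = 1 \<and> (case Vs of [] \<Rightarrow> xs \<in> marked_cells (\<lambda>ds. \<Phi> (1 # ds)) []
        | V # Vs' \<Rightarrow> (0 < x) \<in> V \<and> xs \<in> marked_cells (\<lambda>ds. \<Phi> (1 # ds)) Vs'))"
proof (cases "x + z \<le> 1")
  case True
  then consider "x = 0" "z = 0" | "x = 1" "z = 0" | "x = 0" "z = 1" by linarith
  then show ?thesis
    by cases (auto simp: marked_cells_def cell_sums_def cell_marks_def All_less_Suc2 split: list.split)
next
  case False
  then show ?thesis by (auto simp: marked_cells_def cell_sums_def)
qed

lemma measure_bernoulli_bool:
  assumes "0 \<le> t" "t \<le> 1"
  shows "measure (measure_pmf (bernoulli_pmf t)) V = (if True \<in> V then t else 0) + (if False \<in> V then 1 - t else 0)"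
proof -
  have "finite V" by simp
  moreover have "V = (if True \<in> V then {True} else {}) \<union> (if False \<in> V then {False} else {})"
    by (auto split: if_splits) (metis (full_types))+
  ultimately have "measure (measure_pmf (bernoulli_pmf t)) V =
    (\<Sum>v\<in>(if True \<in> V then {True} else {}) \<union> (if False \<in> V then {False} else {}). pmf (bernoulli_pmf t) v)"
    by (metis measure_measure_pmf_finite)
  also have "\<dots> = (if True \<in> V then t else 0) + (if False \<in> V then 1 - t else 0)"
    using assms by simp
  finally show ?thesis .
qed

lemma measure_marked_cells_Suc:
  fixes a b :: real
  assumes "0 \<le> a" "0 \<le> b"
  defines "c \<equiv> pair_pmf (poisson_law a) (poisson_law b)"
  shows "measure (replicate_pmf (Suc K) c) (marked_cells \<Phi> Vs) =
    exp (- (a + b)) * (measure (replicate_pmf K c) (marked_cells (\<lambda>ds. \<Phi> (0 # ds)) Vs) +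
      (case Vs of [] \<Rightarrow> a + b | V # Vs' \<Rightarrow> (if True \<in> V then a else 0) + (if False \<in> V then b else 0)) *
      measure (replicate_pmf K c) (marked_cells (\<lambda>ds. \<Phi> (1 # ds)) (tl Vs)))"
proof -
  let ?R = "replicate_pmf K c" and ?P = "pair_pmf c (replicate_pmf K c)"
  let ?S0 = "marked_cells (\<lambda>ds. \<Phi> (0 # ds)) Vs" and ?S1 = "marked_cells (\<lambda>ds. \<Phi> (1 # ds)) (tl Vs)"
  define T where "T v \<longleftrightarrow> (case Vs of [] \<Rightarrow> True | V # _ \<Rightarrow> v \<in> V)" for v
  have mem: "((x, z), xs) \<in> (\<lambda>(x, xs). x # xs) -` marked_cells \<Phi> Vs \<longleftrightarrow>
     ((x, z), xs) \<in> {(0, 0)} \<times> ?S0 \<union> ((if T True then {(1, 0)} else {}) \<union> (if T False then {(0, 1)} else {})) \<times> ?S1"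
    for x z xs
  proof (cases "x + z \<le> 1")
    case True
    then consider "x = 0" "z = 0" | "x = 1" "z = 0" | "x = 0" "z = 1" by linarith
    then show ?thesis by cases (simp_all add: marked_cells_Cons T_def split: list.split)
  next
    case False
    then show ?thesis by (auto simp: marked_cells_Cons split: if_splits)
  qed
  have eq: "(\<lambda>(x, xs). x # xs) -` marked_cells \<Phi> Vs =
    {(0, 0)} \<times> ?S0 \<union> ((if T True then {(1, 0)} else {}) \<union> (if T False then {(0, 1)} else {})) \<times> ?S1"
    by (rule set_eqI) (metis mem surj_pair)
  have "measure (replicate_pmf (Suc K) c) (marked_cells \<Phi> Vs) =
     measure ?P ((\<lambda>(x, xs). x # xs) -` marked_cells \<Phi> Vs)"
    unfolding replicate_pmf_Suc_pair by simp
  also have "\<dots> = measure ?P ({(0, 0)} \<times> ?S0) +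
     measure ?P (((if T True then {(1, 0)} else {}) \<union> (if T False then {(0, 1)} else {})) \<times> ?S1)"
    unfolding eq by (intro measure_pmf.finite_measure_Union) (auto split: if_splits)
  also have "\<dots> = pmf c (0, 0) * measure ?R ?S0 +
     ((if T True then pmf c (1, 0) else 0) + (if T False then pmf c (0, 1) else 0)) * measure ?R ?S1"
    unfolding measure_pair_pmf_Times by (simp add: measure_measure_pmf_finite)
  finally have eq: "measure (replicate_pmf (Suc K) c) (marked_cells \<Phi> Vs) = pmf c (0, 0) * measure ?R ?S0 +
     ((if T True then pmf c (1, 0) else 0) + (if T False then pmf c (0, 1) else 0)) * measure ?R ?S1" .
  have vals: "pmf c (0, 0) = exp (- (a + b))" "pmf c (1, 0) = exp (- (a + b)) * a"
    "pmf c (0, 1) = exp (- (a + b)) * b"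
    using assms by (auto simp: c_def pmf_pair pmf_poisson_law mult_exp_exp algebra_simps)
  show ?thesis
    unfolding eq vals by (cases Vs) (auto simp: T_def algebra_simps)
qed

text \<open>In a cell whose sum is one, the arrival belongs to the first component with
  probability \<open>a / (a + b)\<close>. Hence marks are Bernoulli, independent of the sums; this
  is thinning for a single grid.\<close>

lemma measure_marked_cells:
  fixes a b :: real
  assumes "0 < a" "0 \<le> b"
  defines "c \<equiv> pair_pmf (poisson_law a) (poisson_law b)"
  shows "measure (replicate_pmf K c) (marked_cells \<Phi> Vs) =
    measure (replicate_pmf K c) (marked_cells \<Phi> (replicate (length Vs) UNIV)) *
    (\<Prod>i<length Vs. measure (bernoulli_pmf (a / (a + b))) (Vs ! i))"
proof (induction K arbitrary: \<Phi> Vs)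
  case 0
  show ?case by (cases Vs) (auto simp: marked_cells_def cell_sums_def cell_marks_def)
next
  case (Suc K)
  note step = measure_marked_cells_Suc[of a b, folded c_def]
  have ab: "0 \<le> a" "0 \<le> b" "0 < a + b" using assms by auto
  show ?case
  proof (cases Vs)
    case Nil
    then show ?thesis by simp
  next
    case (Cons V Vs')
    let ?\<beta> = "\<lambda>V. measure (bernoulli_pmf (a / (a + b))) V"
    have "(a + b) * ?\<beta> V = (if True \<in> V then a else 0) + (if False \<in> V then b else 0)"
    proof -
      have "(a + b) * (a / (a + b)) = a" "(a + b) * (1 - a / (a + b)) = b"
        using ab(3) by (simp_all add: right_diff_distrib)
      then show ?thesis using ab
        by (subst measure_bernoulli_bool) (auto simp: distrib_left)
    qed
    then have V: "(if True \<in> V then a else 0) + (if False \<in> V then b else 0) = (a + b) * ?\<beta> V" by simp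
    have prod: "(\<Prod>i<length Vs. ?\<beta> (Vs ! i)) = ?\<beta> V * (\<Prod>i<length Vs'. ?\<beta> (Vs' ! i))"
      unfolding Cons by (simp add: prod.lessThan_Suc_shift del: prod.lessThan_Suc)
    let ?m = "\<lambda>\<Phi> Vs. measure (replicate_pmf K c) (marked_cells \<Phi> Vs)"
    have "measure (replicate_pmf (Suc K) c) (marked_cells \<Phi> Vs) =
      exp (- (a + b)) * (?m (\<lambda>ds. \<Phi> (0 # ds)) Vs + (a + b) * ?\<beta> V * ?m (\<lambda>ds. \<Phi> (1 # ds)) Vs')"
      unfolding step[OF ab(1,2)] V[symmetric] using Cons by simp
    also have "\<dots> = exp (- (a + b)) * (?m (\<lambda>ds. \<Phi> (0 # ds)) (replicate (length Vs) UNIV) +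
        (a + b) * ?m (\<lambda>ds. \<Phi> (1 # ds)) (replicate (length Vs') UNIV)) * (\<Prod>i<length Vs. ?\<beta> (Vs ! i))"
      unfolding Suc.IH[of _ Vs] Suc.IH[of _ Vs'] prod by (simp add: algebra_simps)
    also have "exp (- (a + b)) * (?m (\<lambda>ds. \<Phi> (0 # ds)) (replicate (length Vs) UNIV) +
        (a + b) * ?m (\<lambda>ds. \<Phi> (1 # ds)) (replicate (length Vs') UNIV)) =
        measure (replicate_pmf (Suc K) c) (marked_cells \<Phi> (replicate (length Vs) UNIV))"
      unfolding step[OF ab(1,2)] Cons by simp
    finally show ?thesis .
  qed
qed

lemma measurable_nat_of_real:
  assumes "(\<lambda>x. real (f x)) \<in> borel_measurable M"
  shows "f \<in> measurable M (count_space UNIV)"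
proof -
  have "(\<lambda>x. nat \<lfloor>real (f x)\<rfloor>) \<in> measurable M (count_space UNIV)"
    using assms by measurable
  then show ?thesis by simp
qed

lemma measurable_at_random_time:
  assumes N: "\<forall>t\<ge>0. N t \<in> measurable M (count_space UNIV)"
    and path: "\<And>\<omega>. \<omega> \<in> space M \<Longrightarrow> counting_path (\<lambda>t. N t \<omega>)"
    and T: "T \<in> borel_measurable M" "\<And>\<omega>. \<omega> \<in> space M \<Longrightarrow> 0 \<le> T \<omega>"
  shows "(\<lambda>\<omega>. N (T \<omega>) \<omega>) \<in> measurable M (count_space UNIV)"
proof (rule measurable_nat_of_real, rule borel_measurable_LIMSEQ_real)
  fix q
  show "(\<lambda>\<omega>. real (N (real (grid_index q (T \<omega>)) / 2 ^ q) \<omega>)) \<in> borel_measurable M"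
  proof (rule measurable_compose[where g=real and N="count_space UNIV"])
    show "(\<lambda>\<omega>. N (real (grid_index q (T \<omega>)) / 2 ^ q) \<omega>) \<in> measurable M (count_space UNIV)"
    proof (rule measurable_compose_countable[where g="\<lambda>\<omega>. grid_index q (T \<omega>)" and f="\<lambda>i. N (real i / 2 ^ q)"])
      show "(\<lambda>\<omega>. grid_index q (T \<omega>)) \<in> measurable M (count_space UNIV)"
        unfolding grid_index_def using T(1) by measurable
      show "N (real i / 2 ^ q) \<in> measurable M (count_space UNIV)" for i
        using N by simp
    qed
  qed simp
next
  fix \<omega> assume \<omega>: "\<omega> \<in> space M"
  have "eventually (\<lambda>q. N (real (grid_index q (T \<omega>)) / 2 ^ q) \<omega> = N (T \<omega>) \<omega>) sequentially"
    by (intro counting_path_eventually_eq[OF path[OF \<omega>]] grid_index_limit grid_index_ge T(2) \<omega>)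
  then show "(\<lambda>q. real (N (real (grid_index q (T \<omega>)) / 2 ^ q) \<omega>)) \<longlonglongrightarrow> real (N (T \<omega>) \<omega>)"
    by (intro tendsto_eventually) (auto elim: eventually_mono)
qed

text \<open>The window grows with \<open>q\<close>, as in \<open>crowded_cell\<close>, so that
  these families are increasing in \<open>q\<close> and generate the algebra of the
  process.\<close>

definition grid_events :: "'a measure \<Rightarrow> (real \<Rightarrow> 'a \<Rightarrow> nat) \<Rightarrow> nat \<Rightarrow> 'a set set" where
  "grid_events M N q = {{\<omega> \<in> space M. \<Phi> (grid_increments N q (q * 2 ^ q) \<omega>)} | \<Phi>. True}"

lemma grid_eventsI: "{\<omega> \<in> space M. \<Phi> (grid_increments N q (q * 2 ^ q) \<omega>)} \<in> grid_events M N q"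
  unfolding grid_events_def by blast

lemma grid_events_mono:
  assumes path: "\<And>\<omega>. \<omega> \<in> space M \<Longrightarrow> counting_path (\<lambda>t. N t \<omega>)" and "q \<le> q'"
  shows "grid_events M N q \<subseteq> grid_events M N q'"
proof
  fix A assume "A \<in> grid_events M N q"
  then obtain \<Phi> where A: "A = {\<omega> \<in> space M. \<Phi> (grid_increments N q (q * 2 ^ q) \<omega>)}"
    by (auto simp: grid_events_def)
  define m :: nat where "m = 2 ^ (q' - q)"
  define \<Psi> where "\<Psi> ys = \<Phi> (map (\<lambda>i. sum_list (take (Suc i * m) ys) - sum_list (take (i * m) ys)) [0..<q * 2 ^ q])" for ys :: "nat list"
  have pow: "(2::real) ^ q' = 2 ^ q * real m" "(2::nat) ^ q' = 2 ^ q * m"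
    unfolding m_def using \<open>q \<le> q'\<close> by (simp_all flip: power_add)
  have "m \<noteq> 0" by (simp add: m_def)
  have "grid_increments N q (q * 2 ^ q) \<omega> = map (\<lambda>i. sum_list (take (Suc i * m) (grid_increments N q' (q' * 2 ^ q') \<omega>))
      - sum_list (take (i * m) (grid_increments N q' (q' * 2 ^ q') \<omega>))) [0..<q * 2 ^ q]"
    if \<omega>: "\<omega> \<in> space M" for \<omega>
  proof -
    have walk: "N (real i / 2 ^ q) \<omega> = sum_list (take (i * m) (grid_increments N q' (q' * 2 ^ q') \<omega>))"
      if i: "i \<le> q * 2 ^ q" for i
    proof -
      have "i * m \<le> q * 2 ^ q * m" using i by (rule mult_le_mono1)
      also have "\<dots> \<le> q' * 2 ^ q'" using \<open>q \<le> q'\<close> by (simp add: pow mult.assoc)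
      finally have le: "i * m \<le> q' * 2 ^ q'" .
      have "real i / 2 ^ q = real (i * m) / 2 ^ q'"
        using \<open>m \<noteq> 0\<close> by (simp add: pow)
      then show ?thesis
        unfolding grid_increments_def using counting_path_grid_sum[OF path[OF \<omega>] le, of q'] by simp
    qed
    show ?thesis unfolding grid_increments_def[of N q]
    proof (intro map_cong refl)
      fix i assume "i \<in> set [0..<q * 2 ^ q]"
      then have "i \<le> q * 2 ^ q" "Suc i \<le> q * 2 ^ q" by auto
      then show "N (real (Suc i) / 2 ^ q) \<omega> - N (real i / 2 ^ q) \<omega> =
        sum_list (take (Suc i * m) (grid_increments N q' (q' * 2 ^ q') \<omega>))
        - sum_list (take (i * m) (grid_increments N q' (q' * 2 ^ q') \<omega>))"
        by (simp only: walk)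
    qed
  qed
  then have "A = {\<omega> \<in> space M. \<Psi> (grid_increments N q' (q' * 2 ^ q') \<omega>)}"
    unfolding A \<Psi>_def by (intro Collect_cong conj_cong refl) simp
  then show "A \<in> grid_events M N q'" unfolding grid_events_def by blast
qed

lemma Int_stable_grid_events:
  assumes path: "\<And>\<omega>. \<omega> \<in> space M \<Longrightarrow> counting_path (\<lambda>t. N t \<omega>)"
  shows "Int_stable (\<Union>q. grid_events M N q)"
proof (rule Int_stableI)
  fix A B assume "A \<in> (\<Union>q. grid_events M N q)" "B \<in> (\<Union>q. grid_events M N q)"
  then obtain q q' where AB: "A \<in> grid_events M N q" "B \<in> grid_events M N q'" by blast
  have "A \<in> grid_events M N (max q q')" "B \<in> grid_events M N (max q q')"
    using AB grid_events_mono[of M N, OF path max.cobounded1] grid_events_mono[of M N, OF path max.cobounded2]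
    by blast+
  then obtain \<Phi> \<Psi> where A: "A = {\<omega> \<in> space M. \<Phi> (grid_increments N (max q q') (max q q' * 2 ^ max q q') \<omega>)}"
    and B: "B = {\<omega> \<in> space M. \<Psi> (grid_increments N (max q q') (max q q' * 2 ^ max q q') \<omega>)}"
    unfolding grid_events_def by blast
  have "A \<inter> B = {\<omega> \<in> space M. (\<lambda>xs. \<Phi> xs \<and> \<Psi> xs) (grid_increments N (max q q') (max q q' * 2 ^ max q q') \<omega>)}"
    unfolding A B by blast
  also have "\<dots> \<in> grid_events M N (max q q')" by (rule grid_eventsI)
  finally show "A \<inter> B \<in> (\<Union>q. grid_events M N q)" by (rule UN_I[OF UNIV_I])
qed

text \<open>A right-continuous path is determined by its values at dyadic times.\<close>

lemma process_algebra_subset_grid: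
  assumes N: "\<forall>t\<ge>0. N t \<in> measurable M (count_space UNIV)"
    and path: "\<And>\<omega>. \<omega> \<in> space M \<Longrightarrow> counting_path (\<lambda>t. N t \<omega>)"
  shows "sets (process_algebra M N) \<subseteq> sigma_sets (space M) (\<Union>q. grid_events M N q)"
proof -
  let ?D = "\<Union>q. grid_events M N q"
  let ?G = "sigma (space M) ?D"
  have D: "?D \<subseteq> Pow (space M)" by (auto simp: grid_events_def)
  have sp: "space ?G = space M" and st: "sets ?G = sigma_sets (space M) ?D"
    using D by (auto intro: space_measure_of sets_measure_of)
  have "N t \<in> measurable ?G (count_space UNIV)" if t: "0 \<le> t" for t
  proof (rule measurable_nat_of_real, rule borel_measurable_LIMSEQ_real)
    fix q
    have q0: "t \<le> real (nat \<lceil>t\<rceil>)" by linarith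
    let ?q = "q + nat \<lceil>t\<rceil>"
    show "(\<lambda>\<omega>. real (N (real (grid_index ?q t) / 2 ^ ?q) \<omega>)) \<in> borel_measurable ?G"
    proof (rule measurable_compose[where g=real and N="count_space UNIV"])
      show "(\<lambda>\<omega>. N (real (grid_index ?q t) / 2 ^ ?q) \<omega>) \<in> measurable ?G (count_space UNIV)"
      proof (rule measurableI)
        fix B
        have "t \<le> real (?q * 2 ^ ?q) / 2 ^ ?q" using q0 by simp
        then have le: "grid_index ?q t \<le> ?q * 2 ^ ?q" unfolding grid_index_le_iff .
        have "N (real (grid_index ?q t) / 2 ^ ?q) \<omega> = sum_list (take (grid_index ?q t) (grid_increments N ?q (?q * 2 ^ ?q) \<omega>))"
          if "\<omega> \<in> space M" for \<omega>
          unfolding grid_increments_def by (rule counting_path_grid_sum[OF path[OF that] le])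
        then have "(\<lambda>\<omega>. N (real (grid_index ?q t) / 2 ^ ?q) \<omega>) -` B \<inter> space M =
          {\<omega> \<in> space M. (\<lambda>xs. sum_list (take (grid_index ?q t) xs) \<in> B) (grid_increments N ?q (?q * 2 ^ ?q) \<omega>)}"
          by (intro set_eqI) (simp add: conj_commute cong: conj_cong)
        also have "\<dots> \<in> grid_events M N ?q" by (rule grid_eventsI)
        finally have "(\<lambda>\<omega>. N (real (grid_index ?q t) / 2 ^ ?q) \<omega>) -` B \<inter> space M \<in> ?D"
          by (rule UN_I[OF UNIV_I])
        then show "(\<lambda>\<omega>. N (real (grid_index ?q t) / 2 ^ ?q) \<omega>) -` B \<inter> space ?G \<in> sets ?G"
          unfolding sp st by (rule sigma_sets.Basic)
      qed simp
    qed simp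
  next
    fix \<omega> assume "\<omega> \<in> space ?G"
    then have "eventually (\<lambda>q. N (real (grid_index q t) / 2 ^ q) \<omega> = N t \<omega>) sequentially"
      unfolding sp by (intro counting_path_eventually_eq[OF path] grid_index_limit grid_index_ge t)
    then have "(\<lambda>q. real (N (real (grid_index q t) / 2 ^ q) \<omega>)) \<longlonglongrightarrow> real (N t \<omega>)"
      by (intro tendsto_eventually) (auto elim: eventually_mono)
    then show "(\<lambda>q. real (N (real (grid_index (q + nat \<lceil>t\<rceil>) t) / 2 ^ (q + nat \<lceil>t\<rceil>)) \<omega>)) \<longlonglongrightarrow> real (N t \<omega>)"
      by (rule LIMSEQ_ignore_initial_segment)
  qed
  then have "N t -` B \<inter> space M \<in> sigma_sets (space M) ?D" if "0 \<le> t" for t B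
    using that measurable_sets[of "N t" ?G "count_space UNIV" B] unfolding sp st by simp
  then show ?thesis
    unfolding process_algebra_props(2)[OF N] by (intro sigma_sets_mono) auto
qed

lemma measurable_compose2_countable:
  fixes f :: "'a \<Rightarrow> 'b :: countable" and g :: "'a \<Rightarrow> 'c :: countable"
  assumes "f \<in> measurable M (count_space UNIV)" "g \<in> measurable M (count_space UNIV)"
  shows "(\<lambda>x. h (f x) (g x)) \<in> measurable M (count_space UNIV)"
proof -
  have "(\<lambda>x. (f x, g x)) \<in> measurable M (count_space UNIV)"
    using measurable_Pair[OF assms] by (simp add: pair_measure_countable)
  from measurable_compose[OF this, of "case_prod h" "count_space UNIV"] show ?thesis by simp
qed

lemma grid_increments_add:
  assumes "counting_path (\<lambda>t. X t \<omega>)" "counting_path (\<lambda>t. Z t \<omega>)"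
  shows "grid_increments (\<lambda>t \<omega>. X t \<omega> + Z t \<omega>) q K \<omega> = map (\<lambda>(x, z). x + z) (grid_cells X Z q K \<omega>)"
proof (rule nth_equalityI)
  fix i assume "i < length (grid_increments (\<lambda>t \<omega>. X t \<omega> + Z t \<omega>) q K \<omega>)"
  then have i: "i < K" by (simp add: grid_increments_def)
  have le: "real i / 2 ^ q \<le> real (Suc i) / 2 ^ q" by (simp add: divide_right_mono)
  have "X (real i / 2 ^ q) \<omega> \<le> X (real (Suc i) / 2 ^ q) \<omega>" "Z (real i / 2 ^ q) \<omega> \<le> Z (real (Suc i) / 2 ^ q) \<omega>"
    using assms counting_path_mono[OF _ _ le] by auto
  then show "grid_increments (\<lambda>t \<omega>. X t \<omega> + Z t \<omega>) q K \<omega> ! i = map (\<lambda>(x, z). x + z) (grid_cells X Z q K \<omega>) ! i"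
    using i by (simp add: grid_increments_def grid_cells_def del: of_nat_Suc)
qed (simp add: grid_increments_def grid_cells_def)

context prob_space
begin

context
  fixes a b :: real and X Z :: "real \<Rightarrow> 'a \<Rightarrow> nat" and F :: "real \<Rightarrow> 'a \<Rightarrow> nat" and marks :: "'a \<Rightarrow> nat \<Rightarrow> bool"
  assumes X: "poisson_grid M a X" and Z: "poisson_grid M b Z" and a: "0 < a"
    and indep: "indep_set (sets (process_algebra M X)) (sets (process_algebra M Z))"
  defines "F \<equiv> \<lambda>t \<omega>. X t \<omega> + Z t \<omega>"
    and "marks \<equiv> \<lambda>\<omega>. mark (\<lambda>t. F t \<omega>) (\<lambda>t. X t \<omega>)"
begin

lemma superposition_poisson_grid: "poisson_grid M (a + b) F" and superposition_rate_pos: "0 < a + b"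
  using poisson_grid_add[OF prob_space_axioms X Z indep] Z a by (auto simp: F_def poisson_grid_def)

lemma component_paths:
  "\<omega> \<in> space M \<Longrightarrow> counting_path (\<lambda>t. X t \<omega>)" "\<omega> \<in> space M \<Longrightarrow> counting_path (\<lambda>t. Z t \<omega>)"
  "\<omega> \<in> space M \<Longrightarrow> counting_path (\<lambda>t. F t \<omega>)"
  using X Z superposition_poisson_grid by (auto simp: poisson_grid_def)

lemma component_measurable:
  "\<forall>t\<ge>0. X t \<in> measurable M (count_space UNIV)" "\<forall>t\<ge>0. Z t \<in> measurable M (count_space UNIV)"
  "\<forall>t\<ge>0. F t \<in> measurable M (count_space UNIV)"
  using X Z superposition_poisson_grid by (auto simp: poisson_grid_def)

lemma marks_events: "{\<omega> \<in> space M. marks \<omega> l \<in> V} \<in> events"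
proof -
  have at: "(\<lambda>\<omega>. X (arrival F i \<omega>) \<omega>) \<in> measurable M (count_space UNIV)" for i
  proof (rule measurable_at_random_time[OF component_measurable(1) component_paths(1)])
    show "arrival F i \<in> borel_measurable M"
      by (rule arrival_measurable[OF component_measurable(3) component_paths(3)])
    show "0 \<le> arrival F i \<omega>" for \<omega> by (simp only: arrival_eq_path_arrival path_arrival_nonneg)
  qed
  have "(\<lambda>\<omega>. X (arrival F (l - 1) \<omega>) \<omega> < X (arrival F l \<omega>) \<omega>) \<in> measurable M (count_space UNIV)"
    by (rule measurable_compose2_countable[where h="(<)", OF at at])
  then have "(\<lambda>\<omega>. X (arrival F (l - 1) \<omega>) \<omega> < X (arrival F l \<omega>) \<omega>) -` V \<inter> space M \<in> events"
    by (rule measurable_sets) simp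
  also have "(\<lambda>\<omega>. X (arrival F (l - 1) \<omega>) \<omega> < X (arrival F l \<omega>) \<omega>) -` V \<inter> space M = {\<omega> \<in> space M. marks \<omega> l \<in> V}"
    unfolding marks_def mark_def arrival_eq_path_arrival by blast
  finally show ?thesis .
qed

lemma all_marks_events: "{\<omega> \<in> space M. \<forall>i<l. marks \<omega> (Suc i) \<in> V i} \<in> events"
proof -
  have "{\<omega> \<in> space M. \<forall>i\<in>{..<l}. marks \<omega> (Suc i) \<in> V i} \<in> events"
    by (rule sets.sets_Collect_finite_All) (rule marks_events, simp)
  then show ?thesis by (simp only: Ball_def lessThan_iff)
qed

text \<open>On this event the grid shows the first \<open>l\<close> arrivals of the superposition
  and their marks.\<close>

definition fine_grid :: "nat \<Rightarrow> nat \<Rightarrow> 'a set" where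
  "fine_grid q l = {\<omega> \<in> space M. (\<forall>d\<in>set (grid_increments F q (q * 2 ^ q) \<omega>). d \<le> 1) \<and> l \<le> F (real q) \<omega>}"

lemma fine_grid_marked_cells:
  assumes \<omega>: "\<omega> \<in> space M" and reg: "regular_path (\<lambda>t. F t \<omega>)"
  shows "\<Phi> (grid_increments F q (q * 2 ^ q) \<omega>) \<and> \<omega> \<in> fine_grid q l \<and> (\<forall>i<l. marks \<omega> (Suc i) \<in> V i) \<longleftrightarrow>
    grid_cells X Z q (q * 2 ^ q) \<omega> \<in> marked_cells \<Phi> (map V [0..<l])"
proof -
  let ?K = "q * 2 ^ q" and ?f = "\<lambda>t. F t \<omega>"
  let ?c = "grid_cells X Z q ?K \<omega>"
  have sums: "grid_increments F q ?K \<omega> = cell_sums ?c"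
    unfolding F_def cell_sums_def by (rule grid_increments_add[where X=X and Z=Z and \<omega>=\<omega>, OF component_paths(1,2)[OF \<omega>]])
  show ?thesis
  proof (cases "\<forall>d\<in>set (cell_sums ?c). d \<le> 1")
    case True
    have small: "?f (real (Suc i) * (1 / 2 ^ q)) - ?f (real i * (1 / 2 ^ q)) \<le> 1" if "i < ?K" for i
    proof -
      have "grid_increments F q ?K \<omega> ! i \<in> set (cell_sums ?c)"
        unfolding sums[symmetric] by (rule nth_mem) (use that in \<open>simp add: grid_increments_def\<close>)
      then have "grid_increments F q ?K \<omega> ! i \<le> 1" using True by blast
      then show ?thesis using that by (simp add: grid_increments_def del: of_nat_Suc)
    qed
    have K: "real ?K * (1 / 2 ^ q) = real q" by simp
    have "map (marks \<omega>) [1..<Suc (?f (real q))] = cell_marks ?c"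
    proof -
      have "?c = map (\<lambda>i. (X (real (Suc i) * (1 / 2 ^ q)) \<omega> - X (real i * (1 / 2 ^ q)) \<omega>,
          Z (real (Suc i) * (1 / 2 ^ q)) \<omega> - Z (real i * (1 / 2 ^ q)) \<omega>)) [0..<?K]"
        by (rule nth_equalityI) (simp_all add: grid_cells_def grid_increments_def del: of_nat_Suc)
      then show ?thesis
        unfolding marks_def cell_marks_def K[symmetric]
        using marks_from_cells[OF reg component_paths(1,2)[OF \<omega>] F_def[THEN meta_eq_to_obj_eq, THEN fun_cong, THEN fun_cong], of "1 / 2 ^ q" ?K] small
        by simp
    qed
    then have marks: "cell_marks ?c = map (marks \<omega>) [1..<Suc (?f (real q))]" ..
    have len: "length (cell_marks ?c) = ?f (real q)" unfolding marks by simp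
    have nth: "cell_marks ?c ! i = marks \<omega> (Suc i)" if "i < ?f (real q)" for i
      unfolding marks using that by (simp del: upt_Suc)
    have same: "l \<le> ?f (real q) \<Longrightarrow>
      (\<forall>i<l. cell_marks ?c ! i \<in> map V [0..<l] ! i) \<longleftrightarrow> (\<forall>i<l. marks \<omega> (Suc i) \<in> V i)"
      using nth by simp
    have logic: "b \<Longrightarrow> c \<Longrightarrow> (d \<Longrightarrow> f = e) \<Longrightarrow> (a \<and> (c \<and> b \<and> d) \<and> e) = (a \<and> b \<and> d \<and> f)" for a b c d e f
      by blast
    show ?thesis
      unfolding marked_cells_def fine_grid_def mem_Collect_eq sums len length_map length_upt diff_zero
      by (rule logic[OF True \<omega> same])
  next
    case False
    then show ?thesis
      unfolding marked_cells_def fine_grid_def sums mem_Collect_eq by (simp only: simp_thms)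
  qed
qed

lemma cells_prob: "prob {\<omega> \<in> space M. grid_cells X Z q K \<omega> \<in> S} =
    measure (replicate_pmf K (pair_pmf (poisson_law (a / 2 ^ q)) (poisson_law (b / 2 ^ q)))) S"
  and cells_events: "{\<omega> \<in> space M. grid_cells X Z q K \<omega> \<in> S} \<in> events"
proof -
  have m: "grid_cells X Z q K \<in> measurable M (count_space UNIV)"
    unfolding grid_cells_def[abs_def]
    by (rule measurable_compose[OF measurable_Pair[OF measurable_grid_increments[OF component_measurable(1)]
          measurable_grid_increments[OF component_measurable(2)]], where g="\<lambda>(x, y). zip x y", simplified])
      (simp add: pair_measure_countable)
  have eq: "{\<omega> \<in> space M. grid_cells X Z q K \<omega> \<in> S} = grid_cells X Z q K -` S \<inter> space M" by blast
  show "{\<omega> \<in> space M. grid_cells X Z q K \<omega> \<in> S} \<in> events"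
    unfolding eq by (rule measurable_sets[OF m]) simp
  have "prob (grid_cells X Z q K -` S \<inter> space M) = measure (distr M (count_space UNIV) (grid_cells X Z q K)) S"
    using m by (simp add: measure_distr)
  then show "prob {\<omega> \<in> space M. grid_cells X Z q K \<omega> \<in> S} =
    measure (replicate_pmf K (pair_pmf (poisson_law (a / 2 ^ q)) (poisson_law (b / 2 ^ q)))) S"
    unfolding eq distr_grid_cells[OF prob_space_axioms X Z indep] .
qed

lemma F_increments_events: "{\<omega> \<in> space M. \<Phi> (grid_increments F q K \<omega>)} \<in> events"
  by (rule events_increments[OF superposition_poisson_grid superposition_rate_pos])

lemma F_ge_events: "0 \<le> t \<Longrightarrow> {\<omega> \<in> space M. l \<le> F t \<omega>} \<in> events"
proof -
  assume "0 \<le> t"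
  then have "F t -` {l..} \<inter> space M \<in> events" using component_measurable(3) by (intro measurable_sets) auto
  then show ?thesis by (simp add: vimage_def Int_def conj_commute)
qed

lemma fine_grid_events: "fine_grid q l \<in> events"
proof -
  have "fine_grid q l = {\<omega> \<in> space M. \<forall>d\<in>set (grid_increments F q (q * 2 ^ q) \<omega>). d \<le> 1} \<inter> {\<omega> \<in> space M. l \<le> F (real q) \<omega>}"
    unfolding fine_grid_def by blast
  moreover have "{\<omega> \<in> space M. \<forall>d\<in>set (grid_increments F q (q * 2 ^ q) \<omega>). d \<le> 1} \<in> events"
    by (rule F_increments_events)
  ultimately show ?thesis using F_ge_events[of "real q" l] by (simp only: sets.Int of_nat_0_le_iff)
qed

lemma grid_event_marks:
  assumes B: "B = {\<omega> \<in> space M. \<Phi> (grid_increments F q (q * 2 ^ q) \<omega>)}"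
  shows "prob (B \<inter> fine_grid q l \<inter> {\<omega> \<in> space M. \<forall>i<l. marks \<omega> (Suc i) \<in> V i}) =
    prob (B \<inter> fine_grid q l) * (\<Prod>i<l. measure (bernoulli_pmf (a / (a + b))) (V i))"
proof -
  let ?m = "\<lambda>V. measure (replicate_pmf (q * 2 ^ q) (pair_pmf (poisson_law (a / 2 ^ q)) (poisson_law (b / 2 ^ q))))
    (marked_cells \<Phi> (map V [0..<l]))"
  have reg: "AE \<omega> in M. regular_path (\<lambda>t. F t \<omega>)"
    by (rule AE_regular_path[OF superposition_poisson_grid superposition_rate_pos])
  have Bev: "B \<in> events" unfolding B by (rule F_increments_events)
  have eq: "prob (B \<inter> fine_grid q l \<inter> {\<omega> \<in> space M. \<forall>i<l. marks \<omega> (Suc i) \<in> V i}) = ?m V" for V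
    unfolding cells_prob[symmetric]
  proof (rule finite_measure_eq_AE)
    show "AE \<omega> in M. \<omega> \<in> B \<inter> fine_grid q l \<inter> {\<omega> \<in> space M. \<forall>i<l. marks \<omega> (Suc i) \<in> V i} \<longleftrightarrow>
        \<omega> \<in> {\<omega> \<in> space M. grid_cells X Z q (q * 2 ^ q) \<omega> \<in> marked_cells \<Phi> (map V [0..<l])}"
      using reg
    proof (rule AE_mp, intro AE_I2 impI)
      fix \<omega> assume "\<omega> \<in> space M" "regular_path (\<lambda>t. F t \<omega>)"
      from fine_grid_marked_cells[OF this, of \<Phi> q l V] \<open>\<omega> \<in> space M\<close>
      show "\<omega> \<in> B \<inter> fine_grid q l \<inter> {\<omega> \<in> space M. \<forall>i<l. marks \<omega> (Suc i) \<in> V i} \<longleftrightarrow>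
        \<omega> \<in> {\<omega> \<in> space M. grid_cells X Z q (q * 2 ^ q) \<omega> \<in> marked_cells \<Phi> (map V [0..<l])}"
        unfolding B by blast
    qed
    show "B \<inter> fine_grid q l \<inter> {\<omega> \<in> space M. \<forall>i<l. marks \<omega> (Suc i) \<in> V i} \<in> events"
      by (intro sets.Int Bev fine_grid_events all_marks_events)
  qed (rule cells_events)
  have ab: "a / 2 ^ q / (a / 2 ^ q + b / 2 ^ q) = a / (a + b)"
    by (simp add: add_divide_distrib[symmetric])
  have "?m V = ?m (\<lambda>_. UNIV) * (\<Prod>i<l. measure (bernoulli_pmf (a / (a + b))) (V i))"
  proof -
    have "0 < a / 2 ^ q" "0 \<le> b / 2 ^ q" using a Z by (auto simp: poisson_grid_def)
    from measure_marked_cells[OF this, of "q * 2 ^ q" \<Phi> "map V [0..<l]"] show ?thesis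
      unfolding ab by (simp add: map_replicate_const)
  qed
  moreover have "B \<inter> fine_grid q l \<inter> {\<omega> \<in> space M. \<forall>i<l. marks \<omega> (Suc i) \<in> UNIV} = B \<inter> fine_grid q l"
    unfolding fine_grid_def by blast
  ultimately show ?thesis using eq[of V] eq[of "\<lambda>_. UNIV"] by simp
qed

lemma fine_grid_limit: "(\<lambda>q. prob (space M - fine_grid q l)) \<longlonglongrightarrow> 0"
proof (rule tendsto_sandwich[of "\<lambda>_. 0"])
  let ?C = "crowded_cell F"
  have C: "?C q \<in> events" for q by (rule crowded_cell_events[OF superposition_poisson_grid superposition_rate_pos])
  let ?L = "\<lambda>q. {\<omega> \<in> space M. F (real q) \<omega> < l}"
  have L_eq: "?L q = space M - {\<omega> \<in> space M. l \<le> F (real q) \<omega>}" for q by auto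
  have L: "?L q \<in> events" for q unfolding L_eq using F_ge_events[of "real q"] by auto
  have "prob (space M - fine_grid q l) \<le> prob (?C q) + prob (?L q)" for q
  proof -
    have two: "(2::nat) \<le> d \<longleftrightarrow> \<not> d \<le> 1" for d by auto
    have "space M - fine_grid q l \<subseteq> ?C q \<union> ?L q"
      unfolding crowded_cell_def[OF superposition_poisson_grid superposition_rate_pos] fine_grid_def
        two linorder_not_le[symmetric] by blast
    then have "prob (space M - fine_grid q l) \<le> prob (?C q \<union> ?L q)"
      using C L by (intro finite_measure_mono) auto
    also have "\<dots> \<le> prob (?C q) + prob (?L q)"
      using C L by (intro measure_subadditive) auto
    finally show ?thesis .
  qed
  then show "eventually (\<lambda>q. prob (space M - fine_grid q l) \<le> prob (?C q) + prob (?L q)) sequentially" by simp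
  have "(\<lambda>q. prob (?L q)) \<longlonglongrightarrow> prob {}"
  proof (rule prob_tendsto_of_eventually_eq[OF L])
    show "AE \<omega> in M. eventually (\<lambda>q. \<omega> \<in> ?L q \<longleftrightarrow> \<omega> \<in> {}) sequentially"
      using AE_unbounded[OF superposition_poisson_grid superposition_rate_pos]
    proof (rule AE_mp, intro AE_I2 impI)
      fix \<omega> assume \<omega>: "\<omega> \<in> space M" and "\<forall>l. \<exists>t\<ge>0. l \<le> F t \<omega>"
      then obtain t where t: "0 \<le> t" "l \<le> F t \<omega>" by blast
      obtain q0 :: nat where q0: "t \<le> real q0" using real_arch_simple by blast
      have "l \<le> F (real q) \<omega>" if "q0 \<le> q" for q
      proof -
        have "t \<le> real q" using q0 that by (meson of_nat_le_iff order_trans)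
        then show ?thesis using counting_path_mono[OF component_paths(3)[OF \<omega>] t(1)] t(2) order_trans by blast
      qed
      then show "eventually (\<lambda>q. \<omega> \<in> ?L q \<longleftrightarrow> \<omega> \<in> {}) sequentially"
        unfolding eventually_sequentially by (intro exI[of _ q0]) (auto simp: not_less)
    qed
  qed simp
  with crowded_cell_vanishes[OF superposition_poisson_grid superposition_rate_pos]
  have "(\<lambda>q. prob (?C q) + prob (?L q)) \<longlonglongrightarrow> 0 + prob {}" by (rule tendsto_add)
  then show "(\<lambda>q. prob (?C q) + prob (?L q)) \<longlonglongrightarrow> 0" by simp
qed simp_all

lemma fine_grid_restrict_limit:
  assumes A: "A \<in> events"
  shows "(\<lambda>q. prob (A \<inter> fine_grid q l)) \<longlonglongrightarrow> prob A"
proof (rule tendsto_sandwich[of "\<lambda>q. prob A - prob (space M - fine_grid q l)" _ _ "\<lambda>_. prob A"])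
  have "prob A - prob (space M - fine_grid q l) \<le> prob (A \<inter> fine_grid q l)" for q
  proof -
    have "prob A \<le> prob ((A \<inter> fine_grid q l) \<union> (space M - fine_grid q l))"
      using A fine_grid_events sets.sets_into_space[OF A] by (intro finite_measure_mono) auto
    also have "\<dots> \<le> prob (A \<inter> fine_grid q l) + prob (space M - fine_grid q l)"
      using A fine_grid_events by (intro measure_subadditive) auto
    finally show ?thesis by simp
  qed
  then show "eventually (\<lambda>q. prob A - prob (space M - fine_grid q l) \<le> prob (A \<inter> fine_grid q l)) sequentially" by simp
  show "eventually (\<lambda>q. prob (A \<inter> fine_grid q l) \<le> prob A) sequentially"
    using A fine_grid_events by (intro always_eventually allI finite_measure_mono) auto
  have "(\<lambda>q. prob A - prob (space M - fine_grid q l)) \<longlonglongrightarrow> prob A - 0"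
    by (intro tendsto_diff tendsto_const fine_grid_limit)
  then show "(\<lambda>q. prob A - prob (space M - fine_grid q l)) \<longlonglongrightarrow> prob A" by simp
qed simp

text \<open>The thinning theorem. For grid events the formula holds in the limit of fine grids;
  the grid events form a generating family that is stable under intersections, and Dynkin's
  argument extends the formula to the whole algebra of the superposition.\<close>

theorem marks_independent:
  assumes A: "A \<in> sets (process_algebra M F)"
  shows "prob (A \<inter> {\<omega> \<in> space M. \<forall>i<l. marks \<omega> (Suc i) \<in> V i}) =
    prob A * (\<Prod>i<l. measure (bernoulli_pmf (a / (a + b))) (V i))"
proof -
  let ?E = "{\<omega> \<in> space M. \<forall>i<l. marks \<omega> (Suc i) \<in> V i}"
  let ?D = "\<Union>q. grid_events M F q"
  let ?p = "\<Prod>i<l. measure (bernoulli_pmf (a / (a + b))) (V i)"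
  have E: "?E \<in> events" by (rule all_marks_events)
  have D: "?D \<subseteq> events" using F_increments_events by (auto simp: grid_events_def)
  have mult: "prob (B \<inter> ?E) = prob B * ?p" if BD: "B \<in> ?D" for B
  proof -
    obtain q0 where q0: "B \<in> grid_events M F q0" using BD by (rule UN_E)
    have "B \<in> events" using D BD by (rule subsetD)
    have "prob (B \<inter> ?E \<inter> fine_grid q l) = prob (B \<inter> fine_grid q l) * ?p" if "q0 \<le> q" for q
    proof -
      have "B \<in> grid_events M F q" using q0 grid_events_mono[of M F, OF component_paths(3) that] by blast
      then obtain \<Phi> where "B = {\<omega> \<in> space M. \<Phi> (grid_increments F q (q * 2 ^ q) \<omega>)}"
        by (auto simp: grid_events_def)
      from grid_event_marks[OF this, of l V] show ?thesis by (simp only: Int_ac)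
    qed
    then have ev: "eventually (\<lambda>q. prob (B \<inter> ?E \<inter> fine_grid q l) = prob (B \<inter> fine_grid q l) * ?p) sequentially"
      unfolding eventually_sequentially by blast
    have "B \<inter> ?E \<in> events" using \<open>B \<in> events\<close> E by (rule sets.Int)
    from tendsto_cong[OF ev, THEN iffD1, OF fine_grid_restrict_limit[OF this]]
    have "(\<lambda>q. prob (B \<inter> fine_grid q l) * ?p) \<longlonglongrightarrow> prob (B \<inter> ?E)" .
    moreover have "(\<lambda>q. prob (B \<inter> fine_grid q l) * ?p) \<longlonglongrightarrow> prob B * ?p"
      by (intro tendsto_mult tendsto_const fine_grid_restrict_limit \<open>B \<in> events\<close>)
    ultimately show ?thesis by (rule LIMSEQ_unique)
  qed
  have "{\<omega> \<in> space M. (\<lambda>_. True) (grid_increments F 0 (0 * 2 ^ 0) \<omega>)} \<in> ?D"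
    by (rule UN_I[OF UNIV_I]) (rule grid_eventsI)
  then have "space M \<in> ?D" by simp
  from mult[OF this] have pE: "prob ?E = ?p"
    unfolding Int_absorb1[OF sets.sets_into_space[OF E]] prob_space by (simp only: mult_1)
  have "indep_set ?D {?E}"
  proof (rule indep_setI[OF D])
    show "{?E} \<subseteq> events" using E by (simp only: insert_subset empty_subsetI)
    fix B C assume B: "B \<in> ?D" and "C \<in> {?E}"
    then have "C = ?E" by (simp only: singleton_iff)
    then show "prob (B \<inter> C) = prob B * prob C" using mult[OF B] pE by (simp only:)
  qed
  then have "indep_set (sigma_sets (space M) ?D) (sigma_sets (space M) {?E})"
    by (rule indep_set_sigma_sets) (rule Int_stable_grid_events[OF component_paths(3)], auto simp: Int_stable_def)
  then have "prob (A \<inter> ?E) = prob A * prob ?E"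
  proof (rule indep_setD)
    show "A \<in> sigma_sets (space M) ?D"
      using process_algebra_subset_grid[OF component_measurable(3) component_paths(3)] A by (rule subsetD)
    show "?E \<in> sigma_sets (space M) {?E}" by (rule sigma_sets.Basic) (rule singletonI)
  qed
  then show ?thesis unfolding pE .
qed

end

end

section \<open>Freezing the conditioning variable\<close>

text \<open>By Fubini, integrating the indicator over an event of \<open>G\<close> is integrating
  first in the frozen variable, because the joint law of the two independent components is the
  product law.\<close>

lemma (in prob_space) cond_pr_freeze:
  assumes G: "subalgebra M G" and H: "subalgebra M H" and indep: "indep_set (sets G) (sets H)"
    and A: "A \<in> sets (G \<Otimes>\<^sub>M H)"
  shows "AE \<omega> in M. cond_pr M G {\<omega> \<in> space M. (\<omega>, \<omega>) \<in> A} \<omega> = prob {\<omega>' \<in> space M. (\<omega>, \<omega>') \<in> A}"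
proof -
  have spG: "space G = space M" and spH: "space H = space M" and GM: "sets G \<subseteq> events" and HM: "sets H \<subseteq> events"
    using G H by (auto simp: subalgebra_def)
  have idG: "(\<lambda>x. x) \<in> measurable M G" and idH: "(\<lambda>x. x) \<in> measurable M H"
    using measurable_from_subalg[OF G measurable_ident_sets[OF refl]]
      measurable_from_subalg[OF H measurable_ident_sets[OF refl]] by auto
  let ?G = "distr M G (\<lambda>x. x)" and ?H = "distr M H (\<lambda>x. x)"
  interpret GP: prob_space ?G by (rule prob_space_distr[OF idG])
  interpret HP: prob_space ?H by (rule prob_space_distr[OF idH])
  have sigma_id: "sigma_sets (space M) {(\<lambda>x. x) -` A \<inter> space M | A. A \<in> sets F} = sets F"
    if F: "subalgebra M F" for F
  proof -
    have "{(\<lambda>x. x) -` A \<inter> space M | A. A \<in> sets F} = sets F"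
      using F sets.sets_into_space[of _ F] by (auto simp: subalgebra_def Int_absorb2)
    then show ?thesis using F sets.sigma_sets_eq[of F] by (simp add: subalgebra_def)
  qed
  have "indep_var G (\<lambda>x. x) H (\<lambda>x. x)"
    unfolding indep_var_eq sigma_id[OF G] sigma_id[OF H] using idG idH indep by blast
  then have prod: "?G \<Otimes>\<^sub>M ?H = distr M (G \<Otimes>\<^sub>M H) (\<lambda>x. (x, x))"
    unfolding indep_var_distribution_eq by blast
  have diag: "(\<lambda>x. (x, x)) \<in> measurable M (G \<Otimes>\<^sub>M H)"
    by (rule measurable_Pair[OF idG idH])
  define h where "h \<omega> = prob {\<omega>' \<in> space M. (\<omega>, \<omega>') \<in> A}" for \<omega>
  have sets_eq: "sets (G \<Otimes>\<^sub>M ?H) = sets (G \<Otimes>\<^sub>M H)"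
    by (intro sets_pair_measure_cong) simp_all
  have h_em: "ennreal (h \<omega>) = emeasure ?H (Pair \<omega> -` A)" for \<omega>
  proof -
    have "Pair \<omega> -` A \<in> sets H" by (rule sets_Pair1[OF A])
    then have "emeasure ?H (Pair \<omega> -` A) = emeasure M ((\<lambda>x. x) -` (Pair \<omega> -` A) \<inter> space M)"
      by (rule emeasure_distr[OF idH])
    also have "(\<lambda>x. x) -` (Pair \<omega> -` A) \<inter> space M = {\<omega>' \<in> space M. (\<omega>, \<omega>') \<in> A}" by blast
    finally show ?thesis unfolding h_def by (simp add: emeasure_eq_measure)
  qed
  have h_G: "h \<in> borel_measurable G"
  proof -
    have "(\<lambda>\<omega>. emeasure ?H (Pair \<omega> -` A)) \<in> borel_measurable G"
      using A sets_eq by (intro HP.measurable_emeasure_Pair) simp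
    then have "(\<lambda>\<omega>. enn2real (ennreal (h \<omega>))) \<in> borel_measurable G"
      unfolding h_em by measurable
    then show ?thesis by (simp add: h_def[abs_def])
  qed
  then have h_M: "h \<in> borel_measurable M" by (rule measurable_from_subalg[OF G])
  let ?A = "{\<omega> \<in> space M. (\<omega>, \<omega>) \<in> A}"
  have A_M: "?A \<in> events"
    using measurable_sets[OF diag A] by (simp add: vimage_def Int_def conj_commute)
  have h_int: "integrable M h"
    by (rule integrable_const_bound[where B=1]) (use h_M in \<open>auto simp: h_def\<close>)
  have eq: "prob (B \<inter> ?A) = (\<integral>x\<in>B. h x \<partial>M)" if B: "B \<in> sets G" for B
  proof -
    have BM: "B \<in> events" using B GM by blast
    have BH: "B \<times> space M \<in> sets (G \<Otimes>\<^sub>M H)" using B spH by (metis pair_measureI sets.top)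
    then have C: "(B \<times> space M) \<inter> A \<in> sets (G \<Otimes>\<^sub>M H)" using A by (rule sets.Int)
    have "ennreal (prob (B \<inter> ?A)) = emeasure M ((\<lambda>x. (x, x)) -` ((B \<times> space M) \<inter> A) \<inter> space M)"
    proof -
      have "(\<lambda>x. (x, x)) -` ((B \<times> space M) \<inter> A) \<inter> space M = B \<inter> ?A" by blast
      then show ?thesis by (simp add: emeasure_eq_measure)
    qed
    also have "\<dots> = emeasure (?G \<Otimes>\<^sub>M ?H) ((B \<times> space M) \<inter> A)"
      unfolding prod by (rule emeasure_distr[OF diag C, symmetric])
    also have "\<dots> = (\<integral>\<^sup>+x. emeasure ?H (Pair x -` ((B \<times> space M) \<inter> A)) \<partial>?G)"
    proof (rule HP.emeasure_pair_measure_alt)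
      have "sets (?G \<Otimes>\<^sub>M ?H) = sets (G \<Otimes>\<^sub>M H)" by (intro sets_pair_measure_cong) simp_all
      then show "(B \<times> space M) \<inter> A \<in> sets (?G \<Otimes>\<^sub>M ?H)" using C by simp
    qed
    also have "\<dots> = (\<integral>\<^sup>+x. ennreal (indicator B x * h x) \<partial>?G)"
    proof (rule nn_integral_cong)
      fix x
      have "Pair x -` A \<subseteq> space M" using sets.sets_into_space[OF sets_Pair1[OF A]] spH by blast
      then have "Pair x -` ((B \<times> space M) \<inter> A) = (if x \<in> B then Pair x -` A else {})" by auto
      then show "emeasure ?H (Pair x -` ((B \<times> space M) \<inter> A)) = ennreal (indicator B x * h x)"
        by (simp add: h_em indicator_def)
    qed
    also have "\<dots> = (\<integral>\<^sup>+x. ennreal (indicator B x * h x) \<partial>M)"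
      using B h_G by (subst nn_integral_distr[OF idG]) auto
    also have "\<dots> = ennreal (\<integral>x. indicator B x * h x \<partial>M)"
    proof (rule nn_integral_eq_integral)
      show "integrable M (\<lambda>x. indicator B x * h x)"
        using integrable_real_mult_indicator[OF BM h_int] by (simp add: mult.commute)
      show "AE x in M. 0 \<le> indicator B x * h x" by (simp add: h_def)
    qed
    finally have "ennreal (prob (B \<inter> ?A)) = ennreal (\<integral>x. indicator B x * h x \<partial>M)" .
    then show ?thesis
      by (subst (asm) ennreal_inj) (auto simp: h_def set_lebesgue_integral_def intro!: integral_nonneg_AE)
  qed
  interpret sub: finite_measure_subalgebra M G
    by unfold_locales (rule G)
  have "AE \<omega> in M. real_cond_exp M G (indicator ?A) \<omega> = h \<omega>"
  proof (rule sub.real_cond_exp_charact)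
    fix B assume B: "B \<in> sets G"
    have "(\<integral>x\<in>B. indicator ?A x \<partial>M) = (\<integral>x. indicator (B \<inter> ?A) x \<partial>M)"
      unfolding set_lebesgue_integral_def by (intro Bochner_Integration.integral_cong) (auto simp: indicator_def)
    also have "\<dots> = prob (B \<inter> ?A)"
      using A_M GM B by (subst Bochner_Integration.integral_indicator) (auto simp: Int_absorb2 sets.sets_into_space)
    finally show "(\<integral>x\<in>B. indicator ?A x \<partial>M) = (\<integral>x\<in>B. h x \<partial>M)" using eq[OF B] by simp
  qed (use A_M h_int h_G in \<open>auto intro!: integrable_real_indicator simp: emeasure_eq_measure\<close>)
  then show ?thesis unfolding cond_pr_def h_def .
qed

section \<open>Selecting a state from a uniform variable\<close>

lemma pick_unique:
  fixes k k' :: nat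
  assumes q: "\<forall>j\<in>{1..p}. 0 \<le> (q j :: real)"
    and k: "k \<in> {1..p}" "(\<Sum>j\<in>{1..<k}. q j) \<le> u" "u < (\<Sum>j\<in>{1..k}. q j)"
    and k': "k' \<in> {1..p}" "(\<Sum>j\<in>{1..<k'}. q j) \<le> u" "u < (\<Sum>j\<in>{1..k'}. q j)"
  shows "k = k'"
proof -
  have "\<not> k < k'" if k: "u < (\<Sum>j\<in>{1..k}. q j)" and k': "k' \<in> {1..p}" "(\<Sum>j\<in>{1..<k'}. q j) \<le> u" for k k'
  proof
    assume "k < k'"
    then have "(\<Sum>j\<in>{1..k}. q j) \<le> (\<Sum>j\<in>{1..<k'}. q j)"
      using q k'(1) by (intro sum_mono2) auto
    with k k'(2) show False by linarith
  qed
  from this[OF k(3) k'(1,2)] this[OF k'(3) k(1,2)] show ?thesis by linarith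
qed

text \<open>The intervals of \<open>pick\<close> are disjoint for nonnegative \<open>q\<close>, so
  the definite description is harmless.\<close>

lemma pick_eq_Some_iff:
  assumes q: "\<forall>j\<in>{1..p}. 0 \<le> q j"
  shows "pick p q u = Some k \<longleftrightarrow> k \<in> {1..p} \<and> (\<Sum>j\<in>{1..<k}. q j) \<le> u \<and> u < (\<Sum>j\<in>{1..k}. q j)"
    (is "_ \<longleftrightarrow> ?R k")
proof
  assume *: "pick p q u = Some k"
  then have ex: "\<exists>k. ?R k" unfolding pick_def by (metis option.distinct(1))
  then have "\<exists>!k. ?R k" using pick_unique[OF q] by blast
  then have "?R (THE k. ?R k)" by (rule theI')
  moreover have "pick p q u = Some (THE k. ?R k)"
    using ex unfolding pick_def Bex_def by (rule if_P)
  ultimately show "?R k" using * by simp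
next
  assume R: "?R k"
  then have "(THE k. ?R k) = k" using pick_unique[OF q] by (intro the_equality) blast+
  moreover have "\<exists>k\<in>{1..p}. (\<Sum>j\<in>{1..<k}. q j) \<le> u \<and> u < (\<Sum>j\<in>{1..k}. q j)" using R by blast
  ultimately show "pick p q u = Some k" unfolding pick_def by (simp only: if_True)
qed

lemma pick_range: "pick p q u = Some k \<Longrightarrow> \<forall>j\<in>{1..p}. 0 \<le> q j \<Longrightarrow> k \<in> {1..p}"
  by (simp only: pick_eq_Some_iff)

lemma measurable_option_nat:
  assumes "\<And>k. {\<omega> \<in> space M. f \<omega> = Some (k::nat)} \<in> sets M"
  shows "f \<in> measurable M (count_space UNIV)"
proof (subst measurable_count_space_eq2_countable, safe)
  fix a :: "nat option"
  show "f -` {a} \<inter> space M \<in> sets M"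
  proof (cases a)
    case None
    have "f -` {a} \<inter> space M = space M - (\<Union>k. {\<omega> \<in> space M. f \<omega> = Some k})"
      unfolding None by auto
    then show ?thesis using assms by auto
  next
    case (Some k)
    have "f -` {a} \<inter> space M = {\<omega> \<in> space M. f \<omega> = Some k}" unfolding Some by auto
    then show ?thesis using assms by simp
  qed
qed auto

lemma pick_measurable:
  assumes q: "\<And>j. j \<in> {1..p} \<Longrightarrow> (\<lambda>\<omega>. q \<omega> j) \<in> borel_measurable M" and u: "u \<in> borel_measurable M"
    and pos: "\<And>\<omega>. \<omega> \<in> space M \<Longrightarrow> \<forall>j\<in>{1..p}. 0 \<le> q \<omega> j"
  shows "(\<lambda>\<omega>. pick p (q \<omega>) (u \<omega>)) \<in> measurable M (count_space UNIV)"
proof (rule measurable_option_nat)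
  fix k
  have "{\<omega> \<in> space M. pick p (q \<omega>) (u \<omega>) = Some k} =
    (if k \<in> {1..p} then {\<omega> \<in> space M. (\<Sum>j\<in>{1..<k}. q \<omega> j) \<le> u \<omega> \<and> u \<omega> < (\<Sum>j\<in>{1..k}. q \<omega> j)} else {})"
    using pick_eq_Some_iff[OF pos] by auto
  moreover have "{\<omega> \<in> space M. (\<Sum>j\<in>{1..<k}. q \<omega> j) \<le> u \<omega> \<and> u \<omega> < (\<Sum>j\<in>{1..k}. q \<omega> j)} \<in> sets M"
    if k: "k \<in> {1..p}"
  proof -
    have [measurable]: "(\<lambda>\<omega>. \<Sum>j\<in>{1..<k}. q \<omega> j) \<in> borel_measurable M" "(\<lambda>\<omega>. \<Sum>j\<in>{1..k}. q \<omega> j) \<in> borel_measurable M"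
      using q k by (auto intro!: borel_measurable_sum)
    show ?thesis using u by measurable
  qed
  ultimately show "{\<omega> \<in> space M. pick p (q \<omega>) (u \<omega>) = Some k} \<in> sets M" by simp
qed

lemma (in prob_space) prob_pick:
  assumes U: "U \<in> borel_measurable M" "distr M borel U = uniform_measure lborel {0<..<1}"
    and q: "\<forall>j\<in>{1..p}. 0 \<le> q j" "(\<Sum>j\<in>{1..p}. q j) \<le> 1" and k: "k \<in> {1..p}"
  shows "prob {\<omega> \<in> space M. pick p q (U \<omega>) = Some k} = q k"
proof -
  let ?l = "\<Sum>j\<in>{1..<k}. q j" and ?r = "\<Sum>j\<in>{1..k}. q j"
  have "{1..k} = insert k {1..<k}" using k by auto
  then have r: "?r = ?l + q k" by simp
  have l0: "0 \<le> ?l" using q k by (intro sum_nonneg) auto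
  have r1: "?r \<le> 1"
  proof -
    have "?r \<le> (\<Sum>j\<in>{1..p}. q j)" using q k by (intro sum_mono2) auto
    then show ?thesis using q by simp
  qed
  have qk: "0 \<le> q k" using q k by auto
  have "{\<omega> \<in> space M. pick p q (U \<omega>) = Some k} = U -` {?l..<?r} \<inter> space M"
    unfolding pick_eq_Some_iff[OF q(1)] using k by auto
  then have "prob {\<omega> \<in> space M. pick p q (U \<omega>) = Some k} = measure (distr M borel U) {?l..<?r}"
    using U(1) by (simp add: measure_distr)
  also have "\<dots> = measure lborel ({0<..<1} \<inter> {?l..<?r}) / measure lborel {0<..<1::real}"
    unfolding U(2) by (subst measure_uniform_measure) auto
  also have "\<dots> = measure lborel ({0<..<1} \<inter> {?l..<?r})" by simp
  also have "\<dots> = measure lborel {?l<..<?r}"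
  proof (rule measure_eq_AE)
    have "AE x in lborel. x \<noteq> ?l" by (rule AE_lborel_singleton)
    then show "AE x in lborel. x \<in> {0<..<1} \<inter> {?l..<?r} \<longleftrightarrow> x \<in> {?l<..<?r}"
      by eventually_elim (use l0 r1 in auto)
  qed auto
  also have "\<dots> = q k" using r qk by simp
  finally show ?thesis .
qed

section \<open>The chain at frozen arrival times\<close>

text \<open>Row \<open>i\<close> of the matrix \<open>I + S / lam\<close> at time
  \<open>s\<close>.\<close>

abbreviation jump_law :: "(real \<Rightarrow> nat \<Rightarrow> nat \<Rightarrow> real) \<Rightarrow> real \<Rightarrow> real \<Rightarrow> nat \<Rightarrow> nat \<Rightarrow> real" where
  "jump_law S lam t i j \<equiv> S t i j / lam + (if i = j then 1 else 0)"

definition bounded_rates :: "nat \<Rightarrow> (real \<Rightarrow> nat \<Rightarrow> nat \<Rightarrow> real) \<Rightarrow> real \<Rightarrow> bool" where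
  "bounded_rates p S lam \<longleftrightarrow> 0 < lam \<and> (\<forall>t\<ge>0. \<forall>i\<in>{1..p}. \<bar>S t i i\<bar> \<le> lam)"

lemma jump_law_nonneg:
  assumes S: "subintensity p S" and r: "bounded_rates p S lam" and "0 \<le> t" "i \<in> {1..p}"
  shows "\<forall>j\<in>{1..p}. 0 \<le> jump_law S lam t i j"
proof
  fix j assume j: "j \<in> {1..p}"
  have lam: "0 < lam" and bound: "\<bar>S t i i\<bar> \<le> lam" using r assms(3,4) by (auto simp: bounded_rates_def)
  have off: "i \<noteq> j \<Longrightarrow> 0 \<le> S t i j" using S assms(3,4) j by (auto simp: subintensity_def)
  have "- 1 \<le> S t i i / lam" using lam bound by (simp add: field_simps abs_le_iff)
  then show "0 \<le> jump_law S lam t i j" using off lam by (cases "i = j") auto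
qed

lemma sum_jump_law:
  assumes i: "i \<in> {1..p}"
  shows "(\<Sum>j\<in>{1..p}. jump_law S lam t i j) = (\<Sum>j\<in>{1..p}. S t i j) / lam + 1"
  using i by (simp add: sum.distrib sum_divide_distrib)

lemma sum_jump_law_le:
  assumes S: "subintensity p S" and r: "bounded_rates p S lam" and "0 \<le> t" "i \<in> {1..p}"
  shows "(\<Sum>j\<in>{1..p}. jump_law S lam t i j) \<le> 1"
proof -
  have "(\<Sum>j\<in>{1..p}. S t i j) \<le> 0" using S assms(3,4) by (auto simp: subintensity_def)
  then show ?thesis
    unfolding sum_jump_law[OF assms(4)] using r by (simp add: bounded_rates_def divide_nonpos_pos)
qed

lemma marked_chain_range:
  assumes S: "subintensity p S" and r: "bounded_rates p S lam" and \<pi>: "\<forall>i\<in>{1..p}. 0 \<le> \<pi> i"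
    and t: "\<And>i. 0 \<le> t i"
  shows "marked_chain p S \<pi> lam t b u l = Some a \<Longrightarrow> a \<in> {1..p}"
proof (induction l arbitrary: a)
  case 0
  then show ?case using pick_range \<pi> by simp
next
  case (Suc l)
  show ?case
  proof (cases "b (Suc l)")
    case True
    with Suc.prems obtain i where i: "marked_chain p S \<pi> lam t b u l = Some i"
      "pick p (jump_law S lam (t (Suc l)) i) (u (card {i \<in> {1..Suc l}. b i})) = Some a"
      by (auto simp del: atLeastAtMost_iff split: option.splits)
    show ?thesis by (rule pick_range[OF i(2) jump_law_nonneg[OF S r t Suc.IH[OF i(1)]]])
  qed (use Suc in simp)
qed

lemma card_marks_Suc:
  fixes l :: nat
  shows
  "card {i \<in> {1..Suc l}. b i} = card {i \<in> {1..l}. b i} + (if b (Suc l) then 1 else 0)"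
proof -
  have "{i \<in> {1..Suc l}. b i} = (if b (Suc l) then insert (Suc l) {i \<in> {1..l}. b i} else {i \<in> {1..l}. b i})"
    by (auto simp: le_Suc_eq)
  then show ?thesis by simp
qed

lemma card_marks_measurable:
  fixes l :: nat
  assumes "\<And>i. i \<in> {1..l} \<Longrightarrow> (\<lambda>\<omega>. b \<omega> i) \<in> measurable N (count_space UNIV)"
  shows "(\<lambda>\<omega>. card {i \<in> {1..l}. b \<omega> i}) \<in> measurable N (count_space UNIV)"
  using assms
proof (induction l)
  case (Suc l)
  show ?case unfolding card_marks_Suc
    by (rule measurable_compose2_countable[where h="\<lambda>c v. c + (if v then 1 else 0)", OF Suc.IH Suc.prems])
      (use Suc.prems in auto)
qed simp

lemma sets_eq_Some: "f \<in> measurable N (count_space UNIV) \<Longrightarrow> {\<omega> \<in> space N. f \<omega> = c} \<in> sets N"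
  using measurable_sets[of f N "count_space UNIV" "{c}"] by (simp add: vimage_def Int_def conj_commute)

lemma marked_chain_measurable:
  assumes S: "subintensity p S" and r: "bounded_rates p S lam" and \<pi>: "\<forall>i\<in>{1..p}. 0 \<le> \<pi> i"
    and t: "\<And>i. (\<lambda>\<omega>. t \<omega> i) \<in> borel_measurable N" "\<And>i \<omega>. 0 \<le> t \<omega> i"
    and u: "\<And>i. (\<lambda>\<omega>. u \<omega> i) \<in> borel_measurable N"
    and b: "\<And>i. i \<in> {1..l} \<Longrightarrow> (\<lambda>\<omega>. b \<omega> i) \<in> measurable N (count_space UNIV)"
  shows "(\<lambda>\<omega>. marked_chain p S \<pi> lam (t \<omega>) (b \<omega>) (u \<omega>) l) \<in> measurable N (count_space UNIV)"
  using b
proof (induction l)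
  case 0
  show ?case unfolding marked_chain.simps by (rule pick_measurable) (use \<pi> u in auto)
next
  case (Suc l)
  let ?X = "\<lambda>\<omega>. marked_chain p S \<pi> lam (t \<omega>) (b \<omega>) (u \<omega>) l"
  let ?c = "\<lambda>\<omega>. card {i \<in> {1..Suc l}. b \<omega> i}"
  let ?P = "\<lambda>i \<omega>. pick p (jump_law S lam (t \<omega> (Suc l)) i) (u \<omega> (?c \<omega>))"
  have X: "?X \<in> measurable N (count_space UNIV)" by (rule Suc.IH) (use Suc.prems in auto)
  have c: "?c \<in> measurable N (count_space UNIV)" by (rule card_marks_measurable) (use Suc.prems in auto)
  have uc: "(\<lambda>\<omega>. u \<omega> (?c \<omega>)) \<in> borel_measurable N"
    by (rule measurable_compose_countable[where f="\<lambda>i \<omega>. u \<omega> i", OF u c])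
  have t': "(\<lambda>\<omega>. t \<omega> (Suc l)) \<in> measurable N (restrict_space borel {0..})"
    using t by (intro measurable_restrict_space2) auto
  have P: "?P i \<in> measurable N (count_space UNIV)" if i: "i \<in> {1..p}" for i
  proof (rule pick_measurable[OF _ uc])
    fix j assume "j \<in> {1..p}"
    then have "(\<lambda>t. S t i j) \<in> borel_measurable (restrict_space borel {0..})"
      using S i by (auto simp: subintensity_def)
    from measurable_compose[OF t' this]
    show "(\<lambda>\<omega>. jump_law S lam (t \<omega> (Suc l)) i j) \<in> borel_measurable N" by measurable
  qed (rule jump_law_nonneg[OF S r t(2) i])
  have B: "{\<omega> \<in> space N. b \<omega> (Suc l)} \<in> sets N"
    using sets_eq_Some[OF Suc.prems, of "Suc l" True] by simp
  show ?case
  proof (rule measurable_option_nat)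
    fix a
    have "(marked_chain p S \<pi> lam (t \<omega>) (b \<omega>) (u \<omega>) (Suc l) = Some a) \<longleftrightarrow>
      (b \<omega> (Suc l) \<and> (\<exists>i\<in>{1..p}. ?X \<omega> = Some i \<and> ?P i \<omega> = Some a)) \<or> (\<not> b \<omega> (Suc l) \<and> ?X \<omega> = Some a)" for \<omega>
    proof (cases "b \<omega> (Suc l)")
      case True
      show ?thesis
      proof (cases "?X \<omega>")
        case (Some i)
        moreover have "i \<in> {1..p}" by (rule marked_chain_range[OF S r \<pi> t(2) Some])
        ultimately show ?thesis using True by (simp del: atLeastAtMost_iff)
      qed (use True in simp)
    qed simp
    then have "{\<omega> \<in> space N. marked_chain p S \<pi> lam (t \<omega>) (b \<omega>) (u \<omega>) (Suc l) = Some a} =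
      ({\<omega> \<in> space N. b \<omega> (Suc l)} \<inter>
        (\<Union>i\<in>{1..p}. {\<omega> \<in> space N. ?X \<omega> = Some i} \<inter> {\<omega> \<in> space N. ?P i \<omega> = Some a})) \<union>
      ((space N - {\<omega> \<in> space N. b \<omega> (Suc l)}) \<inter> {\<omega> \<in> space N. ?X \<omega> = Some a})"
      by (simp only:) blast
    also have "\<dots> \<in> sets N"
      by (intro sets.Un sets.Int sets.Diff sets.finite_UN B sets.top sets_eq_Some X P) auto
    finally show "{\<omega> \<in> space N. marked_chain p S \<pi> lam (t \<omega>) (b \<omega>) (u \<omega>) (Suc l) = Some a} \<in> sets N" .
  qed
qed

lemma marked_chain_cong:
  assumes "\<And>i. i \<le> card {i \<in> {1..l}. b i} \<Longrightarrow> u i = u' i"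
  shows "marked_chain p S \<pi> lam t b u l = marked_chain p S \<pi> lam t b u' l"
  using assms
proof (induction l)
  case (Suc l)
  have IH: "marked_chain p S \<pi> lam t b u l = marked_chain p S \<pi> lam t b u' l"
    by (rule Suc.IH) (use Suc.prems in \<open>simp only: card_marks_Suc\<close>)
  have "u (card {i \<in> {1..Suc l}. b i}) = u' (card {i \<in> {1..Suc l}. b i})"
    by (rule Suc.prems) simp
  then show ?case unfolding marked_chain.simps IH by (simp only:)
qed simp

text \<open>The independent ingredients after passing to the superposed clock: the clock itself,
  the mark of each arrival, the uniform variables and the reward clocks. The constructors of
  \<open>source\<close> serve as labels; \<open>Extra_Clock l\<close> stands for the mark of the
  \<open>l\<close>-th arrival.\<close>

fun noise_events ::
  "'a measure \<Rightarrow> 'a measure \<Rightarrow> (nat \<Rightarrow> 'a \<Rightarrow> bool) \<Rightarrow> (nat \<Rightarrow> 'a \<Rightarrow> real) \<Rightarrow> (nat \<Rightarrow> 'a set set) \<Rightarrow> source \<Rightarrow> 'a set set" where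
  "noise_events M G b u H Clock = sets G"
| "noise_events M G b u H (Extra_Clock l) = {{\<omega> \<in> space M. b l \<omega> \<in> V} | V. True}"
| "noise_events M G b u H (Unif l) = {u l -` B \<inter> space M | B. B \<in> sets borel}"
| "noise_events M G b u H (Reward_Clock k) = H k"
| "noise_events M G b u H (Extra_Reward_Clock k l) = {}"

definition noise_sources :: "nat \<Rightarrow> source set" where
  "noise_sources m = {Clock} \<union> Extra_Clock ` {1..} \<union> range Unif \<union> Reward_Clock ` {1..m}"

text \<open>The probabilistic content of uniformisation, separated from its origin in Poisson
  processes: a clock algebra, Bernoulli marks, uniform choices and further noise, all
  independent.\<close>

locale marked_chain_space = prob_space M for M :: "'a measure" +
  fixes p m :: nat and S :: "real \<Rightarrow> nat \<Rightarrow> nat \<Rightarrow> real" and \<pi> :: "nat \<Rightarrow> real" and lam n :: real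
    and G :: "'a measure" and b :: "nat \<Rightarrow> 'a \<Rightarrow> bool" and u :: "nat \<Rightarrow> 'a \<Rightarrow> real" and H :: "nat \<Rightarrow> 'a set set"
  assumes S: "subintensity p S" and rates: "bounded_rates p S lam" and n: "lam \<le> n"
    and \<pi>: "\<forall>i\<in>{1..p}. 0 \<le> \<pi> i" "(\<Sum>i\<in>{1..p}. \<pi> i) = 1"
    and u: "\<And>l. u l \<in> borel_measurable M" "\<And>l. distr M borel (u l) = uniform_measure lborel {0<..<1}"
    and b: "\<And>l. 1 \<le> l \<Longrightarrow> prob {\<omega> \<in> space M. b l \<omega>} = lam / n"
    and G: "subalgebra M G"
    and H: "\<And>k. Int_stable (H k)"
    and noise: "indep_sets (noise_events M G b u H) (noise_sources m)"
begin

abbreviation "noise \<equiv> noise_events M G b u H"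

lemma noise_subset_events: "x \<in> noise_sources m \<Longrightarrow> noise x \<subseteq> events"
  using noise by (auto simp: indep_sets_def)

lemma noise_Int_stable: "Int_stable (noise x)"
proof (cases x)
  case (Extra_Clock l)
  show ?thesis unfolding Extra_Clock noise_events.simps
  proof (rule Int_stableI)
    fix A B assume "A \<in> {{\<omega> \<in> space M. b l \<omega> \<in> V} | V. True}" "B \<in> {{\<omega> \<in> space M. b l \<omega> \<in> V} | V. True}"
    then obtain V W where AB: "A = {\<omega> \<in> space M. b l \<omega> \<in> V}" "B = {\<omega> \<in> space M. b l \<omega> \<in> W}" by auto
    have "A \<inter> B = {\<omega> \<in> space M. b l \<omega> \<in> V \<inter> W}" unfolding AB by auto
    then show "A \<inter> B \<in> {{\<omega> \<in> space M. b l \<omega> \<in> V} | V. True}"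
      by (intro CollectI exI[of _ "V \<inter> W"] conjI TrueI)
  qed
next
  case (Unif l)
  show ?thesis unfolding Unif noise_events.simps
  proof (rule Int_stableI)
    fix A B assume "A \<in> {u l -` B \<inter> space M | B. B \<in> sets borel}" "B \<in> {u l -` B \<inter> space M | B. B \<in> sets borel}"
    then obtain V W where AB: "A = u l -` V \<inter> space M" "B = u l -` W \<inter> space M" "V \<in> sets borel" "W \<in> sets borel" by auto
    have "A \<inter> B = u l -` (V \<inter> W) \<inter> space M" "V \<inter> W \<in> sets borel" using AB by auto
    then show "A \<inter> B \<in> {u l -` B \<inter> space M | B. B \<in> sets borel}" by (intro CollectI exI[of _ "V \<inter> W"] conjI)
  qed
next
  case (Reward_Clock k)
  then show ?thesis using H[of k] by simp
qed (auto simp: Int_stable_def)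

definition noise_algebra :: "source set \<Rightarrow> 'a measure" where
  "noise_algebra K = sigma (space M) (\<Union>x\<in>K. noise x)"

lemma noise_algebra:
  assumes "K \<subseteq> noise_sources m"
  shows "space (noise_algebra K) = space M"
    and "sets (noise_algebra K) = sigma_sets (space M) (\<Union>x\<in>K. noise x)"
    and "sets (noise_algebra K) \<subseteq> events"
    and "subalgebra M (noise_algebra K)"
proof -
  have ev: "(\<Union>x\<in>K. noise x) \<subseteq> events" using noise_subset_events assms by blast
  then have sub: "(\<Union>x\<in>K. noise x) \<subseteq> Pow (space M)" using sets.sets_into_space by blast
  show sp: "space (noise_algebra K) = space M" unfolding noise_algebra_def using sub by (rule space_measure_of)
  show st: "sets (noise_algebra K) = sigma_sets (space M) (\<Union>x\<in>K. noise x)"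
    unfolding noise_algebra_def using sub by (rule sets_measure_of)
  show sb: "sets (noise_algebra K) \<subseteq> events" unfolding st using ev by (rule sets.sigma_sets_subset)
  show "subalgebra M (noise_algebra K)" unfolding subalgebra_def using sp sb by simp
qed

lemma noise_algebra_mem:
  "K \<subseteq> noise_sources m \<Longrightarrow> x \<in> K \<Longrightarrow> A \<in> noise x \<Longrightarrow> A \<in> sets (noise_algebra K)"
  unfolding noise_algebra(2) by (rule sigma_sets.Basic) blast

lemma noise_algebra_indep:
  assumes K: "K \<subseteq> noise_sources m" and L: "L \<subseteq> noise_sources m" and KL: "K \<inter> L = {}"
  shows "indep_set (sets (noise_algebra K)) (sets (noise_algebra L))"
proof -
  have "indep_sets (\<lambda>j. sigma_sets (space M) (\<Union>i\<in>case_bool K L j. noise i)) UNIV"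
  proof (rule indep_sets_collect_sigma)
    show "indep_sets noise (\<Union>j\<in>UNIV. case_bool K L j)"
      by (rule indep_sets_mono_index[OF _ noise]) (use K L in \<open>auto simp: UNIV_bool\<close>)
    show "disjoint_family_on (case_bool K L) UNIV"
      using KL unfolding disjoint_family_on_def by (auto split: bool.split)
  qed (rule noise_Int_stable)
  then show ?thesis
    unfolding indep_set_def noise_algebra(2)[OF K] noise_algebra(2)[OF L]
    by (rule indep_sets_mono_sets) (auto split: bool.split)
qed

lemma noise_indep_prob:
  assumes "K \<subseteq> noise_sources m" "L \<subseteq> noise_sources m" "K \<inter> L = {}"
    and "A \<in> sets (noise_algebra K)" "B \<in> sets (noise_algebra L)"
  shows "prob (A \<inter> B) = prob A * prob B"
  by (rule indep_setD[OF noise_algebra_indep[OF assms(1-3)] assms(4,5)])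

lemma mark_noise_measurable:
  assumes "K \<subseteq> noise_sources m" "Extra_Clock l \<in> K"
  shows "b l \<in> measurable (noise_algebra K) (count_space UNIV)"
proof (rule measurableI)
  fix V
  have "b l -` V \<inter> space M = {\<omega> \<in> space M. b l \<omega> \<in> V}" by blast
  then have "b l -` V \<inter> space M \<in> noise (Extra_Clock l)" by auto
  then show "b l -` V \<inter> space (noise_algebra K) \<in> sets (noise_algebra K)"
    unfolding noise_algebra(1)[OF assms(1)] by (rule noise_algebra_mem[OF assms])
qed simp

lemma choice_noise_measurable:
  assumes "K \<subseteq> noise_sources m" "Unif l \<in> K"
  shows "u l \<in> borel_measurable (noise_algebra K)"
proof (rule measurableI)
  fix V :: "real set" assume "V \<in> sets borel"
  then have "u l -` V \<inter> space M \<in> noise (Unif l)" by auto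
  then show "u l -` V \<inter> space (noise_algebra K) \<in> sets (noise_algebra K)"
    unfolding noise_algebra(1)[OF assms(1)] by (rule noise_algebra_mem[OF assms])
qed simp

definition chain :: "(nat \<Rightarrow> real) \<Rightarrow> nat \<Rightarrow> 'a \<Rightarrow> nat option" where
  "chain t l \<omega> = marked_chain p S \<pi> lam t (\<lambda>l. b l \<omega>) (\<lambda>l. u l \<omega>) l"

definition history :: "(nat \<Rightarrow> real) \<Rightarrow> nat \<Rightarrow> 'a \<Rightarrow> nat option list" where
  "history t l \<omega> = map (\<lambda>i. chain t i \<omega>) [0..<Suc l]"

text \<open>Entry \<open>(i, j)\<close> of the matrix \<open>Q\<close> for the \<open>l\<close>-th
  arrival.\<close>

definition kernel :: "(nat \<Rightarrow> real) \<Rightarrow> nat \<Rightarrow> nat \<Rightarrow> nat \<Rightarrow> real" where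
  "kernel t l i j = (if i = j then 1 else 0) + S (t l) i j / n"

definition chain_noise :: "source set" where
  "chain_noise = Extra_Clock ` {1..} \<union> range Unif"

lemma chain_noise: "chain_noise \<subseteq> noise_sources m"
  by (auto simp: chain_noise_def noise_sources_def)

context
  fixes t :: "nat \<Rightarrow> real"
  assumes t: "\<And>l. 0 \<le> t l"
begin

lemma chain_range: "chain t l \<omega> = Some a \<Longrightarrow> a \<in> {1..p}"
  unfolding chain_def by (rule marked_chain_range[OF S rates \<pi>(1) t])

lemma chain_measurable: "chain t l \<in> measurable (noise_algebra chain_noise) (count_space UNIV)"
  unfolding chain_def[abs_def]
proof (rule marked_chain_measurable[OF S rates \<pi>(1)])
  show "(\<lambda>\<omega>. u i \<omega>) \<in> borel_measurable (noise_algebra chain_noise)" for i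
    by (rule choice_noise_measurable[OF chain_noise]) (simp add: chain_noise_def)
  show "(\<lambda>\<omega>. b i \<omega>) \<in> measurable (noise_algebra chain_noise) (count_space UNIV)" if "i \<in> {1..l}" for i
    by (rule mark_noise_measurable[OF chain_noise]) (use that in \<open>simp add: chain_noise_def\<close>)
qed (simp_all add: t)

lemma history_measurable: "history t l \<in> measurable (noise_algebra chain_noise) (count_space UNIV)"
  unfolding history_def[abs_def] by (rule measurable_map_upt) (rule chain_measurable)

lemma history_events:
  "{\<omega> \<in> space M. \<Psi> (history t l \<omega>)} \<in> sets (noise_algebra chain_noise)"
  "{\<omega> \<in> space M. \<Psi> (history t l \<omega>)} \<in> events"
proof -
  have "history t l -` {h. \<Psi> h} \<inter> space (noise_algebra chain_noise) \<in> sets (noise_algebra chain_noise)"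
    by (rule measurable_sets[OF history_measurable]) simp
  then have "history t l -` {h. \<Psi> h} \<inter> space M \<in> sets (noise_algebra chain_noise)"
    unfolding noise_algebra(1)[OF chain_noise] .
  also have "history t l -` {h. \<Psi> h} \<inter> space M = {\<omega> \<in> space M. \<Psi> (history t l \<omega>)}" by blast
  finally show "{\<omega> \<in> space M. \<Psi> (history t l \<omega>)} \<in> sets (noise_algebra chain_noise)" .
  then show "{\<omega> \<in> space M. \<Psi> (history t l \<omega>)} \<in> events" using noise_algebra(3)[OF chain_noise] by blast
qed

lemma last_history: "last (history t l \<omega>) = chain t l \<omega>"
  by (simp add: history_def)

text \<open>Once the number \<open>s\<close> of marks is fixed, the past uses the uniform choices
  with index at most \<open>s\<close> only; so the next choice, of index \<open>s + 1\<close>, is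
  independent of it.\<close>

lemma past_event:
  fixes l :: nat
  defines "K \<equiv> \<lambda>s. Extra_Clock ` {1..l} \<union> Unif ` {..s}"
  shows "{\<omega> \<in> space M. \<Psi> (history t l \<omega>) \<and> card {i \<in> {1..l}. b i \<omega>} = s} \<in> sets (noise_algebra (K s))"
proof -
  let ?u = "\<lambda>\<omega> i. if i \<le> s then u i \<omega> else 0"
  let ?X = "\<lambda>i \<omega>. marked_chain p S \<pi> lam t (\<lambda>l. b l \<omega>) (?u \<omega>) i"
  let ?h = "\<lambda>\<omega>. map (\<lambda>i. ?X i \<omega>) [0..<Suc l]"
  have K: "K s \<subseteq> noise_sources m" by (auto simp: K_def noise_sources_def)
  have bm: "b i \<in> measurable (noise_algebra (K s)) (count_space UNIV)" if "i \<in> {1..l}" for i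
    by (rule mark_noise_measurable[OF K]) (use that in \<open>auto simp: K_def\<close>)
  have um: "(\<lambda>\<omega>. ?u \<omega> i) \<in> borel_measurable (noise_algebra (K s))" for i
    using choice_noise_measurable[OF K, of i] by (cases "i \<le> s") (auto simp: K_def)
  have "?X i \<in> measurable (noise_algebra (K s)) (count_space UNIV)" if "i < Suc l" for i
    by (rule marked_chain_measurable[OF S rates \<pi>(1)]) (use um bm that t in auto)
  then have hm: "?h \<in> measurable (noise_algebra (K s)) (count_space UNIV)"
    by (rule measurable_map_upt)
  have cm: "(\<lambda>\<omega>. card {i \<in> {1..l}. b i \<omega>}) \<in> measurable (noise_algebra (K s)) (count_space UNIV)"
    by (rule card_marks_measurable) (rule bm)
  have "(\<lambda>\<omega>. \<Psi> (?h \<omega>) \<and> card {i \<in> {1..l}. b i \<omega>} = s) \<in> measurable (noise_algebra (K s)) (count_space UNIV)"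
    by (rule measurable_compose2_countable[where h="\<lambda>h c. \<Psi> h \<and> c = s", OF hm cm])
  from sets_eq_Some[OF this, of True]
  have "{\<omega> \<in> space M. \<Psi> (?h \<omega>) \<and> card {i \<in> {1..l}. b i \<omega>} = s} \<in> sets (noise_algebra (K s))"
    by (simp add: noise_algebra(1)[OF K])
  moreover have same: "?h \<omega> = history t l \<omega>" if s: "card {i \<in> {1..l}. b i \<omega>} = s" for \<omega>
    unfolding history_def chain_def
  proof (intro map_cong refl marked_chain_cong)
    fix x i assume x: "x \<in> set [0..<Suc l]" and i: "i \<le> card {i \<in> {1..x}. b i \<omega>}"
    have "card {i \<in> {1..x}. b i \<omega>} \<le> card {i \<in> {1..l}. b i \<omega>}"
      by (rule card_mono) (use x in auto)
    then show "?u \<omega> i = u i \<omega>" using i s by simp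
  qed
  then have "(\<Psi> (?h \<omega>) \<and> card {i \<in> {1..l}. b i \<omega>} = s) = (\<Psi> (history t l \<omega>) \<and> card {i \<in> {1..l}. b i \<omega>} = s)" for \<omega>
    by (cases "card {i \<in> {1..l}. b i \<omega>} = s") (simp_all only: simp_thms)
  ultimately show ?thesis by (simp only:)
qed

text \<open>The chain moves by \<open>jump_law\<close> with probability \<open>lam / n\<close> and
  stays with probability \<open>1 - lam / n\<close>; these combine to
  \<open>kernel\<close>.\<close>

lemma frozen_markov_at_count:
  fixes l :: nat and \<Psi> :: "nat option list \<Rightarrow> bool"
  assumes ij: "i \<in> {1..p}" "j \<in> {1..p}"
  defines "A \<equiv> \<lambda>s. {\<omega> \<in> space M. (\<Psi> (history t l \<omega>) \<and> chain t l \<omega> = Some i) \<and> card {i \<in> {1..l}. b i \<omega>} = s}"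
  shows "prob (A s \<inter> {\<omega> \<in> space M. chain t (Suc l) \<omega> = Some j}) = prob (A s) * kernel t (Suc l) i j"
proof -
  let ?L = "Extra_Clock (Suc l)" and ?U = "Unif (Suc s)"
  let ?b = "\<lambda>v. {\<omega> \<in> space M. b (Suc l) \<omega> = v}"
  let ?P = "{\<omega> \<in> space M. pick p (jump_law S lam (t (Suc l)) i) (u (Suc s) \<omega>) = Some j}"
  let ?K = "Extra_Clock ` {1..l} \<union> Unif ` {..s}"
  note q = jump_law_nonneg[OF S rates t ij(1), of "Suc l"]
  have lam: "0 < lam" "0 < n" using rates n by (auto simp: bounded_rates_def)
  have A_eq: "A s = {\<omega> \<in> space M. (\<lambda>h. \<Psi> h \<and> last h = Some i) (history t l \<omega>) \<and> card {i \<in> {1..l}. b i \<omega>} = s}"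
    unfolding A_def by (simp only: last_history)
  have Am: "A s \<in> sets (noise_algebra ?K)"
    unfolding A_eq by (rule past_event)
  have src: "?K \<subseteq> noise_sources m" "{?L, ?U} \<subseteq> noise_sources m" "{?L} \<subseteq> noise_sources m" "{?U} \<subseteq> noise_sources m"
    "?K \<inter> {?L, ?U} = {}" "{?L} \<inter> {?U} = {}"
    by (auto simp: noise_sources_def)
  have bm: "?b v \<in> sets (noise_algebra K)" if "?L \<in> K" "K \<subseteq> noise_sources m" for v K
    using sets_eq_Some[OF mark_noise_measurable[OF that(2,1)], of v] by (simp add: noise_algebra(1)[OF that(2)])
  have Pm: "?P \<in> sets (noise_algebra K)" if "?U \<in> K" "K \<subseteq> noise_sources m" for K
  proof -
    have "(\<lambda>\<omega>. pick p (jump_law S lam (t (Suc l)) i) (u (Suc s) \<omega>)) \<in> measurable (noise_algebra K) (count_space UNIV)"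
      by (rule pick_measurable) (use choice_noise_measurable[OF that(2,1)] q in auto)
    from sets_eq_Some[OF this, of "Some j"] show ?thesis by (simp add: noise_algebra(1)[OF that(2)])
  qed
  have ev: "A s \<in> events" "?b v \<in> events" "?P \<in> events" for v
    using Am bm[of "{?L}" v] Pm[of "{?U}"] noise_algebra(3) src by blast+
  have pP: "prob ?P = jump_law S lam (t (Suc l)) i j"
    by (rule prob_pick[OF u q sum_jump_law_le[OF S rates t ij(1)] ij(2)])
  have pT: "prob (?b True) = lam / n" using b[of "Suc l"] by simp
  have pF: "prob (?b False) = 1 - lam / n"
  proof -
    have "?b False = space M - ?b True" by auto
    then show ?thesis using prob_compl[OF ev(2)[of True]] pT by simp
  qed
  have move: "prob (A s \<inter> (?b True \<inter> ?P)) = prob (A s) * (lam / n * jump_law S lam (t (Suc l)) i j)"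
  proof -
    have "?b True \<inter> ?P \<in> sets (noise_algebra {?L, ?U})"
      by (rule sets.Int) (rule bm Pm, simp, rule src)+
    then have "prob (A s \<inter> (?b True \<inter> ?P)) = prob (A s) * prob (?b True \<inter> ?P)"
      by (rule noise_indep_prob[OF src(1,2,5) Am])
    moreover have "prob (?b True \<inter> ?P) = prob (?b True) * prob ?P"
      by (rule noise_indep_prob[OF src(3,4,6)]) (rule bm Pm, simp, rule src)+
    ultimately show ?thesis unfolding pT pP by simp
  qed
  have stay: "prob (A s \<inter> ?b False) = prob (A s) * (1 - lam / n)"
    unfolding pF[symmetric] by (rule noise_indep_prob[OF src(1,3) _ Am bm]) (use src in auto)
  have step: "chain t (Suc l) \<omega> = (if b (Suc l) \<omega> then pick p (jump_law S lam (t (Suc l)) i) (u (Suc s) \<omega>) else Some i)"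
    if "\<omega> \<in> A s" for \<omega>
  proof -
    have "chain t l \<omega> = Some i" "card {i \<in> {1..l}. b i \<omega>} = s" using that by (auto simp: A_def)
    then show ?thesis unfolding chain_def marked_chain.simps card_marks_Suc by simp
  qed
  have split: "A s \<inter> {\<omega> \<in> space M. chain t (Suc l) \<omega> = Some j} =
    (A s \<inter> (?b True \<inter> ?P)) \<union> (if i = j then A s \<inter> ?b False else {})" (is "?lhs = ?rhs")
  proof (rule set_eqI)
    fix \<omega>
    show "\<omega> \<in> ?lhs \<longleftrightarrow> \<omega> \<in> ?rhs"
    proof (cases "\<omega> \<in> A s")
      case True
      then have "\<omega> \<in> space M" by (simp add: A_def)
      then show ?thesis using True step[OF True] by simp
    qed simp
  qed
  have s1: "A s \<inter> (?b True \<inter> ?P) \<in> events" and s2: "A s \<inter> ?b False \<in> events"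
    by (intro sets.Int ev)+
  have s3: "(if i = j then A s \<inter> ?b False else {}) \<in> events"
  proof (cases "i = j")
    case True
    show ?thesis unfolding if_P[OF True] by (rule s2)
  next
    case False
    show ?thesis unfolding if_not_P[OF False] by (rule sets.empty_sets)
  qed
  have p3: "prob (if i = j then A s \<inter> ?b False else {}) = prob (A s) * ((1 - lam / n) * (if i = j then 1 else 0))"
  proof (cases "i = j")
    case True
    show ?thesis unfolding if_P[OF True] mult_1_right by (rule stay)
  next
    case False
    show ?thesis unfolding if_not_P[OF False] measure_empty mult_zero_right ..
  qed
  have weight: "lam / n * jump_law S lam (t (Suc l)) i j + (1 - lam / n) * (if i = j then 1 else 0) = kernel t (Suc l) i j"
    using lam unfolding kernel_def by (cases "i = j") (simp_all add: field_simps)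
  have "prob (A s \<inter> {\<omega> \<in> space M. chain t (Suc l) \<omega> = Some j}) =
    prob (A s \<inter> (?b True \<inter> ?P)) + prob (if i = j then A s \<inter> ?b False else {})"
    unfolding split by (rule finite_measure_Union[OF s1 s3]) auto
  also have "\<dots> = prob (A s) * kernel t (Suc l) i j"
    unfolding move p3 distrib_left[symmetric] weight ..
  finally show ?thesis .
qed

text \<open>Sum of the previous lemma over the number of marks.\<close>

lemma frozen_markov:
  assumes ij: "i \<in> {1..p}" "j \<in> {1..p}"
  shows "prob {\<omega> \<in> space M. \<Psi> (history t l \<omega>) \<and> chain t l \<omega> = Some i \<and> chain t (Suc l) \<omega> = Some j} =
    prob {\<omega> \<in> space M. \<Psi> (history t l \<omega>) \<and> chain t l \<omega> = Some i} * kernel t (Suc l) i j"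
proof -
  define A where "A s = {\<omega> \<in> space M. (\<Psi> (history t l \<omega>) \<and> chain t l \<omega> = Some i) \<and> card {i \<in> {1..l}. b i \<omega>} = s}" for s
  let ?C = "{\<omega> \<in> space M. chain t (Suc l) \<omega> = Some j}"
  have "A s = {\<omega> \<in> space M. (\<lambda>h. \<Psi> h \<and> last h = Some i) (history t l \<omega>) \<and> card {i \<in> {1..l}. b i \<omega>} = s}" for s
    unfolding A_def by (simp only: last_history)
  note A_eq = this
  have K: "Extra_Clock ` {1..l} \<union> Unif ` {..s} \<subseteq> noise_sources m" for s by (auto simp: noise_sources_def)
  have Am: "A s \<in> events" for s
    unfolding A_eq by (rule subsetD[OF noise_algebra(3)[OF K] past_event])
  have Cm: "?C \<in> events" using history_events(2)[of "\<lambda>h. last h = Some j" "Suc l"] by (simp only: last_history)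
  have card: "card {i \<in> {1..l}. b i \<omega>} \<in> {..l}" for \<omega>
  proof -
    have "card {i \<in> {1..l}. b i \<omega>} \<le> card {1..l}" by (rule card_mono) auto
    then show ?thesis by simp
  qed
  have A_UN: "{\<omega> \<in> space M. \<Psi> (history t l \<omega>) \<and> chain t l \<omega> = Some i} = (\<Union>s\<in>{..l}. A s)"
    unfolding A_def using card by blast
  have AC_UN: "{\<omega> \<in> space M. \<Psi> (history t l \<omega>) \<and> chain t l \<omega> = Some i \<and> chain t (Suc l) \<omega> = Some j} = (\<Union>s\<in>{..l}. A s \<inter> ?C)"
    unfolding A_def using card by blast
  have disj: "disjoint_family_on A {..l}" "disjoint_family_on (\<lambda>s. A s \<inter> ?C) {..l}"
    unfolding A_def disjoint_family_on_def by auto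
  have "prob (\<Union>s\<in>{..l}. A s \<inter> ?C) = (\<Sum>s\<le>l. prob (A s \<inter> ?C))"
    by (rule finite_measure_finite_Union) (use Am Cm disj in auto)
  also have "\<dots> = (\<Sum>s\<le>l. prob (A s)) * kernel t (Suc l) i j"
    unfolding sum_distrib_right A_def by (intro sum.cong refl frozen_markov_at_count ij)
  also have "(\<Sum>s\<le>l. prob (A s)) = prob (\<Union>s\<in>{..l}. A s)"
    by (rule finite_measure_finite_Union[symmetric]) (use Am disj in auto)
  finally show ?thesis unfolding A_UN AC_UN .
qed

text \<open>The chain terminates exactly if it moves to no state.\<close>

lemma frozen_termination:
  assumes i: "i \<in> {1..p}"
  shows "prob {\<omega> \<in> space M. \<Psi> (history t l \<omega>) \<and> chain t l \<omega> = Some i \<and> chain t (Suc l) \<omega> = None} =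
    prob {\<omega> \<in> space M. \<Psi> (history t l \<omega>) \<and> chain t l \<omega> = Some i} * (1 - (\<Sum>j\<in>{1..p}. kernel t (Suc l) i j))"
proof -
  let ?A = "{\<omega> \<in> space M. \<Psi> (history t l \<omega>) \<and> chain t l \<omega> = Some i}"
  let ?C = "\<lambda>c. {\<omega> \<in> space M. chain t (Suc l) \<omega> = c}"
  have Am: "?A \<in> events" using history_events(2)[of "\<lambda>h. \<Psi> h \<and> last h = Some i" l] by (simp only: last_history)
  have Cm: "?C c \<in> events" for c using history_events(2)[of "\<lambda>h. last h = c" "Suc l"] by (simp only: last_history)
  have eq: "{\<omega> \<in> space M. \<Psi> (history t l \<omega>) \<and> chain t l \<omega> = Some i \<and> chain t (Suc l) \<omega> = c} = ?A \<inter> ?C c" for c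
    by blast
  have part: "?A = (?A \<inter> ?C None) \<union> (\<Union>j\<in>{1..p}. ?A \<inter> ?C (Some j))" (is "_ = ?R")
  proof (rule set_eqI)
    fix \<omega>
    show "\<omega> \<in> ?A \<longleftrightarrow> \<omega> \<in> ?R" using chain_range[of "Suc l" \<omega>] by (cases "chain t (Suc l) \<omega>") auto
  qed
  have "prob ?A = prob ((?A \<inter> ?C None) \<union> (\<Union>j\<in>{1..p}. ?A \<inter> ?C (Some j)))"
    by (rule arg_cong[OF part])
  also have "\<dots> = prob (?A \<inter> ?C None) + prob (\<Union>j\<in>{1..p}. ?A \<inter> ?C (Some j))"
  proof (rule finite_measure_Union)
    show "?A \<inter> ?C None \<in> events" by (intro sets.Int Am Cm)
    show "(\<Union>j\<in>{1..p}. ?A \<inter> ?C (Some j)) \<in> events" by (intro sets.finite_UN sets.Int Am Cm) simp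
  qed auto
  also have "prob (\<Union>j\<in>{1..p}. ?A \<inter> ?C (Some j)) = (\<Sum>j\<in>{1..p}. prob (?A \<inter> ?C (Some j)))"
  proof (rule finite_measure_finite_Union)
    show "(\<lambda>j. ?A \<inter> ?C (Some j)) ` {1..p} \<subseteq> events" using sets.Int[OF Am Cm] by blast
    show "disjoint_family_on (\<lambda>j. ?A \<inter> ?C (Some j)) {1..p}" by (auto simp: disjoint_family_on_def)
  qed simp
  also have "\<dots> = (\<Sum>j\<in>{1..p}. prob ?A * kernel t (Suc l) i j)"
    unfolding eq[symmetric] by (intro sum.cong refl frozen_markov i)
  finally have total: "prob ?A = prob (?A \<inter> ?C None) + prob ?A * (\<Sum>j\<in>{1..p}. kernel t (Suc l) i j)"
    unfolding sum_distrib_left .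
  show ?thesis unfolding eq right_diff_distrib mult_1_right
    using total by linarith
qed

lemma frozen_initial:
  assumes "j \<in> {1..p}"
  shows "prob {\<omega> \<in> space M. chain t 0 \<omega> = Some j} = \<pi> j"
  unfolding chain_def marked_chain.simps by (rule prob_pick[OF u \<pi>(1) eq_refl[OF \<pi>(2)] assms])

end

end

section \<open>Hypoexponential laws\<close>

lemma sets_erlang_law [simp, measurable_cong]: "sets (erlang_law i rate) = sets borel"
  by (simp add: erlang_law_def)

lemma space_erlang_law [simp]: "space (erlang_law i rate) = UNIV"
  by (simp add: erlang_law_def)

lemma erlang_rate:
  assumes "0 < n" "0 < \<rho>"
  shows "ereal n / ereal \<rho> \<noteq> \<infinity>" "real_of_ereal (ereal n / ereal \<rho>) = n / \<rho>"
  using assms by auto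

lemma erlang_law_pos:
  assumes "0 < n" "0 < \<rho>" "0 < i"
  shows "erlang_law i (ereal n / ereal \<rho>) = density lborel (\<lambda>x. ennreal (erlang_density (i - 1) (n / \<rho>) x))"
  using assms erlang_rate[OF assms(1,2)] by (simp add: erlang_law_def)

lemma erlang_law_degenerate:
  assumes "0 < n" "i = 0 \<or> \<rho> = 0"
  shows "erlang_law i (ereal n / ereal \<rho>) = return borel 0"
  using assms by (auto simp: erlang_law_def)

lemma prob_space_erlang_law:
  assumes "0 < n" "0 \<le> \<rho>"
  shows "prob_space (erlang_law i (ereal n / ereal \<rho>))"
proof (cases "i = 0 \<or> \<rho> = 0")
  case True
  then show ?thesis using erlang_law_degenerate[OF assms(1) True] by (simp add: prob_space_return)
next
  case False
  then show ?thesis using erlang_law_pos[of n \<rho> i] assms prob_space_erlang_density[of "n / \<rho>" "i - 1"] by simp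
qed

text \<open>Sums of independent exponential variables are Erlang distributed, and scaling by
  \<open>\<rho>\<close> divides the rate by \<open>\<rho>\<close>. The degenerate cases give the
  point mass at \<open>0\<close>.\<close>

lemma (in prob_space) distr_weighted_exponentials:
  assumes n: "0 < n" and I: "finite I" and E: "indep_vars (\<lambda>_. borel) E I"
    and exp: "\<And>l. l \<in> I \<Longrightarrow> distributed M lborel (E l) (exponential_density n)"
    and \<rho>: "0 \<le> \<rho>"
  shows "distr M borel (\<lambda>\<omega>. \<rho> * (\<Sum>l\<in>I. E l \<omega>)) = erlang_law (card I) (ereal n / ereal \<rho>)"
proof (cases "I = {} \<or> \<rho> = 0")
  case True
  then have "(\<lambda>\<omega>. \<rho> * (\<Sum>l\<in>I. E l \<omega>)) = (\<lambda>_. 0)" by auto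
  moreover have "erlang_law (card I) (ereal n / ereal \<rho>) = return borel 0"
    by (rule erlang_law_degenerate[OF n]) (use True in auto)
  moreover have "distr M borel (\<lambda>_. 0) = return borel (0::real)"
  proof (rule measure_eqI)
    fix A :: "real set" assume "A \<in> sets (distr M borel (\<lambda>_. 0::real))"
    then show "emeasure (distr M borel (\<lambda>_. 0)) A = emeasure (return borel 0) A"
      by (cases "0 \<in> A") (auto simp: emeasure_distr emeasure_space_1)
  qed simp
  ultimately show ?thesis by simp
next
  case False
  then have ne: "I \<noteq> {}" and pos: "0 < \<rho>" using \<rho> by auto
  have "distributed M lborel (\<lambda>x. \<Sum>l\<in>I. E l x) (erlang_density (card I - 1) n)"
    by (rule exponential_distributed_sum[OF I ne n exp E])
  then have "distributed M lborel (\<lambda>x. \<rho> * (\<Sum>l\<in>I. E l x)) (erlang_density (card I - 1) (n / \<rho>))"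
    by (rule erlang_distributed_mult_const[OF _ pos n])
  then have "distr M lborel (\<lambda>\<omega>. \<rho> * (\<Sum>l\<in>I. E l \<omega>)) = density lborel (\<lambda>x. ennreal (erlang_density (card I - 1) (n / \<rho>) x))"
    by (simp add: distributed_distr_eq_density)
  moreover have "distr M lborel (\<lambda>\<omega>. \<rho> * (\<Sum>l\<in>I. E l \<omega>)) = distr M borel (\<lambda>\<omega>. \<rho> * (\<Sum>l\<in>I. E l \<omega>))"
    by (rule distr_cong) auto
  ultimately show ?thesis
    using erlang_law_pos[OF n pos, of "card I"] ne I by (simp add: card_gt_0_iff)
qed

text \<open>Summands with the same state are grouped; the groups are independent, and the group of
  \<open>j\<close> is an Erlang variable whose shape is the number of visits to
  \<open>j\<close>.\<close>

lemma (in prob_space) distr_reward_sum: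
  fixes c :: "nat \<Rightarrow> nat" and \<rho> :: "nat \<Rightarrow> real"
  assumes n: "0 < n" and E: "indep_vars (\<lambda>_. borel) E {..<L}"
    and exp: "\<And>l. l < L \<Longrightarrow> distributed M lborel (E l) (exponential_density n)"
    and \<rho>: "\<And>j. j \<in> {1..p} \<Longrightarrow> 0 \<le> \<rho> j" and c: "\<And>l. l < L \<Longrightarrow> c l \<in> {1..p}" and p: "1 \<le> p"
  shows "distr M borel (\<lambda>\<omega>. \<Sum>l<L. \<rho> (c l) * E l \<omega>) =
    distr (\<Pi>\<^sub>M j\<in>{1..p}. erlang_law (card {l. l < L \<and> c l = j}) (ereal n / ereal (\<rho> j))) borel
      (\<lambda>x. \<Sum>j\<in>{1..p}. x j)"
proof -
  define K where "K j = {l. l < L \<and> c l = j}" for j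
  define T where "T j \<omega> = \<rho> j * (\<Sum>l\<in>K j. E l \<omega>)" for j \<omega>
  have K: "K j \<subseteq> {..<L}" "finite (K j)" for j by (auto simp: K_def)
  have "indep_vars (\<lambda>j. PiM (K j) (\<lambda>_. borel)) (\<lambda>j \<omega>. restrict (\<lambda>i. E i \<omega>) (K j)) {1..p}"
    by (rule indep_vars_restrict[OF E]) (auto simp: K_def disjoint_family_on_def)
  then have "indep_vars (\<lambda>_. borel) (\<lambda>j \<omega>. \<rho> j * (\<Sum>l\<in>K j. restrict (\<lambda>i. E i \<omega>) (K j) l)) {1..p}"
    by (rule indep_vars_compose2[where Y="\<lambda>j x. \<rho> j * (\<Sum>l\<in>K j. x l)"]) measurable
  then have indT: "indep_vars (\<lambda>_. borel) T {1..p}"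
    by (simp add: T_def[abs_def])
  have rvT: "T j \<in> borel_measurable M" if "j \<in> {1..p}" for j
    using indT that by (simp add: indep_vars_def2)
  have lawT: "distr M borel (T j) = erlang_law (card (K j)) (ereal n / ereal (\<rho> j))" if "j \<in> {1..p}" for j
    unfolding T_def[abs_def]
    by (rule distr_weighted_exponentials[OF n K(2) indep_vars_subset[OF E K(1)] exp \<rho>[OF that]])
      (use K in auto)
  have sum: "(\<Sum>l<L. \<rho> (c l) * E l \<omega>) = (\<Sum>j\<in>{1..p}. T j \<omega>)" for \<omega>
  proof -
    have "(\<Sum>j\<in>{1..p}. T j \<omega>) = (\<Sum>j\<in>{1..p}. \<Sum>l\<in>{l\<in>{..<L}. c l = j}. \<rho> (c l) * E l \<omega>)"
      unfolding T_def sum_distrib_left by (intro sum.cong) (auto simp: K_def)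
    also have "\<dots> = (\<Sum>l<L. \<rho> (c l) * E l \<omega>)"
      by (rule sum.group) (use c in auto)
    finally show ?thesis ..
  qed
  have PiM: "distr M (\<Pi>\<^sub>M j\<in>{1..p}. borel) (\<lambda>\<omega>. \<lambda>j\<in>{1..p}. T j \<omega>) =
      (\<Pi>\<^sub>M j\<in>{1..p}. erlang_law (card (K j)) (ereal n / ereal (\<rho> j)))"
  proof -
    have "distr M (\<Pi>\<^sub>M j\<in>{1..p}. borel) (\<lambda>\<omega>. \<lambda>j\<in>{1..p}. T j \<omega>) = (\<Pi>\<^sub>M j\<in>{1..p}. distr M borel (T j))"
      using indep_vars_iff_distr_eq_PiM'[where I="{1..p}" and M'="\<lambda>_. borel" and X=T] indT rvT p by auto
    also have "\<dots> = (\<Pi>\<^sub>M j\<in>{1..p}. erlang_law (card (K j)) (ereal n / ereal (\<rho> j)))"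
      by (intro PiM_cong refl lawT)
    finally show ?thesis .
  qed
  have "distr (distr M (\<Pi>\<^sub>M j\<in>{1..p}. borel) (\<lambda>\<omega>. \<lambda>j\<in>{1..p}. T j \<omega>)) borel (\<lambda>x. \<Sum>j\<in>{1..p}. x j) =
    distr M borel ((\<lambda>x. \<Sum>j\<in>{1..p}. x j) \<circ> (\<lambda>\<omega>. \<lambda>j\<in>{1..p}. T j \<omega>))"
    by (rule distr_distr) (use rvT in \<open>auto intro!: measurable_restrict\<close>)
  also have "(\<lambda>x. \<Sum>j\<in>{1..p}. x j) \<circ> (\<lambda>\<omega>. \<lambda>j\<in>{1..p}. T j \<omega>) = (\<lambda>\<omega>. \<Sum>l<L. \<rho> (c l) * E l \<omega>)"
    by (rule ext) (simp add: sum)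
  finally show ?thesis unfolding PiM K_def by simp
qed

subsection \<open>Reference measures\<close>

text \<open>The measure with the added atom is the sum of two measures, hence countably additive,
  and sigma-finite.\<close>

lemma atom_measure:
  defines "B \<equiv> measure_of UNIV (sets borel) (\<lambda>A. emeasure lborel A + indicator A (0::real))"
  shows "sets B = sets borel" "space B = UNIV"
    "\<And>A. A \<in> sets borel \<Longrightarrow> emeasure B A = emeasure lborel A + indicator A 0"
    "sigma_finite_measure B"
proof -
  have sp: "sigma_algebra UNIV (sets (borel :: real measure))"
    using sets.sigma_algebra_axioms[of "borel :: real measure"] by simp
  show st: "sets B = sets borel" and space: "space B = UNIV"
    unfolding B_def using sigma_algebra.sigma_sets_eq[OF sp] by simp_all
  show em: "emeasure B A = emeasure lborel A + indicator A 0" if "A \<in> sets borel" for A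
    unfolding B_def
  proof (rule emeasure_measure_of_sigma[where \<mu>="\<lambda>A. emeasure lborel A + indicator A (0::real)", OF sp])
    show "positive (sets borel) (\<lambda>A. emeasure lborel A + indicator A (0::real))"
      by (simp add: positive_def)
    show "countably_additive (sets borel) (\<lambda>A. emeasure lborel A + indicator A (0::real))"
    proof (rule countably_additiveI)
      fix A :: "nat \<Rightarrow> real set" assume A: "range A \<subseteq> sets borel" "disjoint_family A"
      have "(\<Sum>i. emeasure lborel (A i) + indicator (A i) 0) =
        (\<Sum>i. emeasure lborel (A i)) + (\<Sum>i. emeasure (return borel 0) (A i))"
        using A by (subst suminf_add[symmetric]) auto
      also have "(\<Sum>i. emeasure lborel (A i)) = emeasure lborel (\<Union>i. A i)"
        using A by (intro suminf_emeasure) auto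
      also have "(\<Sum>i. emeasure (return borel (0::real)) (A i)) = emeasure (return borel 0) (\<Union>i. A i)"
        using A by (intro suminf_emeasure) auto
      also have "emeasure (return borel (0::real)) (\<Union>i. A i) = indicator (\<Union>i. A i) 0"
        using A by (intro emeasure_return sets.countable_UN) auto
      finally show "(\<Sum>i. emeasure lborel (A i) + indicator (A i) 0) = emeasure lborel (\<Union>i. A i) + indicator (\<Union>i. A i) 0" .
    qed
  qed (use that in simp)
  show "sigma_finite_measure B"
  proof
    let ?A = "range (\<lambda>k::nat. {- real k..real k})"
    have "\<Union>?A = UNIV"
    proof (rule set_eqI)
      fix x :: real
      obtain k :: nat where "\<bar>x\<bar> \<le> real k" using real_arch_simple by blast
      then have "x \<in> {- real k..real k}" by auto
      then show "x \<in> \<Union>?A \<longleftrightarrow> x \<in> UNIV" by blast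
    qed
    moreover have "\<forall>a\<in>?A. emeasure B a \<noteq> \<infinity>"
      using em by (auto simp: indicator_def)
    ultimately show "\<exists>A. countable A \<and> A \<subseteq> sets B \<and> \<Union>A = space B \<and> (\<forall>a\<in>A. emeasure B a \<noteq> \<infinity>)"
      using st space by (intro exI[of _ ?A]) auto
  qed
qed

lemma sets_reward_base [simp, measurable_cong]: "sets (reward_base p r k) = sets borel"
  and space_reward_base [simp]: "space (reward_base p r k) = UNIV"
  and sigma_finite_reward_base: "sigma_finite_measure (reward_base p r k)"
  using atom_measure by (simp_all add: reward_base_def lborel.sigma_finite_measure_axioms)

lemma null_reward_base:
  assumes "A \<in> null_sets (reward_base p r k)"
  shows "A \<in> null_sets lborel" "(\<exists>j\<in>{1..p}. \<not> 0 < r j k) \<Longrightarrow> 0 \<notin> A"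
proof -
  have A: "A \<in> sets borel" "emeasure (reward_base p r k) A = 0"
    using assms by (auto simp: null_sets_def)
  have atom: "emeasure lborel A = 0 \<and> (indicator A (0::real) :: ennreal) = 0" if "\<not> (\<forall>j\<in>{1..p}. 0 < r j k)"
  proof -
    have "reward_base p r k = measure_of UNIV (sets borel) (\<lambda>A. emeasure lborel A + indicator A 0)"
      unfolding reward_base_def using that by (rule if_not_P)
    then have "emeasure lborel A + indicator A (0::real) = 0"
      using A(2) atom_measure(3)[OF A(1)] by simp
    then show ?thesis by (simp only: add_eq_0_iff_both_eq_0 zero_le)
  qed
  show "A \<in> null_sets lborel"
  proof (cases "\<forall>j\<in>{1..p}. 0 < r j k")
    case True
    then have "reward_base p r k = lborel" unfolding reward_base_def by (rule if_P)
    then show ?thesis using A by (simp add: null_sets_def)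
  next
    case False
    then show ?thesis using A(1) atom by (simp add: null_sets_def)
  qed
  show "0 \<notin> A" if "\<exists>j\<in>{1..p}. \<not> 0 < r j k"
    using atom that by (auto simp: indicator_def split: if_splits)
qed

text \<open>One absolutely continuous summand is enough: conditionally on the others, the sum is a
  translate of it.\<close>

lemma emeasure_sum_of_independent_null:
  fixes \<mu> :: "nat \<Rightarrow> real measure"
  assumes "finite J" "j0 \<notin> J" and \<mu>: "\<And>j. prob_space (\<mu> j)" "\<And>j. sets (\<mu> j) = sets borel"
    and ac: "\<mu> j0 = density lborel f" "f \<in> borel_measurable borel"
    and A: "A \<in> null_sets lborel"
  shows "emeasure (distr (PiM (insert j0 J) \<mu>) borel (\<lambda>x. \<Sum>j\<in>insert j0 J. x j)) A = 0"
proof -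
  interpret product_sigma_finite \<mu>
    by (rule product_sigma_finite.intro) (rule prob_space_imp_sigma_finite[OF \<mu>(1)])
  have [measurable_cong]: "sets (\<mu> j) = sets borel" for j by (rule \<mu>(2))
  have Ab: "A \<in> sets borel" using A by auto
  have m: "(\<lambda>x. \<Sum>j\<in>insert j0 J. x j) \<in> borel_measurable (PiM (insert j0 J) \<mu>)"
    by measurable
  have "emeasure (distr (PiM (insert j0 J) \<mu>) borel (\<lambda>x. \<Sum>j\<in>insert j0 J. x j)) A =
    (\<integral>\<^sup>+ x. indicator A (\<Sum>j\<in>insert j0 J. x j) \<partial>PiM (insert j0 J) \<mu>)"
  proof -
    have "emeasure (distr (PiM (insert j0 J) \<mu>) borel (\<lambda>x. \<Sum>j\<in>insert j0 J. x j)) A =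
      (\<integral>\<^sup>+ y. indicator A y \<partial>distr (PiM (insert j0 J) \<mu>) borel (\<lambda>x. \<Sum>j\<in>insert j0 J. x j))"
      using Ab by (intro nn_integral_indicator[symmetric]) simp
    also have "\<dots> = (\<integral>\<^sup>+ x. indicator A (\<Sum>j\<in>insert j0 J. x j) \<partial>PiM (insert j0 J) \<mu>)"
      using Ab by (intro nn_integral_distr[OF m]) simp
    finally show ?thesis .
  qed
  also have "\<dots> = (\<integral>\<^sup>+ x. (\<integral>\<^sup>+ y. indicator A (\<Sum>j\<in>insert j0 J. (x(j0 := y)) j) \<partial>\<mu> j0) \<partial>PiM J \<mu>)"
    by (rule product_nn_integral_insert[OF assms(1,2) measurable_compose[OF m borel_measurable_indicator[OF Ab]]])
  also have "\<dots> = (\<integral>\<^sup>+ x. 0 \<partial>PiM J \<mu>)"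
  proof (rule nn_integral_cong)
    fix x :: "nat \<Rightarrow> real"
    let ?s = "\<Sum>j\<in>J. x j"
    have sum: "(\<Sum>j\<in>insert j0 J. (x(j0 := y)) j) = ?s + y" for y
    proof -
      have "(\<Sum>j\<in>J. (x(j0 := y)) j) = ?s" by (intro sum.cong refl) (use assms(2) in auto)
      then show ?thesis using assms(1,2) by simp
    qed
    have pre: "((+) ?s) -` A \<in> sets borel" using measurable_sets[of "(+) ?s" borel borel A] Ab by simp
    have "emeasure lborel (((+) ?s) -` A) = emeasure (distr lborel borel ((+) ?s)) A"
      using Ab by (subst emeasure_distr) auto
    also have "\<dots> = 0" unfolding lborel_distr_plus using A by auto
    finally have "((+) ?s) -` A \<in> null_sets lborel" using pre by auto
    then have "AE y in lborel. y \<notin> ((+) ?s) -` A" by (rule AE_not_in)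
    then have "AE y in lborel. f y * indicator A (?s + y) = 0"
      by eventually_elim simp
    then have "(\<integral>\<^sup>+ y. f y * indicator A (?s + y) \<partial>lborel) = (\<integral>\<^sup>+ y. 0 \<partial>(lborel :: real measure))"
      by (rule nn_integral_cong_AE)
    then have "(\<integral>\<^sup>+ y. indicator A (?s + y) \<partial>\<mu> j0) = 0"
      unfolding ac(1) using ac(2) Ab by (subst nn_integral_density) auto
    then show "(\<integral>\<^sup>+ y. indicator A (\<Sum>j\<in>insert j0 J. (x(j0 := y)) j) \<partial>\<mu> j0) = 0" unfolding sum .
  qed
  finally show ?thesis by simp
qed

lemma hypoexp_law_props:
  assumes n: "0 < n" and r: "\<And>j. j \<in> {1..p} \<Longrightarrow> 0 \<le> r j k"
  shows "prob_space (hypoexp_law p n r k i)" "sets (hypoexp_law p n r k i) = sets borel"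
proof -
  have "prob_space (\<Pi>\<^sub>M j\<in>{1..p}. erlang_law (i j) (ereal (real n) / ereal (r j k)))"
    by (rule prob_space_PiM, rule prob_space_erlang_law) (use n r in simp_all)
  moreover have "(\<lambda>x. \<Sum>j\<in>{1..p}. x j) \<in> borel_measurable (\<Pi>\<^sub>M j\<in>{1..p}. erlang_law (i j) (ereal (real n) / ereal (r j k)))"
    by measurable
  ultimately show "prob_space (hypoexp_law p n r k i)"
    unfolding hypoexp_law_def by (rule prob_space.prob_space_distr)
  show "sets (hypoexp_law p n r k i) = sets borel" by (simp add: hypoexp_law_def)
qed

text \<open>If some visited state has positive reward, that summand is absolutely continuous.
  Otherwise the law is the point mass at \<open>0\<close>, and the base measure has an atom
  there.\<close>

lemma hypoexp_law_absolutely_continuous: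
  assumes n: "0 < n" and r: "\<And>j. j \<in> {1..p} \<Longrightarrow> 0 \<le> r j k" and i: "i \<in> multi_indices p"
  shows "absolutely_continuous (reward_base p r k) (hypoexp_law p n r k i)"
  unfolding absolutely_continuous_def
proof
  fix A assume A: "A \<in> null_sets (reward_base p r k)"
  note null = null_reward_base[OF A]
  have Ab: "A \<in> sets borel" using null(1) by auto
  define \<mu> where "\<mu> j = (if j \<in> {1..p} then erlang_law (i j) (ereal (real n) / ereal (r j k)) else return borel 0)" for j
  have n': "0 < real n" using n by simp
  have "prob_space (erlang_law (i j) (ereal (real n) / ereal (r j k)))" if "j \<in> {1..p}" for j
    by (rule prob_space_erlang_law[OF n' r[OF that]])
  then have \<mu>: "prob_space (\<mu> j)" "sets (\<mu> j) = sets borel" for j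
    unfolding \<mu>_def by (cases "j \<in> {1..p}", simp_all only: if_True if_False) (simp_all add: prob_space_return)
  have law: "hypoexp_law p n r k i = distr (PiM {1..p} \<mu>) borel (\<lambda>x. \<Sum>j\<in>{1..p}. x j)"
    unfolding hypoexp_law_def by (intro distr_cong PiM_cong refl) (auto simp: \<mu>_def)
  have "emeasure (hypoexp_law p n r k i) A = 0"
  proof (cases "\<exists>j0\<in>{1..p}. 0 < i j0 \<and> 0 < r j0 k")
    case True
    then obtain j0 where j0: "j0 \<in> {1..p}" "0 < i j0" "0 < r j0 k" by blast
    have ins: "{1..p} = insert j0 ({1..p} - {j0})" using j0 by blast
    have \<mu>_j0: "\<mu> j0 = density lborel (\<lambda>x. ennreal (erlang_density (i j0 - 1) (real n / r j0 k) x))"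
      unfolding \<mu>_def using j0 erlang_law_pos[OF n' j0(3,2)] by simp
    show ?thesis unfolding law
      by (subst (1 2) ins)
        (rule emeasure_sum_of_independent_null[of "{1..p} - {j0}" j0 \<mu>, OF _ _ \<mu>(1) \<mu>(2) \<mu>_j0 _ null(1)], simp_all)
  next
    case False
    then have deg: "i j = 0 \<or> r j k = 0" if "j \<in> {1..p}" for j using r[OF that] that by force
    have "0 < (\<Sum>a\<in>{1..p}. i a)" using i by (simp add: multi_indices_def)
    then obtain a where "a \<in> {1..p}" "i a \<noteq> 0" by (metis less_numeral_extra(3) sum.neutral)
    then have "\<exists>j\<in>{1..p}. \<not> 0 < r j k" using deg by force
    then have "0 \<notin> A" by (rule null(2))
    have "AE x in PiM {1..p} \<mu>. x j = 0" if "j \<in> {1..p}" for j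
    proof (rule AE_PiM_component[OF \<mu>(1) that])
      have ret: "\<mu> j = return borel 0" unfolding \<mu>_def using that erlang_law_degenerate[OF n' deg[OF that]] by simp
      show "AE x in \<mu> j. x = 0" unfolding ret by (subst AE_return) simp_all
    qed
    then have "AE x in PiM {1..p} \<mu>. \<forall>j\<in>{1..p}. x j = 0" by (intro AE_finite_allI) auto
    then have "AE x in PiM {1..p} \<mu>. (\<Sum>j\<in>{1..p}. x j) \<notin> A"
      by eventually_elim (use \<open>0 \<notin> A\<close> in simp)
    moreover have m: "(\<lambda>x. \<Sum>j\<in>{1..p}. x j) \<in> borel_measurable (PiM {1..p} \<mu>)"
    proof -
      have [measurable_cong]: "sets (\<mu> j) = sets borel" for j by (rule \<mu>(2))
      show ?thesis by measurable
    qed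
    ultimately have "AE y in hypoexp_law p n r k i. y \<notin> A"
      unfolding law using Ab by (subst AE_distr_iff[OF m]) auto
    moreover have "A \<in> sets (hypoexp_law p n r k i)"
      using Ab hypoexp_law_props(2)[where r=r and k=k, OF n r] by simp
    ultimately have "A \<in> null_sets (hypoexp_law p n r k i)" by (simp only: AE_iff_null_sets)
    then show ?thesis by (rule null_setsD1)
  qed
  then show "A \<in> null_sets (hypoexp_law p n r k i)"
    using Ab hypoexp_law_props(2)[where r=r and k=k, OF n r] by (auto simp: null_sets_def)
qed

lemma hypoexp_density:
  assumes n: "0 < n" and r: "\<And>j. j \<in> {1..p} \<Longrightarrow> 0 \<le> r j k" and i: "i \<in> multi_indices p"
  shows "hypoexp_dens p n r k i \<in> borel_measurable (reward_base p r k)"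
    and "density (reward_base p r k) (hypoexp_dens p n r k i) = hypoexp_law p n r k i"
proof -
  interpret sigma_finite_measure "reward_base p r k" by (rule sigma_finite_reward_base)
  show "hypoexp_dens p n r k i \<in> borel_measurable (reward_base p r k)"
    unfolding hypoexp_dens_def by simp
  show "density (reward_base p r k) (hypoexp_dens p n r k i) = hypoexp_law p n r k i"
    unfolding hypoexp_dens_def
    by (rule density_RN_deriv[OF hypoexp_law_absolutely_continuous[where r=r and k=k, OF n r i]])
      (use hypoexp_law_props(2)[where r=r and k=k, OF n r] in simp_all)
qed

text \<open>Both sides agree on boxes by Fubini.\<close>

lemma density_PiM:
  assumes R: "product_sigma_finite R" and I: "finite I"
    and f: "\<And>k. f k \<in> borel_measurable (R k)" and D: "\<And>k. prob_space (density (R k) (f k))"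
  shows "density (PiM I R) (\<lambda>x. \<Prod>k\<in>I. f k (x k)) = (\<Pi>\<^sub>M k\<in>I. density (R k) (f k))"
proof -
  interpret R: product_sigma_finite R by (rule R)
  interpret D: product_sigma_finite "\<lambda>k. density (R k) (f k)"
    by (rule product_sigma_finite.intro) (rule prob_space_imp_sigma_finite[OF D])
  note f[measurable]
  show ?thesis
  proof (rule D.PiM_eqI[OF I])
    show "sets (density (PiM I R) (\<lambda>x. \<Prod>k\<in>I. f k (x k))) = sets (\<Pi>\<^sub>M k\<in>I. density (R k) (f k))"
      by (simp, intro sets_PiM_cong) simp_all
    fix A assume A: "\<And>i. i \<in> I \<Longrightarrow> A i \<in> sets (density (R i) (f i))"
    have box: "Pi\<^sub>E I A \<in> sets (PiM I R)" using A I by (intro sets_PiM_I_finite) auto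
    have "emeasure (density (PiM I R) (\<lambda>x. \<Prod>k\<in>I. f k (x k))) (Pi\<^sub>E I A) =
      (\<integral>\<^sup>+x. (\<Prod>k\<in>I. f k (x k)) * indicator (Pi\<^sub>E I A) x \<partial>PiM I R)"
      by (rule emeasure_density[OF _ box]) measurable
    also have "\<dots> = (\<integral>\<^sup>+x. (\<Prod>k\<in>I. f k (x k) * indicator (A k) (x k)) \<partial>PiM I R)"
    proof (rule nn_integral_cong)
      fix x assume x: "x \<in> space (PiM I R)"
      have "(\<Prod>k\<in>I. indicator (A k) (x k)) = (indicator (Pi\<^sub>E I A) x :: ennreal)"
      proof (cases "x \<in> Pi\<^sub>E I A")
        case True
        then show ?thesis by (auto simp: PiE_iff intro!: prod.neutral)
      next
        case False
        then obtain k where k: "k \<in> I" "x k \<notin> A k" using x by (auto simp: space_PiM PiE_iff)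
        have "(\<Prod>k\<in>I. indicator (A k) (x k)) = (0 :: ennreal)"
          using I k(1) by (rule prod_zero[OF _ bexI[rotated]]) (use k(2) in simp)
        then show ?thesis using False by simp
      qed
      then show "(\<Prod>k\<in>I. f k (x k)) * indicator (Pi\<^sub>E I A) x = (\<Prod>k\<in>I. f k (x k) * indicator (A k) (x k))"
        by (simp add: prod.distrib)
    qed
    also have "\<dots> = (\<Prod>k\<in>I. \<integral>\<^sup>+x. f k x * indicator (A k) x \<partial>R k)"
      using A by (intro R.product_nn_integral_prod[OF I]) auto
    also have "\<dots> = (\<Prod>k\<in>I. emeasure (density (R k) (f k)) (A k))"
      using A by (intro prod.cong refl emeasure_density[symmetric]) auto
    finally show "emeasure (density (PiM I R) (\<lambda>x. \<Prod>k\<in>I. f k (x k))) (Pi\<^sub>E I A) =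
      (\<Prod>k\<in>I. emeasure (density (R k) (f k)) (A k))" .
  qed
qed

section \<open>Independence of marks, choices and reward clocks\<close>

context prob_space
begin

lemma indep_set_collect:
  assumes F: "indep_sets F I" and st: "\<And>i. i \<in> I \<Longrightarrow> Int_stable (F i)"
    and "A \<subseteq> I" "B \<subseteq> I" "A \<inter> B = {}"
  shows "indep_set (sigma_sets (space M) (\<Union>i\<in>A. F i)) (sigma_sets (space M) (\<Union>i\<in>B. F i))"
proof -
  have "indep_sets (\<lambda>j. sigma_sets (space M) (\<Union>i\<in>case_bool A B j. F i)) UNIV"
  proof (rule indep_sets_collect_sigma)
    show "indep_sets F (\<Union>j\<in>UNIV. case_bool A B j)"
      by (rule indep_sets_mono_index[OF _ F]) (use assms(3,4) in \<open>auto simp: UNIV_bool\<close>)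
    show "disjoint_family_on (case_bool A B) UNIV"
      using assms(5) unfolding disjoint_family_on_def by (auto split: bool.split)
    show "Int_stable (F i)" if "i \<in> case_bool A B j" for i j
      using that assms(3,4) by (intro st) (auto split: bool.splits)
  qed
  then show ?thesis
    unfolding indep_set_def by (rule indep_sets_mono_sets) (auto split: bool.split)
qed

lemma indep_set_mono:
  assumes "indep_set A B" "A' \<subseteq> A" "B' \<subseteq> B"
  shows "indep_set A' B'"
  using assms(1) unfolding indep_set_def
  by (rule indep_sets_mono_sets) (use assms(2,3) in \<open>auto split: bool.split\<close>)

lemma process_algebra_le:
  assumes N: "\<And>t. 0 \<le> t \<Longrightarrow> N t \<in> measurable A (count_space UNIV)" and A: "subalgebra M A"
  shows "sets (process_algebra M N) \<subseteq> sets A"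
proof -
  have sp: "space A = space M" using A by (simp add: subalgebra_def)
  have "N t \<in> measurable M (count_space UNIV)" if "0 \<le> t" for t
    by (rule measurable_from_subalg[OF A N[OF that]])
  then have NM: "\<forall>t\<ge>0. N t \<in> measurable M (count_space UNIV)" by blast
  have "N t -` B \<inter> space M \<in> sets A" if "0 \<le> t" for t B
    using measurable_sets[OF N[OF that], of B] by (simp add: sp)
  then have "{N t -` B \<inter> space M | t B. 0 \<le> t} \<subseteq> sets A" by auto
  from sets.sigma_sets_subset[OF this] show ?thesis
    unfolding process_algebra_props(2)[OF NM] sp .
qed

lemma sum_measurable_generated:
  assumes L: "finite L" and X: "\<And>l. l \<in> L \<Longrightarrow> \<forall>t\<ge>0. X l t \<in> measurable M (count_space UNIV)"
    and sub: "\<And>l. l \<in> L \<Longrightarrow> sets (process_algebra M (X l)) \<subseteq> sets A" and A: "subalgebra M A"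
  shows "sets (process_algebra M (\<lambda>t \<omega>. \<Sum>l\<in>L. X l t \<omega> :: nat)) \<subseteq> sets A"
proof (rule process_algebra_le[OF _ A])
  fix t :: real assume t: "0 \<le> t"
  have sp: "space A = space M" using A by (simp add: subalgebra_def)
  have "X l t \<in> measurable A (count_space UNIV)" if l: "l \<in> L" for l
  proof (rule measurableI)
    fix B
    have "X l t -` B \<inter> space M \<in> sets (process_algebra M (X l))"
      unfolding process_algebra_props(2)[OF X[OF l]] using t by (intro sigma_sets.Basic) blast
    then show "X l t -` B \<inter> space A \<in> sets A" unfolding sp using sub[OF l] by blast
  qed simp
  with L show "(\<lambda>\<omega>. \<Sum>l\<in>L. X l t \<omega>) \<in> measurable A (count_space UNIV)"
  proof (induction L rule: finite_induct)
    case (insert l L)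
    then have "(\<lambda>\<omega>. X l t \<omega> + (\<Sum>l\<in>L. X l t \<omega>)) \<in> measurable A (count_space UNIV)"
      by (intro measurable_count_space_add) auto
    then show ?case using insert by simp
  qed simp
qed

lemma generated_subalgebra:
  assumes "E \<subseteq> events"
  shows "subalgebra M (sigma (space M) E)" "sets (sigma (space M) E) = sigma_sets (space M) E"
proof -
  have "E \<subseteq> Pow (space M)" using assms sets.sets_into_space by blast
  then show *: "sets (sigma (space M) E) = sigma_sets (space M) E" by (rule sets_measure_of)
  show "subalgebra M (sigma (space M) E)"
    unfolding subalgebra_def * using sets.sigma_sets_subset[OF assms] \<open>E \<subseteq> Pow (space M)\<close> by (simp add: space_measure_of)
qed

text \<open>The finite sum of unit-rate clocks is built one clock at a time; each new clock is
  independent of the sum so far.\<close>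

lemma superposed_grid:
  fixes F :: "'i \<Rightarrow> 'a set set" and c :: "nat \<Rightarrow> 'i"
  assumes F: "indep_sets F I" and st: "\<And>i. i \<in> I \<Longrightarrow> Int_stable (F i)"
    and c0: "c0 \<in> I" and L: "finite L" and c: "\<And>l. l \<in> L \<Longrightarrow> c l \<in> I" "inj_on c L" "c0 \<notin> c ` L"
    and F0: "F c0 = sets (process_algebra M X)" and FL: "\<And>l. l \<in> L \<Longrightarrow> F (c l) = sets (process_algebra M (X' l))"
    and X': "\<And>l. l \<in> L \<Longrightarrow> poisson_grid M 1 (X' l)"
  shows "poisson_grid M (card L) (\<lambda>t \<omega>. \<Sum>l\<in>L. X' l t \<omega>)"
    and "indep_set (sets (process_algebra M X)) (sets (process_algebra M (\<lambda>t \<omega>. \<Sum>l\<in>L. X' l t \<omega>)))"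
proof -
  have ev: "F i \<subseteq> events" if "i \<in> I" for i using F that by (auto simp: indep_sets_def)
  have sum_le: "sets (process_algebra M (\<lambda>t \<omega>. \<Sum>l\<in>K. X' l t \<omega>)) \<subseteq> sigma_sets (space M) (\<Union>i\<in>c ` K. F i)"
    if K: "K \<subseteq> L" for K
  proof -
    have "(\<Union>i\<in>c ` K. F i) \<subseteq> events" using ev c(1) K by blast
    note gen = generated_subalgebra[OF this]
    have X'm: "\<forall>t\<ge>0. X' l t \<in> measurable M (count_space UNIV)" if "l \<in> K" for l
      using X'[of l] that K by (auto simp: poisson_grid_def)
    have "sets (process_algebra M (X' l)) \<subseteq> sets (sigma (space M) (\<Union>i\<in>c ` K. F i))" if "l \<in> K" for l
      unfolding gen(2) using FL[of l] that K by (intro subsetI sigma_sets.Basic) blast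
    from sum_measurable_generated[OF finite_subset[OF K L] X'm this gen(1)]
    show ?thesis unfolding gen(2) .
  qed
  have self: "F i \<subseteq> sigma_sets (space M) (\<Union>i\<in>{i}. F i)" for i by auto
  have indep_with: "indep_set (F i) (sets (process_algebra M (\<lambda>t \<omega>. \<Sum>l\<in>K. X' l t \<omega>)))"
    if "i \<in> I" "K \<subseteq> L" "i \<notin> c ` K" for i K
  proof (rule indep_set_mono[OF indep_set_collect[OF F st, of "{i}" "c ` K"] self sum_le])
    show "c ` K \<subseteq> I" using c(1) that(2) by blast
  qed (use that in auto)
  show "indep_set (sets (process_algebra M X)) (sets (process_algebra M (\<lambda>t \<omega>. \<Sum>l\<in>L. X' l t \<omega>)))"
    using indep_with[OF c0 order_refl c(3)] unfolding F0 .
  have "K \<subseteq> L \<Longrightarrow> poisson_grid M (card K) (\<lambda>t \<omega>. \<Sum>l\<in>K. X' l t \<omega>)" if "finite K" for K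
    using that
  proof (induction K rule: finite_induct)
    case empty
    then show ?case using poisson_grid_zero[OF prob_space_axioms] by simp
  next
    case (insert l K)
    then have l: "l \<in> L" "K \<subseteq> L" by auto
    have "c l \<notin> c ` K" using insert c(2) l by (auto dest: inj_onD)
    from indep_with[OF c(1)[OF l(1)] l(2) this] have "indep_set (sets (process_algebra M (X' l))) (sets (process_algebra M (\<lambda>t \<omega>. \<Sum>l\<in>K. X' l t \<omega>)))"
      unfolding FL[OF l(1)] .
    from poisson_grid_add[OF prob_space_axioms X'[OF l(1)] insert.IH[OF l(2)] this]
    show ?case using insert by simp
  qed
  from this[OF L order_refl] show "poisson_grid M (card L) (\<lambda>t \<omega>. \<Sum>l\<in>L. X' l t \<omega>)" .
qed

text \<open>Padding with the whole space reduces the product formula for arbitrary finite index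
  sets to larger, more convenient ones.\<close>

lemma indep_sets_of_finite:
  assumes I: "\<And>K. finite K \<Longrightarrow> K \<subseteq> I \<Longrightarrow> \<exists>K'. K \<subseteq> K' \<and> finite K' \<and> K' \<noteq> {} \<and> K' \<subseteq> I \<and>
      (\<forall>A\<in>Pi K' F. prob (\<Inter>j\<in>K'. A j) = (\<Prod>j\<in>K'. prob (A j)))"
    and F: "\<And>i. i \<in> I \<Longrightarrow> F i \<subseteq> events" "\<And>i. i \<in> I \<Longrightarrow> space M \<in> F i"
  shows "indep_sets F I"
proof (subst indep_sets_finite_index_sets, intro allI impI)
  fix K assume K: "K \<subseteq> I" "K \<noteq> {}" "finite K"
  obtain K' where K': "K \<subseteq> K'" "finite K'" "K' \<noteq> {}" "K' \<subseteq> I"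
    "\<forall>A\<in>Pi K' F. prob (\<Inter>j\<in>K'. A j) = (\<Prod>j\<in>K'. prob (A j))"
    using I[OF K(3,1)] by blast
  have "indep_sets F K'"
    by (subst indep_sets_finite[OF K'(3,2)]) (use F K'(4,5) in auto)
  then show "indep_sets F K" by (rule indep_sets_mono_index[OF K'(1)])
qed

text \<open>The marks and the clock come from the same block of sources. Within the block they
  factorise by thinning, and the blocks are independent of each other.\<close>

lemma noise_independent:
  fixes b :: "nat \<Rightarrow> 'a \<Rightarrow> bool" and u :: "nat \<Rightarrow> 'a \<Rightarrow> real"
  assumes blocks: "indep_sets B ({Clock} \<union> range Unif \<union> Reward_Clock ` {1..m})"
    and Bc: "\<And>A C. A \<in> B Clock \<Longrightarrow> C \<in> B Clock \<Longrightarrow> A \<inter> C \<in> B Clock" "sets G \<subseteq> B Clock"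
      "\<And>l V. 1 \<le> l \<Longrightarrow> {\<omega> \<in> space M. b l \<omega> \<in> V} \<in> B Clock"
    and Bu: "\<And>l. {u l -` V \<inter> space M | V. V \<in> sets borel} \<subseteq> B (Unif l)"
    and Bh: "\<And>k. H k \<subseteq> B (Reward_Clock k)" "\<And>k. space M \<in> H k"
    and G: "space G = space M"
    and marks: "\<And>A l V. A \<in> sets G \<Longrightarrow>
      prob (A \<inter> {\<omega> \<in> space M. \<forall>i<l. b (Suc i) \<omega> \<in> V i}) = prob A * (\<Prod>i<l. \<beta> (V i))"
    and \<beta>: "\<beta> UNIV = 1"
  shows "indep_sets (noise_events M G b u H) (noise_sources m)"
proof (rule indep_sets_of_finite)
  let ?F = "noise_events M G b u H"
  have Bev: "B x \<subseteq> events" if "x \<in> {Clock} \<union> range Unif \<union> Reward_Clock ` {1..m}" for x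
    using blocks that by (auto simp: indep_sets_def)
  show "?F i \<subseteq> events" if "i \<in> noise_sources m" for i
  proof (cases i)
    case Clock
    then show ?thesis using subset_trans[OF Bc(2) Bev[of Clock]] by simp
  next
    case (Extra_Clock l)
    then have "1 \<le> l" using that by (auto simp: noise_sources_def)
    have "B Clock \<subseteq> events" by (rule Bev) simp
    then have "{\<omega> \<in> space M. b l \<omega> \<in> V} \<in> events" for V using Bc(3)[OF \<open>1 \<le> l\<close>] by (rule subsetD)
    then show ?thesis unfolding Extra_Clock by auto
  next
    case (Unif l)
    then show ?thesis using subset_trans[OF Bu Bev[of "Unif l"]] by simp
  next
    case (Reward_Clock k)
    then have "k \<in> {1..m}" using that by (auto simp: noise_sources_def)
    then show ?thesis using subset_trans[OF Bh(1) Bev[of "Reward_Clock k"]] Reward_Clock by simp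
  qed simp
  have "space M \<in> {u l -` V \<inter> space M | V. V \<in> sets borel}" for l
    by (intro CollectI exI[of _ UNIV]) auto
  moreover have "space M \<in> {{\<omega> \<in> space M. b l \<omega> \<in> V} | V. True}" for l
    by (intro CollectI exI[of _ UNIV]) auto
  moreover have "space M \<in> sets G" using sets.top[of G] G by simp
  ultimately show "space M \<in> ?F i" if "i \<in> noise_sources m" for i
    using that Bh(2) by (auto simp: noise_sources_def simp del: mem_Collect_eq)
  fix K assume K: "finite K" "K \<subseteq> noise_sources m"
  define g :: "source \<Rightarrow> nat" where "g x = (case x of Extra_Clock l \<Rightarrow> l | Unif l \<Rightarrow> l | _ \<Rightarrow> 0)" for x
  define l where "l = Max (insert 0 (g ` K))"
  have gl: "g x \<le> l" if "x \<in> K" for x unfolding l_def using K(1) that by (intro Max_ge) auto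
  let ?K1 = "insert Clock (Extra_Clock ` {1..l})" and ?K2 = "Unif ` {..l} \<union> Reward_Clock ` {1..m}"
  let ?K = "?K1 \<union> ?K2"
  show "\<exists>K'. K \<subseteq> K' \<and> finite K' \<and> K' \<noteq> {} \<and> K' \<subseteq> noise_sources m \<and>
      (\<forall>A\<in>Pi K' ?F. prob (\<Inter>j\<in>K'. A j) = (\<Prod>j\<in>K'. prob (A j)))"
  proof (intro exI[of _ ?K] conjI ballI)
    show "K \<subseteq> ?K"
    proof
      fix x assume x: "x \<in> K"
      then show "x \<in> ?K" using K(2) gl[OF x] by (cases x) (auto simp: noise_sources_def g_def)
    qed
    show "?K \<subseteq> noise_sources m" by (auto simp: noise_sources_def)
    fix A assume A: "A \<in> Pi ?K ?F"
    have AC: "A Clock \<in> sets G" using Pi_mem[OF A, of Clock] by simp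
    have "\<forall>i\<in>{..<l}. \<exists>V. A (Extra_Clock (Suc i)) = {\<omega> \<in> space M. b (Suc i) \<omega> \<in> V}"
    proof
      fix i assume "i \<in> {..<l}"
      then have "Suc i \<in> {1..l}" by auto
      then have "Extra_Clock (Suc i) \<in> ?K" by blast
      from Pi_mem[OF A this] have "A (Extra_Clock (Suc i)) \<in> {{\<omega> \<in> space M. b (Suc i) \<omega> \<in> V} | V. True}"
        unfolding noise_events.simps .
      then show "\<exists>V. A (Extra_Clock (Suc i)) = {\<omega> \<in> space M. b (Suc i) \<omega> \<in> V}" by (elim CollectE exE conjE) (rule exI)
    qed
    from bchoice[OF this] obtain V where V: "\<And>i. i < l \<Longrightarrow> A (Extra_Clock (Suc i)) = {\<omega> \<in> space M. b (Suc i) \<omega> \<in> V i}"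
      by auto
    have ACs: "A Clock \<subseteq> space M" using sets.sets_into_space[OF AC] G by simp
    have range: "{1..l} = Suc ` {..<l}" by (simp add: image_Suc_lessThan)
    have W: "(\<Inter>j\<in>?K1. A j) = A Clock \<inter> {\<omega> \<in> space M. \<forall>i<l. b (Suc i) \<omega> \<in> V i}"
    proof -
      have "(\<Inter>j\<in>?K1. A j) = A Clock \<inter> (\<Inter>i\<in>{..<l}. A (Extra_Clock (Suc i)))"
        unfolding range by (simp only: INT_insert image_image INT_extend_simps)
      also have "(\<Inter>i\<in>{..<l}. A (Extra_Clock (Suc i))) = (\<Inter>i\<in>{..<l}. {\<omega> \<in> space M. b (Suc i) \<omega> \<in> V i})"
        by (intro INF_cong refl V) simp
      finally have "(\<Inter>j\<in>?K1. A j) = A Clock \<inter> (\<Inter>i\<in>{..<l}. {\<omega> \<in> space M. b (Suc i) \<omega> \<in> V i})" .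
      moreover have "E \<subseteq> \<Omega> \<Longrightarrow> E \<inter> (\<Inter>i\<in>{..<l}. {\<omega> \<in> \<Omega>. P i \<omega>}) = E \<inter> {\<omega> \<in> \<Omega>. \<forall>i<l. P i \<omega>}"
        for E \<Omega> :: "'a set" and P by auto
      ultimately show ?thesis using ACs by (simp only:)
    qed
    have single: "prob {\<omega> \<in> space M. b (Suc i) \<omega> \<in> W} = \<beta> W" if "i < l" for i W
    proof -
      let ?V = "\<lambda>j. if j = i then W else UNIV"
      have all: "(\<forall>j<l. b (Suc j) \<omega> \<in> ?V j) = (b (Suc i) \<omega> \<in> W)" for \<omega>
      proof
        assume "\<forall>j<l. b (Suc j) \<omega> \<in> ?V j"
        then have "b (Suc i) \<omega> \<in> ?V i" using that by blast
        then show "b (Suc i) \<omega> \<in> W" by simp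
      qed simp
      have "{\<omega> \<in> space M. b (Suc i) \<omega> \<in> W} = space G \<inter> {\<omega> \<in> space M. \<forall>j<l. b (Suc j) \<omega> \<in> ?V j}"
        unfolding all G by blast
      then have "prob {\<omega> \<in> space M. b (Suc i) \<omega> \<in> W} = prob (space G) * (\<Prod>j<l. \<beta> (?V j))"
        by (simp only: marks[OF sets.top])
      also have "(\<Prod>j<l. \<beta> (?V j)) = (\<Prod>j<l. if j = i then \<beta> W else 1)"
        by (intro prod.cong refl) (simp add: \<beta>)
      finally show ?thesis using that G by (simp add: prob_space)
    qed
    have p1: "prob (\<Inter>j\<in>?K1. A j) = (\<Prod>j\<in>?K1. prob (A j))"
    proof -
      have "(\<Prod>j\<in>?K1. prob (A j)) = prob (A Clock) * (\<Prod>j\<in>Extra_Clock ` Suc ` {..<l}. prob (A j))"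
        unfolding range by (subst prod.insert) auto
      also have "(\<Prod>j\<in>Extra_Clock ` Suc ` {..<l}. prob (A j)) = (\<Prod>i<l. prob (A (Extra_Clock (Suc i))))"
        unfolding image_image by (subst prod.reindex) (auto simp: inj_on_def)
      also have "\<dots> = (\<Prod>i<l. \<beta> (V i))" by (intro prod.cong refl) (simp add: V single)
      finally show ?thesis unfolding W marks[OF AC] ..
    qed
    have WB: "(\<Inter>j\<in>?K1. A j) \<in> B Clock"
    proof -
      have "A Clock \<inter> {\<omega> \<in> space M. \<forall>i<j. b (Suc i) \<omega> \<in> V i} \<in> B Clock" if "j \<le> l" for j
        using that
      proof (induction j)
        case 0
        then show ?case using AC Bc(2) ACs by (auto simp: Int_absorb2)
      next
        case (Suc j)
        have "A Clock \<inter> {\<omega> \<in> space M. \<forall>i<Suc j. b (Suc i) \<omega> \<in> V i} =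
          (A Clock \<inter> {\<omega> \<in> space M. \<forall>i<j. b (Suc i) \<omega> \<in> V i}) \<inter> {\<omega> \<in> space M. b (Suc j) \<omega> \<in> V j}"
          by (auto simp: less_Suc_eq)
        then show ?case using Suc Bc(1,3) by simp
      qed
      then show ?thesis unfolding W by simp
    qed
    define A' where "A' = A(Clock := (\<Inter>j\<in>?K1. A j))"
    let ?J = "insert Clock ?K2"
    have "prob (\<Inter>j\<in>?J. A' j) = (\<Prod>j\<in>?J. prob (A' j))"
    proof (rule indep_setsD[OF blocks])
      show "?J \<subseteq> {Clock} \<union> range Unif \<union> Reward_Clock ` {1..m}" by auto
      show "\<forall>j\<in>?J. A' j \<in> B j"
      proof
        fix j assume j: "j \<in> ?J"
        show "A' j \<in> B j"
        proof (cases "j = Clock")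
          case False
          then have "j \<in> ?K2" "A' j = A j" using j by (auto simp: A'_def)
          moreover have "A j \<in> ?F j" using Pi_mem[OF A] \<open>j \<in> ?K2\<close> by blast
          moreover have "?F j \<subseteq> B j"
          proof -
            consider l where "j = Unif l" | k where "j = Reward_Clock k" using \<open>j \<in> ?K2\<close> by blast
            then show ?thesis by cases (simp_all only: noise_events.simps Bu Bh(1))
          qed
          ultimately show ?thesis by (simp only: subsetD)
        qed (use WB in \<open>simp add: A'_def\<close>)
      qed
    qed auto
    moreover have "(\<Inter>j\<in>?J. A' j) = (\<Inter>j\<in>?K. A j)" unfolding A'_def by auto
    moreover have "(\<Prod>j\<in>?J. prob (A' j)) = (\<Prod>j\<in>?K1. prob (A j)) * (\<Prod>j\<in>?K2. prob (A j))"
    proof -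
      have "(\<Prod>j\<in>?K2. prob (A' j)) = (\<Prod>j\<in>?K2. prob (A j))" by (intro prod.cong refl) (auto simp: A'_def)
      moreover have "(\<Prod>j\<in>?J. prob (A' j)) = prob (A' Clock) * (\<Prod>j\<in>?K2. prob (A' j))"
        by (rule prod.insert) auto
      moreover have "A' Clock = (\<Inter>j\<in>?K1. A j)" unfolding A'_def by (rule fun_upd_same)
      ultimately show ?thesis by (simp only: p1)
    qed
    moreover have "(\<Prod>j\<in>?K. prob (A j)) = (\<Prod>j\<in>?K1. prob (A j)) * (\<Prod>j\<in>?K2. prob (A j))"
      by (rule prod.union_disjoint) auto
    ultimately show "prob (\<Inter>j\<in>?K. A j) = (\<Prod>j\<in>?K. prob (A j))" by simp
  qed auto
qed

end

section \<open>Total rewards along a path\<close>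

text \<open>With every arrival marked, no arrival is skipped; measurability of the embedded chain
  is inherited this way.\<close>

lemma embedded_chain_as_marked_chain:
  "embedded_chain p S \<pi> N U l \<omega> =
    marked_chain p S \<pi> (real (base_intensity p S)) (\<lambda>l. arrival N l \<omega>) (\<lambda>_. True) (\<lambda>l. U l \<omega>) l"
proof (induction l)
  case (Suc l)
  have "{i \<in> {1..Suc l}. True} = {1..Suc l}" by auto
  then have "card {i \<in> {1..Suc l}. True} = Suc l" by (simp only: card_atLeastAtMost diff_Suc_1)
  with Suc show ?case by (simp only: embedded_chain.simps marked_chain.simps if_True)
qed simp

text \<open>The state is constant between consecutive arrivals, so the integral is a finite
  sum.\<close>

lemma total_reward_regular:
  fixes c :: "nat \<Rightarrow> nat option"
  assumes f: "regular_path f" and J: "\<And>t. J t \<omega> = c (f t)"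
    and L: "\<And>l. c l = None \<longleftrightarrow> L \<le> l"
  shows "total_reward \<rho> J \<omega> = (\<Sum>l<L. \<rho> (the (c l)) * (path_arrival f (Suc l) - path_arrival f l))"
proof -
  let ?a = "path_arrival f"
  let ?g = "\<lambda>t. case c (f t) of None \<Rightarrow> 0 | Some i \<Rightarrow> \<rho> i"
  have "{t. 0 \<le> t \<and> J t \<omega> = None} = {?a L..}"
  proof (rule set_eqI)
    fix t
    show "t \<in> {t. 0 \<le> t \<and> J t \<omega> = None} \<longleftrightarrow> t \<in> {?a L..}"
      using regular_arrival_le_iff[OF f, of t L] path_arrival_nonneg[of f L] J L by auto
  qed
  then have \<tau>: "termination_time J \<omega> = ?a L"
    unfolding termination_time_def by simp
  have pt: "indicator {0..<?a L} t *\<^sub>R ?g t = (\<Sum>l<L. \<rho> (the (c l)) * indicator {?a l..<?a (Suc l)} t)" for t :: real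
  proof (cases "0 \<le> t")
    case True
    have ind: "indicator {?a l..<?a (Suc l)} t = (if l = f t then 1 else 0 :: real)" for l
      using regular_between_arrivals[OF f True, of l] by (auto simp: indicator_def)
    have "(\<Sum>l<L. \<rho> (the (c l)) * indicator {?a l..<?a (Suc l)} t) = (if f t < L then \<rho> (the (c (f t))) else 0)"
      unfolding ind by (simp add: if_distrib[where f="(*) _"] sum.delta cong: if_cong)
    moreover have "t < ?a L \<longleftrightarrow> f t < L" by (rule regular_less_arrival_iff[OF f True])
    ultimately show ?thesis using True L[of "f t"] by (cases "c (f t)") (auto simp: indicator_def)
  next
    case False
    then have "t \<notin> {?a l..<?a (Suc l)}" for l using path_arrival_nonneg[of f l] by auto
    then show ?thesis using False by simp
  qed
  have "total_reward \<rho> J \<omega> = (\<integral>t. indicator {0..<?a L} t *\<^sub>R ?g t \<partial>lborel)"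
    unfolding total_reward_def set_lebesgue_integral_def \<tau> J ..
  also have "\<dots> = (\<integral>t. (\<Sum>l<L. \<rho> (the (c l)) * indicator {?a l..<?a (Suc l)} t) \<partial>lborel)"
    unfolding pt ..
  also have "\<dots> = (\<Sum>l<L. \<integral>t. \<rho> (the (c l)) * indicator {?a l..<?a (Suc l)} t \<partial>lborel)"
    by (rule Bochner_Integration.integral_sum)
      (intro integrable_mult_right integrable_real_indicator, simp_all add: regular_arrival_mono[OF f])
  also have "\<dots> = (\<Sum>l<L. \<rho> (the (c l)) * (?a (Suc l) - ?a l))"
    by (intro sum.cong refl) (simp add: regular_arrival_mono[OF f])
  finally show ?thesis .
qed

text \<open>If the set of times is closed under small steps to the right, the infimum may be taken
  over rational times.\<close>

lemma borel_measurable_Inf_right_constant: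
  fixes Z :: "'a \<Rightarrow> real \<Rightarrow> bool"
  assumes Z: "\<And>t. 0 \<le> t \<Longrightarrow> {\<omega> \<in> space P. Z \<omega> t} \<in> sets P"
    and right: "\<And>\<omega> t. \<omega> \<in> space P \<Longrightarrow> 0 \<le> t \<Longrightarrow> Z \<omega> t \<Longrightarrow> \<exists>e>0. \<forall>s. t \<le> s \<longrightarrow> s < t + e \<longrightarrow> Z \<omega> s"
  shows "(\<lambda>\<omega>. Inf {t. 0 \<le> t \<and> Z \<omega> t}) \<in> borel_measurable P"
proof (rule borel_measurableI_less)
  fix x :: real
  let ?Q = "\<lambda>x. {q \<in> \<rat>. 0 \<le> q \<and> q < (x::real)}"
  let ?E = "\<Union>q\<in>{q \<in> \<rat>. 0 \<le> q}. {\<omega> \<in> space P. Z \<omega> q}"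
  have rat: "\<exists>q\<in>\<rat>. 0 \<le> q \<and> Z \<omega> q \<and> q < y" if at: "\<omega> \<in> space P" "0 \<le> t" "Z \<omega> t" "t < y" for \<omega> t y
  proof -
    obtain e where e: "0 < e" "\<And>s. t \<le> s \<Longrightarrow> s < t + e \<Longrightarrow> Z \<omega> s"
      using right[OF at(1-3)] by blast
    obtain q where q: "q \<in> \<rat>" "t < q" "q < min (t + e) y"
      using Rats_dense_in_real[of t "min (t + e) y"] e(1) at(4) by auto
    then show ?thesis using e(2)[of q] at(2) by (intro bexI[of _ q]) auto
  qed
  have less: "Inf {t. 0 \<le> t \<and> Z \<omega> t} < x \<longleftrightarrow> (\<exists>q\<in>?Q x. Z \<omega> q) \<or> (Inf ({} :: real set) < x \<and> \<not> (\<exists>q\<in>{q \<in> \<rat>. 0 \<le> q}. Z \<omega> q))"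
    if \<omega>: "\<omega> \<in> space P" for \<omega>
  proof (cases "\<exists>t\<ge>0. Z \<omega> t")
    case True
    then obtain t0 where t0: "0 \<le> t0" "Z \<omega> t0" by blast
    obtain q where q: "q \<in> \<rat>" "0 \<le> q" "Z \<omega> q" using rat[OF \<omega> t0, of "t0 + 1"] by auto
    have ne: "{t. 0 \<le> t \<and> Z \<omega> t} \<noteq> {}" using t0 by blast
    have bdd: "bdd_below {t. 0 \<le> t \<and> Z \<omega> t}" by (rule bdd_belowI[of _ 0]) auto
    have "Inf {t. 0 \<le> t \<and> Z \<omega> t} < x \<longleftrightarrow> (\<exists>t. 0 \<le> t \<and> Z \<omega> t \<and> t < x)"
      using cInf_less_iff[OF ne bdd, of x] by blast
    also have "\<dots> \<longleftrightarrow> (\<exists>q\<in>?Q x. Z \<omega> q)" using rat[OF \<omega>] by blast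
    finally show ?thesis using q by blast
  next
    case False
    then have e: "{t. 0 \<le> t \<and> Z \<omega> t} = {}" by blast
    show ?thesis unfolding e using False by blast
  qed
  have cnt: "countable {q \<in> \<rat>. 0 \<le> q \<and> q < x}" "countable {q \<in> \<rat>. 0 \<le> (q::real)}"
    using countable_rat by (auto intro: countable_subset[OF _ countable_rat])
  have "{\<omega> \<in> space P. Inf {t. 0 \<le> t \<and> Z \<omega> t} < x} =
    (\<Union>q\<in>?Q x. {\<omega> \<in> space P. Z \<omega> q}) \<union> (if Inf ({} :: real set) < x then space P - ?E else {})"
    using less by auto
  also have "\<dots> \<in> sets P"
    using Z cnt by (auto intro!: sets.Un sets.countable_UN'' sets.Diff)
  finally show "{\<omega> \<in> space P. Inf {t. 0 \<le> t \<and> Z \<omega> t} < x} \<in> sets P" .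
qed

lemma total_reward_measurable:
  fixes c :: "nat \<Rightarrow> 'a \<Rightarrow> nat option"
  assumes c: "\<And>l. c l \<in> measurable P (count_space UNIV)"
    and X: "\<forall>t\<ge>0. X t \<in> measurable P (count_space UNIV)"
    and path: "\<And>\<omega>. \<omega> \<in> space P \<Longrightarrow> counting_path (\<lambda>t. X t \<omega>)"
  shows "(\<lambda>\<omega>. total_reward \<rho> (\<lambda>t \<omega>. c (X t \<omega>) \<omega>) \<omega>) \<in> borel_measurable P"
proof -
  let ?J = "\<lambda>t \<omega>. c (X t \<omega>) \<omega>"
  let ?\<tau> = "\<lambda>\<omega>. termination_time ?J \<omega>"
  let ?v = "\<lambda>x. case x of None \<Rightarrow> 0 | Some i \<Rightarrow> \<rho> i"
  have \<tau>: "?\<tau> \<in> borel_measurable P"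
    unfolding termination_time_def
  proof (rule borel_measurable_Inf_right_constant)
    fix t :: real assume t: "0 \<le> t"
    have "(\<lambda>\<omega>. c (X t \<omega>) \<omega>) \<in> measurable P (count_space UNIV)"
      by (rule measurable_compose_countable[OF c]) (use X t in blast)
    from sets_eq_Some[OF this] show "{\<omega> \<in> space P. c (X t \<omega>) \<omega> = None} \<in> sets P" .
  next
    fix \<omega> and t :: real assume \<omega>: "\<omega> \<in> space P" "0 \<le> t" "c (X t \<omega>) \<omega> = None"
    obtain e where e: "0 < e" "\<And>s. t \<le> s \<Longrightarrow> s < t + e \<Longrightarrow> X s \<omega> = X t \<omega>"
      using counting_path_right_constant[OF path[OF \<omega>(1)] \<omega>(2)] by blast
    show "\<exists>e>0. \<forall>s. t \<le> s \<longrightarrow> s < t + e \<longrightarrow> c (X s \<omega>) \<omega> = None"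
    proof (intro exI[of _ e] conjI allI impI e(1))
      fix s assume "t \<le> s" "s < t + e"
      from e(2)[OF this] show "c (X s \<omega>) \<omega> = None" using \<omega>(3) by (simp only:)
    qed
  qed
  let ?D = "P \<Otimes>\<^sub>M (lborel :: real measure)"
  have XD: "(\<lambda>z. X (max 0 (snd z)) (fst z)) \<in> measurable ?D (count_space UNIV)"
  proof (rule measurable_at_random_time[where N="\<lambda>t z. X t (fst z)" and T="\<lambda>z. max 0 (snd z)"])
    show "\<forall>t\<ge>0. (\<lambda>z. X t (fst z)) \<in> measurable ?D (count_space UNIV)"
      using X by (auto intro!: measurable_compose[OF measurable_fst])
    show "counting_path (\<lambda>t. X t (fst z))" if "z \<in> space ?D" for z
      using that by (intro path) (auto simp: space_pair_measure)
  qed measurable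
  have cD: "(\<lambda>z. c (X (max 0 (snd z)) (fst z)) (fst z)) \<in> measurable ?D (count_space UNIV)"
    by (rule measurable_compose_countable[OF _ XD]) (rule measurable_compose[OF measurable_fst c])
  have vD: "(\<lambda>z. ?v (c (X (max 0 (snd z)) (fst z)) (fst z))) \<in> borel_measurable ?D"
    by (rule measurable_compose[OF cD]) simp
  have ind: "{z \<in> space ?D. 0 \<le> snd z \<and> snd z < ?\<tau> (fst z)} \<in> sets ?D"
    using measurable_compose[OF measurable_fst \<tau>] by measurable
  have "(\<lambda>z. indicator {z \<in> space ?D. 0 \<le> snd z \<and> snd z < ?\<tau> (fst z)} z * ?v (c (X (max 0 (snd z)) (fst z)) (fst z))) \<in> borel_measurable ?D"
    using ind vD by (intro borel_measurable_times borel_measurable_indicator)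
  then have "(\<lambda>(\<omega>, t). indicator {z \<in> space ?D. 0 \<le> snd z \<and> snd z < ?\<tau> (fst z)} (\<omega>, t) * ?v (c (X (max 0 t) \<omega>) \<omega>)) \<in> borel_measurable ?D"
    by (simp add: case_prod_unfold)
  then have m: "(\<lambda>\<omega>. \<integral>t. indicator {z \<in> space ?D. 0 \<le> snd z \<and> snd z < ?\<tau> (fst z)} (\<omega>, t) * ?v (c (X (max 0 t) \<omega>) \<omega>) \<partial>lborel) \<in> borel_measurable P"
    by (rule lborel.borel_measurable_lebesgue_integral)
  show ?thesis
  proof (rule measurable_cong[THEN iffD1, OF _ m])
    fix \<omega> assume \<omega>: "\<omega> \<in> space P"
    show "(\<integral>t. indicator {z \<in> space ?D. 0 \<le> snd z \<and> snd z < ?\<tau> (fst z)} (\<omega>, t) * ?v (c (X (max 0 t) \<omega>) \<omega>) \<partial>lborel) =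
      total_reward \<rho> ?J \<omega>"
      unfolding total_reward_def set_lebesgue_integral_def
      by (intro Bochner_Integration.integral_cong refl) (use \<omega> in \<open>auto simp: indicator_def space_pair_measure max_def\<close>)
  qed
qed

section \<open>The reward model\<close>

locale reward_model = prob_space P for P :: "'a measure" +
  fixes p m n lam0 :: nat
    and S :: "real \<Rightarrow> nat \<Rightarrow> nat \<Rightarrow> real"
    and \<pi> :: "nat \<Rightarrow> real"
    and r :: "nat \<Rightarrow> nat \<Rightarrow> real"
    and N :: "real \<Rightarrow> 'a \<Rightarrow> nat"
    and N' :: "nat \<Rightarrow> real \<Rightarrow> 'a \<Rightarrow> nat"
    and U :: "nat \<Rightarrow> 'a \<Rightarrow> real"
    and M :: "nat \<Rightarrow> real \<Rightarrow> 'a \<Rightarrow> nat"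
    and M' :: "nat \<Rightarrow> nat \<Rightarrow> real \<Rightarrow> 'a \<Rightarrow> nat"
  assumes p: "1 \<le> p" and m: "1 \<le> m"
    and S: "subintensity p S"
    and bounded: "bdd_above (exit_rates p S)"
    and lam0: "lam0 = base_intensity p S" "0 < lam0"
    and \<pi>: "\<forall>i\<in>{1..p}. 0 \<le> \<pi> i" "(\<Sum>i\<in>{1..p}. \<pi> i) = 1"
    and r: "\<forall>i\<in>{1..p}. \<forall>k\<in>{1..m}. 0 \<le> r i k"
    and N: "poisson_process P (real lam0) N"
    and N': "\<forall>l\<ge>lam0 + 1. poisson_process P 1 (N' l)"
    and U: "\<forall>l. U l \<in> borel_measurable P \<and> distr P borel (U l) = uniform_measure lborel {0<..<1}"
    and M: "\<forall>k\<in>{1..m}. poisson_process P (real lam0) (M k)"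
    and M': "\<forall>k\<in>{1..m}. \<forall>l\<ge>lam0 + 1. poisson_process P 1 (M' k l)"
    and indep: "indep_sets (source_events P N N' U M M') (sources lam0 m)"
    and terminating: "AE \<omega> in P. \<exists>t\<ge>0. jump_process p S \<pi> N U t \<omega> = None"
    and n: "lam0 \<le> n"
begin

abbreviation "F \<equiv> source_events P N N' U M M'"

definition Nn :: "real \<Rightarrow> 'a \<Rightarrow> nat" where "Nn = superposition lam0 n N N'"
definition Mn :: "nat \<Rightarrow> real \<Rightarrow> 'a \<Rightarrow> nat" where "Mn k = superposition lam0 n (M k) (M' k)"
definition chi :: "nat \<Rightarrow> 'a \<Rightarrow> real" where "chi = arrival Nn"
definition G :: "'a measure" where "G = process_algebra P Nn"
definition label :: "nat \<Rightarrow> 'a \<Rightarrow> bool" where "label l \<omega> = mark (\<lambda>t. Nn t \<omega>) (\<lambda>t. N t \<omega>) l"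
definition state :: "nat \<Rightarrow> 'a \<Rightarrow> nat option" where "state l \<omega> = jump_process p S \<pi> N U (chi l \<omega>) \<omega>"
definition Y :: "nat \<Rightarrow> 'a \<Rightarrow> real" where
  "Y k = total_reward (\<lambda>i. r i k) (\<lambda>t \<omega>. state (Mn k t \<omega>) \<omega>)"
definition reward_sources :: "nat \<Rightarrow> source set" where
  "reward_sources k = insert (Reward_Clock k) (Extra_Reward_Clock k ` {lam0 + 1..})"
definition H :: "nat \<Rightarrow> 'a set set" where
  "H k = sigma_sets (space P) (\<Union>x\<in>reward_sources k \<inter> sources lam0 m. F x)"

lemma n_pos: "0 < n" using lam0(2) n by simp

lemma F_stable: "x \<in> sources lam0 m \<Longrightarrow> Int_stable (F x)"
  by (cases x) (simp_all add: sets.Int_stable)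

lemma F_events: "x \<in> sources lam0 m \<Longrightarrow> F x \<subseteq> events"
  using indep by (auto simp: indep_sets_def)

lemma grid_one: "poisson_process P 1 X \<Longrightarrow> poisson_grid P 1 X"
  by (rule poisson_grid_of_process[OF prob_space_axioms]) simp_all

lemma grid_base: "poisson_process P (real lam0) X \<Longrightarrow> poisson_grid P (real lam0) X"
  by (rule poisson_grid_of_process[OF prob_space_axioms]) (use lam0(2) in simp_all)

lemma extra_clocks:
  "poisson_grid P (real (n - lam0)) (\<lambda>t \<omega>. \<Sum>l\<in>{lam0 + 1..n}. N' l t \<omega>)"
  "indep_set (sets (process_algebra P N)) (sets (process_algebra P (\<lambda>t \<omega>. \<Sum>l\<in>{lam0 + 1..n}. N' l t \<omega>)))"
  using superposed_grid[OF indep F_stable, of Clock "{lam0 + 1..n}" Extra_Clock N N'] grid_one N'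
  by (auto simp: sources_def inj_on_def)

lemma extra_reward_clocks:
  assumes "k \<in> {1..m}"
  shows "poisson_grid P (real (n - lam0)) (\<lambda>t \<omega>. \<Sum>l\<in>{lam0 + 1..n}. M' k l t \<omega>)"
    "indep_set (sets (process_algebra P (M k))) (sets (process_algebra P (\<lambda>t \<omega>. \<Sum>l\<in>{lam0 + 1..n}. M' k l t \<omega>)))"
  using superposed_grid[OF indep F_stable, of "Reward_Clock k" "{lam0 + 1..n}" "Extra_Reward_Clock k" "M k" "M' k"] grid_one M' assms
  by (auto simp: sources_def inj_on_def)

lemma Nn_eq: "Nn = (\<lambda>t \<omega>. N t \<omega> + (\<Sum>l\<in>{lam0 + 1..n}. N' l t \<omega>))"
  by (intro ext) (simp add: Nn_def superposition_def)

lemma Mn_eq: "Mn k = (\<lambda>t \<omega>. M k t \<omega> + (\<Sum>l\<in>{lam0 + 1..n}. M' k l t \<omega>))"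
  by (intro ext) (simp add: Mn_def superposition_def)

lemma rate_sum: "real lam0 + real (n - lam0) = real n"
  using n by simp

lemma Nn_grid: "poisson_grid P (real n) Nn"
  using poisson_grid_add[OF prob_space_axioms grid_base[OF N] extra_clocks] unfolding Nn_eq rate_sum .

lemma Mn_grid: "k \<in> {1..m} \<Longrightarrow> poisson_grid P (real n) (Mn k)"
  using poisson_grid_add[OF prob_space_axioms grid_base extra_reward_clocks] M unfolding Mn_eq rate_sum by blast

lemma Nn_props: "\<forall>t\<ge>0. Nn t \<in> measurable P (count_space UNIV)"
  "\<And>\<omega>. \<omega> \<in> space P \<Longrightarrow> counting_path (\<lambda>t. Nn t \<omega>)"
  using Nn_grid by (auto simp: poisson_grid_def)

lemma N_props: "\<forall>t\<ge>0. N t \<in> measurable P (count_space UNIV)"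
  "\<And>\<omega>. \<omega> \<in> space P \<Longrightarrow> counting_path (\<lambda>t. N t \<omega>)"
  using grid_base[OF N] by (auto simp: poisson_grid_def)

lemma extra_paths: "\<omega> \<in> space P \<Longrightarrow> counting_path (\<lambda>t. \<Sum>l\<in>{lam0 + 1..n}. N' l t \<omega>)"
  using extra_clocks(1) by (auto simp: poisson_grid_def)

lemma Mn_props: "k \<in> {1..m} \<Longrightarrow> \<forall>t\<ge>0. Mn k t \<in> measurable P (count_space UNIV)"
  "\<And>\<omega>. k \<in> {1..m} \<Longrightarrow> \<omega> \<in> space P \<Longrightarrow> counting_path (\<lambda>t. Mn k t \<omega>)"
  using Mn_grid by (auto simp: poisson_grid_def)

lemma chi_nonneg: "0 \<le> chi l \<omega>"
  unfolding chi_def arrival_eq_path_arrival by (rule path_arrival_nonneg)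

lemma G_subalgebra: "subalgebra P G"
  unfolding subalgebra_def G_def using process_algebra_props[OF Nn_props(1)] by simp

lemma chi_measurable_G: "chi l \<in> borel_measurable G"
  unfolding chi_def G_def
  by (rule arrival_measurable) (use process_algebra_props[OF Nn_props(1)] Nn_props(2) in auto)

lemma chi_measurable: "chi l \<in> borel_measurable P"
  by (rule measurable_from_subalg[OF G_subalgebra chi_measurable_G])

lemma rates: "bounded_rates p S (real lam0)"
proof -
  have "\<bar>S t i i\<bar> \<le> real lam0" if "0 \<le> t" "i \<in> {1..p}" for t i
  proof -
    have "\<bar>S t i i\<bar> \<in> exit_rates p S" using that by (auto simp: exit_rates_def)
    then have "\<bar>S t i i\<bar> \<le> Sup (exit_rates p S)" using bounded by (rule cSup_upper)
    also have "\<dots> \<le> real (nat \<lceil>Sup (exit_rates p S)\<rceil>)" by (rule real_nat_ceiling_ge)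
    finally show ?thesis by (simp add: lam0(1) base_intensity_def)
  qed
  then show ?thesis using lam0(2) by (auto simp: bounded_rates_def)
qed

lemma state_measurable: "state l \<in> measurable P (count_space UNIV)"
proof -
  have emb: "embedded_chain p S \<pi> N U i \<in> measurable P (count_space UNIV)" for i
  proof -
    have "(\<lambda>\<omega>. marked_chain p S \<pi> (real lam0) (\<lambda>l. arrival N l \<omega>) (\<lambda>_. True) (\<lambda>l. U l \<omega>) i) \<in> measurable P (count_space UNIV)"
    proof (rule marked_chain_measurable[OF S rates \<pi>(1)])
      show "(\<lambda>\<omega>. arrival N i \<omega>) \<in> borel_measurable P" for i
        by (rule arrival_measurable[OF N_props])
      show "0 \<le> arrival N i \<omega>" for i \<omega> unfolding arrival_eq_path_arrival by (rule path_arrival_nonneg)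
    qed (use U in auto)
    then show ?thesis by (subst measurable_cong[where g="\<lambda>\<omega>. marked_chain p S \<pi> (real lam0) (\<lambda>l. arrival N l \<omega>) (\<lambda>_. True) (\<lambda>l. U l \<omega>) i"]) (simp_all only: lam0(1) embedded_chain_as_marked_chain)
  qed
  have "(\<lambda>\<omega>. N (chi l \<omega>) \<omega>) \<in> measurable P (count_space UNIV)"
    by (rule measurable_at_random_time[OF N_props chi_measurable chi_nonneg])
  then show ?thesis
    unfolding state_def[abs_def] jump_process_def by (rule measurable_compose_countable[OF emb])
qed

lemma Y_measurable: "k \<in> {1..m} \<Longrightarrow> Y k \<in> borel_measurable P"
  unfolding Y_def by (rule total_reward_measurable[OF state_measurable Mn_props])

lemma AE_regular_clocks:
  "AE \<omega> in P. regular_path (\<lambda>t. Nn t \<omega>)" "AE \<omega> in P. \<forall>k\<in>{1..m}. regular_path (\<lambda>t. Mn k t \<omega>)"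
proof -
  have pos: "0 < real n" using n_pos by simp
  show "AE \<omega> in P. regular_path (\<lambda>t. Nn t \<omega>)" by (rule AE_regular_path[OF Nn_grid pos])
  show "AE \<omega> in P. \<forall>k\<in>{1..m}. regular_path (\<lambda>t. Mn k t \<omega>)"
    using AE_regular_path[OF Mn_grid pos] by (intro AE_finite_allI) auto
qed

lemma label_marks:
  assumes "A \<in> sets G"
  shows "prob (A \<inter> {\<omega> \<in> space P. \<forall>i<l. label (Suc i) \<omega> \<in> V i}) =
    prob A * (\<Prod>i<l. measure (bernoulli_pmf (real lam0 / real n)) (V i))"
  using marks_independent[OF grid_base[OF N] extra_clocks(1) _ extra_clocks(2), of A l V] lam0(2) assms
  unfolding label_def Nn_eq[symmetric] G_def rate_sum Nn_eq[THEN fun_cong, THEN fun_cong, symmetric]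
  by simp

end

context reward_model
begin

section \<open>The sources of randomness behind the labelled chain\<close>

lemma measurable_process_generated:
  assumes X: "\<forall>t\<ge>0. X t \<in> measurable P (count_space UNIV)" and t: "0 \<le> t"
    and sub: "sets (process_algebra P X) \<subseteq> sets A" and A: "space A = space P"
  shows "X t \<in> measurable A (count_space UNIV)"
proof (rule measurableI)
  fix B
  have "X t -` B \<inter> space P \<in> sets (process_algebra P X)"
    unfolding process_algebra_props(2)[OF X] using t by (intro sigma_sets.Basic) blast
  then show "X t -` B \<inter> space A \<in> sets A" unfolding A using sub by blast
qed simp

text \<open>Superposed clock and labels are functions of the original clock and the extra
  clocks.\<close>

lemma clock_block:
  defines "D \<equiv> insert Clock (Extra_Clock ` {lam0 + 1..})"
  defines "A \<equiv> sigma (space P) (\<Union>x\<in>D. F x)"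
  shows "sets A = sigma_sets (space P) (\<Union>x\<in>D. F x)" "sets G \<subseteq> sets A" "label l \<in> measurable A (count_space UNIV)"
proof -
  have D: "D \<subseteq> sources lam0 m" by (auto simp: D_def sources_def)
  then have ev: "(\<Union>x\<in>D. F x) \<subseteq> events" using F_events by blast
  have A: "subalgebra P A" unfolding A_def by (rule generated_subalgebra(1)[OF ev])
  show sA: "sets A = sigma_sets (space P) (\<Union>x\<in>D. F x)" unfolding A_def by (rule generated_subalgebra(2)[OF ev])
  have spA: "space A = space P" using A by (simp add: subalgebra_def)
  have F: "F x \<subseteq> sets A" if "x \<in> D" for x unfolding sA using that by (blast intro: sigma_sets.Basic)
  have Nsub: "sets (process_algebra P N) \<subseteq> sets A" using F[of Clock] by (simp add: D_def)
  have N'sub: "sets (process_algebra P (N' l)) \<subseteq> sets A" if "l \<in> {lam0 + 1..n}" for l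
    using F[of "Extra_Clock l"] that by (simp add: D_def)
  have N'm: "\<forall>t\<ge>0. N' l t \<in> measurable P (count_space UNIV)" if "l \<in> {lam0 + 1..n}" for l
    using N' that by (simp add: poisson_process_def)
  have Nm: "N t \<in> measurable A (count_space UNIV)" if "0 \<le> t" for t
    by (rule measurable_process_generated[OF N_props(1) that Nsub spA])
  have Em: "N' l t \<in> measurable A (count_space UNIV)" if "0 \<le> t" "l \<in> {lam0 + 1..n}" for l t
    by (rule measurable_process_generated[OF N'm[OF that(2)] that(1) N'sub[OF that(2)] spA])
  have Nnm: "Nn t \<in> measurable A (count_space UNIV)" if "0 \<le> t" for t
    unfolding Nn_eq using Nm[OF that] Em[OF that] by measurable
  show GA: "sets G \<subseteq> sets A"
    unfolding G_def by (rule process_algebra_le[OF _ A]) (rule Nnm)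
  have sp: "space G = space P" using G_subalgebra by (simp add: subalgebra_def)
  have chiA: "chi l \<in> borel_measurable A" for l
  proof (rule measurableI)
    fix B :: "real set" assume "B \<in> sets borel"
    then have "chi l -` B \<inter> space G \<in> sets G" by (rule measurable_sets[OF chi_measurable_G])
    then show "chi l -` B \<inter> space A \<in> sets A" using GA unfolding sp spA by blast
  qed simp
  have at: "(\<lambda>\<omega>. N (chi l \<omega>) \<omega>) \<in> measurable A (count_space UNIV)" for l
    by (rule measurable_at_random_time[OF _ _ chiA chi_nonneg]) (use Nm N_props(2) spA in auto)
  have eq: "label l = (\<lambda>\<omega>. (N (chi (l - 1) \<omega>) \<omega>) < (N (chi l \<omega>) \<omega>))"
    by (intro ext) (simp add: label_def mark_def chi_def arrival_eq_path_arrival)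
  show "label l \<in> measurable A (count_space UNIV)"
    unfolding eq by (rule measurable_compose2_countable[OF at at])
qed

lemma H_properties: "Int_stable (H k)" "space P \<in> H k" "sets (sigma (space P) (\<Union>x\<in>reward_sources k \<inter> sources lam0 m. F x)) = H k"
proof -
  have ev: "(\<Union>x\<in>reward_sources k \<inter> sources lam0 m. F x) \<subseteq> events" using F_events by blast
  show eq: "sets (sigma (space P) (\<Union>x\<in>reward_sources k \<inter> sources lam0 m. F x)) = H k"
    unfolding H_def by (rule generated_subalgebra(2)[OF ev])
  show "Int_stable (H k)" unfolding eq[symmetric] by (rule sets.Int_stable)
  show "space P \<in> H k" unfolding H_def by (rule sigma_sets_top)
qed

text \<open>The original sources are grouped into blocks, one for the clocks, one for each uniform
  variable and one for each reward type.\<close>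

lemma noise: "indep_sets (noise_events P G label U H) (noise_sources m)"
proof -
  define D where "D = case_source (insert Clock (Extra_Clock ` {lam0 + 1..})) (\<lambda>_. {}) (\<lambda>l. {Unif l}) (\<lambda>k. reward_sources k \<inter> sources lam0 m) (\<lambda>_ _. {})"
  have D: "D Clock = insert Clock (Extra_Clock ` {lam0 + 1..})" "D (Unif l) = {Unif l}"
    "D (Reward_Clock k) = reward_sources k \<inter> sources lam0 m" for l k
    by (simp_all add: D_def)
  let ?B = "\<lambda>x. sigma_sets (space P) (\<Union>y\<in>D x. F y)"
  let ?I = "{Clock} \<union> range Unif \<union> Reward_Clock ` {1..m}"
  have sub: "D x \<subseteq> sources lam0 m" if "x \<in> ?I" for x
    using that by (auto simp: D sources_def)
  note block = clock_block
  show ?thesis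
  proof (rule noise_independent)
    show "indep_sets ?B ?I"
    proof (rule indep_sets_collect_sigma)
      show "indep_sets F (\<Union>x\<in>?I. D x)" by (rule indep_sets_mono_index[OF _ indep]) (use sub in blast)
      show "Int_stable (F y)" if "x \<in> ?I" "y \<in> D x" for x y by (rule F_stable) (use sub that in blast)
      show "disjoint_family_on D ?I" by (auto simp: disjoint_family_on_def D reward_sources_def)
    qed
    show "A \<inter> C \<in> ?B Clock" if "A \<in> ?B Clock" "C \<in> ?B Clock" for A C
      using that unfolding D block(1)[symmetric] by (rule sets.Int)
    show "sets G \<subseteq> ?B Clock" unfolding D using block(1,2) by simp
    show "{\<omega> \<in> space P. label l \<omega> \<in> V} \<in> ?B Clock" for l V
    proof -
      have "label l -` V \<inter> space (sigma (space P) (\<Union>y\<in>D Clock. F y)) \<in> ?B Clock"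
        unfolding D block(1)[symmetric] by (rule measurable_sets[OF block(3)]) simp
      moreover have "space (sigma (space P) (\<Union>y\<in>D Clock. F y)) = space P"
        by (rule space_measure_of) (use sub[of Clock] F_events sets.sets_into_space in blast)
      moreover have "label l -` V \<inter> space P = {\<omega> \<in> space P. label l \<omega> \<in> V}" by blast
      ultimately show ?thesis by (simp only:)
    qed
    show "{U l -` V \<inter> space P | V. V \<in> sets borel} \<subseteq> ?B (Unif l)" for l
    proof -
      have "{U l -` V \<inter> space P | V. V \<in> sets borel} \<subseteq> F (Unif l)"
        by (auto simp: sets_vimage_algebra2)
      then show ?thesis unfolding D by (auto intro: sigma_sets.Basic)
    qed
    show "H k \<subseteq> ?B (Reward_Clock k)" for k by (simp add: H_def D)
    show "space P \<in> H k" for k by (rule H_properties(2))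
    show "space G = space P" using G_subalgebra by (simp add: subalgebra_def)
    show "prob (A \<inter> {\<omega> \<in> space P. \<forall>i<l. label (Suc i) \<omega> \<in> V i}) =
        prob A * (\<Prod>i<l. measure (bernoulli_pmf (real lam0 / real n)) (V i))" if "A \<in> sets G" for A l V
      by (rule label_marks[OF that])
    show "measure (bernoulli_pmf (real lam0 / real n)) UNIV = 1" by simp
  qed
qed

lemma prob_label:
  assumes "1 \<le> l"
  shows "prob {\<omega> \<in> space P. label l \<omega>} = real lam0 / real n"
proof -
  let ?b = "bernoulli_pmf (real lam0 / real n)"
  obtain l' where l': "l = Suc l'" using assms by (cases l) simp_all
  define V where "V i = (if Suc i = l then {True} else UNIV)" for i
  have "space P \<in> sets G" using G_subalgebra sets.top[of G] by (simp add: subalgebra_def)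
  note marks = label_marks[OF this, of l V]
  have eq: "space P \<inter> {\<omega> \<in> space P. \<forall>i<l. label (Suc i) \<omega> \<in> V i} = {\<omega> \<in> space P. label l \<omega>}" (is "?A = ?B")
  proof (rule set_eqI)
    fix \<omega>
    have "(\<forall>i<l. label (Suc i) \<omega> \<in> V i) \<longleftrightarrow> label l \<omega>"
    proof
      assume "\<forall>i<l. label (Suc i) \<omega> \<in> V i"
      then have "label (Suc l') \<omega> \<in> V l'" unfolding l' by (elim allE impE) (rule lessI)
      then show "label l \<omega>" unfolding V_def l' if_P[OF refl] by (simp only: singleton_iff)
    next
      assume "label l \<omega>"
      then show "\<forall>i<l. label (Suc i) \<omega> \<in> V i" 
        unfolding V_def l' by (intro allI impI) (case_tac "i = l'", simp_all)
    qed
    then show "\<omega> \<in> ?A \<longleftrightarrow> \<omega> \<in> ?B" by blast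
  qed
  have "(\<Prod>i<l. measure ?b (V i)) = (\<Prod>i<l. if i = l' then measure ?b {True} else 1)"
    by (rule prod.cong) (simp_all add: V_def l')
  also have "\<dots> = measure ?b {True}" by (subst prod.delta) (simp_all add: l')
  finally have pr: "(\<Prod>i<l. measure ?b (V i)) = measure ?b {True}" .
  have "measure ?b {True} = real lam0 / real n"
    using n n_pos by (simp add: measure_pmf_single pmf_bernoulli_True)
  with marks[unfolded eq pr prob_space mult_1] show ?thesis by (rule trans)
qed

sublocale marked: marked_chain_space P p m S \<pi> "real lam0" "real n" G label U H
proof
  show "U l \<in> borel_measurable P" for l using U by blast
  show "distr P borel (U l) = uniform_measure lborel {0<..<1}" for l using U by blast
qed (use S rates n \<pi> prob_label G_subalgebra H_properties(1) noise in simp_all)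

section \<open>Almost sure structure of the paths\<close>

lemma AE_state_eq_chain: "AE \<omega> in P. \<forall>l. state l \<omega> = marked.chain (\<lambda>i. chi i \<omega>) l \<omega>"
  using AE_regular_clocks(1) AE_space
proof eventually_elim
  case (elim \<omega>)
  have "embedded_chain p S \<pi> N U (N (arrival Nn l \<omega>) \<omega>) \<omega> =
      marked_chain p S \<pi> (real lam0) (\<lambda>l. arrival Nn l \<omega>) (mark (\<lambda>t. Nn t \<omega>) (\<lambda>t. N t \<omega>)) (\<lambda>l. U l \<omega>) l" for l
    by (rule embedded_chain_at_arrival[where F=Nn and N=N and \<omega>=\<omega> and p=p and S=S, folded lam0(1),
          OF elim(1) N_props(2)[OF elim(2)] extra_paths[OF elim(2)]]) (simp only: Nn_eq)
  then show ?case
    unfolding state_def jump_process_def marked.chain_def chi_def label_def by blast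
qed

text \<open>Termination is inherited from the embedded chain because the clock only moves
  forward.\<close>

lemma state_absorbed:
  assumes "regular_path (\<lambda>t. Nn t \<omega>)" "\<omega> \<in> space P" "state k \<omega> = None" "k \<le> l"
  shows "state l \<omega> = None"
proof -
  have "chi k \<omega> \<le> chi l \<omega>"
    unfolding chi_def arrival_eq_path_arrival by (rule regular_arrival_mono[OF assms(1,4)])
  then have "N (chi k \<omega>) \<omega> \<le> N (chi l \<omega>) \<omega>"
    using counting_path_mono[OF N_props(2)[OF assms(2)]] chi_nonneg by simp
  with assms(3) show ?thesis unfolding state_def jump_process_def by (rule embedded_chain_absorbed)
qed

lemma AE_initial_state: "AE \<omega> in P. state 0 \<omega> \<noteq> None"
proof -
  let ?C = "\<lambda>c. {\<omega> \<in> space P. marked.chain (\<lambda>_. 0) 0 \<omega> = c}"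
  have ev: "?C c \<in> events" for c
    using marked.history_events(2)[of "\<lambda>_. 0" "\<lambda>h. last h = c" 0] by (simp only: marked.last_history order_refl)
  have "prob (\<Union>j\<in>{1..p}. ?C (Some j)) = (\<Sum>j\<in>{1..p}. prob (?C (Some j)))"
    by (rule finite_measure_finite_Union) (use ev in \<open>auto simp: disjoint_family_on_def\<close>)
  also have "\<dots> = 1"
    using marked.frozen_initial[of "\<lambda>_. 0"] \<pi>(2) by simp
  finally have "AE \<omega> in P. \<omega> \<in> (\<Union>j\<in>{1..p}. ?C (Some j))"
    by (rule AE_prob_1)
  with AE_state_eq_chain show ?thesis
    by eventually_elim (auto simp: marked.chain_def)
qed

text \<open>By assumption the process terminates; some arrival of the superposed clock comes
  later, and the states from there on are terminated. The initial state is not, because the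
  initial law has total mass one.\<close>

lemma AE_lifetime: "AE \<omega> in P. \<exists>L>0. \<forall>l. state l \<omega> = None \<longleftrightarrow> L \<le> l"
  using AE_regular_clocks(1) AE_space terminating AE_initial_state
proof eventually_elim
  case (elim \<omega>)
  obtain t where t: "0 \<le> t" "jump_process p S \<pi> N U t \<omega> = None" using elim(3) by blast
  let ?k = "Suc (Nn t \<omega>)"
  have "t \<le> chi ?k \<omega>"
    using regular_less_arrival_iff[OF elim(1) t(1), of ?k] by (simp add: chi_def arrival_eq_path_arrival)
  then have "N t \<omega> \<le> N (chi ?k \<omega>) \<omega>"
    using counting_path_mono[OF N_props(2)[OF elim(2)]] t(1) by simp
  then have dead: "state ?k \<omega> = None"
    using t(2) unfolding state_def jump_process_def by (metis embedded_chain_absorbed)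
  define L where "L = (LEAST l. state l \<omega> = None)"
  have "state L \<omega> = None" unfolding L_def using dead by (rule LeastI)
  then have "state l \<omega> = None \<longleftrightarrow> L \<le> l" for l
    using state_absorbed[OF elim(1,2), of L l] Least_le[of "\<lambda>l. state l \<omega> = None" l] by (auto simp: L_def)
  moreover have "0 < L" using elim(4) \<open>state L \<omega> = None\<close> by (cases L) auto
  ultimately show ?case by blast
qed

lemma AE_reward_sum:
  "AE \<omega> in P. \<forall>k\<in>{1..m}. \<forall>L. (\<forall>l. state l \<omega> = None \<longleftrightarrow> L \<le> l) \<longrightarrow>
    Y k \<omega> = (\<Sum>l<L. r (the (state l \<omega>)) k * hold (Mn k) l \<omega>)"
  using AE_regular_clocks(2)
proof eventually_elim
  case (elim \<omega>)
  show ?case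
  proof (intro ballI allI impI)
    fix k L assume k: "k \<in> {1..m}" and L: "\<forall>l. state l \<omega> = None \<longleftrightarrow> L \<le> l"
    have "regular_path (\<lambda>t. Mn k t \<omega>)" using elim k by blast
    from total_reward_regular[OF this, where c="\<lambda>l. state l \<omega>" and J="\<lambda>t \<omega>. state (Mn k t \<omega>) \<omega>" and L=L and \<rho>="\<lambda>i. r i k"] L
    show "Y k \<omega> = (\<Sum>l<L. r (the (state l \<omega>)) k * hold (Mn k) l \<omega>)"
      unfolding Y_def hold_def arrival_eq_path_arrival by blast
  qed
qed

section \<open>Conditioning on the superposed clock\<close>

definition path :: "nat \<Rightarrow> 'a \<Rightarrow> nat option list" where
  "path l \<omega> = map (\<lambda>i. state i \<omega>) [0..<Suc l]"

lemma AE_path_eq_history: "AE \<omega> in P. \<forall>l. path l \<omega> = marked.history (\<lambda>i. chi i \<omega>) l \<omega>"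
  using AE_state_eq_chain by eventually_elim (simp add: path_def marked.history_def)

lemma path_measurable: "path l \<in> measurable P (count_space UNIV)"
  unfolding path_def[abs_def] by (rule measurable_map_upt) (rule state_measurable)

lemma cond_pr_cong_AE:
  assumes "A \<in> events" "B \<in> events" "AE \<omega> in P. \<omega> \<in> A \<longleftrightarrow> \<omega> \<in> B"
  shows "AE \<omega> in P. cond_pr P G A \<omega> = cond_pr P G B \<omega>"
proof -
  interpret sub: sigma_finite_subalgebra P G
    by (rule finite_measure_subalgebra_is_sigma_finite) (unfold_locales, rule G_subalgebra)
  show ?thesis unfolding cond_pr_def
    by (rule sub.real_cond_exp_cong) (use assms in \<open>auto simp: indicator_def\<close>)
qed

end

section \<open>Visit counts of a finite history\<close>

definition visits :: "nat \<Rightarrow> (nat \<Rightarrow> nat) \<Rightarrow> nat option list \<Rightarrow> bool" where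
  "visits p i h \<longleftrightarrow> (\<forall>a\<in>{1..p}. count_list h (Some a) = i a)"

lemma count_list_map_upt: "count_list (map X [0..<L]) a = card {l. l < L \<and> X l = a}"
proof (induction L)
  case (Suc L)
  have "{l. l < Suc L \<and> X l = a} = (if X L = a then insert L else id) {l. l < L \<and> X l = a}"
    by (auto simp: less_Suc_eq)
  then show ?case using Suc by simp
qed simp

text \<open>If the counts of the states \<open>1, \<dots>, p\<close> exhaust the length, there is
  no room for another entry.\<close>

lemma visits_range:
  assumes v: "visits p i h" and len: "length h = (\<Sum>a\<in>{1..p}. i a)"
  shows "set h \<subseteq> Some ` {1..p}"
proof (rule ccontr)
  assume "\<not> set h \<subseteq> Some ` {1..p}"
  then obtain x where x: "x \<in> set h" "x \<notin> Some ` {1..p}" by blast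
  have "(\<Sum>y\<in>Some ` {1..p}. count_list h y) = (\<Sum>a\<in>{1..p}. i a)"
    using v by (subst sum.reindex) (auto simp: visits_def)
  then have "length h < count_list h x + (\<Sum>y\<in>Some ` {1..p}. count_list h y)"
    using x(1) len count_list_0_iff[of h x] by linarith
  also have "\<dots> = (\<Sum>y\<in>insert x (Some ` {1..p}). count_list h y)"
    using x(2) by simp
  also have "\<dots> \<le> (\<Sum>y\<in>insert x (Some ` {1..p}) \<union> set h. count_list h y)"
    by (rule sum_mono2) auto
  also have "\<dots> = length h" by (rule sum_count_set) auto
  finally show False by simp
qed

lemma visits_length:
  assumes "visits p i h" "set h \<subseteq> Some ` {1..p}"
  shows "length h = (\<Sum>a\<in>{1..p}. i a)"
proof -
  have "length h = (\<Sum>y\<in>Some ` {1..p}. count_list h y)"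
    using sum_count_set[OF assms(2)] by simp
  also have "\<dots> = (\<Sum>a\<in>{1..p}. i a)"
    using assms(1) by (subst sum.reindex) (auto simp: visits_def)
  finally show ?thesis .
qed

text \<open>This equivalence is what turns the Markov property into the recursion for
  \<open>\<alpha>\<close>.\<close>

lemma visits_snoc:
  assumes "j \<in> {1..p}"
  shows "visits p i (h @ [Some j]) \<longleftrightarrow> 0 < i j \<and> visits p (i(j := i j - 1)) h"
proof -
  have "count_list (h @ [Some j]) (Some a) = i a \<longleftrightarrow>
      (if a = j then 0 < i j else True) \<and> count_list h (Some a) = (i(j := i j - 1)) a" for a
    by auto
  then show ?thesis unfolding visits_def using assms by auto
qed

lemma multi_indices_countable: "countable (multi_indices p)"
  unfolding multi_indices_def by (rule countable_subset[of _ "{1..p} \<rightarrow>\<^sub>E UNIV"]) (auto intro: countable_PiE)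

lemma unit_index:
  assumes "h \<in> {1..p}"
  shows "unit_index p h \<in> multi_indices p" "(\<Sum>a\<in>{1..p}. unit_index p h a) = 1"
    "visits p (unit_index p h) [x] \<longleftrightarrow> x = Some h"
proof -
  show s: "(\<Sum>a\<in>{1..p}. unit_index p h a) = 1"
    using assms by (simp add: unit_index_def sum.delta)
  show "unit_index p h \<in> multi_indices p"
    unfolding multi_indices_def using s by (simp add: unit_index_def)
  show "visits p (unit_index p h) [x] \<longleftrightarrow> x = Some h"
    using assms by (auto simp: visits_def unit_index_def split: if_splits)
qed

lemma decrement_index:
  assumes "i \<in> multi_indices p" "j \<in> {1..p}" "0 < i j" "2 \<le> (\<Sum>a\<in>{1..p}. i a)"
  shows "i(j := i j - 1) \<in> multi_indices p" "(\<Sum>a\<in>{1..p}. (i(j := i j - 1)) a) = (\<Sum>a\<in>{1..p}. i a) - 1"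
proof -
  have "(\<Sum>a\<in>{1..p}. i a) = i j + (\<Sum>a\<in>{1..p} - {j}. i a)"
    using assms(2) by (simp add: sum.remove)
  moreover have "(\<Sum>a\<in>{1..p}. (i(j := i j - 1)) a) = (i j - 1) + (\<Sum>a\<in>{1..p} - {j}. i a)"
    using assms(2) by (simp add: sum.remove)
  ultimately show s: "(\<Sum>a\<in>{1..p}. (i(j := i j - 1)) a) = (\<Sum>a\<in>{1..p}. i a) - 1"
    using assms(3) by simp
  show "i(j := i j - 1) \<in> multi_indices p"
    using assms s by (auto simp: multi_indices_def PiE_def extensional_def)
qed

lemma (in marked_chain_space) history_nth: "k \<le> l \<Longrightarrow> history t l \<omega> ! k = chain t k \<omega>"
  by (simp add: history_def del: upt_Suc)

lemma (in marked_chain_space) history_Suc: "history t (Suc l) \<omega> = history t l \<omega> @ [chain t (Suc l) \<omega>]"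
  by (simp add: history_def)

lemma (in marked_chain_space) length_history: "length (history t l \<omega>) = Suc l"
  by (simp add: history_def)

lemma (in marked_chain_space) history_last: "last (history t l \<omega>) = chain t l \<omega>"
  by (simp add: history_def)

context reward_model
begin

section \<open>Conditional laws of the path given the clock\<close>

abbreviation past :: "'a \<Rightarrow> nat \<Rightarrow> 'a \<Rightarrow> nat option list" where
  "past \<omega> \<equiv> marked.history (\<lambda>i. chi i \<omega>)"

abbreviation reward_noise :: "'a measure" where
  "reward_noise \<equiv> marked.noise_algebra (Reward_Clock ` {1..m})"

lemma past_events: "{\<omega>' \<in> space P. \<Psi> (past \<omega> l \<omega>')} \<in> events"
  by (rule marked.history_events(2)) (rule chi_nonneg)

lemma reward_noise_sources: "Reward_Clock ` {1..m} \<subseteq> noise_sources m"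
  by (auto simp: noise_sources_def)

lemma path_events:
  assumes B: "\<And>l h. B l h \<in> events"
  shows "{\<omega>' \<in> space P. \<exists>l. \<Psi> l (path l \<omega>') \<and> \<omega>' \<in> B l (path l \<omega>')} \<in> events"
proof -
  have eq: "{\<omega>' \<in> space P. \<exists>l. \<Psi> l (path l \<omega>') \<and> \<omega>' \<in> B l (path l \<omega>')} =
      (\<Union>l. \<Union>h\<in>{h. \<Psi> l h}. (path l -` {h} \<inter> space P) \<inter> B l h)"
    by auto
  show ?thesis unfolding eq
    by (intro sets.countable_UN'' sets.Int measurable_sets[OF path_measurable] B countableI_type) simp_all
qed

text \<open>All randomness of the history besides the clock, and all of the reward noise, is
  independent of the clock; splitting into countably many histories shows that the event is
  jointly measurable, so it can be frozen.\<close>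

lemma cond_pr_path:
  assumes B: "\<And>l h. B l h \<in> sets reward_noise"
  shows "AE \<omega> in P. cond_pr P G {\<omega>' \<in> space P. \<exists>l. \<Psi> l (path l \<omega>') \<and> \<omega>' \<in> B l (path l \<omega>')} \<omega> =
    prob {\<omega>' \<in> space P. \<exists>l. \<Psi> l (past \<omega> l \<omega>') \<and> \<omega>' \<in> B l (past \<omega> l \<omega>')}"
proof -
  define K where "K = noise_sources m - {Clock}"
  let ?K = "marked.noise_algebra K"
  have K: "K \<subseteq> noise_sources m" by (auto simp: K_def)
  have C: "{Clock} \<subseteq> noise_sources m" by (auto simp: noise_sources_def)
  have spK: "space ?K = space P" and spG: "space G = space P"
    using marked.noise_algebra(1)[OF K] G_subalgebra by (auto simp: subalgebra_def)
  have "indep_set (sets (marked.noise_algebra {Clock})) (sets ?K)"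
    by (rule marked.noise_algebra_indep[OF C K]) (simp add: K_def)
  then have ind: "indep_set (sets G) (sets ?K)"
    by (rule indep_set_mono) (auto intro: marked.noise_algebra_mem[OF C])
  have BK: "B l h \<in> sets ?K" for l h
  proof -
    have "sets reward_noise \<subseteq> sets ?K"
      unfolding marked.noise_algebra(2)[OF K] marked.noise_algebra(2)[OF reward_noise_sources]
      by (rule sigma_sets_mono') (auto simp: K_def noise_sources_def)
    then show ?thesis using B by blast
  qed
  have BP: "B l h \<in> events" for l h using B marked.noise_algebra(3)[OF reward_noise_sources] by blast
  let ?D = "G \<Otimes>\<^sub>M ?K"
  have hm: "(\<lambda>z. past (fst z) l (snd z)) \<in> measurable ?D (count_space UNIV)" for l
    unfolding marked.history_def
  proof (rule measurable_map_upt)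
    fix j
    show "(\<lambda>z. marked.chain (\<lambda>i. chi i (fst z)) j (snd z)) \<in> measurable ?D (count_space UNIV)"
      unfolding marked.chain_def
    proof (rule marked_chain_measurable[OF S rates \<pi>(1)])
      show "(\<lambda>z. chi i (fst z)) \<in> borel_measurable ?D" for i
        by (rule measurable_compose[OF measurable_fst chi_measurable_G])
      show "0 \<le> chi i (fst z)" for i and z :: "'a \<times> 'a" by (rule chi_nonneg)
      show "(\<lambda>z. U i (snd z)) \<in> borel_measurable ?D" for i
        by (rule measurable_compose[OF measurable_snd marked.choice_noise_measurable[OF K]])
          (auto simp: K_def noise_sources_def)
      show "(\<lambda>z. label i (snd z)) \<in> measurable ?D (count_space UNIV)" if "i \<in> {1..j}" for i
        by (rule measurable_compose[OF measurable_snd marked.mark_noise_measurable[OF K]])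
          (use that in \<open>auto simp: K_def noise_sources_def\<close>)
    qed
  qed
  define A where "A = (\<Union>l. \<Union>h\<in>{h. \<Psi> l h}. ((\<lambda>z. past (fst z) l (snd z)) -` {h} \<inter> space ?D) \<inter> (space G \<times> B l h))"
  have AD: "A \<in> sets ?D"
    unfolding A_def
    by (intro sets.countable_UN'' sets.Int measurable_sets[OF hm] pair_measureI BK sets.top countableI_type) simp_all
  have A: "(\<omega>, \<omega>') \<in> A \<longleftrightarrow> (\<exists>l. \<Psi> l (past \<omega> l \<omega>') \<and> \<omega>' \<in> B l (past \<omega> l \<omega>'))"
    if "\<omega> \<in> space P" "\<omega>' \<in> space P" for \<omega> \<omega>'
    unfolding A_def using that by (auto simp: space_pair_measure spK spG)
  have "AE \<omega> in P. cond_pr P G {\<omega> \<in> space P. (\<omega>, \<omega>) \<in> A} \<omega> = prob {\<omega>' \<in> space P. (\<omega>, \<omega>') \<in> A}"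
    by (rule cond_pr_freeze[OF G_subalgebra marked.noise_algebra(4)[OF K] ind AD])
  moreover have "AE \<omega> in P. cond_pr P G {\<omega>' \<in> space P. \<exists>l. \<Psi> l (path l \<omega>') \<and> \<omega>' \<in> B l (path l \<omega>')} \<omega> =
      cond_pr P G {\<omega> \<in> space P. (\<omega>, \<omega>) \<in> A} \<omega>"
  proof (rule cond_pr_cong_AE)
    show "{\<omega>' \<in> space P. \<exists>l. \<Psi> l (path l \<omega>') \<and> \<omega>' \<in> B l (path l \<omega>')} \<in> events"
      by (rule path_events) (rule BP)
    have dm: "(\<lambda>\<omega>. (\<omega>, \<omega>)) \<in> measurable P ?D"
      using measurable_from_subalg[OF G_subalgebra measurable_ident_sets[OF refl]]
        measurable_from_subalg[OF marked.noise_algebra(4)[OF K] measurable_ident_sets[OF refl]]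
      by (intro measurable_Pair) auto
    have "(\<lambda>\<omega>. (\<omega>, \<omega>)) -` A \<inter> space P = {\<omega> \<in> space P. (\<omega>, \<omega>) \<in> A}" by blast
    then show "{\<omega> \<in> space P. (\<omega>, \<omega>) \<in> A} \<in> events" using measurable_sets[OF dm AD] by simp
    show "AE \<omega> in P. (\<omega> \<in> {\<omega>' \<in> space P. \<exists>l. \<Psi> l (path l \<omega>') \<and> \<omega>' \<in> B l (path l \<omega>')}) =
        (\<omega> \<in> {\<omega> \<in> space P. (\<omega>, \<omega>) \<in> A})"
      using AE_path_eq_history AE_space
    proof eventually_elim
      case (elim \<omega>)
      then have "past \<omega> l \<omega> = path l \<omega>" for l by (simp only:)
      then show ?case using A[OF elim(2) elim(2)] elim(2) by simp
    qed
  qed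
  ultimately show ?thesis
    using AE_space
  proof eventually_elim
    case (elim \<omega>)
    have "{\<omega>' \<in> space P. (\<omega>, \<omega>') \<in> A} = {\<omega>' \<in> space P. \<exists>l. \<Psi> l (past \<omega> l \<omega>') \<and> \<omega>' \<in> B l (past \<omega> l \<omega>')}"
      by (rule Collect_cong) (use A[OF elim(3)] in blast)
    then show ?case using elim(1,2) by (simp only:)
  qed
qed

lemma cond_pr_path_event:
  "AE \<omega> in P. cond_pr P G {\<omega>' \<in> space P. \<Psi> (path l \<omega>')} \<omega> = prob {\<omega>' \<in> space P. \<Psi> (past \<omega> l \<omega>')}"
proof -
  have "space P \<in> sets reward_noise"
    using sets.top[of reward_noise] unfolding marked.noise_algebra(1)[OF reward_noise_sources] .
  from cond_pr_path[of "\<lambda>_ _. space P" "\<lambda>k h. k = l \<and> \<Psi> h", OF this]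
  show ?thesis by (simp cong: conj_cong)
qed

lemma path_nth: "k \<le> l \<Longrightarrow> path l \<omega> ! k = state k \<omega>"
  by (simp add: path_def del: upt_Suc)

lemma last_path: "last (path l \<omega>) = state l \<omega>"
  by (simp add: path_def)

lemma cond_pr_state:
  "AE \<omega> in P. cond_pr P G {\<omega>' \<in> space P. state l \<omega>' = s} \<omega> = prob {\<omega>' \<in> space P. marked.chain (\<lambda>i. chi i \<omega>) l \<omega>' = s}"
  using cond_pr_path_event[of "\<lambda>h. last h = s" l] by (simp only: last_path marked.history_last)

definition \<alpha> :: "(nat \<Rightarrow> nat) \<Rightarrow> nat \<Rightarrow> 'a \<Rightarrow> real" where
  "\<alpha> i j = cond_pr P G {\<omega> \<in> space P. visits p i (path ((\<Sum>a\<in>{1..p}. i a) - 1) \<omega>) \<and> state ((\<Sum>a\<in>{1..p}. i a) - 1) \<omega> = Some j}"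

definition \<beta> :: "nat \<Rightarrow> nat \<Rightarrow> 'a \<Rightarrow> real" where
  "\<beta> l j = cond_pr_event P G {\<omega> \<in> space P. state l \<omega> = None} {\<omega> \<in> space P. state (l - 1) \<omega> = Some j}"

text \<open>The value of \<open>\<alpha>\<close> after freezing the clock at
  \<open>\<omega>\<close>.\<close>

definition visit_prob :: "'a \<Rightarrow> (nat \<Rightarrow> nat) \<Rightarrow> nat \<Rightarrow> nat \<Rightarrow> real" where
  "visit_prob \<omega> i l j = prob {\<omega>' \<in> space P. visits p i (past \<omega> l \<omega>') \<and> marked.chain (\<lambda>i. chi i \<omega>) l \<omega>' = Some j}"

lemma AE_\<alpha>: "AE \<omega> in P. \<forall>i\<in>multi_indices p. \<forall>j\<in>{1..p}. \<alpha> i j \<omega> = visit_prob \<omega> i ((\<Sum>a\<in>{1..p}. i a) - 1) j"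
proof (intro AE_ball_countable[THEN iffD2] ballI multi_indices_countable)
  fix i j
  show "AE \<omega> in P. \<alpha> i j \<omega> = visit_prob \<omega> i ((\<Sum>a\<in>{1..p}. i a) - 1) j"
    unfolding \<alpha>_def visit_prob_def
    using cond_pr_path_event[of "\<lambda>h. visits p i h \<and> last h = Some j" "(\<Sum>a\<in>{1..p}. i a) - 1"]
    by (simp only: last_path marked.history_last)
qed auto

lemma AE_\<beta>:
  "AE \<omega> in P. \<forall>l. \<forall>j\<in>{1..p}. 0 < cond_pr P G {\<omega>' \<in> space P. state l \<omega>' = Some j} \<omega> \<longrightarrow>
    \<beta> (Suc l) j \<omega> = 1 - (\<Sum>a\<in>{1..p}. marked.kernel (\<lambda>i. chi i \<omega>) (Suc l) j a)"
proof (intro AE_all_countable[THEN iffD2] AE_ball_countable[THEN iffD2] allI ballI)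
  fix l j assume j: "j \<in> {1..p}"
  have "AE \<omega> in P. cond_pr P G {\<omega>' \<in> space P. state l \<omega>' = Some j \<and> state (Suc l) \<omega>' = None} \<omega> =
      prob {\<omega>' \<in> space P. marked.chain (\<lambda>i. chi i \<omega>) l \<omega>' = Some j \<and> marked.chain (\<lambda>i. chi i \<omega>) (Suc l) \<omega>' = None}"
    using cond_pr_path_event[of "\<lambda>h. h ! l = Some j \<and> h ! Suc l = None" "Suc l"]
    by (simp only: path_nth marked.history_nth le_SucI order_refl)
  with cond_pr_state[of l "Some j"]
  show "AE \<omega> in P. 0 < cond_pr P G {\<omega>' \<in> space P. state l \<omega>' = Some j} \<omega> \<longrightarrow>
    \<beta> (Suc l) j \<omega> = 1 - (\<Sum>a\<in>{1..p}. marked.kernel (\<lambda>i. chi i \<omega>) (Suc l) j a)"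
  proof eventually_elim
    case (elim \<omega>)
    have eq: "{\<omega> \<in> space P. state (Suc l) \<omega> = None} \<inter> {\<omega> \<in> space P. state l \<omega> = Some j} =
        {\<omega>' \<in> space P. state l \<omega>' = Some j \<and> state (Suc l) \<omega>' = None}" by blast
    have "prob {\<omega>' \<in> space P. marked.chain (\<lambda>i. chi i \<omega>) l \<omega>' = Some j \<and> marked.chain (\<lambda>i. chi i \<omega>) (Suc l) \<omega>' = None} =
        prob {\<omega>' \<in> space P. marked.chain (\<lambda>i. chi i \<omega>) l \<omega>' = Some j} *
          (1 - (\<Sum>a\<in>{1..p}. marked.kernel (\<lambda>i. chi i \<omega>) (Suc l) j a))"
      using marked.frozen_termination[OF chi_nonneg j, where \<Psi>="\<lambda>_. True" and l=l] by (simp only: simp_thms)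
    then show ?case
      using elim unfolding \<beta>_def cond_pr_event_def diff_Suc_1 eq by simp
  qed
qed auto

text \<open>Where the conditioning event has conditional probability zero, \<open>\<alpha>\<close>
  vanishes, and so do both sides.\<close>

lemma AE_\<alpha>\<beta>:
  "AE \<omega> in P. \<forall>i\<in>multi_indices p. \<forall>j\<in>{1..p}. \<alpha> i j \<omega> * \<beta> (\<Sum>a\<in>{1..p}. i a) j \<omega> =
    prob {\<omega>' \<in> space P. visits p i (past \<omega> ((\<Sum>a\<in>{1..p}. i a) - 1) \<omega>') \<and>
      marked.chain (\<lambda>i. chi i \<omega>) ((\<Sum>a\<in>{1..p}. i a) - 1) \<omega>' = Some j \<and>
      marked.chain (\<lambda>i. chi i \<omega>) (\<Sum>a\<in>{1..p}. i a) \<omega>' = None}"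
proof -
  have "AE \<omega> in P. \<forall>l. \<forall>j\<in>{1..p}. cond_pr P G {\<omega>' \<in> space P. state l \<omega>' = Some j} \<omega> =
      prob {\<omega>' \<in> space P. marked.chain (\<lambda>i. chi i \<omega>) l \<omega>' = Some j}"
    by (intro AE_all_countable[THEN iffD2] AE_ball_countable[THEN iffD2] allI ballI cond_pr_state) auto
  with AE_\<alpha> AE_\<beta> show ?thesis
  proof eventually_elim
    case (elim \<omega>)
    show ?case
    proof (intro ballI)
      fix i j assume i: "i \<in> multi_indices p" and j: "j \<in> {1..p}"
      obtain l where l: "(\<Sum>a\<in>{1..p}. i a) = Suc l"
        using i by (cases "\<Sum>a\<in>{1..p}. i a") (auto simp: multi_indices_def)
      let ?c = "marked.chain (\<lambda>i. chi i \<omega>)"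
      have \<alpha>: "\<alpha> i j \<omega> = visit_prob \<omega> i l j" using elim(1) i j l by simp
      have fz: "prob {\<omega>' \<in> space P. visits p i (past \<omega> l \<omega>') \<and> ?c l \<omega>' = Some j \<and> ?c (Suc l) \<omega>' = None} =
          visit_prob \<omega> i l j * (1 - (\<Sum>a\<in>{1..p}. marked.kernel (\<lambda>i. chi i \<omega>) (Suc l) j a))"
        unfolding visit_prob_def by (rule marked.frozen_termination[OF chi_nonneg j])
      have "\<alpha> i j \<omega> * \<beta> (Suc l) j \<omega> = visit_prob \<omega> i l j * (1 - (\<Sum>a\<in>{1..p}. marked.kernel (\<lambda>i. chi i \<omega>) (Suc l) j a))"
      proof (cases "0 < cond_pr P G {\<omega>' \<in> space P. state l \<omega>' = Some j} \<omega>")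
        case True
        then show ?thesis using elim(2) j \<alpha> by simp
      next
        case False
        then have 0: "prob {\<omega>' \<in> space P. ?c l \<omega>' = Some j} \<le> 0" using elim(3) j by simp
        have "visit_prob \<omega> i l j \<le> prob {\<omega>' \<in> space P. ?c l \<omega>' = Some j}"
          unfolding visit_prob_def
          by (rule finite_measure_mono)
            (use past_events[of "\<lambda>h. last h = Some j" \<omega> l] in \<open>auto simp: marked.history_last\<close>)
        then have "visit_prob \<omega> i l j = 0" using 0 by (auto simp: visit_prob_def intro!: antisym)
        then show ?thesis using \<alpha> by simp
      qed
      then show "\<alpha> i j \<omega> * \<beta> (\<Sum>a\<in>{1..p}. i a) j \<omega> = prob {\<omega>' \<in> space P.
          visits p i (past \<omega> ((\<Sum>a\<in>{1..p}. i a) - 1) \<omega>') \<and> ?c ((\<Sum>a\<in>{1..p}. i a) - 1) \<omega>' = Some j \<and> ?c (\<Sum>a\<in>{1..p}. i a) \<omega>' = None}"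
        unfolding l diff_Suc_1 fz .
    qed
  qed
qed

lemma AE_\<alpha>_unit:
  "AE \<omega> in P. \<forall>h\<in>{1..p}. \<forall>j\<in>{1..p}. \<alpha> (unit_index p h) j \<omega> = (if h = j then \<pi> j else 0)"
  using AE_\<alpha>
proof eventually_elim
  case (elim \<omega>)
  show ?case
  proof (intro ballI)
    fix h j assume h: "h \<in> {1..p}" and j: "j \<in> {1..p}"
    let ?c = "marked.chain (\<lambda>i. chi i \<omega>)"
    have past: "past \<omega> 0 \<omega>' = [?c 0 \<omega>']" for \<omega>' by (simp add: marked.history_def)
    have "\<alpha> (unit_index p h) j \<omega> = visit_prob \<omega> (unit_index p h) 0 j"
      using elim unit_index(1,2)[OF h] j by simp
    also have "\<dots> = prob {\<omega>' \<in> space P. ?c 0 \<omega>' = Some h \<and> ?c 0 \<omega>' = Some j}"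
      unfolding visit_prob_def past unit_index(3)[OF h] by (simp only: simp_thms)
    also have "\<dots> = (if h = j then \<pi> j else 0)"
      using marked.frozen_initial[of "\<lambda>i. chi i \<omega>", OF chi_nonneg j] by (cases "h = j") (auto cong: conj_cong)
    finally show "\<alpha> (unit_index p h) j \<omega> = (if h = j then \<pi> j else 0)" .
  qed
qed

text \<open>Split by the previous state \<open>h\<close>, which exists because the counts leave no
  room for termination.\<close>

lemma visit_prob_step:
  assumes j: "j \<in> {1..p}" and i: "0 < i j" and l: "l = (\<Sum>a\<in>{1..p}. (i(j := i j - 1)) a) - 1" "0 < (\<Sum>a\<in>{1..p}. (i(j := i j - 1)) a)"
  shows "visit_prob \<omega> i (Suc l) j =
    (\<Sum>h\<in>{1..p}. visit_prob \<omega> (i(j := i j - 1)) l h * marked.kernel (\<lambda>i. chi i \<omega>) (Suc l) h j)"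
proof -
  let ?i = "i(j := i j - 1)" and ?c = "marked.chain (\<lambda>i. chi i \<omega>)"
  let ?E = "\<lambda>h. {\<omega>' \<in> space P. visits p ?i (past \<omega> l \<omega>') \<and> ?c l \<omega>' = Some h \<and> ?c (Suc l) \<omega>' = Some j}"
  have some: "\<exists>h\<in>{1..p}. ?c l \<omega>' = Some h" if v: "visits p ?i (past \<omega> l \<omega>')" for \<omega>'
  proof -
    have "set (past \<omega> l \<omega>') \<subseteq> Some ` {1..p}"
      by (rule visits_range[OF v]) (use l in \<open>simp only: marked.length_history Suc_diff_1\<close>)
    moreover have "?c l \<omega>' \<in> set (past \<omega> l \<omega>')"
      by (simp add: marked.history_def)
    ultimately show ?thesis by blast
  qed
  have "{\<omega>' \<in> space P. visits p i (past \<omega> (Suc l) \<omega>') \<and> ?c (Suc l) \<omega>' = Some j} = (\<Union>h\<in>{1..p}. ?E h)" (is "?L = ?R")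
  proof (rule set_eqI)
    fix \<omega>'
    have "visits p i (past \<omega> (Suc l) \<omega>') \<longleftrightarrow> visits p ?i (past \<omega> l \<omega>')" if "?c (Suc l) \<omega>' = Some j"
      unfolding marked.history_Suc that visits_snoc[OF j] using i by blast
    then show "\<omega>' \<in> ?L \<longleftrightarrow> \<omega>' \<in> ?R" using some[of \<omega>'] by blast
  qed
  moreover have "prob (\<Union>h\<in>{1..p}. ?E h) = (\<Sum>h\<in>{1..p}. prob (?E h))"
  proof (rule finite_measure_finite_Union)
    have "?E h \<in> events" for h
    proof -
      have "take (Suc l) (past \<omega> (Suc l) \<omega>') = past \<omega> l \<omega>'" for \<omega>'
        by (simp add: marked.history_Suc marked.length_history)
      then show ?thesis
        using past_events[of "\<lambda>g. visits p ?i (take (Suc l) g) \<and> g ! l = Some h \<and> g ! Suc l = Some j" \<omega> "Suc l"]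
        by (simp only: marked.history_nth le_SucI order_refl)
    qed
    then show "?E ` {1..p} \<subseteq> events" by blast
    show "disjoint_family_on ?E {1..p}" by (auto simp: disjoint_family_on_def)
  qed simp
  moreover have "prob (?E h) = visit_prob \<omega> ?i l h * marked.kernel (\<lambda>i. chi i \<omega>) (Suc l) h j" if "h \<in> {1..p}" for h
    unfolding visit_prob_def by (rule marked.frozen_markov[OF chi_nonneg that j])
  ultimately show ?thesis unfolding visit_prob_def[of \<omega> i] by simp
qed

lemma AE_\<alpha>_recursion:
  "AE \<omega> in P. \<forall>i\<in>multi_indices p. 2 \<le> (\<Sum>a\<in>{1..p}. i a) \<longrightarrow> (\<forall>j\<in>{1..p}. \<alpha> i j \<omega> =
    (if 0 < i j then \<Sum>h\<in>{1..p}. \<alpha> (i(j := i j - 1)) h \<omega> *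
      marked.kernel (\<lambda>i. chi i \<omega>) ((\<Sum>a\<in>{1..p}. i a) - 1) h j else 0))"
  using AE_\<alpha>
proof eventually_elim
  case (elim \<omega>)
  show ?case
  proof (intro ballI impI)
    fix i j assume i: "i \<in> multi_indices p" and two: "2 \<le> (\<Sum>a\<in>{1..p}. i a)" and j: "j \<in> {1..p}"
    let ?s = "\<Sum>a\<in>{1..p}. i a"
    have \<alpha>: "\<alpha> i j \<omega> = visit_prob \<omega> i (?s - 1) j" using elim i j by blast
    show "\<alpha> i j \<omega> = (if 0 < i j then \<Sum>h\<in>{1..p}. \<alpha> (i(j := i j - 1)) h \<omega> * marked.kernel (\<lambda>i. chi i \<omega>) (?s - 1) h j else 0)"
    proof (cases "0 < i j")
      case True
      note d = decrement_index[OF i j True two]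
      have s: "?s - 1 = Suc (?s - 1 - 1)" using two by simp
      have "visit_prob \<omega> i (Suc (?s - 1 - 1)) j =
          (\<Sum>h\<in>{1..p}. visit_prob \<omega> (i(j := i j - 1)) (?s - 1 - 1) h * marked.kernel (\<lambda>i. chi i \<omega>) (Suc (?s - 1 - 1)) h j)"
      proof (rule visit_prob_step[where j=j and i=i, OF j True])
        show "?s - 1 - 1 = (\<Sum>a\<in>{1..p}. (i(j := i j - 1)) a) - 1" unfolding d(2) ..
        show "0 < (\<Sum>a\<in>{1..p}. (i(j := i j - 1)) a)" unfolding d(2) using two by simp
      qed
      moreover have "\<alpha> (i(j := i j - 1)) h \<omega> = visit_prob \<omega> (i(j := i j - 1)) (?s - 1 - 1) h" if "h \<in> {1..p}" for h
        using elim[rule_format, OF d(1) that] unfolding d(2) .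
      ultimately show ?thesis unfolding \<alpha> if_P[OF True] s[symmetric] by (simp only: cong: sum.cong)
    next
      case False
      have "\<not> (visits p i (past \<omega> (?s - 1) \<omega>') \<and> marked.chain (\<lambda>i. chi i \<omega>) (?s - 1) \<omega>' = Some j)" for \<omega>'
      proof
        assume v: "visits p i (past \<omega> (?s - 1) \<omega>') \<and> marked.chain (\<lambda>i. chi i \<omega>) (?s - 1) \<omega>' = Some j"
        then have "Some j \<in> set (past \<omega> (?s - 1) \<omega>')" by (auto simp: marked.history_def)
        then have "count_list (past \<omega> (?s - 1) \<omega>') (Some j) \<noteq> 0" by (simp add: count_list_0_iff)
        then show False using v False j by (auto simp: visits_def)
      qed
      then have "visit_prob \<omega> i (?s - 1) j = prob {}"
        unfolding visit_prob_def by (intro arg_cong[where f=prob]) blast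
      then have "visit_prob \<omega> i (?s - 1) j = 0" by simp
      then show ?thesis using False \<alpha> by simp
    qed
  qed
qed

end

section \<open>Enumeration of multi-indices and densities of product laws\<close>

lemma infsum_ennreal_eq_suminf:
  fixes f :: "nat \<Rightarrow> ennreal"
  shows "(\<Sum>\<^sub>\<infinity>k. f k) = (\<Sum>k. f k)"
proof -
  have "(f has_sum infsum f UNIV) UNIV" by (rule has_sum_infsum, rule nonneg_summable_on_complete) (rule zero_le)
  then show ?thesis by (intro sums_unique has_sum_imp_sums)
qed

text \<open>The unordered sum in the mixture can thus be treated as a series, for which monotone
  convergence is available.\<close>

lemma multi_indices_enumeration:
  assumes "1 \<le> p"
  shows "\<exists>idx :: nat \<Rightarrow> nat \<Rightarrow> nat. bij_betw idx UNIV (multi_indices p)"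
proof -
  let ?e = "\<lambda>c. \<lambda>a\<in>{1..p}. if a = 1 then Suc c else 0"
  have "inj ?e"
  proof (rule injI)
    fix c d assume "?e c = ?e d"
    then have "?e c 1 = ?e d 1" by (rule fun_cong)
    then show "c = d" using assms by simp
  qed
  moreover have "range ?e \<subseteq> multi_indices p"
    using assms by (auto simp: multi_indices_def sum.delta)
  ultimately have inf: "infinite (multi_indices p)"
    using infinite_super[of "range ?e"] range_inj_infinite by metis
  have "bij_betw (from_nat_into (multi_indices p)) UNIV (multi_indices p)" by (rule bij_betw_from_nat_into[OF multi_indices_countable inf])
  then show ?thesis by blast
qed

text \<open>Only factors in \<open>I\<close> are constrained; the others are replaced by a point
  mass to apply the general form.\<close>

lemma density_PiM_on:
  assumes I: "finite I" and R: "\<And>k. k \<in> I \<Longrightarrow> sigma_finite_measure (R k)"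
    and f: "\<And>k. k \<in> I \<Longrightarrow> f k \<in> borel_measurable (R k)" and D: "\<And>k. k \<in> I \<Longrightarrow> prob_space (density (R k) (f k))"
  shows "density (PiM I R) (\<lambda>x. \<Prod>k\<in>I. f k (x k)) = (\<Pi>\<^sub>M k\<in>I. density (R k) (f k))"
proof -
  obtain z where z: "z \<in> space (return (count_space UNIV) undefined :: 'b measure)" by simp
  let ?N = "return (count_space UNIV) undefined :: 'b measure"
  have N: "prob_space ?N" by (rule prob_space_return) simp
  let ?R = "\<lambda>k. if k \<in> I then R k else ?N" and ?f = "\<lambda>k. if k \<in> I then f k else (\<lambda>_. 1)"
  have "density (PiM I ?R) (\<lambda>x. \<Prod>k\<in>I. ?f k (x k)) = (\<Pi>\<^sub>M k\<in>I. density (?R k) (?f k))"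
  proof (rule density_PiM[OF _ I])
    show "product_sigma_finite ?R"
      by (rule product_sigma_finite.intro) (use R N prob_space_imp_sigma_finite in auto)
    show "?f k \<in> borel_measurable (?R k)" for k using f by auto
    show "prob_space (density (?R k) (?f k))" for k using D N by (auto simp: density_1)
  qed
  moreover have "PiM I ?R = PiM I R" by (rule PiM_cong) simp_all
  moreover have "(\<Pi>\<^sub>M k\<in>I. density (?R k) (?f k)) = (\<Pi>\<^sub>M k\<in>I. density (R k) (f k))" by (rule PiM_cong) simp_all
  moreover have "(\<lambda>x. \<Prod>k\<in>I. ?f k (x k)) = (\<lambda>x. \<Prod>k\<in>I. f k (x k))" by (intro ext prod.cong) simp_all
  ultimately show ?thesis by simp
qed

lemma (in marked_chain_space) chain_absorbed: "chain t k \<omega> = None \<Longrightarrow> k \<le> l \<Longrightarrow> chain t l \<omega> = None"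
  unfolding chain_def by (rule marked_chain_absorbed)

lemma (in marked_chain_space) butlast_history: "butlast (history t (Suc l) \<omega>) = history t l \<omega>"
  by (simp add: history_Suc)

context reward_model
begin

section \<open>The law of the rewards collected along a fixed history\<close>

text \<open>The last entry of a history is the terminated state and collects nothing, hence
  \<open>length h - 1\<close>.\<close>

definition reward_vector :: "nat option list \<Rightarrow> 'a \<Rightarrow> nat \<Rightarrow> real" where
  "reward_vector h \<omega> = (\<lambda>k\<in>{1..m}. \<Sum>l<length h - 1. r (the (h ! l)) k * hold (Mn k) l \<omega>)"

abbreviation reward_algebra :: "nat \<Rightarrow> 'a measure" where
  "reward_algebra k \<equiv> sigma (space P) (\<Union>x\<in>reward_sources k \<inter> sources lam0 m. F x)"

lemma reward_algebra:
  "subalgebra P (reward_algebra k)" "sets (reward_algebra k) = H k" "space (reward_algebra k) = space P"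
proof -
  have ev: "(\<Union>x\<in>reward_sources k \<inter> sources lam0 m. F x) \<subseteq> events" using F_events by blast
  show *: "subalgebra P (reward_algebra k)" by (rule generated_subalgebra(1)[OF ev])
  then show "space (reward_algebra k) = space P" by (simp add: subalgebra_def)
  show "sets (reward_algebra k) = H k" by (rule H_properties(3))
qed

lemma hold_reward_algebra:
  assumes k: "k \<in> {1..m}"
  shows "hold (Mn k) l \<in> borel_measurable (reward_algebra k)"
proof -
  let ?A = "reward_algebra k"
  have F: "F x \<subseteq> sets ?A" if "x \<in> reward_sources k" "x \<in> sources lam0 m" for x
    unfolding reward_algebra(2) H_def using that by (blast intro: sigma_sets.Basic)
  have Msub: "sets (process_algebra P (M k)) \<subseteq> sets ?A"
    using F[of "Reward_Clock k"] k by (simp add: reward_sources_def sources_def)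
  have M'sub: "sets (process_algebra P (M' k l)) \<subseteq> sets ?A" if "l \<in> {lam0 + 1..n}" for l
    using F[of "Extra_Reward_Clock k l"] k that by (simp add: reward_sources_def sources_def)
  have Mm: "\<forall>t\<ge>0. M k t \<in> measurable P (count_space UNIV)" using M k by (simp add: poisson_process_def)
  have M'm: "\<forall>t\<ge>0. M' k l t \<in> measurable P (count_space UNIV)" if "l \<in> {lam0 + 1..n}" for l
    using M' k that by (simp add: poisson_process_def)
  have MA: "M k t \<in> measurable ?A (count_space UNIV)" if "0 \<le> t" for t
    by (rule measurable_process_generated[OF Mm that Msub reward_algebra(3)])
  have M'A: "M' k l t \<in> measurable ?A (count_space UNIV)" if "0 \<le> t" "l \<in> {lam0 + 1..n}" for l t
    by (rule measurable_process_generated[OF M'm[OF that(2)] that(1) M'sub[OF that(2)] reward_algebra(3)])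
  have "Mn k t \<in> measurable ?A (count_space UNIV)" if "0 \<le> t" for t
    unfolding Mn_eq using MA[OF that] M'A[OF that] by measurable
  then have "arrival (Mn k) l \<in> borel_measurable ?A" for l
    by (intro arrival_measurable) (use Mn_props(2)[OF k] reward_algebra(3) in auto)
  then show ?thesis unfolding hold_def[abs_def] by (intro borel_measurable_diff)
qed

lemma collected_reward_algebra:
  "k \<in> {1..m} \<Longrightarrow> (\<lambda>\<omega>. \<Sum>l<L. c l * hold (Mn k) l \<omega>) \<in> borel_measurable (reward_algebra k)"
  by (intro borel_measurable_sum borel_measurable_times borel_measurable_const hold_reward_algebra)

lemma reward_algebra_noise: "k \<in> {1..m} \<Longrightarrow> sets (reward_algebra k) \<subseteq> sets reward_noise"
  unfolding reward_algebra(2)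
  by (rule subsetI, rule marked.noise_algebra_mem[OF reward_noise_sources, of "Reward_Clock k"]) auto

lemma reward_vector_measurable:
  "reward_vector h \<in> measurable reward_noise (\<Pi>\<^sub>M k\<in>{1..m}. borel)"
  unfolding reward_vector_def[abs_def]
proof (rule measurable_restrict)
  fix k assume k: "k \<in> {1..m}"
  have "subalgebra reward_noise (reward_algebra k)"
    using reward_algebra_noise[OF k] marked.noise_algebra(1)[OF reward_noise_sources] reward_algebra(3)
    by (simp add: subalgebra_def)
  then show "(\<lambda>\<omega>. \<Sum>l<length h - 1. r (the (h ! l)) k * hold (Mn k) l \<omega>) \<in> borel_measurable reward_noise"
    by (rule measurable_from_subalg[OF _ collected_reward_algebra[OF k]])
qed

text \<open>Different reward types use different blocks of sources.\<close>

lemma collected_rewards_indep: "indep_vars (\<lambda>_. borel) (\<lambda>k \<omega>. \<Sum>l<L. c k l * hold (Mn k) l \<omega>) {1..m}"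
proof -
  have "indep_sets H {1..m}"
  proof (rule indep_setsI)
    show "H k \<subseteq> events" if "k \<in> {1..m}" for k
      using reward_algebra(1,2)[of k] by (auto simp: subalgebra_def)
    fix A K assume K: "K \<noteq> {}" "K \<subseteq> {1..m}" "finite K" and A: "\<forall>k\<in>K. A k \<in> H k"
    have "prob (\<Inter>x\<in>Reward_Clock ` K. (case x of Reward_Clock k \<Rightarrow> A k)) = (\<Prod>x\<in>Reward_Clock ` K. prob (case x of Reward_Clock k \<Rightarrow> A k))"
    proof (rule indep_setsD[OF noise])
      show "Reward_Clock ` K \<subseteq> noise_sources m" using K(2) by (auto simp: noise_sources_def)
    qed (use K A in auto)
    then show "prob (\<Inter>k\<in>K. A k) = (\<Prod>k\<in>K. prob (A k))"
      by (simp add: prod.reindex inj_on_def image_image)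
  qed
  then have "indep_sets (\<lambda>k. {(\<lambda>\<omega>. \<Sum>l<L. c k l * hold (Mn k) l \<omega>) -` A \<inter> space P | A. A \<in> sets borel}) {1..m}"
  proof (rule indep_sets_mono_sets)
    fix k assume k: "k \<in> {1..m}"
    show "{(\<lambda>\<omega>. \<Sum>l<L. c k l * hold (Mn k) l \<omega>) -` A \<inter> space P | A. A \<in> sets borel} \<subseteq> H k"
      using measurable_sets[OF collected_reward_algebra[OF k, where L=L and c="c k"]] unfolding reward_algebra(2,3) by blast
  qed
  moreover have "(\<lambda>\<omega>. \<Sum>l<L. c k l * hold (Mn k) l \<omega>) \<in> borel_measurable P" if "k \<in> {1..m}" for k
    by (rule measurable_from_subalg[OF reward_algebra(1) collected_reward_algebra[OF that]])
  ultimately show ?thesis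
    by (intro indep_vars_def2[THEN iffD2] conjI ballI)
qed

text \<open>Along a fixed history the rewards are weighted sums of exponential holding times,
  independent across reward types.\<close>

lemma distr_reward_vector:
  assumes v: "visits p i h" and len: "length h = (\<Sum>a\<in>{1..p}. i a)"
  shows "distr P (\<Pi>\<^sub>M k\<in>{1..m}. borel) (reward_vector (h @ [s])) = (\<Pi>\<^sub>M k\<in>{1..m}. hypoexp_law p n r k i)"
proof -
  let ?L = "length h" and ?Z = "\<lambda>k \<omega>. \<Sum>l<length h. r (the (h ! l)) k * hold (Mn k) l \<omega>"
  have rng: "the (h ! l) \<in> {1..p}" "h ! l = Some (the (h ! l))" if "l < ?L" for l
  proof -
    have "h ! l \<in> Some ` {1..p}" using visits_range[OF v len] nth_mem[OF that] by blast
    then show "the (h ! l) \<in> {1..p}" "h ! l = Some (the (h ! l))" by auto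
  qed
  have vec: "reward_vector (h @ [s]) = (\<lambda>\<omega>. \<lambda>k\<in>{1..m}. ?Z k \<omega>)"
    by (intro ext) (simp add: reward_vector_def nth_append)
  have "distr P (\<Pi>\<^sub>M k\<in>{1..m}. borel) (\<lambda>\<omega>. \<lambda>k\<in>{1..m}. ?Z k \<omega>) = (\<Pi>\<^sub>M k\<in>{1..m}. distr P borel (?Z k))"
  proof (rule indep_vars_iff_distr_eq_PiM'[THEN iffD1])
    show "{1..m} \<noteq> {}" using m by auto
    show "?Z k \<in> borel_measurable P" if "k \<in> {1..m}" for k
      by (rule measurable_from_subalg[OF reward_algebra(1) collected_reward_algebra[OF that]])
    show "indep_vars (\<lambda>_. borel) ?Z {1..m}" by (rule collected_rewards_indep)
  qed
  also have "\<dots> = (\<Pi>\<^sub>M k\<in>{1..m}. hypoexp_law p n r k i)"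
  proof (rule PiM_cong)
    fix k assume k: "k \<in> {1..m}"
    have pos: "0 < real n" using n_pos by simp
    have "distr P borel (?Z k) = distr (\<Pi>\<^sub>M j\<in>{1..p}. erlang_law (card {l. l < ?L \<and> the (h ! l) = j}) (ereal n / ereal (r j k))) borel
        (\<lambda>x. \<Sum>j\<in>{1..p}. x j)"
      by (rule distr_reward_sum[OF pos hold_indep[OF Mn_grid[OF k] pos] hold_exponential[OF Mn_grid[OF k] pos]])
        (use r k p rng in auto)
    also have "(\<Pi>\<^sub>M j\<in>{1..p}. erlang_law (card {l. l < ?L \<and> the (h ! l) = j}) (ereal n / ereal (r j k))) =
        (\<Pi>\<^sub>M j\<in>{1..p}. erlang_law (i j) (ereal n / ereal (r j k)))"
    proof (rule PiM_cong)
      fix j assume j: "j \<in> {1..p}"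
      have "i j = count_list (map ((!) h) [0..<?L]) (Some j)"
        using v j by (simp add: map_nth visits_def)
      also have "\<dots> = card {l. l < ?L \<and> h ! l = Some j}" by (rule count_list_map_upt)
      also have "{l. l < ?L \<and> h ! l = Some j} = {l. l < ?L \<and> the (h ! l) = j}"
        using rng(2) by force
      finally show "erlang_law (card {l. l < ?L \<and> the (h ! l) = j}) (ereal n / ereal (r j k)) =
          erlang_law (i j) (ereal n / ereal (r j k))" by simp
    qed simp
    finally show "distr P borel (?Z k) = hypoexp_law p n r k i" unfolding hypoexp_law_def .
  qed simp
  finally show ?thesis unfolding vec .
qed

section \<open>The conditional density\<close>

text \<open>The histories with prescribed counts are finitely many; history and reward clocks are
  independent, and the law of the rewards is the same for all of these histories.\<close>

lemma frozen_reward: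
  assumes i: "i \<in> multi_indices p" and l: "(\<Sum>a\<in>{1..p}. i a) = Suc l" and A: "A \<in> sets (\<Pi>\<^sub>M k\<in>{1..m}. borel)"
  shows "prob {\<omega>' \<in> space P. visits p i (past \<omega> l \<omega>') \<and> marked.chain (\<lambda>i. chi i \<omega>) (Suc l) \<omega>' = None \<and>
      reward_vector (past \<omega> (Suc l) \<omega>') \<omega>' \<in> A} =
    prob {\<omega>' \<in> space P. visits p i (past \<omega> l \<omega>') \<and> marked.chain (\<lambda>i. chi i \<omega>) (Suc l) \<omega>' = None} *
      measure (\<Pi>\<^sub>M k\<in>{1..m}. hypoexp_law p n r k i) A"
proof -
  let ?c = "marked.chain (\<lambda>i. chi i \<omega>)"
  let ?\<mu> = "\<Pi>\<^sub>M k\<in>{1..m}. hypoexp_law p n r k i"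
  define Hs where "Hs = (\<lambda>h. h @ [None]) ` {h. set h \<subseteq> Some ` {1..p} \<and> length h = Suc l \<and> visits p i h}"
  have "finite {h. set h \<subseteq> Some ` {1..p} \<and> length h = Suc l}"
    by (rule finite_lists_length_eq) simp
  then have fin: "finite Hs" unfolding Hs_def by (intro finite_imageI) (rule finite_subset[rotated], assumption, blast)
  let ?E = "\<lambda>h. {\<omega>' \<in> space P. past \<omega> (Suc l) \<omega>' = h}"
  let ?R = "\<lambda>h. reward_vector h -` A \<inter> space P"
  have mem: "visits p i (past \<omega> l \<omega>') \<and> ?c (Suc l) \<omega>' = None \<longleftrightarrow> past \<omega> (Suc l) \<omega>' \<in> Hs" for \<omega>'
  proof
    assume v: "visits p i (past \<omega> l \<omega>') \<and> ?c (Suc l) \<omega>' = None"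
    then have "set (past \<omega> l \<omega>') \<subseteq> Some ` {1..p}"
      using visits_range[of p i "past \<omega> l \<omega>'"] l by (simp only: marked.length_history)
    then show "past \<omega> (Suc l) \<omega>' \<in> Hs"
      unfolding Hs_def using v by (intro image_eqI[of _ _ "past \<omega> l \<omega>'"]) (simp_all add: marked.history_Suc marked.length_history)
  next
    assume "past \<omega> (Suc l) \<omega>' \<in> Hs"
    then show "visits p i (past \<omega> l \<omega>') \<and> ?c (Suc l) \<omega>' = None"
      by (auto simp: Hs_def marked.history_Suc)
  qed
  have R: "?R h \<in> sets reward_noise" for h
    using measurable_sets[OF reward_vector_measurable A] unfolding marked.noise_algebra(1)[OF reward_noise_sources] .
  then have Rev: "?R h \<in> events" for h using marked.noise_algebra(3)[OF reward_noise_sources] by blast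
  have Eev: "?E h \<in> events" for h by (rule past_events)
  have prod: "prob (?E h \<inter> ?R h) = prob (?E h) * measure ?\<mu> A" if h: "h \<in> Hs" for h
  proof -
    have "prob (?E h \<inter> ?R h) = prob (?E h) * prob (?R h)"
    proof (rule marked.noise_indep_prob[OF marked.chain_noise reward_noise_sources _ _ R])
      show "marked.chain_noise \<inter> Reward_Clock ` {1..m} = {}" by (auto simp: marked.chain_noise_def)
      show "?E h \<in> sets (marked.noise_algebra marked.chain_noise)"
        by (rule marked.history_events(1)) (rule chi_nonneg)
    qed
    also have "prob (?R h) = measure (distr P (\<Pi>\<^sub>M k\<in>{1..m}. borel) (reward_vector h)) A"
      by (rule measure_distr[symmetric, OF _ A])
        (rule measurable_from_subalg[OF marked.noise_algebra(4)[OF reward_noise_sources] reward_vector_measurable])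
    also have "distr P (\<Pi>\<^sub>M k\<in>{1..m}. borel) (reward_vector h) = ?\<mu>"
    proof -
      obtain g where g: "h = g @ [None]" "length g = Suc l" "visits p i g" using h unfolding Hs_def by blast
      show ?thesis unfolding g(1) by (rule distr_reward_vector[OF g(3)]) (use g(2) l in \<open>simp only:\<close>)
    qed
    finally show ?thesis .
  qed
  have left: "{\<omega>' \<in> space P. visits p i (past \<omega> l \<omega>') \<and> ?c (Suc l) \<omega>' = None \<and>
      reward_vector (past \<omega> (Suc l) \<omega>') \<omega>' \<in> A} = (\<Union>h\<in>Hs. ?E h \<inter> ?R h)"
    using mem by auto
  have right: "{\<omega>' \<in> space P. visits p i (past \<omega> l \<omega>') \<and> ?c (Suc l) \<omega>' = None} = (\<Union>h\<in>Hs. ?E h)"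
    using mem by auto
  have "prob (\<Union>h\<in>Hs. ?E h \<inter> ?R h) = (\<Sum>h\<in>Hs. prob (?E h \<inter> ?R h))"
    by (rule finite_measure_finite_Union[OF fin]) (use Eev Rev in \<open>auto simp: disjoint_family_on_def\<close>)
  also have "\<dots> = (\<Sum>h\<in>Hs. prob (?E h)) * measure ?\<mu> A"
    using prod by (simp add: sum_distrib_right)
  also have "(\<Sum>h\<in>Hs. prob (?E h)) = prob (\<Union>h\<in>Hs. ?E h)"
    by (rule finite_measure_finite_Union[OF fin, symmetric]) (use Eev in \<open>auto simp: disjoint_family_on_def\<close>)
  finally show ?thesis unfolding left right .
qed

definition total :: "(nat \<Rightarrow> nat) \<Rightarrow> nat" where
  "total i = (\<Sum>a\<in>{1..p}. i a)"

definition rewards :: "'a \<Rightarrow> nat \<Rightarrow> real" where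
  "rewards \<omega> = (\<lambda>k\<in>{1..m}. Y k \<omega>)"

text \<open>The visit counts at termination equal \<open>i\<close>, for the clock frozen at
  \<open>\<omega>\<close>.\<close>

definition ends_with :: "'a \<Rightarrow> (nat \<Rightarrow> nat) \<Rightarrow> 'a set" where
  "ends_with \<omega> i = {\<omega>' \<in> space P. visits p i (past \<omega> (total i - 1) \<omega>') \<and> marked.chain (\<lambda>i. chi i \<omega>) (total i) \<omega>' = None}"

lemma multi_index_total: "i \<in> multi_indices p \<Longrightarrow> \<exists>l. total i = Suc l"
  unfolding multi_indices_def total_def using gr0_implies_Suc by blast

lemma alive_before:
  assumes "i \<in> multi_indices p" "\<omega>' \<in> ends_with \<omega> i"
  shows "marked.chain (\<lambda>i. chi i \<omega>) (total i - 1) \<omega>' \<in> Some ` {1..p}"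
proof -
  obtain l where l: "total i = Suc l" using multi_index_total[OF assms(1)] by blast
  have "visits p i (past \<omega> l \<omega>')" using assms(2) by (simp add: ends_with_def l)
  then have "set (past \<omega> l \<omega>') \<subseteq> Some ` {1..p}"
    by (rule visits_range) (use l in \<open>simp only: marked.length_history total_def\<close>)
  moreover have "marked.chain (\<lambda>i. chi i \<omega>) l \<omega>' \<in> set (past \<omega> l \<omega>')" by (simp add: marked.history_def)
  ultimately show ?thesis unfolding l diff_Suc_1 by blast
qed

lemma ends_with_disjoint:
  assumes i: "i \<in> multi_indices p" "\<omega>' \<in> ends_with \<omega> i" and j: "j \<in> multi_indices p" "\<omega>' \<in> ends_with \<omega> j"
  shows "i = j"
proof -
  let ?c = "marked.chain (\<lambda>i. chi i \<omega>)"
  have le: "total i' \<le> total j'" if i': "i' \<in> multi_indices p" "\<omega>' \<in> ends_with \<omega> i'" and j': "\<omega>' \<in> ends_with \<omega> j'" for i' j'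
  proof (rule ccontr)
    assume "\<not> total i' \<le> total j'"
    then have "total j' \<le> total i' - 1" by simp
    moreover have "?c (total j') \<omega>' = None" using j' by (simp add: ends_with_def)
    ultimately have "?c (total i' - 1) \<omega>' = None" by (rule marked.chain_absorbed[rotated])
    then show False using alive_before[OF i'] by auto
  qed
  have "total i = total j" using le[OF i j(2)] le[OF j i(2)] by (rule antisym)
  then have "i a = j a" if "a \<in> {1..p}" for a
    using i(2) j(2) that by (simp add: ends_with_def visits_def)
  moreover have "i \<in> {1..p} \<rightarrow>\<^sub>E UNIV" "j \<in> {1..p} \<rightarrow>\<^sub>E UNIV" using i(1) j(1) by (simp_all add: multi_indices_def)
  ultimately show ?thesis by (intro PiE_ext)
qed

text \<open>Up to termination the history consists of states \<open>1, \<dots>, p\<close> only,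
  and its counts add up to its length.\<close>

lemma ends_with_exhaustive:
  assumes "\<omega>' \<in> space P" "0 < l" "marked.chain (\<lambda>i. chi i \<omega>) l \<omega>' = None" "marked.chain (\<lambda>i. chi i \<omega>) (l - 1) \<omega>' \<noteq> None"
  shows "\<exists>i\<in>multi_indices p. total i = l \<and> \<omega>' \<in> ends_with \<omega> i"
proof -
  let ?c = "marked.chain (\<lambda>i. chi i \<omega>)"
  obtain l' where l': "l = Suc l'" using assms(2) by (cases l) simp_all
  have "?c k \<omega>' \<in> Some ` {1..p}" if "k \<le> l'" for k
  proof -
    have "?c k \<omega>' \<noteq> None"
    proof
      assume "?c k \<omega>' = None"
      then have "?c l' \<omega>' = None" using that by (rule marked.chain_absorbed)
      then show False using assms(4) unfolding l' diff_Suc_1 by contradiction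
    qed
    then obtain a where "?c k \<omega>' = Some a" by blast
    moreover from this have "a \<in> {1..p}" by (rule marked.chain_range[rotated]) (rule chi_nonneg)
    ultimately show ?thesis by simp
  qed
  then have s: "set (past \<omega> l' \<omega>') \<subseteq> Some ` {1..p}"
    unfolding marked.history_def by (auto simp: less_Suc_eq_le simp del: upt_Suc)
  define i where "i = (\<lambda>a\<in>{1..p}. count_list (past \<omega> l' \<omega>') (Some a))"
  have v: "visits p i (past \<omega> l' \<omega>')" by (simp add: visits_def i_def)
  have t: "total i = Suc l'" using visits_length[OF v s] by (simp only: marked.length_history total_def)
  have "i \<in> {1..p} \<rightarrow>\<^sub>E UNIV" by (simp add: i_def)
  then have "i \<in> multi_indices p" using t unfolding multi_indices_def total_def by simp
  moreover have "\<omega>' \<in> ends_with \<omega> i"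
    unfolding ends_with_def t diff_Suc_1 using v assms(1,3) l' by simp
  ultimately show ?thesis using t l' by blast
qed

lemma prob_ends_with:
  assumes i: "i \<in> multi_indices p"
  shows "(\<Sum>j\<in>{1..p}. prob {\<omega>' \<in> space P. visits p i (past \<omega> (total i - 1) \<omega>') \<and>
      marked.chain (\<lambda>i. chi i \<omega>) (total i - 1) \<omega>' = Some j \<and> marked.chain (\<lambda>i. chi i \<omega>) (total i) \<omega>' = None}) =
    prob (ends_with \<omega> i)"
proof -
  obtain l where l: "total i = Suc l" using multi_index_total[OF i] by blast
  let ?c = "marked.chain (\<lambda>i. chi i \<omega>)"
  let ?E = "\<lambda>j. {\<omega>' \<in> space P. visits p i (past \<omega> l \<omega>') \<and> ?c l \<omega>' = Some j \<and> ?c (Suc l) \<omega>' = None}"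
  have "ends_with \<omega> i = (\<Union>j\<in>{1..p}. ?E j)"
    using alive_before[OF i, of _ \<omega>] unfolding ends_with_def l diff_Suc_1 by blast
  moreover have "prob (\<Union>j\<in>{1..p}. ?E j) = (\<Sum>j\<in>{1..p}. prob (?E j))"
  proof (rule finite_measure_finite_Union)
    have "?E j \<in> events" for j
      using past_events[of "\<lambda>g. visits p i (butlast g) \<and> g ! l = Some j \<and> g ! Suc l = None" \<omega> "Suc l"]
      by (simp only: marked.butlast_history marked.history_nth le_SucI order_refl)
    then show "?E ` {1..p} \<subseteq> events" by blast
    show "disjoint_family_on ?E {1..p}" by (auto simp: disjoint_family_on_def)
  qed simp
  ultimately show ?thesis unfolding l diff_Suc_1 by simp
qed

lemma rewards_measurable: "rewards \<in> measurable P (\<Pi>\<^sub>M k\<in>{1..m}. borel)"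
  unfolding rewards_def[abs_def] by (rule measurable_restrict) (rule Y_measurable)

definition lifetime_is :: "nat \<Rightarrow> nat option list \<Rightarrow> bool" where
  "lifetime_is l h \<longleftrightarrow> 0 < l \<and> h ! l = None \<and> h ! (l - 1) \<noteq> None"

lemma AE_rewards_as_vector:
  "AE \<omega> in P. rewards \<omega> \<in> A \<longleftrightarrow> (\<exists>l. lifetime_is l (path l \<omega>) \<and> reward_vector (path l \<omega>) \<omega> \<in> A)"
  using AE_lifetime AE_reward_sum
proof eventually_elim
  case (elim \<omega>)
  obtain L where L: "0 < L" "\<forall>l. state l \<omega> = None \<longleftrightarrow> L \<le> l" using elim(1) by blast
  have "lifetime_is l (path l \<omega>) \<longleftrightarrow> l = L" for l
  proof -
    have "lifetime_is l (path l \<omega>) \<longleftrightarrow> 0 < l \<and> L \<le> l \<and> \<not> L \<le> l - 1"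
      unfolding lifetime_is_def using L(2) by (simp add: path_nth)
    then show ?thesis using L(1) by auto
  qed
  moreover have "reward_vector (path L \<omega>) \<omega> = rewards \<omega>"
  proof (rule ext)
    fix k
    have "(\<Sum>l<L. r (the (path L \<omega> ! l)) k * hold (Mn k) l \<omega>) = (\<Sum>l<L. r (the (state l \<omega>)) k * hold (Mn k) l \<omega>)"
      by (intro sum.cong refl) (simp add: path_nth)
    then show "reward_vector (path L \<omega>) \<omega> k = rewards \<omega> k"
      using elim(2)[rule_format, of k L] L(2) by (auto simp: reward_vector_def rewards_def path_def restrict_def simp del: upt_Suc)
  qed
  ultimately show ?case by auto
qed

lemma prob_space_hypoexp_laws: "prob_space (\<Pi>\<^sub>M k\<in>{1..m}. hypoexp_law p n r k i)"
proof -
  have "prob_space (\<Pi>\<^sub>M k\<in>{1..m}. if k \<in> {1..m} then hypoexp_law p n r k i else return borel 0)"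
    using hypoexp_law_props(1)[OF n_pos] r by (intro prob_space_PiM) (auto intro: prob_space_return)
  also have "(\<Pi>\<^sub>M k\<in>{1..m}. if k \<in> {1..m} then hypoexp_law p n r k i else return borel 0) = (\<Pi>\<^sub>M k\<in>{1..m}. hypoexp_law p n r k i)"
    by (rule PiM_cong) simp_all
  finally show ?thesis .
qed

text \<open>The event is frozen and then split by the visit counts at termination, which form a
  countable partition.\<close>

lemma cond_pr_rewards:
  assumes idx: "bij_betw idx UNIV (multi_indices p)" and A: "A \<in> sets (\<Pi>\<^sub>M k\<in>{1..m}. borel)"
  shows "AE \<omega> in P. ennreal (cond_pr P G (rewards -` A \<inter> space P) \<omega>) =
    (\<Sum>k. ennreal (prob (ends_with \<omega> (idx k))) * emeasure (\<Pi>\<^sub>M c\<in>{1..m}. hypoexp_law p n r c (idx k)) A)"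
proof -
  let ?B = "\<lambda>h. reward_vector h -` A \<inter> space P"
  have B: "?B h \<in> sets reward_noise" for h
    using measurable_sets[OF reward_vector_measurable A] unfolding marked.noise_algebra(1)[OF reward_noise_sources] .
  then have Bev: "?B h \<in> events" for h using marked.noise_algebra(3)[OF reward_noise_sources] by blast
  have idxm: "idx k \<in> multi_indices p" for k by (rule bij_betw_apply[OF idx UNIV_I])
  have "AE \<omega> in P. cond_pr P G (rewards -` A \<inter> space P) \<omega> =
      cond_pr P G {\<omega>' \<in> space P. \<exists>l. lifetime_is l (path l \<omega>') \<and> \<omega>' \<in> ?B (path l \<omega>')} \<omega>"
  proof (rule cond_pr_cong_AE)
    show "rewards -` A \<inter> space P \<in> events" by (rule measurable_sets[OF rewards_measurable A])
    show "{\<omega>' \<in> space P. \<exists>l. lifetime_is l (path l \<omega>') \<and> \<omega>' \<in> ?B (path l \<omega>')} \<in> events"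
      by (rule path_events) (rule Bev)
    show "AE \<omega> in P. (\<omega> \<in> rewards -` A \<inter> space P) = (\<omega> \<in> {\<omega>' \<in> space P. \<exists>l. lifetime_is l (path l \<omega>') \<and> \<omega>' \<in> ?B (path l \<omega>')})"
      using AE_rewards_as_vector[of A] AE_space by eventually_elim blast
  qed
  with cond_pr_path[where B="\<lambda>l h. ?B h" and \<Psi>=lifetime_is, OF B] show ?thesis
  proof eventually_elim
    case (elim \<omega>)
    let ?c = "marked.chain (\<lambda>i. chi i \<omega>)"
    define D where "D i = {\<omega>' \<in> space P. visits p i (past \<omega> (total i - 1) \<omega>') \<and> ?c (total i) \<omega>' = None \<and>
      reward_vector (past \<omega> (total i) \<omega>') \<omega>' \<in> A}" for i
    have D_ends: "D i = {\<omega>' \<in> ends_with \<omega> i. reward_vector (past \<omega> (total i) \<omega>') \<omega>' \<in> A}" for i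
      unfolding D_def ends_with_def by blast
    have Dev: "D i \<in> events" if i: "i \<in> multi_indices p" for i
    proof -
      obtain l where l: "total i = Suc l" using multi_index_total[OF i] by blast
      have "D i = (\<Union>h\<in>{h. visits p i (butlast h) \<and> h ! Suc l = None}. {\<omega>' \<in> space P. past \<omega> (Suc l) \<omega>' = h} \<inter> ?B h)"
        unfolding D_def l diff_Suc_1 by (auto simp: marked.butlast_history marked.history_nth)
      also have "\<dots> \<in> events"
        by (intro sets.countable_UN'' sets.Int past_events Bev countableI_type)
      finally show ?thesis .
    qed
    have life: "lifetime_is l (past \<omega> l \<omega>') \<longleftrightarrow> 0 < l \<and> ?c l \<omega>' = None \<and> ?c (l - 1) \<omega>' \<noteq> None" for l \<omega>'
      by (simp add: lifetime_is_def marked.history_nth)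
    have "{\<omega>' \<in> space P. \<exists>l. lifetime_is l (past \<omega> l \<omega>') \<and> \<omega>' \<in> ?B (past \<omega> l \<omega>')} = (\<Union>k. D (idx k))" (is "?L = ?R")
    proof (intro equalityI subsetI)
      fix \<omega>' assume "\<omega>' \<in> ?L"
      then obtain l where l: "\<omega>' \<in> space P" "0 < l" "?c l \<omega>' = None" "?c (l - 1) \<omega>' \<noteq> None" "reward_vector (past \<omega> l \<omega>') \<omega>' \<in> A"
        unfolding life by blast
      obtain i where i: "i \<in> multi_indices p" "total i = l" "\<omega>' \<in> ends_with \<omega> i"
        using ends_with_exhaustive[OF l(1-4)] by blast
      obtain k where k: "i = idx k" using i(1) unfolding bij_betw_imp_surj_on[OF idx, symmetric] by (rule imageE)
      have "\<omega>' \<in> D (idx k)" unfolding D_ends using i(3) l(5) unfolding k[symmetric] i(2) by (intro CollectI conjI)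
      then show "\<omega>' \<in> ?R" by blast
    next
      fix \<omega>' assume "\<omega>' \<in> ?R"
      then obtain k where k: "\<omega>' \<in> D (idx k)" by blast
      then have e: "\<omega>' \<in> ends_with \<omega> (idx k)" unfolding D_ends by simp
      have "0 < total (idx k)" using multi_index_total[OF idxm[of k]] by auto
      moreover have "?c (total (idx k) - 1) \<omega>' \<noteq> None" using alive_before[OF idxm e] by auto
      ultimately have "lifetime_is (total (idx k)) (past \<omega> (total (idx k)) \<omega>')" unfolding life using e by (simp add: ends_with_def)
      then show "\<omega>' \<in> ?L" using k unfolding D_ends ends_with_def by blast
    qed
    then have "ennreal (cond_pr P G (rewards -` A \<inter> space P) \<omega>) = emeasure P (\<Union>k. D (idx k))"
      using elim by (simp only: emeasure_eq_measure)
    also have "\<dots> = (\<Sum>k. emeasure P (D (idx k)))"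
    proof (rule suminf_emeasure[symmetric])
      show "range (\<lambda>k. D (idx k)) \<subseteq> events" using Dev idxm by blast
      show "disjoint_family (\<lambda>k. D (idx k))"
        unfolding disjoint_family_on_def
      proof (intro ballI impI)
        fix k l :: nat assume "k \<noteq> l"
        then have ne: "idx k \<noteq> idx l" using inj_onD[OF bij_betw_imp_inj_on[OF idx] _ UNIV_I UNIV_I] by blast
        show "D (idx k) \<inter> D (idx l) = {}"
        proof (rule equals0I)
          fix \<omega>' assume "\<omega>' \<in> D (idx k) \<inter> D (idx l)"
          then have "\<omega>' \<in> ends_with \<omega> (idx k)" "\<omega>' \<in> ends_with \<omega> (idx l)" unfolding D_ends by simp_all
          then show False using ends_with_disjoint[OF idxm _ idxm] ne by blast
        qed
      qed
    qed
    also have "\<dots> = (\<Sum>k. ennreal (prob (ends_with \<omega> (idx k))) * emeasure (\<Pi>\<^sub>M c\<in>{1..m}. hypoexp_law p n r c (idx k)) A)"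
    proof (rule suminf_cong)
      fix k
      let ?\<mu> = "\<Pi>\<^sub>M c\<in>{1..m}. hypoexp_law p n r c (idx k)"
      obtain l where l: "total (idx k) = Suc l" using multi_index_total[OF idxm] by blast
      have "prob (D (idx k)) = prob (ends_with \<omega> (idx k)) * measure ?\<mu> A"
        unfolding D_def ends_with_def l diff_Suc_1 using frozen_reward[OF idxm _ A, of k l \<omega>] l by (simp only: total_def)
      moreover have "prob_space ?\<mu>" by (rule prob_space_hypoexp_laws)
      ultimately show "emeasure P (D (idx k)) = ennreal (prob (ends_with \<omega> (idx k))) * emeasure ?\<mu> A"
        by (simp only: emeasure_eq_measure ennreal_mult[OF measure_nonneg measure_nonneg] finite_measure.emeasure_eq_measure[OF prob_space.finite_measure])
    qed
    finally show ?case .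
  qed
qed

abbreviation base :: "(nat \<Rightarrow> real) measure" where
  "base \<equiv> \<Pi>\<^sub>M k\<in>{1..m}. reward_base p r k"

abbreviation dens :: "(nat \<Rightarrow> nat) \<Rightarrow> (nat \<Rightarrow> real) \<Rightarrow> ennreal" where
  "dens i x \<equiv> \<Prod>k\<in>{1..m}. hypoexp_dens p n r k i (x k)"

abbreviation mixture :: "'a \<Rightarrow> (nat \<Rightarrow> real) \<Rightarrow> ennreal" where
  "mixture \<omega> x \<equiv> \<Sum>\<^sub>\<infinity>i\<in>multi_indices p. \<Sum>j\<in>{1..p}. ennreal (\<alpha> i j \<omega> * \<beta> (total i) j \<omega>) * dens i x"

lemma sets_base: "sets base = sets (\<Pi>\<^sub>M k\<in>{1..m}. borel)"
  by (rule sets_PiM_cong) simp_all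

lemma hypoexp_densities:
  assumes "k \<in> {1..m}" "i \<in> multi_indices p"
  shows "hypoexp_dens p n r k i \<in> borel_measurable (reward_base p r k)"
    "density (reward_base p r k) (hypoexp_dens p n r k i) = hypoexp_law p n r k i"
  using hypoexp_density[where r=r and k=k, OF n_pos _ assms(2)] r assms(1) by auto

lemma dens_measurable:
  assumes i: "i \<in> multi_indices p"
  shows "dens i \<in> borel_measurable base"
proof (rule borel_measurable_prod_ennreal)
  fix k assume k: "k \<in> {1..m}"
  have "(\<lambda>x. x k) \<in> measurable base (reward_base p r k)" by (rule measurable_component_singleton[OF k])
  then show "(\<lambda>x. hypoexp_dens p n r k i (x k)) \<in> borel_measurable base"
    by (rule measurable_compose[OF _ hypoexp_densities(1)[OF k i]])
qed

lemma density_dens: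
  assumes i: "i \<in> multi_indices p"
  shows "density base (dens i) = (\<Pi>\<^sub>M k\<in>{1..m}. hypoexp_law p n r k i)"
proof -
  have "density base (dens i) = (\<Pi>\<^sub>M k\<in>{1..m}. density (reward_base p r k) (hypoexp_dens p n r k i))"
    by (rule density_PiM_on)
      (use hypoexp_densities i hypoexp_law_props(1)[OF n_pos] r in \<open>auto simp: sigma_finite_reward_base\<close>)
  also have "\<dots> = (\<Pi>\<^sub>M k\<in>{1..m}. hypoexp_law p n r k i)"
    by (rule PiM_cong) (use hypoexp_densities(2) i in auto)
  finally show ?thesis .
qed

lemma weights_measurable: "\<alpha> i j \<in> borel_measurable G" "\<beta> l j \<in> borel_measurable G"
  unfolding \<alpha>_def \<beta>_def cond_pr_event_def[abs_def] cond_pr_def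
  by (intro borel_measurable_cond_exp borel_measurable_divide)+

text \<open>The mixture density integrates term by term to the mixture of laws in
  \<open>cond_pr_rewards\<close>.\<close>

theorem conditional_density_rewards: "conditional_density P G base rewards mixture"
proof -
  obtain idx :: "nat \<Rightarrow> nat \<Rightarrow> nat" where idx: "bij_betw idx UNIV (multi_indices p)" using multi_indices_enumeration[OF p] ..
  have idxm: "idx k \<in> multi_indices p" for k by (rule bij_betw_apply[OF idx UNIV_I])
  let ?w = "\<lambda>k j \<omega>. ennreal (\<alpha> (idx k) j \<omega> * \<beta> (total (idx k)) j \<omega>)"
  have mix: "mixture \<omega> x = (\<Sum>k. \<Sum>j\<in>{1..p}. ?w k j \<omega> * dens (idx k) x)" for \<omega> x
    by (rule trans[OF infsum_reindex_bij_betw[OF idx, symmetric] infsum_ennreal_eq_suminf])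
  have wG: "?w k j \<in> borel_measurable G" for k j
    by (intro measurable_compose[OF _ measurable_ennreal] borel_measurable_times weights_measurable)
  show ?thesis
    unfolding conditional_density_def
  proof (intro conjI ballI)
    show "rewards \<in> measurable P base"
      using rewards_measurable unfolding measurable_cong_sets[OF refl sets_base] .
    have "(\<lambda>z. \<Sum>k. \<Sum>j\<in>{1..p}. ?w k j (fst z) * dens (idx k) (snd z)) \<in> borel_measurable (G \<Otimes>\<^sub>M base)"
      by (intro borel_measurable_suminf_order borel_measurable_sum borel_measurable_times_ennreal
        measurable_compose[OF measurable_fst wG] measurable_compose[OF measurable_snd dens_measurable[OF idxm]])
    then show "(\<lambda>(\<omega>, x). mixture \<omega> x) \<in> borel_measurable (G \<Otimes>\<^sub>M base)"
      unfolding mix case_prod_unfold .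
    fix A assume A: "A \<in> sets base"
    then have A': "A \<in> sets (\<Pi>\<^sub>M k\<in>{1..m}. borel)" unfolding sets_base .
    show "AE \<omega> in P. ennreal (cond_pr P G (rewards -` A \<inter> space P) \<omega>) = emeasure (density base (mixture \<omega>)) A"
      using cond_pr_rewards[OF idx A'] AE_\<alpha>\<beta>
    proof eventually_elim
      case (elim \<omega>)
      have w: "(\<Sum>j\<in>{1..p}. ?w k j \<omega>) = ennreal (prob (ends_with \<omega> (idx k)))" for k
      proof -
        have "(\<Sum>j\<in>{1..p}. \<alpha> (idx k) j \<omega> * \<beta> (total (idx k)) j \<omega>) = prob (ends_with \<omega> (idx k))"
          unfolding prob_ends_with[OF idxm, symmetric]
          by (rule sum.cong[OF refl]) (use elim(2) idxm in \<open>simp only: total_def\<close>)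
        moreover have "0 \<le> \<alpha> (idx k) j \<omega> * \<beta> (total (idx k)) j \<omega>" if "j \<in> {1..p}" for j
          using elim(2)[rule_format, OF idxm that] unfolding total_def by (simp only: measure_nonneg)
        ultimately show ?thesis by (simp only: sum_ennreal)
      qed
      have mixw: "mixture \<omega> x = (\<Sum>k. ennreal (prob (ends_with \<omega> (idx k))) * dens (idx k) x)" for x
        unfolding mix w[symmetric] sum_distrib_right ..
      have mm: "(\<lambda>x. \<Sum>k. ennreal (prob (ends_with \<omega> (idx k))) * dens (idx k) x) \<in> borel_measurable base"
        by (intro borel_measurable_suminf_order borel_measurable_times_ennreal borel_measurable_const dens_measurable[OF idxm])
      have "emeasure (density base (mixture \<omega>)) A =
          (\<integral>\<^sup>+x. (\<Sum>k. ennreal (prob (ends_with \<omega> (idx k))) * dens (idx k) x) * indicator A x \<partial>base)"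
        unfolding mixw by (rule emeasure_density[OF mm A])
      also have "\<dots> = (\<integral>\<^sup>+x. (\<Sum>k. ennreal (prob (ends_with \<omega> (idx k))) * (dens (idx k) x * indicator A x)) \<partial>base)"
        by (simp only: ennreal_suminf_multc[symmetric] mult.assoc)
      also have "\<dots> = (\<Sum>k. \<integral>\<^sup>+x. ennreal (prob (ends_with \<omega> (idx k))) * (dens (idx k) x * indicator A x) \<partial>base)"
        by (rule nn_integral_suminf)
          (intro borel_measurable_times_ennreal borel_measurable_const dens_measurable[OF idxm] borel_measurable_indicator A)
      also have "\<dots> = (\<Sum>k. ennreal (prob (ends_with \<omega> (idx k))) * emeasure (density base (dens (idx k))) A)"
      proof (rule suminf_cong)
        fix k
        have "(\<integral>\<^sup>+x. ennreal (prob (ends_with \<omega> (idx k))) * (dens (idx k) x * indicator A x) \<partial>base) =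
            ennreal (prob (ends_with \<omega> (idx k))) * (\<integral>\<^sup>+x. dens (idx k) x * indicator A x \<partial>base)"
          by (rule nn_integral_cmult) (intro borel_measurable_times_ennreal dens_measurable[OF idxm] borel_measurable_indicator A)
        then show "(\<integral>\<^sup>+x. ennreal (prob (ends_with \<omega> (idx k))) * (dens (idx k) x * indicator A x) \<partial>base) =
            ennreal (prob (ends_with \<omega> (idx k))) * emeasure (density base (dens (idx k))) A"
          unfolding emeasure_density[OF dens_measurable[OF idxm] A] .
      qed
      finally show ?case using elim(1) unfolding density_dens[OF idxm] by (simp only:)
    qed
  qed
qed

end

theorem theorem6:
  fixes P :: "'a measure"
    and p m n lam0 :: nat
    and S :: "real \<Rightarrow> nat \<Rightarrow> nat \<Rightarrow> real"
    and \<pi> :: "nat \<Rightarrow> real"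
    and r :: "nat \<Rightarrow> nat \<Rightarrow> real"
    and N :: "real \<Rightarrow> 'a \<Rightarrow> nat"
    and N' :: "nat \<Rightarrow> real \<Rightarrow> 'a \<Rightarrow> nat"
    and U :: "nat \<Rightarrow> 'a \<Rightarrow> real"
    and M :: "nat \<Rightarrow> real \<Rightarrow> 'a \<Rightarrow> nat"
    and M' :: "nat \<Rightarrow> nat \<Rightarrow> real \<Rightarrow> 'a \<Rightarrow> nat"
    and J :: "real \<Rightarrow> 'a \<Rightarrow> nat option"
    and Nn :: "real \<Rightarrow> 'a \<Rightarrow> nat"
    and Mn :: "nat \<Rightarrow> real \<Rightarrow> 'a \<Rightarrow> nat"
    and chi :: "nat \<Rightarrow> 'a \<Rightarrow> real"
    and Jn :: "nat \<Rightarrow> real \<Rightarrow> 'a \<Rightarrow> nat option"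
    and Y :: "nat \<Rightarrow> 'a \<Rightarrow> real"
    and Q :: "nat \<Rightarrow> 'a \<Rightarrow> nat \<Rightarrow> nat \<Rightarrow> real"
    and G :: "'a measure"
    and \<alpha> :: "(nat \<Rightarrow> nat) \<Rightarrow> nat \<Rightarrow> 'a \<Rightarrow> real"
    and \<beta> :: "nat \<Rightarrow> nat \<Rightarrow> 'a \<Rightarrow> real"
    and len :: "(nat \<Rightarrow> nat) \<Rightarrow> nat"
  assumes "prob_space P" and "1 \<le> p" and "1 \<le> m"
    and "subintensity p S"
    and "bdd_above (exit_rates p S)"
    and lam0: "lam0 = base_intensity p S" "0 < lam0"
    and "\<forall>i\<in>{1..p}. 0 \<le> \<pi> i" and "(\<Sum>i\<in>{1..p}. \<pi> i) = 1"
    and "\<forall>i\<in>{1..p}. \<forall>k\<in>{1..m}. 0 \<le> r i k"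
    and "poisson_process P (real lam0) N"
    and "\<forall>l\<ge>lam0 + 1. poisson_process P 1 (N' l)"
    and "\<forall>l. U l \<in> borel_measurable P \<and> distr P borel (U l) = uniform_measure lborel {0<..<1}"
    and "\<forall>k\<in>{1..m}. poisson_process P (real lam0) (M k)"
    and "\<forall>k\<in>{1..m}. \<forall>l\<ge>lam0 + 1. poisson_process P 1 (M' k l)"
    and "prob_space.indep_sets P (source_events P N N' U M M') (sources lam0 m)"
    and J: "J = jump_process p S \<pi> N U"
    and terminating: "AE \<omega> in P. \<exists>t\<ge>0. J t \<omega> = None"
    and n: "lam0 \<le> n"
    and Nn: "Nn = superposition lam0 n N N'"
    and chi: "chi = arrival Nn"
    and Mn: "Mn = (\<lambda>k. superposition lam0 n (M k) (M' k))"
    and Jn: "Jn = (\<lambda>k t \<omega>. J (chi (Mn k t \<omega>) \<omega>) \<omega>)"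
    and Y: "Y = (\<lambda>k. total_reward (\<lambda>i. r i k) (Jn k))"
    and Q: "Q = (\<lambda>l \<omega> i j. (if i = j then 1 else 0) + S (chi l \<omega>) i j / real n)"
    and G: "G = process_algebra P Nn"
    and len: "len = (\<lambda>i. \<Sum>a\<in>{1..p}. i a)"
    and \<alpha>: "\<alpha> = (\<lambda>i j. cond_pr P G
        {\<omega> \<in> space P.
          (\<forall>a\<in>{1..p}. card {l \<in> {0..len i - 1}. J (chi l \<omega>) \<omega> = Some a} = i a) \<and>
          J (chi (len i - 1) \<omega>) \<omega> = Some j})"
    and \<beta>: "\<beta> = (\<lambda>l j. cond_pr_event P G
        {\<omega> \<in> space P. J (chi l \<omega>) \<omega> = None}
        {\<omega> \<in> space P. J (chi (l - 1) \<omega>) \<omega> = Some j})"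
  shows "(\<forall>k\<in>{1..m}. \<forall>i\<in>multi_indices p.
            hypoexp_dens p n r k i \<in> borel_measurable (reward_base p r k) \<and>
            density (reward_base p r k) (hypoexp_dens p n r k i) = hypoexp_law p n r k i)
     \<and> conditional_density P G (\<Pi>\<^sub>M k\<in>{1..m}. reward_base p r k)
          (\<lambda>\<omega>. \<lambda>k\<in>{1..m}. Y k \<omega>)
          (\<lambda>\<omega> x. \<Sum>\<^sub>\<infinity>i\<in>multi_indices p. \<Sum>j\<in>{1..p}.
             ennreal (\<alpha> i j \<omega> * \<beta> (len i) j \<omega>) * (\<Prod>k\<in>{1..m}. hypoexp_dens p n r k i (x k)))
     \<and> (AE \<omega> in P. \<forall>l\<ge>1. \<forall>j\<in>{1..p}.
          0 < cond_pr P G {\<omega>' \<in> space P. J (chi (l - 1) \<omega>') \<omega>' = Some j} \<omega> \<longrightarrow>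
          \<beta> l j \<omega> = 1 - (\<Sum>a\<in>{1..p}. Q l \<omega> j a))
     \<and> (AE \<omega> in P. \<forall>h\<in>{1..p}. \<forall>j\<in>{1..p}.
          \<alpha> (unit_index p h) j \<omega> = (if h = j then \<pi> j else 0))
     \<and> (AE \<omega> in P. \<forall>i\<in>multi_indices p. 2 \<le> len i \<longrightarrow> (\<forall>j\<in>{1..p}.
          \<alpha> i j \<omega> =
            (if 0 < i j
             then \<Sum>h\<in>{1..p}. \<alpha> (i(j := i j - 1)) h \<omega> * Q (len i - 1) \<omega> h j
             else 0)))"
proof -
  interpret rm: reward_model P p m n lam0 S \<pi> r N N' U M M'
  proof (rule reward_model.intro)
    show "prob_space P" by fact
    show "reward_model_axioms P p m n lam0 S \<pi> r N N' U M M'"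
      by (rule reward_model_axioms.intro) (fact | rule terminating[unfolded J] | rule lam0 | rule n)+
  qed
  have chi_eq: "chi = rm.chi" unfolding chi Nn rm.chi_def rm.Nn_def ..
  have G_eq: "G = rm.G" unfolding G Nn rm.G_def rm.Nn_def ..
  have state_eq: "J (chi l \<omega>) \<omega> = rm.state l \<omega>" for l \<omega>
    unfolding J chi_eq rm.state_def ..
  have len_eq: "len = rm.total" unfolding len rm.total_def[abs_def] ..
  have Y_eq: "Y k = rm.Y k" for k
  proof -
    have "(\<lambda>t \<omega>. J (chi (Mn k t \<omega>) \<omega>) \<omega>) = (\<lambda>t \<omega>. rm.state (rm.Mn k t \<omega>) \<omega>)"
      unfolding state_eq Mn rm.Mn_def ..
    then show ?thesis unfolding Y Jn rm.Y_def by simp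
  qed
  have visits_eq: "(\<forall>a\<in>{1..p}. card {l \<in> {0..k}. rm.state l \<omega> = Some a} = i a) \<longleftrightarrow> visits p i (rm.path k \<omega>)" for i k \<omega>
  proof -
    have "{l \<in> {0..k}. rm.state l \<omega> = Some a} = {l. l < Suc k \<and> rm.state l \<omega> = Some a}" for a by auto
    then show ?thesis unfolding visits_def rm.path_def count_list_map_upt by simp
  qed
  have \<alpha>_eq: "\<alpha> = rm.\<alpha>"
    by (intro ext) (simp only: \<alpha> rm.\<alpha>_def state_eq visits_eq G_eq len)
  have \<beta>_eq: "\<beta> = rm.\<beta>"
    by (intro ext) (simp only: \<beta> rm.\<beta>_def state_eq G_eq)
  have Q_eq: "Q l \<omega> i j = rm.marked.kernel (\<lambda>i. rm.chi i \<omega>) l i j" for l \<omega> i j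
    unfolding Q rm.marked.kernel_def chi_eq ..
  show ?thesis
  proof (intro conjI)
    show "\<forall>k\<in>{1..m}. \<forall>i\<in>multi_indices p. hypoexp_dens p n r k i \<in> borel_measurable (reward_base p r k) \<and>
        density (reward_base p r k) (hypoexp_dens p n r k i) = hypoexp_law p n r k i"
      by (intro ballI conjI rm.hypoexp_densities)
    have "rm.rewards = (\<lambda>\<omega>. \<lambda>k\<in>{1..m}. Y k \<omega>)"
      unfolding rm.rewards_def[abs_def] Y_eq ..
    with rm.conditional_density_rewards
    show "conditional_density P G (\<Pi>\<^sub>M k\<in>{1..m}. reward_base p r k) (\<lambda>\<omega>. \<lambda>k\<in>{1..m}. Y k \<omega>)
        (\<lambda>\<omega> x. \<Sum>\<^sub>\<infinity>i\<in>multi_indices p. \<Sum>j\<in>{1..p}.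
          ennreal (\<alpha> i j \<omega> * \<beta> (len i) j \<omega>) * (\<Prod>k\<in>{1..m}. hypoexp_dens p n r k i (x k)))"
      unfolding G_eq \<alpha>_eq \<beta>_eq len_eq by (simp only:)
    show "AE \<omega> in P. \<forall>l\<ge>1. \<forall>j\<in>{1..p}.
        0 < cond_pr P G {\<omega>' \<in> space P. J (chi (l - 1) \<omega>') \<omega>' = Some j} \<omega> \<longrightarrow>
        \<beta> l j \<omega> = 1 - (\<Sum>a\<in>{1..p}. Q l \<omega> j a)"
      using rm.AE_\<beta>
    proof eventually_elim
      case (elim \<omega>)
      show ?case
      proof (intro allI impI)
        fix l :: nat assume "1 \<le> l"
        then obtain k where k: "l = Suc k" by (cases l) simp_all
        show "\<forall>j\<in>{1..p}. 0 < cond_pr P G {\<omega>' \<in> space P. J (chi (l - 1) \<omega>') \<omega>' = Some j} \<omega> \<longrightarrow>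
            \<beta> l j \<omega> = 1 - (\<Sum>a\<in>{1..p}. Q l \<omega> j a)"
          using elim unfolding k diff_Suc_1 state_eq G_eq \<beta>_eq Q_eq by blast
      qed
    qed
    show "AE \<omega> in P. \<forall>h\<in>{1..p}. \<forall>j\<in>{1..p}. \<alpha> (unit_index p h) j \<omega> = (if h = j then \<pi> j else 0)"
      unfolding \<alpha>_eq by (rule rm.AE_\<alpha>_unit)
    show "AE \<omega> in P. \<forall>i\<in>multi_indices p. 2 \<le> len i \<longrightarrow> (\<forall>j\<in>{1..p}. \<alpha> i j \<omega> =
        (if 0 < i j then \<Sum>h\<in>{1..p}. \<alpha> (i(j := i j - 1)) h \<omega> * Q (len i - 1) \<omega> h j else 0))"
      unfolding \<alpha>_eq Q_eq len by (rule rm.AE_\<alpha>_recursion)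
  qed
qed

end
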